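(* For $0<\alpha<1$, the quantum query complexity of quantum $\alpha$-Rényi entropy estimation is $\Omega\big(d^{\frac{1}{2\alpha}-o(1)}+\frac{d^{\frac{1}{2\alpha}-\frac{1}{2}}}{\varepsilon^{\frac{1}{2\alpha}}}+\frac{\sqrt{d}}{\sqrt{\varepsilon}}\big)$. For non-integer $\alpha>1$, it is $\Omega\big(\frac{d^{\frac{1}{2}-\frac{1}{2\alpha}}}{\varepsilon}+\frac{\sqrt{d}}{\sqrt{\varepsilon}}\big)$. For integer $\alpha\geq 2$, it is $\Omega\big(\frac{d^{1-\frac{1}{\alpha}}}{\varepsilon^{\frac{1}{\alpha}}}+\frac{d^{\frac{1}{2}-\frac{1}{2\alpha}}}{\varepsilon}\big)$.
   Context: Quantum $\alpha$-Rényi entropy estimation: given an unknown $d$-dimensional quantum state $\rho$, estimate $\mathrm{S}_\alpha^{\textup{Rén}}(\rho) = \frac{1}{1-\alpha}\ln\big(\tr(\rho^\alpha)\big)$ to within additive error $\varepsilon$ with success probability at least $2/3$. Query complexity is measured in the purified quantum query access model: the oracle is a unitary $U$ acting on subsystems $\mathsf{A}$ and $\mathsf{B}$ with $\rho = \tr_{\mathsf{B}}\big(U_{\mathsf{AB}}\, |0\rangle\langle 0|_{\mathsf{AB}}\, U_{\mathsf{AB}}^\dagger\big)$, and a query means one use of (controlled-)$U$ or (controlled-)$U^\dagger$. *)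

theory Defs
  imports Complex_Main "Jordan_Normal_Form.Schur_Decomposition"
begin

definition unitary_mat :: "nat \<Rightarrow> complex mat \<Rightarrow> bool" where
  "unitary_mat n U \<longleftrightarrow> U \<in> carrier_mat n n \<and> mat_adjoint U * U = 1\<^sub>m n \<and> U * mat_adjoint U = 1\<^sub>m n"

definition kron :: "complex mat \<Rightarrow> complex mat \<Rightarrow> complex mat" where
  "kron A B = mat (dim_row A * dim_row B) (dim_col A * dim_col B)
     (\<lambda>(i,j). A $$ (i div dim_row B, j div dim_col B) * B $$ (i mod dim_row B, j mod dim_col B))"

text \<open>U acts on A (dim d) tensor B (dim m); rho = tr_B (U |0><0| U^dagger).\<close>
definition oracle_state :: "nat \<Rightarrow> nat \<Rightarrow> complex mat \<Rightarrow> complex mat" where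
  "oracle_state d m U = mat d d (\<lambda>(i,j). \<Sum>k<m. U $$ (i*m+k, 0) * cnj (U $$ (j*m+k, 0)))"

definition trace_pow :: "real \<Rightarrow> nat \<Rightarrow> complex mat \<Rightarrow> real" where
  "trace_pow \<alpha> d \<rho> = (THE s. \<exists>W lam. unitary_mat d W \<and> (\<forall>i<d. lam i \<ge> 0) \<and>
       \<rho> = W * mat_diag d (\<lambda>i. complex_of_real (lam i)) * mat_adjoint W \<and>
       s = (\<Sum>i<d. lam i powr \<alpha>))"

definition renyi_entropy :: "real \<Rightarrow> nat \<Rightarrow> complex mat \<Rightarrow> real" where
  "renyi_entropy \<alpha> d \<rho> = ln (trace_pow \<alpha> d \<rho>) / (1 - \<alpha>)"

text \<open>Registers: control qubit (dim 2) tensor A tensor B (dim d*m) tensor ancilla (dim k).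
  The controlled oracle is |0><0| x I + |1><1| x G x I_k, G = U or U^dagger.\<close>
definition ctrl_gate :: "nat \<Rightarrow> complex mat \<Rightarrow> complex mat" where
  "ctrl_gate k G = kron (mat_diag 2 (\<lambda>i. if i = 0 then 1 else 0)) (1\<^sub>m (dim_row G * k))
                 + kron (mat_diag 2 (\<lambda>i. if i = 1 then 1 else 0)) (kron G (1\<^sub>m k))"

fun alg_state :: "nat \<Rightarrow> nat \<Rightarrow> nat \<Rightarrow> (nat \<Rightarrow> complex mat) \<Rightarrow> (nat \<Rightarrow> bool) \<Rightarrow> complex mat
                  \<Rightarrow> nat \<Rightarrow> complex vec" where
  "alg_state d m k V qinv U 0 = V 0 *\<^sub>v unit_vec (2*d*m*k) 0"
| "alg_state d m k V qinv U (Suc t) =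
     V (Suc t) *\<^sub>v (ctrl_gate k (if qinv t then mat_adjoint U else U) *\<^sub>v alg_state d m k V qinv U t)"

definition success_prob :: "nat \<Rightarrow> nat \<Rightarrow> nat \<Rightarrow> (nat \<Rightarrow> complex mat) \<Rightarrow> (nat \<Rightarrow> bool)
     \<Rightarrow> (nat \<Rightarrow> real) \<Rightarrow> complex mat \<Rightarrow> nat \<Rightarrow> real \<Rightarrow> real \<Rightarrow> real" where
  "success_prob d m k V qinv f U T target \<epsilon> =
     (\<Sum>j\<in>{j. j < 2*d*m*k \<and> \<bar>f j - target\<bar> \<le> \<epsilon>}. (cmod (alg_state d m k V qinv U T $ j))\<^sup>2)"

definition renyi_estimable :: "real \<Rightarrow> nat \<Rightarrow> real \<Rightarrow> nat \<Rightarrow> bool" where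
  "renyi_estimable \<alpha> d \<epsilon> T \<longleftrightarrow>
     (\<forall>m\<ge>1. \<exists>k\<ge>1. \<exists>V qinv f.
        (\<forall>t\<le>T. unitary_mat (2*d*m*k) (V t)) \<and>
        (\<forall>U. unitary_mat (d*m) U \<longrightarrow>
           success_prob d m k V qinv f U T (renyi_entropy \<alpha> d (oracle_state d m U)) \<epsilon> \<ge> 2/3))"

end

theory Submission
  imports Defs "HOL-Analysis.L2_Norm" "HOL-Combinatorics.Transposition" "HOL-Combinatorics.Permutations"
begin

text \<open>For a real unit vector psi orthogonal to e_0 and v = (e_0 - psi) / sqrt 2, the reflection I - 2 v v^T is
  self-adjoint and maps e_0 to psi, so it is a legitimate oracle for the reduced state of psi. Two such oracles
  differ by O(|v - v'|). The hybrid argument alone then yields the terms that depend on the precision through one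
  exceptional eigenvalue. The other terms come from hiding a state: on the symmetric subspace the reflection about
  v is simulated with error O(1 / sqrt n) by n copies of v, so T queries reduce to about T^2 copies. Randomizing
  the purification turns the copies of v into copies of a density matrix, and a second-moment computation shows
  that these cannot distinguish the maximally mixed state from a random member of a family with a different
  entropy: signed perfect matchings, (I + eta Z) / q, or rank-one mixtures, (1 - tau) I / q + tau phi phi^T with a
  random sign vector phi.\<close>

section \<open>Query algorithms and the hybrid argument\<close>

text \<open>The obstacle is coherence: the oracle exposes a pure vector, whereas second-moment
  bounds compare mixed states. The purifying system is therefore cut into M blocks, each holding an
  independently scrambled square root of the hidden density matrix. The scramblings have mean zero,
  so as long as no two of the n copies fall into one block, averaging removes the coherence between
  different sets of occupied blocks and leaves one copy of the density matrix per occupied block.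
  Collisions cost O(n / sqrt M); since \<open>renyi_estimable\<close> fixes T before the purifier
  dimension is chosen, M of order n^2 with n of order T^2 is affordable. A copy falls into some
  block with probability p / 2 when the hidden part has trace p, so rare hidden parts are protected
  by dilution. The two families trade entropy against visibility: a matching shifts the trace of the
  power by order eta^2 and its scaled overlaps differ from 1 by about eta^2 / r, while a rank-one
  mixture moves a single eigenvalue by about tau with overlap fluctuations of order tau^2; the
  latter is used for integer orders.\<close>

definition nrm :: "'i set \<Rightarrow> ('i \<Rightarrow> complex) \<Rightarrow> real" where
  "nrm A f = L2_set (\<lambda>i. cmod (f i)) A"

lemma nrm_nonneg [simp]: "0 \<le> nrm A f"
  by (simp add: nrm_def)

lemma nrm_sq: "(nrm A f)\<^sup>2 = (\<Sum>i\<in>A. (cmod (f i))\<^sup>2)"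
  by (simp add: nrm_def L2_set_def sum_nonneg)

lemma nrm_eq_sqrt: "nrm A f = sqrt (\<Sum>i\<in>A. (cmod (f i))\<^sup>2)"
  by (simp add: nrm_def L2_set_def)

lemma nrm_cong: "(\<And>i. i \<in> A \<Longrightarrow> f i = g i) \<Longrightarrow> nrm A f = nrm A g"
  by (simp add: nrm_eq_sqrt)

lemma nrm_add_le: "nrm A (\<lambda>i. f i + g i) \<le> nrm A f + nrm A g"
proof -
  have "nrm A (\<lambda>i. f i + g i) \<le> L2_set (\<lambda>i. cmod (f i) + cmod (g i)) A"
    unfolding nrm_def by (rule L2_set_mono) (auto intro: norm_triangle_ineq)
  also have "\<dots> \<le> nrm A f + nrm A g"
    unfolding nrm_def by (rule L2_set_triangle_ineq)
  finally show ?thesis .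
qed

lemma nrm_diff_triangle: "nrm A (\<lambda>i. f i - h i) \<le> nrm A (\<lambda>i. f i - g i) + nrm A (\<lambda>i. g i - h i)"
  using nrm_add_le[of A "\<lambda>i. f i - g i" "\<lambda>i. g i - h i"] by simp

lemma nrm_scale: "nrm A (\<lambda>i. c * f i) = cmod c * nrm A f"
  by (simp add: nrm_eq_sqrt norm_mult power_mult_distrib real_sqrt_mult flip: sum_distrib_left)

lemma nrm_mono_set: "finite A \<Longrightarrow> B \<subseteq> A \<Longrightarrow> nrm B f \<le> nrm A f"
  unfolding nrm_eq_sqrt by (intro real_sqrt_le_mono sum_mono2) auto

lemma nrm_le_iff: "0 \<le> c \<Longrightarrow> nrm A f \<le> c \<longleftrightarrow> (\<Sum>i\<in>A. (cmod (f i))\<^sup>2) \<le> c\<^sup>2"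
  using nrm_sq[of A f] by (metis nrm_nonneg power2_le_imp_le power_mono)

text \<open>Difference of squares, with the reverse triangle inequality on \<open>B\<close>;
  monotonicity in the index set then replaces \<open>B\<close> by the whole space.\<close>

lemma accept_diff_le:
  assumes "finite A" "B \<subseteq> A"
  shows "\<bar>(nrm B f)\<^sup>2 - (nrm B g)\<^sup>2\<bar> \<le> nrm A (\<lambda>i. f i - g i) * (nrm A f + nrm A g)"
proof -
  have 1: "nrm B f - nrm B g \<le> nrm B (\<lambda>i. f i - g i)"
    using nrm_diff_triangle[of B f "\<lambda>_. 0" g] by simp
  have "nrm B (\<lambda>i. g i - f i) = nrm B (\<lambda>i. f i - g i)"
    by (simp add: nrm_eq_sqrt norm_minus_commute)
  then have 2: "nrm B g - nrm B f \<le> nrm B (\<lambda>i. f i - g i)"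
    using nrm_diff_triangle[of B g "\<lambda>_. 0" f] by simp
  have "\<bar>(nrm B f)\<^sup>2 - (nrm B g)\<^sup>2\<bar> = \<bar>nrm B f - nrm B g\<bar> * (nrm B f + nrm B g)"
    by (simp add: power2_eq_square square_diff_square_factored abs_mult mult.commute)
  also have "\<dots> \<le> nrm B (\<lambda>i. f i - g i) * (nrm B f + nrm B g)"
    using 1 2 by (intro mult_right_mono) auto
  also have "\<dots> \<le> nrm A (\<lambda>i. f i - g i) * (nrm A f + nrm A g)"
    by (intro mult_mono add_mono nrm_mono_set assms) auto
  finally show ?thesis .
qed

lemma inner_le_nrm: "cmod (\<Sum>i\<in>A. f i * g i) \<le> nrm A f * nrm A g"
proof -
  have "cmod (\<Sum>i\<in>A. f i * g i) \<le> (\<Sum>i\<in>A. \<bar>cmod (f i)\<bar> * \<bar>cmod (g i)\<bar>)"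
    by (rule order_trans[OF norm_sum]) (simp add: norm_mult)
  also have "\<dots> \<le> nrm A f * nrm A g"
    unfolding nrm_def by (rule L2_set_mult_ineq)
  finally show ?thesis .
qed

lemma cmod_sq: "of_real ((cmod z)\<^sup>2) = cnj z * z"
  by (metis complex_norm_square mult.commute)

lemma of_real_nrm_sq: "complex_of_real ((nrm A f)\<^sup>2) = (\<Sum>i\<in>A. cnj (f i) * f i)"
  unfolding nrm_sq of_real_sum cmod_sq ..

lemma cmod_sub_scale_sq:
  "(cmod (a - of_real c * b))\<^sup>2 = (cmod a)\<^sup>2 - 2 * c * Re (cnj b * a) + c\<^sup>2 * (cmod b)\<^sup>2"
  unfolding cmod_power2 by (simp add: power2_eq_square algebra_simps)

locale query_algorithm =
  fixes X :: "'x set" and R :: "'r set" and R1 :: "'r set"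
    and V :: "nat \<Rightarrow> 'x \<times> 'r \<Rightarrow> 'x \<times> 'r \<Rightarrow> complex" and \<phi>0 :: "'x \<times> 'r \<Rightarrow> complex" and T :: nat
  assumes finX: "finite X" and finR: "finite R"
    and V_iso: "\<And>t \<phi>. 0 < t \<Longrightarrow> t \<le> T \<Longrightarrow> nrm (X \<times> R) (\<lambda>j. \<Sum>i\<in>X \<times> R. V t j i * \<phi> i) = nrm (X \<times> R) \<phi>"
    and \<phi>0_unit: "nrm (X \<times> R) \<phi>0 = 1"
begin

definition app :: "nat \<Rightarrow> ('x \<times> 'r \<Rightarrow> complex) \<Rightarrow> 'x \<times> 'r \<Rightarrow> complex" where
  "app t \<phi> = (\<lambda>j. \<Sum>i\<in>X \<times> R. V t j i * \<phi> i)"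

definition refl_query :: "('x \<Rightarrow> real) \<Rightarrow> ('x \<times> 'r \<Rightarrow> complex) \<Rightarrow> 'x \<times> 'r \<Rightarrow> complex" where
  "refl_query v \<phi> = (\<lambda>(x, r). \<phi> (x, r) -
     (if r \<in> R1 then 2 * of_real (v x) * (\<Sum>y\<in>X. of_real (v y) * \<phi> (y, r)) else 0))"

primrec run :: "('x \<Rightarrow> real) \<Rightarrow> nat \<Rightarrow> 'x \<times> 'r \<Rightarrow> complex" where
  "run v 0 = \<phi>0"
| "run v (Suc t) = app (Suc t) (refl_query v (run v t))"

lemma app_diff: "app t (\<lambda>j. \<phi> j - \<psi> j) j = app t \<phi> j - app t \<psi> j"
  by (simp add: app_def right_diff_distrib sum_subtractf)

lemma app_scale: "app t (\<lambda>j. c * \<phi> j) j = c * app t \<phi> j"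
  by (simp add: app_def sum_distrib_left mult_ac)

lemma app_sum: "app t (\<lambda>j. \<Sum>s\<in>S. \<phi> s j) j = (\<Sum>s\<in>S. app t (\<phi> s) j)"
  unfolding app_def sum_distrib_left by (rule sum.swap)

lemma nrm_app: "0 < t \<Longrightarrow> t \<le> T \<Longrightarrow> nrm (X \<times> R) (app t \<phi>) = nrm (X \<times> R) \<phi>"
  unfolding app_def by (rule V_iso)

lemma nrm_sq_prod: "(nrm (X \<times> R) \<phi>)\<^sup>2 = (\<Sum>r\<in>R. (nrm X (\<lambda>x. \<phi> (x, r)))\<^sup>2)"
  unfolding nrm_sq by (subst sum.swap) (simp add: sum.cartesian_product)

lemma reflection_isometry:
  assumes "(\<Sum>x\<in>X. (v x)\<^sup>2) = (1::real)"
  shows "(nrm X (\<lambda>x. a x - 2 * of_real (v x) * (\<Sum>y\<in>X. of_real (v y) * a y)))\<^sup>2 = (nrm X a)\<^sup>2"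
proof -
  define s where "s = (\<Sum>y\<in>X. of_real (v y) * a y)"
  have v1: "(\<Sum>x\<in>X. complex_of_real (v x) * of_real (v x)) = 1"
    using arg_cong[OF assms, of complex_of_real] by (simp add: power2_eq_square)
  have cs: "cnj s = (\<Sum>y\<in>X. of_real (v y) * cnj (a y))" by (simp add: s_def)
  have "complex_of_real ((nrm X (\<lambda>x. a x - 2 * of_real (v x) * s))\<^sup>2)
      = (\<Sum>x\<in>X. cnj (a x) * a x) - 2 * s * (\<Sum>x\<in>X. of_real (v x) * cnj (a x))
        - 2 * cnj s * (\<Sum>x\<in>X. of_real (v x) * a x)
        + 4 * s * cnj s * (\<Sum>x\<in>X. complex_of_real (v x) * of_real (v x))"
    unfolding of_real_nrm_sq by (simp add: algebra_simps sum.distrib sum_subtractf sum_distrib_left)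
  also have "\<dots> = complex_of_real ((nrm X a)\<^sup>2)"
    unfolding v1 cs[symmetric] s_def[symmetric] of_real_nrm_sq by simp
  finally show ?thesis unfolding s_def of_real_eq_iff .
qed

lemma nrm_refl_query:
  assumes "(\<Sum>x\<in>X. (v x)\<^sup>2) = 1"
  shows "nrm (X \<times> R) (refl_query v \<phi>) = nrm (X \<times> R) \<phi>"
proof -
  have "(nrm (X \<times> R) (refl_query v \<phi>))\<^sup>2 = (nrm (X \<times> R) \<phi>)\<^sup>2"
    unfolding nrm_sq_prod
  proof (rule sum.cong[OF refl])
    fix r
    show "(nrm X (\<lambda>x. refl_query v \<phi> (x, r)))\<^sup>2 = (nrm X (\<lambda>x. \<phi> (x, r)))\<^sup>2"
      using reflection_isometry[OF assms, of "\<lambda>x. \<phi> (x, r)"]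
      by (cases "r \<in> R1") (simp_all add: refl_query_def)
  qed
  then show ?thesis by simp
qed

lemma nrm_run:
  assumes "(\<Sum>x\<in>X. (v x)\<^sup>2) = 1" "t \<le> T"
  shows "nrm (X \<times> R) (run v t) = 1"
  using assms(2) by (induction t) (simp_all add: \<phi>0_unit nrm_app nrm_refl_query[OF assms(1)])

text \<open>With sv and sw the overlaps of a slice with v and w, the two reflections differ by -2
  (sv - sw) v - 2 sw (v - w). Each summand has norm at most 2 delta times that of the slice.\<close>

lemma refl_query_perturb:
  assumes v: "(\<Sum>x\<in>X. (v x)\<^sup>2) = 1" and w: "(\<Sum>x\<in>X. (w x)\<^sup>2) = 1"
  defines "\<delta> \<equiv> nrm X (\<lambda>x. of_real (v x - w x))"
  shows "nrm (X \<times> R) (\<lambda>j. refl_query v \<phi> j - refl_query w \<phi> j) \<le> 4 * \<delta> * nrm (X \<times> R) \<phi>"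
proof -
  have nv: "nrm X (\<lambda>x. of_real (v x)) = 1" and nw: "nrm X (\<lambda>x. of_real (w x)) = 1"
    using v w by (simp_all add: nrm_eq_sqrt)
  have slice: "nrm X (\<lambda>x. refl_query v \<phi> (x, r) - refl_query w \<phi> (x, r)) \<le> 4 * \<delta> * nrm X (\<lambda>x. \<phi> (x, r))" for r
  proof (cases "r \<in> R1")
    case False
    then show ?thesis by (simp add: refl_query_def nrm_eq_sqrt \<delta>_def sum_nonneg)
  next
    case True
    define a where "a = (\<lambda>x. \<phi> (x, r))"
    define sv where "sv = (\<Sum>y\<in>X. of_real (v y) * a y)"
    define sw where "sw = (\<Sum>y\<in>X. of_real (w y) * a y)"
    have b1: "cmod sw \<le> nrm X a" 
      using inner_le_nrm[where A=X and f="\<lambda>x. of_real (w x)" and g=a] nw by (simp add: sw_def)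
    have "sv - sw = (\<Sum>y\<in>X. of_real (v y - w y) * a y)"
      by (simp add: sv_def sw_def algebra_simps sum_subtractf)
    then have b2: "cmod (sv - sw) \<le> \<delta> * nrm X a"
      unfolding \<delta>_def using inner_le_nrm[where A=X and f="\<lambda>x. of_real (v x - w x)" and g=a] by simp
    have "nrm X (\<lambda>x. refl_query v \<phi> (x, r) - refl_query w \<phi> (x, r))
      = nrm X (\<lambda>x. (- 2 * (sv - sw)) * of_real (v x) + (- 2 * sw) * of_real (v x - w x))"
      using True by (intro nrm_cong) (simp add: refl_query_def sv_def sw_def a_def algebra_simps)
    also have "\<dots> \<le> cmod (- 2 * (sv - sw)) * 1 + cmod (- 2 * sw) * \<delta>"
      by (rule order_trans[OF nrm_add_le]) (simp only: nrm_scale nv \<delta>_def order.refl)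
    also have "\<dots> = 2 * cmod (sv - sw) + 2 * cmod sw * \<delta>"
      by (simp only: norm_mult norm_neg_numeral mult_1_right)
    also have "\<dots> \<le> 2 * (\<delta> * nrm X a) + 2 * nrm X a * \<delta>"
      using b1 b2 by (intro add_mono mult_left_mono mult_right_mono) (auto simp: \<delta>_def)
    finally show ?thesis by (simp add: a_def)
  qed
  have "(nrm (X \<times> R) (\<lambda>j. refl_query v \<phi> j - refl_query w \<phi> j))\<^sup>2 \<le> (4 * \<delta> * nrm (X \<times> R) \<phi>)\<^sup>2"
    unfolding nrm_sq_prod power_mult_distrib[of _ "nrm (X \<times> R) \<phi>"] sum_distrib_left
    using power_mono[OF slice nrm_nonneg, of _ 2] by (intro sum_mono) (simp add: power_mult_distrib)
  then show ?thesis by (rule power2_le_imp_le) (simp add: \<delta>_def)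
qed

text \<open>Hybrid argument: a further step applies the same reflection to the accumulated
  difference, which preserves its norm, and pays for one exchanged reflection on a unit vector.
  Hence the growth is linear in t.\<close>

lemma run_perturb:
  assumes v: "(\<Sum>x\<in>X. (v x)\<^sup>2) = 1" and w: "(\<Sum>x\<in>X. (w x)\<^sup>2) = 1" and "t \<le> T"
  shows "nrm (X \<times> R) (\<lambda>j. run v t j - run w t j) \<le> real t * (4 * nrm X (\<lambda>x. of_real (v x - w x)))"
  using assms(3)
proof (induction t)
  case 0
  then show ?case by (simp add: nrm_eq_sqrt)
next
  case (Suc t)
  let ?d = "4 * nrm X (\<lambda>x. complex_of_real (v x - w x))"
  have lin: "refl_query v (run v t) j - refl_query v (run w t) j = refl_query v (\<lambda>j. run v t j - run w t j) j" for j
    by (cases j) (simp add: refl_query_def algebra_simps sum_subtractf sum_distrib_left)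
  have "nrm (X \<times> R) (\<lambda>j. run v (Suc t) j - run w (Suc t) j)
    = nrm (X \<times> R) (\<lambda>j. refl_query v (run v t) j - refl_query w (run w t) j)"
    using Suc.prems by (simp add: nrm_app flip: app_diff)
  also have "\<dots> \<le> nrm (X \<times> R) (refl_query v (\<lambda>j. run v t j - run w t j))
      + nrm (X \<times> R) (\<lambda>j. refl_query v (run w t) j - refl_query w (run w t) j)"
    using nrm_diff_triangle[where A="X \<times> R" and f="refl_query v (run v t)" and g="refl_query v (run w t)" and h="refl_query w (run w t)"]
    unfolding lin by simp
  also have "\<dots> \<le> real t * ?d + ?d"
    using Suc refl_query_perturb[OF v w, of "run w t"] nrm_run[OF w, of t]
    by (intro add_mono) (auto simp: nrm_refl_query[OF v])
  finally show ?case by (simp add: algebra_simps)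
qed

theorem accept_perturb:
  assumes v: "(\<Sum>x\<in>X. (v x)\<^sup>2) = 1" and w: "(\<Sum>x\<in>X. (w x)\<^sup>2) = 1" and B: "B \<subseteq> X \<times> R"
  shows "\<bar>(nrm B (run v T))\<^sup>2 - (nrm B (run w T))\<^sup>2\<bar> \<le> 8 * real T * nrm X (\<lambda>x. of_real (v x - w x))"
proof -
  have "\<bar>(nrm B (run v T))\<^sup>2 - (nrm B (run w T))\<^sup>2\<bar>
    \<le> nrm (X \<times> R) (\<lambda>j. run v T j - run w T j) * (nrm (X \<times> R) (run v T) + nrm (X \<times> R) (run w T))"
    by (rule accept_diff_le) (use finX finR B in auto)
  also have "\<dots> \<le> (real T * (4 * nrm X (\<lambda>x. of_real (v x - w x)))) * 2"
    using run_perturb[OF v w order.refl] by (simp add: nrm_run[OF v] nrm_run[OF w])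
  finally show ?thesis by simp
qed

end

section \<open>Simulating a reflection with copies of its axis\<close>

context query_algorithm
begin

definition tuples :: "nat \<Rightarrow> (nat \<Rightarrow> 'x) set" where
  "tuples n = PiE {..<n} (\<lambda>_. X)"

definition power_state :: "nat \<Rightarrow> ('x \<Rightarrow> real) \<Rightarrow> (nat \<Rightarrow> 'x) \<Rightarrow> real" where
  "power_state n v f = (\<Prod>l<n. v (f l))"

text \<open>Transpositions generate all permutations of the copies. The extra argument of type 'b
  holds the registers beside the copies; \<open>unit\<close> stands for none.\<close>

definition symmetric :: "nat \<Rightarrow> ((nat \<Rightarrow> 'x) \<Rightarrow> 'b \<Rightarrow> 'c) \<Rightarrow> bool" where
  "symmetric n \<Psi> \<longleftrightarrow> (\<forall>f. \<forall>a<n. \<forall>b<n. \<Psi> (f \<circ> transpose a b) = \<Psi> f)"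

text \<open>When \<open>a\<close> is symmetric in its n copies, this is (n + 1) times the projection
  onto the symmetric subspace of the copies together with the query register: the identity and the n
  exchanges with the query position represent the cosets of S_n in S_(n+1).\<close>

definition swapsum :: "nat \<Rightarrow> ((nat \<Rightarrow> 'x) \<Rightarrow> 'x \<Rightarrow> complex) \<Rightarrow> (nat \<Rightarrow> 'x) \<Rightarrow> 'x \<Rightarrow> complex" where
  "swapsum n a f x = a f x + (\<Sum>l<n. a (f(l := x)) (f l))"

text \<open>This is I - 2 P with P the symmetric projection read off from \<open>swapsum\<close>. It
  does not mention v, so the dependence on the oracle moves entirely into the initial state of the
  copies.\<close>

definition sim_query :: "nat \<Rightarrow> ((nat \<Rightarrow> 'x) \<Rightarrow> 'x \<times> 'r \<Rightarrow> complex) \<Rightarrow> (nat \<Rightarrow> 'x) \<Rightarrow> 'x \<times> 'r \<Rightarrow> complex" where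
  "sim_query n \<Psi> f = (\<lambda>(x, r). \<Psi> f (x, r) -
     (if r \<in> R1 then of_real (2 / (real n + 1)) * swapsum n (\<lambda>f x. \<Psi> f (x, r)) f x else 0))"

primrec sim_run :: "nat \<Rightarrow> ((nat \<Rightarrow> 'x) \<Rightarrow> complex) \<Rightarrow> nat \<Rightarrow> (nat \<Rightarrow> 'x) \<Rightarrow> 'x \<times> 'r \<Rightarrow> complex" where
  "sim_run n \<xi> 0 = (\<lambda>f j. \<xi> f * \<phi>0 j)"
| "sim_run n \<xi> (Suc t) = (\<lambda>f. app (Suc t) (sim_query n (sim_run n \<xi> t) f))"

definition ext :: "nat \<Rightarrow> ((nat \<Rightarrow> 'x) \<Rightarrow> 'x \<times> 'r \<Rightarrow> complex) \<Rightarrow> real" where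
  "ext n \<Psi> = nrm (tuples n \<times> (X \<times> R)) (\<lambda>(f, j). \<Psi> f j)"

lemma finite_tuples [simp]: "finite (tuples n)"
  unfolding tuples_def by (intro finite_PiE) (auto simp: finX)

lemma tuples_mem: "f \<in> tuples n \<Longrightarrow> l < n \<Longrightarrow> f l \<in> X"
  by (auto simp: tuples_def PiE_def)

lemma tuples_upd: "f \<in> tuples n \<Longrightarrow> l < n \<Longrightarrow> x \<in> X \<Longrightarrow> f(l := x) \<in> tuples n"
  by (auto simp: tuples_def PiE_def extensional_def)

lemma upd_comp_transpose: "(f \<circ> transpose a b)(l := x) = f(transpose a b l := x) \<circ> transpose a b"
  by (auto simp: fun_eq_iff transpose_def)

lemma sum_tuples_prod: "(\<Sum>f\<in>tuples n. \<Prod>l<n. g l (f l)) = (\<Prod>l<n. \<Sum>x\<in>X. g l x)"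
  for g :: "nat \<Rightarrow> 'x \<Rightarrow> 'c::comm_semiring_1"
  unfolding tuples_def using prod_sum_PiE[of "{..<n}" "\<lambda>_. X" g] finX by simp

lemma sum_tuples_swap:
  assumes l: "l < n"
  shows "(\<Sum>f\<in>tuples n. \<Sum>x\<in>X. h (f(l := x)) (f l)) = (\<Sum>f\<in>tuples n. \<Sum>x\<in>X. h f x)"
  unfolding sum.cartesian_product
  by (rule sum.reindex_bij_witness[where i="\<lambda>(f, x). (f(l := x), f l)" and j="\<lambda>(f, x). (f(l := x), f l)"])
     (auto simp: tuples_upd l tuples_mem)

lemma sum_power_state:
  assumes "(\<Sum>x\<in>X. (v x)\<^sup>2) = 1"
  shows "(\<Sum>f\<in>tuples n. (power_state n v f)\<^sup>2) = 1"
  unfolding power_state_def prod_power_distrib sum_tuples_prod[where g="\<lambda>_ x. (v x)\<^sup>2"] assms by simp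

lemma symmetric_power_state: "symmetric n (\<lambda>f (_::unit). power_state n v f)"
  unfolding symmetric_def
proof (intro allI impI ext)
  fix f :: "nat \<Rightarrow> 'x" and a b :: nat and u :: unit assume ab: "a < n" "b < n"
  have "power_state n v (f \<circ> transpose a b) = (\<Prod>l<n. v (f (transpose a b l)))"
    by (simp add: power_state_def)
  also have "\<dots> = power_state n v f"
    unfolding power_state_def
    by (rule prod.reindex_bij_witness[where i="transpose a b" and j="transpose a b"])
       (use ab in \<open>auto simp: transpose_def\<close>)
  finally show "power_state n v (f \<circ> transpose a b) = power_state n v f" .
qed

text \<open>Exchanging the query register with copy m only permutes the summands: the identity term
  and the term of m trade places, and every other term changes by a transposition of two copies,
  which symmetry absorbs.\<close>

lemma swapsum_invariant:
  assumes sym: "symmetric n a" and m: "m < n"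
  shows "swapsum n a (f(m := x)) (f m) = swapsum n a f x"
proof -
  have "a (f(m := x, l := f m)) ((f(m := x)) l) = a (f(l := x)) (f l)" if l: "l < n" "l \<noteq> m" for l
  proof -
    have "f(m := x, l := f m) = f(l := x) \<circ> transpose l m"
      using l by (auto simp: fun_eq_iff transpose_def)
    with sym l m show ?thesis by (simp add: symmetric_def)
  qed
  then have "(\<Sum>l\<in>{..<n} - {m}. a (f(m := x, l := f m)) ((f(m := x)) l)) = (\<Sum>l\<in>{..<n} - {m}. a (f(l := x)) (f l))"
    by (intro sum.cong) auto
  then show ?thesis
    unfolding swapsum_def using m by (simp add: sum.remove[of "{..<n}" m])
qed

text \<open>Writing S for \<open>swapsum\<close>, this is the relation (S a, S a) = (n + 1) (S a, a)
  that makes S / (n + 1) a projection. Each of the n + 1 summands of the second factor contributes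
  the same amount because the first factor is invariant under the exchange.\<close>

lemma swapsum_norm:
  assumes sym: "symmetric n a"
  shows "(\<Sum>f\<in>tuples n. \<Sum>x\<in>X. cnj (swapsum n a f x) * swapsum n a f x)
       = of_nat (n + 1) * (\<Sum>f\<in>tuples n. \<Sum>x\<in>X. cnj (swapsum n a f x) * a f x)"
proof -
  let ?S = "\<Sum>f\<in>tuples n. \<Sum>x\<in>X. cnj (swapsum n a f x) * a f x"
  have l: "(\<Sum>f\<in>tuples n. \<Sum>x\<in>X. cnj (swapsum n a f x) * a (f(l := x)) (f l)) = ?S" if "l < n" for l
  proof -
    have "(\<Sum>f\<in>tuples n. \<Sum>x\<in>X. cnj (swapsum n a f x) * a (f(l := x)) (f l))
       = (\<Sum>f\<in>tuples n. \<Sum>x\<in>X. cnj (swapsum n a (f(l := x)) (f l)) * a (f(l := x)) (f l))"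
      by (simp only: swapsum_invariant[OF sym that])
    then show ?thesis
      using sum_tuples_swap[OF that, of "\<lambda>f x. cnj (swapsum n a f x) * a f x"] by simp
  qed
  have "(\<Sum>f\<in>tuples n. \<Sum>x\<in>X. cnj (swapsum n a f x) * swapsum n a f x)
      = ?S + (\<Sum>f\<in>tuples n. \<Sum>x\<in>X. \<Sum>l<n. cnj (swapsum n a f x) * a (f(l := x)) (f l))"
    by (subst (2) swapsum_def) (simp add: distrib_left sum.distrib sum_distrib_left)
  also have "(\<Sum>f\<in>tuples n. \<Sum>x\<in>X. \<Sum>l<n. cnj (swapsum n a f x) * a (f(l := x)) (f l))
     = (\<Sum>l<n. \<Sum>f\<in>tuples n. \<Sum>x\<in>X. cnj (swapsum n a f x) * a (f(l := x)) (f l))"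
    by (simp only: sum.swap[of _ "{..<n}" X] sum.swap[of _ "{..<n}" "tuples n"])
  also have "\<dots> = (\<Sum>l<n. ?S)"
    by (rule sum.cong) (simp_all only: l lessThan_iff)
  finally show ?thesis by (simp add: algebra_simps)
qed

lemma Re_of_nat_mult: "Re (of_nat m * z) = real m * Re z"
  by simp

lemma swapsum_norm_real:
  assumes sym: "symmetric n a"
  shows "(\<Sum>f\<in>tuples n. \<Sum>x\<in>X. (cmod (swapsum n a f x))\<^sup>2)
       = real (n + 1) * (\<Sum>f\<in>tuples n. \<Sum>x\<in>X. Re (cnj (swapsum n a f x) * a f x))"
proof -
  have "complex_of_real (\<Sum>f\<in>tuples n. \<Sum>x\<in>X. (cmod (swapsum n a f x))\<^sup>2)
     = of_nat (n + 1) * (\<Sum>f\<in>tuples n. \<Sum>x\<in>X. cnj (swapsum n a f x) * a f x)"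
    unfolding of_real_sum cmod_sq by (rule swapsum_norm[OF sym])
  from arg_cong[OF this, of Re] show ?thesis
    by (simp only: Re_complex_of_real Re_of_nat_mult Re_sum)
qed

text \<open>Twice a projection subtracted from the identity is an isometry: with coefficient 2 / (n
  + 1) the cross term and the quadratic term cancel.\<close>

lemma swapsum_reflection:
  assumes sym: "symmetric n a"
  shows "(\<Sum>f\<in>tuples n. \<Sum>x\<in>X. (cmod (a f x - of_real (2 / (real n + 1)) * swapsum n a f x))\<^sup>2)
       = (\<Sum>f\<in>tuples n. \<Sum>x\<in>X. (cmod (a f x))\<^sup>2)"
proof -
  define S where "S = (\<Sum>f\<in>tuples n. \<Sum>x\<in>X. Re (cnj (swapsum n a f x) * a f x))"
  have alg: "A - 2 * (2 / (real n + 1)) * S + (2 / (real n + 1))\<^sup>2 * (real (n + 1) * S) = A" for A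
    by (simp add: power2_eq_square divide_simps) (simp add: algebra_simps)
  show ?thesis
    unfolding cmod_sub_scale_sq sum.distrib sum_subtractf sum_distrib_left[symmetric] swapsum_norm_real[OF sym]
      S_def[symmetric] by (rule alg)
qed

lemma ext_sq_slices: "(ext n \<Psi>)\<^sup>2 = (\<Sum>r\<in>R. \<Sum>f\<in>tuples n. \<Sum>x\<in>X. (cmod (\<Psi> f (x, r)))\<^sup>2)"
proof -
  have "(ext n \<Psi>)\<^sup>2 = (\<Sum>f\<in>tuples n. \<Sum>x\<in>X. \<Sum>r\<in>R. (cmod (\<Psi> f (x, r)))\<^sup>2)"
    unfolding ext_def nrm_sq by (simp add: sum.cartesian_product case_prod_beta)
  also have "\<dots> = (\<Sum>r\<in>R. \<Sum>f\<in>tuples n. \<Sum>x\<in>X. (cmod (\<Psi> f (x, r)))\<^sup>2)"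
    by (subst sum.swap[of _ R], subst sum.swap[of _ R]) simp
  finally show ?thesis .
qed

lemma symmetric_slice: "symmetric n \<Psi> \<Longrightarrow> symmetric n (\<lambda>f x. \<Psi> f (x, r))"
  by (auto simp: symmetric_def)

lemma ext_nonneg [simp]: "0 \<le> ext n \<Psi>" by (simp add: ext_def)

lemma ext_sim_query:
  assumes "symmetric n \<Psi>"
  shows "ext n (sim_query n \<Psi>) = ext n \<Psi>"
proof -
  have "(ext n (sim_query n \<Psi>))\<^sup>2 = (ext n \<Psi>)\<^sup>2"
    unfolding ext_sq_slices
  proof (rule sum.cong[OF refl])
    fix r
    show "(\<Sum>f\<in>tuples n. \<Sum>x\<in>X. (cmod (sim_query n \<Psi> f (x, r)))\<^sup>2) = (\<Sum>f\<in>tuples n. \<Sum>x\<in>X. (cmod (\<Psi> f (x, r)))\<^sup>2)"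
      using swapsum_reflection[OF symmetric_slice[OF assms], of r]
      by (cases "r \<in> R1") (simp_all only: sim_query_def prod.case if_True if_False diff_0_right)
  qed
  then show ?thesis by simp
qed

lemma ext_sq_rows: "(ext n \<Psi>)\<^sup>2 = (\<Sum>f\<in>tuples n. (nrm (X \<times> R) (\<Psi> f))\<^sup>2)"
  unfolding ext_def nrm_sq by (simp add: sum.cartesian_product case_prod_beta)

lemma ext_app: "0 < t \<Longrightarrow> t \<le> T \<Longrightarrow> ext n (\<lambda>f. app t (\<Psi> f)) = ext n \<Psi>"
  by (rule power2_eq_imp_eq) (simp_all add: ext_sq_rows nrm_app)

lemma symmetric_sim_query:
  assumes sym: "symmetric n \<Psi>"
  shows "symmetric n (sim_query n \<Psi>)"
proof -
  have sw: "swapsum n (\<lambda>f x. \<Psi> f (x, r)) (f \<circ> transpose a b) x = swapsum n (\<lambda>f x. \<Psi> f (x, r)) f x"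
    if ab: "a < n" "b < n" for f a b x r
  proof -
    have "(\<Sum>l<n. \<Psi> ((f \<circ> transpose a b)(l := x)) ((f \<circ> transpose a b) l, r))
        = (\<Sum>l<n. \<Psi> (f(transpose a b l := x)) (f (transpose a b l), r))"
      unfolding upd_comp_transpose using sym ab by (simp add: symmetric_def)
    also have "\<dots> = (\<Sum>l<n. \<Psi> (f(l := x)) (f l, r))"
      by (rule sum.reindex_bij_witness[where i="transpose a b" and j="transpose a b"])
         (use ab in \<open>auto simp: transpose_def\<close>)
    finally show ?thesis using sym ab by (simp add: swapsum_def symmetric_def)
  qed
  show ?thesis
    unfolding symmetric_def sim_query_def using sw sym by (auto simp: symmetric_def)
qed

lemma symmetric_sim_run:
  assumes "symmetric n (\<lambda>f (_::unit). \<xi> f)"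
  shows "symmetric n (sim_run n \<xi> t)"
proof (induction t)
  case 0
  show ?case using assms by (auto simp: symmetric_def fun_eq_iff)
next
  case (Suc t)
  from symmetric_sim_query[OF this] show ?case by (simp add: symmetric_def)
qed

lemma ext_initial: "(ext n (\<lambda>f j. \<xi> f * \<phi>0 j))\<^sup>2 = (\<Sum>f\<in>tuples n. (cmod (\<xi> f))\<^sup>2)"
  by (simp add: ext_sq_rows nrm_scale \<phi>0_unit)

lemma ext_sim_run:
  assumes "symmetric n (\<lambda>f (_::unit). \<xi> f)" "t \<le> T"
  shows "(ext n (sim_run n \<xi> t))\<^sup>2 = (\<Sum>f\<in>tuples n. (cmod (\<xi> f))\<^sup>2)"
  using assms(2)
proof (induction t)
  case (Suc t)
  then show ?case by (simp add: ext_app ext_sim_query[OF symmetric_sim_run[OF assms(1)]])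
qed (simp add: ext_initial)

lemma sim_query_diff:
  "sim_query n \<Psi> f j - sim_query n \<Psi>' f j = sim_query n (\<lambda>f j. \<Psi> f j - \<Psi>' f j) f j"
  by (cases j) (simp add: sim_query_def swapsum_def algebra_simps sum_subtractf)

lemma sim_query_sum:
  "sim_query n (\<lambda>f j. \<Sum>s\<in>S. c s * \<Psi> s f j) f j = (\<Sum>s\<in>S. c s * sim_query n (\<Psi> s) f j)"
proof -
  obtain x r where j: "j = (x, r)" by (cases j)
  have "swapsum n (\<lambda>f x. \<Sum>s\<in>S. c s * \<Psi> s f (x, r)) f x = (\<Sum>s\<in>S. c s * swapsum n (\<lambda>f x. \<Psi> s f (x, r)) f x)"
    by (simp only: swapsum_def distrib_left sum.distrib sum_distrib_left sum.swap[of _ S "{..<n}"])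
  then show ?thesis
    by (cases "r \<in> R1")
       (simp_all only: j sim_query_def prod.case if_True if_False right_diff_distrib sum_subtractf
          sum_distrib_left mult.left_commute diff_0_right)
qed

text \<open>Linearity in the state of the copies is what later allows the evolution of fixed
  vectors, with the hidden parameters entering only through scalar coefficients.\<close>

lemma sim_run_sum:
  "sim_run n (\<lambda>f. \<Sum>s\<in>S. c s * \<xi> s f) t f j = (\<Sum>s\<in>S. c s * sim_run n (\<xi> s) t f j)"
proof (induction t arbitrary: f j)
  case 0
  show ?case by (simp add: sum_distrib_right mult.assoc)
next
  case (Suc t)
  have "sim_run n (\<lambda>f. \<Sum>s\<in>S. c s * \<xi> s f) t = (\<lambda>f j. \<Sum>s\<in>S. c s * sim_run n (\<xi> s) t f j)"
    using Suc by blast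
  moreover have "sim_query n (\<lambda>f j. \<Sum>s\<in>S. c s * sim_run n (\<xi> s) t f j) f
      = (\<lambda>j. \<Sum>s\<in>S. c s * sim_query n (sim_run n (\<xi> s) t) f j)"
    by (rule HOL.ext) (rule sim_query_sum)
  ultimately show ?case
    by (simp only: sim_run.simps app_sum app_scale)
qed

lemma sim_run_diff:
  "sim_run n \<xi> t f j - sim_run n \<xi>' t f j = sim_run n (\<lambda>f. \<xi> f - \<xi>' f) t f j"
  using sim_run_sum[of n "\<lambda>b. if b then 1 else - 1" "\<lambda>b. if b then \<xi> else \<xi>'" "UNIV :: bool set" t f j]
  by (simp add: UNIV_bool if_distrib cong: if_cong)

lemma power_state_upd:
  assumes "l < n"
  shows "power_state n v (f(l := x)) = v x * (\<Prod>i\<in>{..<n} - {l}. v (f i))"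
  unfolding power_state_def using assms
  by (subst prod.remove[of _ l]) (auto intro!: prod.cong)

lemma power_state_remove:
  assumes "l < n"
  shows "power_state n v f = v (f l) * (\<Prod>i\<in>{..<n} - {l}. v (f i))"
  using power_state_upd[OF assms, of v f "f l"] by simp

text \<open>The vector v tensored with n copies of v is fixed by every exchange, so all n + 1
  summands agree.\<close>

lemma swapsum_power_state:
  "swapsum n (\<lambda>f x. of_real (v x) * of_real (power_state n v f)) f x = of_nat (n + 1) * (of_real (v x) * of_real (power_state n v f))"
proof -
  have "of_real (v (f l)) * of_real (power_state n v (f(l := x))) = (of_real (v x) * of_real (power_state n v f) :: complex)"
    if "l < n" for l
    using power_state_upd[OF that, of v f x] power_state_remove[OF that, of v f]
    by (simp flip: of_real_mult add: mult_ac)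
  then show ?thesis by (simp add: swapsum_def algebra_simps)
qed

lemma symmetric_mult_power_state: "symmetric n (\<lambda>f x. a x * of_real (power_state n v f))"
  using symmetric_power_state[of n v] by (auto simp: symmetric_def fun_eq_iff)

text \<open>Reflecting about the symmetric subspace of n + 1 systems instead of about v errs only on the part
  of the query register orthogonal to v, whose symmetrization has norm 1 / sqrt (n + 1).\<close>
lemma swapsum_orthogonal:
  assumes v: "(\<Sum>x\<in>X. (v x)\<^sup>2) = 1" and orth: "(\<Sum>x\<in>X. of_real (v x) * a x) = 0"
  shows "(\<Sum>f\<in>tuples n. \<Sum>x\<in>X. (cmod (swapsum n (\<lambda>f x. a x * of_real (power_state n v f)) f x))\<^sup>2)
    = real (n + 1) * (nrm X a)\<^sup>2"
proof -
  define b where "b = (\<lambda>f x. a x * complex_of_real (power_state n v f))"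
  \<comment> \<open>Pairing an exchanged term with the original one leaves, at the query position,
    the overlap of v with \<open>a\<close>, which vanishes. Only the identity summand of
    \<open>swapsum\<close> survives in the inner product.\<close>
  have cross: "(\<Sum>x\<in>X. cnj (b (f(l := x)) (f l)) * b f x) = 0" if "l < n" for f l
  proof -
    have "(\<Sum>x\<in>X. cnj (b (f(l := x)) (f l)) * b f x)
       = (\<Sum>x\<in>X. cnj (a (f l)) * of_real (\<Prod>i\<in>{..<n} - {l}. v (f i)) * of_real (power_state n v f) * (of_real (v x) * a x))"
      by (intro sum.cong refl) (simp add: b_def power_state_upd[OF that])
    then show ?thesis unfolding sum_distrib_left[symmetric] orth by simp
  qed
  have "(\<Sum>f\<in>tuples n. \<Sum>x\<in>X. cnj (swapsum n b f x) * b f x)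
      = (\<Sum>f\<in>tuples n. \<Sum>x\<in>X. cnj (b f x) * b f x + (\<Sum>l<n. cnj (b (f(l := x)) (f l)) * b f x))"
    by (simp only: swapsum_def complex_cnj_add cnj_sum distrib_right sum_distrib_right)
  also have "\<dots> = (\<Sum>f\<in>tuples n. (\<Sum>x\<in>X. cnj (b f x) * b f x) + (\<Sum>l<n. \<Sum>x\<in>X. cnj (b (f(l := x)) (f l)) * b f x))"
    by (simp only: sum.distrib sum.swap[of _ "{..<n}" X])
  also have "\<dots> = (\<Sum>f\<in>tuples n. of_real ((power_state n v f)\<^sup>2) * of_real ((nrm X a)\<^sup>2))"
  proof (rule sum.cong[OF refl])
    fix f
    have "(\<Sum>l<n. \<Sum>x\<in>X. cnj (b (f(l := x)) (f l)) * b f x) = 0"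
      using cross by (intro sum.neutral) auto
    moreover have "(\<Sum>x\<in>X. cnj (b f x) * b f x) = of_real ((power_state n v f)\<^sup>2) * of_real ((nrm X a)\<^sup>2)"
      unfolding of_real_nrm_sq sum_distrib_left by (rule sum.cong) (simp_all add: b_def power2_eq_square)
    ultimately show "(\<Sum>x\<in>X. cnj (b f x) * b f x) + (\<Sum>l<n. \<Sum>x\<in>X. cnj (b (f(l := x)) (f l)) * b f x)
       = of_real ((power_state n v f)\<^sup>2) * of_real ((nrm X a)\<^sup>2)" by (simp only: add_0_right)
  qed
  also have "\<dots> = of_real ((nrm X a)\<^sup>2)"
    unfolding sum_distrib_right[symmetric] of_real_sum[symmetric] sum_power_state[OF v] by simp
  finally have "(\<Sum>f\<in>tuples n. \<Sum>x\<in>X. Re (cnj (swapsum n b f x) * b f x)) = (nrm X a)\<^sup>2"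
    by (simp only: Re_sum[symmetric] Re_complex_of_real)
  moreover have "symmetric n b"
    unfolding b_def by (rule symmetric_mult_power_state)
  ultimately show ?thesis
    unfolding b_def[symmetric] by (simp only: swapsum_norm_real)
qed

text \<open>The part orthogonal to v is the average of \<open>a\<close> and its reflection, two
  vectors of equal norm.\<close>

lemma nrm_orthogonal_part:
  assumes v: "(\<Sum>x\<in>X. (v x)\<^sup>2) = 1" and s: "s = (\<Sum>x\<in>X. of_real (v x) * a x)"
  shows "nrm X (\<lambda>x. a x - of_real (v x) * s) \<le> nrm X a"
    and "(\<Sum>x\<in>X. of_real (v x) * (a x - of_real (v x) * s)) = 0"
proof -
  have v1: "(\<Sum>x\<in>X. complex_of_real (v x) * of_real (v x)) = 1"
    using arg_cong[OF v, of complex_of_real] by (simp add: power2_eq_square)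
  have "(\<Sum>x\<in>X. of_real (v x) * (a x - of_real (v x) * s))
      = (\<Sum>x\<in>X. of_real (v x) * a x) - (\<Sum>x\<in>X. (of_real (v x) * of_real (v x)) * s)"
    unfolding sum_subtractf[symmetric] by (rule sum.cong) (simp_all add: right_diff_distrib)
  also have "\<dots> = s - 1 * s"
    unfolding sum_distrib_right[symmetric] v1 s by (rule refl)
  finally show "(\<Sum>x\<in>X. of_real (v x) * (a x - of_real (v x) * s)) = 0" by (simp only: mult_1 diff_self)
  define a' where "a' = (\<lambda>x. a x - 2 * of_real (v x) * s)"
  have "(nrm X a')\<^sup>2 = (nrm X a)\<^sup>2"
    unfolding a'_def s by (rule reflection_isometry[OF v])
  then have a': "nrm X a' = nrm X a" by simp
  have "nrm X (\<lambda>x. a x - of_real (v x) * s) = nrm X (\<lambda>x. (1 / 2) * a x + (1 / 2) * a' x)"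
    by (rule nrm_cong) (simp add: a'_def field_simps)
  also have "\<dots> \<le> nrm X a"
    by (rule order_trans[OF nrm_add_le]) (simp only: nrm_scale a', simp)
  finally show "nrm X (\<lambda>x. a x - of_real (v x) * s) \<le> nrm X a" .
qed

end

context query_algorithm
begin

lemma symmetric_of_real: "symmetric n (\<lambda>f (_::unit). complex_of_real (power_state n v f))"
  using symmetric_power_state[of n v] unfolding symmetric_def fun_eq_iff by metis

text \<open>Split a slice as s v + b with b orthogonal to v. Both reflections negate the component
  along v. The true one fixes b, while the simulated one moves it by 2 / (n + 1) times
  \<open>swapsum\<close>, whose norm is sqrt (n + 1) times that of b.\<close>

lemma sim_query_error:
  assumes v: "(\<Sum>x\<in>X. (v x)\<^sup>2) = 1"
  shows "ext n (\<lambda>f j. sim_query n (\<lambda>f j. of_real (power_state n v f) * \<phi> j) f j - of_real (power_state n v f) * refl_query v \<phi> j)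
     \<le> 2 / sqrt (real n + 1) * nrm (X \<times> R) \<phi>"
    (is "ext n ?D \<le> _")
proof -
  have slice: "(\<Sum>f\<in>tuples n. \<Sum>x\<in>X. (cmod (?D f (x, r)))\<^sup>2) \<le> 4 / (real n + 1) * (nrm X (\<lambda>x. \<phi> (x, r)))\<^sup>2" for r
  proof (cases "r \<in> R1")
    case False
    then show ?thesis by (simp add: sim_query_def refl_query_def)
  next
    case True
    define a where "a = (\<lambda>x. \<phi> (x, r))"
    define s where "s = (\<Sum>x\<in>X. of_real (v x) * a x)"
    define b where "b = (\<lambda>x. a x - of_real (v x) * s)"
    have "swapsum n (\<lambda>f x. of_real (power_state n v f) * \<phi> (x, r)) f x
        = s * swapsum n (\<lambda>f x. of_real (v x) * of_real (power_state n v f)) f x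
          + swapsum n (\<lambda>f x. b x * of_real (power_state n v f)) f x" for f x
      by (simp add: swapsum_def a_def b_def algebra_simps sum.distrib sum_subtractf sum_distrib_left)
    then have "?D f (x, r) = - of_real (2 / (real n + 1)) * swapsum n (\<lambda>f x. b x * of_real (power_state n v f)) f x" for f x
      using True of_nat_neq_0[of n, where 'a=complex, unfolded of_nat_Suc] unfolding swapsum_power_state
      by (simp add: sim_query_def refl_query_def s_def[unfolded a_def, symmetric] divide_simps of_nat_Suc[symmetric] del: of_nat_Suc)
         (use of_nat_neq_0[of n, where 'a=complex] in \<open>simp add: algebra_simps\<close>)
    then have "(\<Sum>f\<in>tuples n. \<Sum>x\<in>X. (cmod (?D f (x, r)))\<^sup>2)
        = (2 / (real n + 1))\<^sup>2 * (\<Sum>f\<in>tuples n. \<Sum>x\<in>X. (cmod (swapsum n (\<lambda>f x. b x * of_real (power_state n v f)) f x))\<^sup>2)"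
      by (simp only: norm_mult norm_minus_cancel power_mult_distrib norm_of_real power2_abs sum_distrib_left)
    also have "\<dots> = (2 / (real n + 1))\<^sup>2 * (real (n + 1) * (nrm X b)\<^sup>2)"
      by (simp only: swapsum_orthogonal[OF v] nrm_orthogonal_part(2)[OF v s_def] b_def)
    also have "\<dots> \<le> (2 / (real n + 1))\<^sup>2 * (real (n + 1) * (nrm X a)\<^sup>2)"
      using nrm_orthogonal_part(1)[OF v s_def] by (intro mult_left_mono power_mono) (simp_all add: b_def)
    also have "\<dots> = 4 / (real n + 1) * (nrm X a)\<^sup>2"
      by (simp add: power2_eq_square add.commute)
    finally show ?thesis by (simp add: a_def)
  qed
  have "(ext n ?D)\<^sup>2 \<le> (\<Sum>r\<in>R. 4 / (real n + 1) * (nrm X (\<lambda>x. \<phi> (x, r)))\<^sup>2)"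
    unfolding ext_sq_slices by (rule sum_mono) (rule slice)
  also have "\<dots> = (2 / sqrt (real n + 1) * nrm (X \<times> R) \<phi>)\<^sup>2"
    unfolding sum_distrib_left[symmetric] power_mult_distrib nrm_sq_prod by (simp add: power_divide)
  finally have "(ext n ?D)\<^sup>2 \<le> (2 / sqrt (real n + 1) * nrm (X \<times> R) \<phi>)\<^sup>2" .
  then show ?thesis by (rule power2_le_imp_le) simp
qed

lemma ext_triangle: "ext n (\<lambda>f j. \<Psi> f j - \<Psi>'' f j) \<le> ext n (\<lambda>f j. \<Psi> f j - \<Psi>' f j) + ext n (\<lambda>f j. \<Psi>' f j - \<Psi>'' f j)"
  using nrm_diff_triangle[where A="tuples n \<times> (X \<times> R)" and f="\<lambda>(f, j). \<Psi> f j" and g="\<lambda>(f, j). \<Psi>' f j" and h="\<lambda>(f, j). \<Psi>'' f j"]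
  by (simp add: ext_def case_prod_unfold)

text \<open>A second hybrid argument. The accumulated error stays symmetric in the copies, so the
  simulated query preserves its norm, and replacing one query costs 2 / sqrt (n + 1).\<close>

lemma sim_run_error:
  assumes v: "(\<Sum>x\<in>X. (v x)\<^sup>2) = 1" and "t \<le> T"
  shows "ext n (\<lambda>f j. sim_run n (\<lambda>f. of_real (power_state n v f)) t f j - of_real (power_state n v f) * run v t j)
    \<le> real t * (2 / sqrt (real n + 1))"
  using assms(2)
proof (induction t)
  case 0
  then show ?case by (simp add: ext_def nrm_eq_sqrt case_prod_unfold)
next
  case (Suc t)
  let ?p = "\<lambda>f. complex_of_real (power_state n v f)"
  let ?\<Psi> = "sim_run n ?p t"
  let ?e = "2 / sqrt (real n + 1)"
  have sym: "symmetric n (\<lambda>f j. ?\<Psi> f j - ?p f * run v t j)"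
    using symmetric_sim_run[of n ?p t] symmetric_power_state[of n v] unfolding symmetric_def fun_eq_iff by metis
  have "sim_run n ?p (Suc t) f j - ?p f * run v (Suc t) j
    = app (Suc t) (\<lambda>j. sim_query n ?\<Psi> f j - ?p f * refl_query v (run v t) j) j" for f j
    by (simp add: app_diff app_scale)
  then have "ext n (\<lambda>f j. sim_run n ?p (Suc t) f j - ?p f * run v (Suc t) j)
    = ext n (\<lambda>f j. sim_query n ?\<Psi> f j - ?p f * refl_query v (run v t) j)"
    using ext_app[of "Suc t" n "\<lambda>f j. sim_query n ?\<Psi> f j - ?p f * refl_query v (run v t) j"] Suc.prems by simp
  also have "\<dots> \<le> ext n (sim_query n (\<lambda>f j. ?\<Psi> f j - ?p f * run v t j))
     + ext n (\<lambda>f j. sim_query n (\<lambda>f j. ?p f * run v t j) f j - ?p f * refl_query v (run v t) j)"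
    using ext_triangle[of n "sim_query n ?\<Psi>" "\<lambda>f j. ?p f * refl_query v (run v t) j" "sim_query n (\<lambda>f j. ?p f * run v t j)"]
    by (simp add: sim_query_diff)
  also have "\<dots> \<le> real t * ?e + ?e"
    using Suc sim_query_error[OF v, of n "run v t"] nrm_run[OF v, of t] 
    by (intro add_mono) (auto simp: ext_sim_query[OF sym])
  also have "\<dots> = real (Suc t) * ?e" by (simp add: distrib_right add_divide_distrib)
  finally show ?case .
qed

definition accept :: "nat \<Rightarrow> ('x \<times> 'r) set \<Rightarrow> ((nat \<Rightarrow> 'x) \<Rightarrow> complex) \<Rightarrow> real" where
  "accept n B \<xi> = (nrm (tuples n \<times> B) (\<lambda>(f, j). sim_run n \<xi> T f j))\<^sup>2"

lemma accept_sim: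
  assumes v: "(\<Sum>x\<in>X. (v x)\<^sup>2) = 1" and B: "B \<subseteq> X \<times> R"
  shows "\<bar>accept n B (\<lambda>f. of_real (power_state n v f)) - (nrm B (run v T))\<^sup>2\<bar> \<le> 4 * real T / sqrt (real n + 1)"
proof -
  let ?p = "\<lambda>f. complex_of_real (power_state n v f)"
  let ?A = "tuples n \<times> (X \<times> R)"
  let ?g = "\<lambda>(f, j). ?p f * run v T j"
  have g: "(nrm (tuples n \<times> C) ?g)\<^sup>2 = (nrm C (run v T))\<^sup>2" for C
  proof -
    have "(nrm (tuples n \<times> C) ?g)\<^sup>2 = (\<Sum>f\<in>tuples n. (power_state n v f)\<^sup>2) * (nrm C (run v T))\<^sup>2"
      unfolding nrm_sq sum_product by (simp add: sum.cartesian_product case_prod_unfold norm_mult power_mult_distrib)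
    then show ?thesis by (simp add: sum_power_state[OF v])
  qed
  have gA: "nrm ?A ?g = 1" 
    using power2_eq_imp_eq[OF _ nrm_nonneg, of ?A ?g 1] g[of "X \<times> R"] nrm_run[OF v order.refl] by simp
  have "(ext n (sim_run n ?p T))\<^sup>2 = 1"
    by (subst ext_sim_run) (simp_all add: symmetric_of_real sum_power_state[OF v])
  then have "ext n (sim_run n ?p T) = 1"
    using power2_eq_imp_eq[OF _ ext_nonneg, of n "sim_run n ?p T" 1] by simp
  then have sA: "nrm ?A (\<lambda>(f, j). sim_run n ?p T f j) = 1"
    unfolding ext_def .
  have "\<bar>accept n B ?p - (nrm (tuples n \<times> B) ?g)\<^sup>2\<bar>
    \<le> nrm ?A (\<lambda>i. (case i of (f, j) \<Rightarrow> sim_run n ?p T f j) - ?g i) * (nrm ?A (\<lambda>(f, j). sim_run n ?p T f j) + nrm ?A ?g)"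
    unfolding accept_def by (rule accept_diff_le) (use B finX finR in auto)
  also have "\<dots> \<le> (real T * (2 / sqrt (real n + 1))) * (1 + 1)"
    unfolding sA gA using sim_run_error[OF v order.refl, of n]
    by (intro mult_right_mono) (auto simp: ext_def case_prod_unfold)
  finally show ?thesis by (simp add: g)
qed

text \<open>Allows the initial state of the copies to be altered, in particular truncated, at a cost
  measured on the copies alone, because the simulated evolution is isometric on symmetric
  states.\<close>

lemma accept_diff:
  assumes s: "symmetric n (\<lambda>f (_::unit). \<xi> f)" "symmetric n (\<lambda>f (_::unit). \<xi>' f)" and B: "B \<subseteq> X \<times> R"
  shows "\<bar>accept n B \<xi> - accept n B \<xi>'\<bar>
    \<le> nrm (tuples n) (\<lambda>f. \<xi> f - \<xi>' f) * (nrm (tuples n) \<xi> + nrm (tuples n) \<xi>')"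
proof -
  let ?A = "tuples n \<times> (X \<times> R)"
  have n: "nrm ?A (\<lambda>(f, j). sim_run n \<zeta> T f j) = nrm (tuples n) \<zeta>"
    if "symmetric n (\<lambda>f (_::unit). \<zeta> f)" for \<zeta>
    using ext_sim_run[OF that order.refl] by (simp add: ext_def nrm_sq[of "tuples n", symmetric])
  have d: "symmetric n (\<lambda>f (_::unit). \<xi> f - \<xi>' f)" using s unfolding symmetric_def fun_eq_iff by metis
  have "\<bar>accept n B \<xi> - accept n B \<xi>'\<bar>
    \<le> nrm ?A (\<lambda>i. (case i of (f, j) \<Rightarrow> sim_run n \<xi> T f j) - (case i of (f, j) \<Rightarrow> sim_run n \<xi>' T f j))
      * (nrm ?A (\<lambda>(f, j). sim_run n \<xi> T f j) + nrm ?A (\<lambda>(f, j). sim_run n \<xi>' T f j))"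
    unfolding accept_def by (rule accept_diff_le) (use B finX finR in auto)
  also have "(\<lambda>i. (case i of (f, j) \<Rightarrow> sim_run n \<xi> T f j) - (case i of (f, j) \<Rightarrow> sim_run n \<xi>' T f j))
      = (\<lambda>(f, j). sim_run n (\<lambda>f. \<xi> f - \<xi>' f) T f j)"
    by (auto simp: sim_run_diff)
  finally show ?thesis by (simp add: n s d)
qed

end

section \<open>Ensembles of hidden states\<close>

lemma prod_subset_if:
  assumes "finite S" "K \<subseteq> S"
  shows "(\<Prod>k\<in>K. g k) = (\<Prod>k\<in>S. if k \<in> K then g k else 1)"
  using assms prod.inter_restrict[of S g K] by (simp add: Int_absorb1)

text \<open>The unit vector v has a known part \<open>t\<close> on \<open>X0\<close> and M hidden
  blocks. Block k consists of the points \<open>hid k a\<close>, with \<open>lab\<close> and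
  \<open>cmp\<close> as inverse maps, and carries \<gamma> times a unit vector \<open>h\<close>
  drawn independently for every block. Mean zero and covariance \<open>\<tau> \<theta>\<close> make
  an occupied block behave, on average, as one copy of the density matrix
  \<open>\<tau> \<theta>\<close>.\<close>

locale hidden_ensemble = query_algorithm X R R1 V \<phi>0 T
  for X :: "'x set" and R :: "'r set" and R1 V \<phi>0 T +
  fixes X0 :: "'x set" and hid :: "nat \<Rightarrow> 'a \<Rightarrow> 'x" and lab :: "'x \<Rightarrow> nat" and cmp :: "'x \<Rightarrow> 'a"
    and M :: nat and A :: "'a set" and t :: "'x \<Rightarrow> real" and \<gamma> :: real
    and \<Omega> :: "'w set" and \<Theta> :: "'th set" and h :: "'th \<Rightarrow> 'w \<Rightarrow> 'a \<Rightarrow> real"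
    and \<tau> :: "'th \<Rightarrow> 'a \<Rightarrow> 'a \<Rightarrow> real"
  assumes X0: "X0 \<subseteq> X" and finA: "finite A" and neA: "A \<noteq> {}"
    and hid_mem: "\<And>k a. k < M \<Longrightarrow> a \<in> A \<Longrightarrow> hid k a \<in> X - X0"
    and hid_cover: "\<And>x. x \<in> X - X0 \<Longrightarrow> lab x < M \<and> cmp x \<in> A \<and> hid (lab x) (cmp x) = x"
    and lab_hid: "\<And>k a. k < M \<Longrightarrow> a \<in> A \<Longrightarrow> lab (hid k a) = k"
    and cmp_hid: "\<And>k a. k < M \<Longrightarrow> a \<in> A \<Longrightarrow> cmp (hid k a) = a"
    and fin\<Omega>: "finite \<Omega>" and ne\<Omega>: "\<Omega> \<noteq> {}"
    and h_norm: "\<And>\<theta> w. \<theta> \<in> \<Theta> \<Longrightarrow> w \<in> \<Omega> \<Longrightarrow> (\<Sum>a\<in>A. (h \<theta> w a)\<^sup>2) = 1"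
    and h_mean: "\<And>\<theta> a. \<theta> \<in> \<Theta> \<Longrightarrow> a \<in> A \<Longrightarrow> (\<Sum>w\<in>\<Omega>. h \<theta> w a) = 0"
    and h_cov: "\<And>\<theta> a b. \<theta> \<in> \<Theta> \<Longrightarrow> a \<in> A \<Longrightarrow> b \<in> A \<Longrightarrow> (\<Sum>w\<in>\<Omega>. h \<theta> w a * h \<theta> w b) = real (card \<Omega>) * \<tau> \<theta> a b"
    and t_norm: "(\<Sum>x\<in>X0. (t x)\<^sup>2) + \<gamma>\<^sup>2 * real M = 1" and M_pos: "0 < M"
begin

definition choices :: "(nat \<Rightarrow> 'w) set" where
  "choices = PiE {..<M} (\<lambda>_. \<Omega>)"

definition vect :: "'th \<Rightarrow> (nat \<Rightarrow> 'w) \<Rightarrow> 'x \<Rightarrow> real" where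
  "vect \<theta> \<omega> x = (if x \<in> X0 then t x else \<gamma> * h \<theta> (\<omega> (lab x)) (cmp x))"

lemma finX0 [simp]: "finite X0"
  using X0 finX by (rule finite_subset)

lemma finite_choices [simp]: "finite choices"
  unfolding choices_def by (intro finite_PiE) (auto simp: fin\<Omega>)

lemma choices_mem: "\<omega> \<in> choices \<Longrightarrow> k < M \<Longrightarrow> \<omega> k \<in> \<Omega>"
  by (auto simp: choices_def PiE_def)

lemma card_choices: "card choices = card \<Omega> ^ M"
  unfolding choices_def by (subst card_PiE) auto

lemma card_choices_pos: "0 < real (card choices)"
  using fin\<Omega> ne\<Omega> by (simp add: card_choices card_gt_0_iff)

lemma sum_X_split:
  fixes F :: "'x \<Rightarrow> 'c::comm_monoid_add"
  shows "(\<Sum>x\<in>X. F x) = (\<Sum>x\<in>X0. F x) + (\<Sum>k<M. \<Sum>a\<in>A. F (hid k a))"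
proof -
  have "(\<Sum>x\<in>X - X0. F x) = (\<Sum>(k, a)\<in>{..<M} \<times> A. F (hid k a))"
    by (rule sum.reindex_bij_witness[where i="\<lambda>(k, a). hid k a" and j="\<lambda>x. (lab x, cmp x)"])
       (auto simp: hid_cover lab_hid cmp_hid dest: hid_mem)
  then show ?thesis
    using sum.subset_diff[OF X0 finX, of F] by (simp add: sum.cartesian_product add.commute)
qed

lemma vect_hid: "k < M \<Longrightarrow> a \<in> A \<Longrightarrow> vect \<theta> \<omega> (hid k a) = \<gamma> * h \<theta> (\<omega> k) a"
  using hid_mem[of k a] by (simp add: vect_def lab_hid cmp_hid)

lemma block_norm:
  assumes "\<theta> \<in> \<Theta>" "\<omega> \<in> choices" "k < M"
  shows "(\<Sum>a\<in>A. (vect \<theta> \<omega> (hid k a))\<^sup>2) = \<gamma>\<^sup>2"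
  using h_norm[OF assms(1) choices_mem[OF assms(2,3)]] assms(3)
  by (simp add: vect_hid power_mult_distrib flip: sum_distrib_left)

lemma vect_unit:
  assumes "\<theta> \<in> \<Theta>" "\<omega> \<in> choices"
  shows "(\<Sum>x\<in>X. (vect \<theta> \<omega> x)\<^sup>2) = 1"
proof -
  have "(\<Sum>x\<in>X0. (vect \<theta> \<omega> x)\<^sup>2) = (\<Sum>x\<in>X0. (t x)\<^sup>2)" by (simp add: vect_def)
  then show ?thesis
    using t_norm by (simp add: sum_X_split block_norm[OF assms] mult.commute)
qed

section \<open>Expansion of the copies into vectors independent of the hidden parameters\<close>

definition hpos :: "nat \<Rightarrow> (nat \<Rightarrow> 'x) \<Rightarrow> nat set" where
  "hpos n f = {l. l < n \<and> f l \<notin> X0}"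

definition distinct_labels :: "nat \<Rightarrow> (nat \<Rightarrow> 'x) \<Rightarrow> bool" where
  "distinct_labels n f \<longleftrightarrow> inj_on (\<lambda>l. lab (f l)) (hpos n f)"

definition known_weight :: "nat \<Rightarrow> (nat \<Rightarrow> 'x) \<Rightarrow> real" where
  "known_weight n f = (\<Prod>l\<in>{..<n} - hpos n f. t (f l))"

text \<open>What a collision-free tuple contains once positions are forgotten: the set of occupied
  blocks and the component seen in each of them.\<close>

definition configs :: "(nat set \<times> (nat \<Rightarrow> 'a)) set" where
  "configs = Sigma (Pow {..<M}) (\<lambda>K. PiE K (\<lambda>_. A))"

definition graph :: "nat set \<times> (nat \<Rightarrow> 'a) \<Rightarrow> 'x set" where
  "graph i = (\<lambda>k. hid k (snd i k)) ` fst i"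

text \<open>The unnormalised symmetric sum over all ways of placing the points of
  \<open>graph i\<close> among the n positions, the other positions carrying known amplitudes.
  Neither \<theta> nor \<omega> occurs in it.\<close>

definition basis :: "nat \<Rightarrow> nat set \<times> (nat \<Rightarrow> 'a) \<Rightarrow> (nat \<Rightarrow> 'x) \<Rightarrow> real" where
  "basis n i f = (if distinct_labels n f \<and> f ` hpos n f = graph i then known_weight n f else 0)"

definition coef :: "'th \<Rightarrow> (nat \<Rightarrow> 'w) \<Rightarrow> nat set \<times> (nat \<Rightarrow> 'a) \<Rightarrow> real" where
  "coef \<theta> \<omega> i = (\<Prod>k\<in>fst i. \<gamma> * h \<theta> (\<omega> k) (snd i k))"

definition dstate :: "nat \<Rightarrow> 'th \<Rightarrow> (nat \<Rightarrow> 'w) \<Rightarrow> (nat \<Rightarrow> 'x) \<Rightarrow> real" where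
  "dstate n \<theta> \<omega> f = (\<Sum>i\<in>configs. coef \<theta> \<omega> i * basis n i f)"

lemma finite_hpos [simp]: "finite (hpos n f)"
  by (simp add: hpos_def)

lemma finite_configs [simp]: "finite configs"
  unfolding configs_def by (intro finite_SigmaI finite_PiE) (auto simp: finA intro: finite_subset)

lemma configsD:
  assumes "i \<in> configs"
  shows "fst i \<subseteq> {..<M}" "finite (fst i)" "\<And>k. k \<in> fst i \<Longrightarrow> k < M" "\<And>k. k \<in> fst i \<Longrightarrow> snd i k \<in> A"
    "snd i \<in> extensional (fst i)"
  using assms finite_subset[of "fst i" "{..<M}"] by (auto simp: configs_def PiE_def)

lemma lab_graph: "i \<in> configs \<Longrightarrow> lab ` graph i = fst i"
  using configsD[of i] lab_hid by (auto simp: graph_def image_image)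

lemma graph_inj: "inj_on graph configs"
proof (rule inj_onI)
  fix i j assume i: "i \<in> configs" and j: "j \<in> configs" and eq: "graph i = graph j"
  have K: "fst i = fst j" using lab_graph[OF i] lab_graph[OF j] eq by simp
  have "snd i k = snd j k" if k: "k \<in> fst i" for k
  proof -
    have "hid k (snd i k) \<in> graph j" using k eq by (auto simp: graph_def)
    then obtain l where l: "l \<in> fst j" "hid k (snd i k) = hid l (snd j l)" by (auto simp: graph_def)
    then have "k = l"
      using lab_hid configsD[OF i] configsD[OF j] k by metis
    then show ?thesis using l cmp_hid configsD[OF i] configsD[OF j] k by metis
  qed
  then have "snd i = snd j"
    using configsD(5)[OF i] configsD(5)[OF j] K by (metis extensionalityI)
  with K show "i = j" by (simp add: prod_eq_iff)
qed

lemma graph_exists: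
  assumes f: "f \<in> tuples n" and d: "distinct_labels n f"
  obtains i where "i \<in> configs" "graph i = f ` hpos n f"
    "fst i = (\<lambda>l. lab (f l)) ` hpos n f" "\<And>l. l \<in> hpos n f \<Longrightarrow> snd i (lab (f l)) = cmp (f l)"
proof -
  define K where "K = (\<lambda>l. lab (f l)) ` hpos n f"
  define a where "a = restrict (\<lambda>k. cmp (f (the_inv_into (hpos n f) (\<lambda>l. lab (f l)) k))) K"
  have al: "a (lab (f l)) = cmp (f l)" if "l \<in> hpos n f" for l
    using that d the_inv_into_f_f[of "\<lambda>l. lab (f l)" "hpos n f" l] by (simp add: a_def K_def distinct_labels_def)
  have fl: "f l \<in> X - X0" if "l \<in> hpos n f" for l
    using that tuples_mem[OF f] by (simp add: hpos_def)
  have "(K, a) \<in> configs"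
    using fl hid_cover al by (auto simp: configs_def K_def PiE_def a_def)
  moreover have "graph (K, a) = f ` hpos n f"
    using fl hid_cover al by (simp add: graph_def K_def image_image)
  ultimately show ?thesis using al by (intro that[of "(K, a)"]) (auto simp: K_def)
qed

text \<open>A collision-free tuple belongs to exactly one configuration, so a single term survives.
  The powers of \<open>y\<close> count hidden positions: y = 1 gives \<open>dstate\<close>, and
  general y gives the generating function in \<open>weight_sum\<close>.\<close>

lemma scaled_sum_basis:
  assumes f: "f \<in> tuples n"
  shows "(\<Sum>i\<in>configs. (coef \<theta> \<omega> i * y ^ card (fst i)) * basis n i f)
    = (if distinct_labels n f then y ^ card (hpos n f) * power_state n (vect \<theta> \<omega>) f else 0)"
proof (cases "distinct_labels n f")
  case False
  then show ?thesis by (simp add: basis_def)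
next
  case True
  obtain i where i: "i \<in> configs" "graph i = f ` hpos n f"
    "fst i = (\<lambda>l. lab (f l)) ` hpos n f" "\<And>l. l \<in> hpos n f \<Longrightarrow> snd i (lab (f l)) = cmp (f l)"
    using graph_exists[OF f True] by blast
  have "basis n j f = 0" if "j \<in> configs - {i}" for j
    using that i(1,2) inj_onD[OF graph_inj, of i j] by (auto simp: basis_def)
  then have "(\<Sum>i\<in>configs. (coef \<theta> \<omega> i * y ^ card (fst i)) * basis n i f) = (coef \<theta> \<omega> i * y ^ card (fst i)) * basis n i f"
    using i(1) by (simp add: sum.remove[of configs i])
  also have "card (fst i) = card (hpos n f)"
    unfolding i(3) using True by (simp add: card_image distinct_labels_def)
  also have "coef \<theta> \<omega> i = (\<Prod>l\<in>hpos n f. \<gamma> * h \<theta> (\<omega> (lab (f l))) (cmp (f l)))"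
    unfolding coef_def i(3) using True i(4) by (subst prod.reindex) (auto simp: distinct_labels_def)
  also have "\<dots> = (\<Prod>l\<in>hpos n f. vect \<theta> \<omega> (f l))"
    by (rule prod.cong) (auto simp: hpos_def vect_def)
  also have "basis n i f = (\<Prod>l\<in>{..<n} - hpos n f. vect \<theta> \<omega> (f l))"
    using True i(2) by (simp add: basis_def known_weight_def) (auto simp: hpos_def vect_def intro!: prod.cong)
  also have "(\<Prod>l\<in>hpos n f. vect \<theta> \<omega> (f l)) * y ^ card (hpos n f) * (\<Prod>l\<in>{..<n} - hpos n f. vect \<theta> \<omega> (f l))
      = y ^ card (hpos n f) * power_state n (vect \<theta> \<omega>) f"
  proof -
    have "power_state n (vect \<theta> \<omega>) f = (\<Prod>l\<in>{..<n} - hpos n f. vect \<theta> \<omega> (f l)) * (\<Prod>l\<in>hpos n f. vect \<theta> \<omega> (f l))"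
      unfolding power_state_def by (rule prod.subset_diff) (auto simp: hpos_def)
    then show ?thesis by (simp only: mult_ac)
  qed
  finally show ?thesis using True by simp
qed

lemma dstate_eq:
  "f \<in> tuples n \<Longrightarrow> dstate n \<theta> \<omega> f = (if distinct_labels n f then power_state n (vect \<theta> \<omega>) f else 0)"
  using scaled_sum_basis[of f n \<theta> \<omega> 1] by (simp add: dstate_def)

lemma basis_symmetric: "symmetric n (\<lambda>f (_::unit). basis n i f)"
proof -
  have "basis n i (f \<circ> transpose a b) = basis n i f" if ab: "a < n" "b < n" for f a b
  proof -
    let ?p = "transpose a b"
    have hp: "hpos n (f \<circ> ?p) = ?p ` hpos n f"
      using ab by (auto simp: hpos_def transpose_def image_iff split: if_splits)
    have "inj_on (\<lambda>l. lab (f (?p l))) (?p ` hpos n f) \<longleftrightarrow> inj_on (\<lambda>l. lab (f l)) (hpos n f)"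
      unfolding inj_on_def by (auto, metis transpose_involutory)
    moreover have "(\<lambda>l. f (?p l)) ` (?p ` hpos n f) = f ` hpos n f"
      by (simp add: image_image)
    moreover have "(\<Prod>l\<in>{..<n} - ?p ` hpos n f. t (f (?p l))) = (\<Prod>l\<in>{..<n} - hpos n f. t (f l))"
      by (rule prod.reindex_bij_witness[where i="?p" and j="?p"]) (use ab in \<open>auto simp: transpose_def image_iff split: if_splits\<close>)
    ultimately show ?thesis
      unfolding basis_def distinct_labels_def known_weight_def hp by (simp add: image_comp comp_def)
  qed
  then show ?thesis by (auto simp: symmetric_def fun_eq_iff)
qed

lemma dstate_symmetric: "symmetric n (\<lambda>f (_::unit). dstate n \<theta> \<omega> f)"
  using basis_symmetric[of n] unfolding symmetric_def fun_eq_iff dstate_def by simp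

lemma symmetric_complex: "symmetric n (\<lambda>f (_::unit). (\<xi> f :: real)) \<Longrightarrow> symmetric n (\<lambda>f (_::unit). complex_of_real (\<xi> f))"
  unfolding symmetric_def fun_eq_iff by metis

text \<open>Under the distribution given by the squared amplitudes, the positions are independent
  and each one lands in block k with probability \<gamma>^2.\<close>

lemma collision_pair:
  assumes th: "\<theta> \<in> \<Theta>" "\<omega> \<in> choices" and l: "l < n" "l' < n" "l \<noteq> l'" and k: "k < M"
  shows "(\<Sum>f\<in>tuples n. (power_state n (vect \<theta> \<omega>) f)\<^sup>2 * of_bool (f l \<notin> X0 \<and> lab (f l) = k \<and> f l' \<notin> X0 \<and> lab (f l') = k)) = \<gamma> ^ 4"
proof -
  define v where "v = vect \<theta> \<omega>"
  define g where "g = (\<lambda>i x. (v x)\<^sup>2 * (if i = l \<or> i = l' then of_bool (x \<notin> X0 \<and> lab x = k) else 1) :: real)"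
  have blk: "(\<Sum>x\<in>X. g i x) = \<gamma>\<^sup>2" if "i = l \<or> i = l'" for i
  proof -
    have "(\<Sum>x\<in>X. g i x) = (\<Sum>k'<M. \<Sum>a\<in>A. (v (hid k' a))\<^sup>2 * of_bool (k' = k))"
      unfolding sum_X_split using that hid_mem
      by (auto simp: g_def lab_hid intro!: sum.cong)
    also have "\<dots> = (\<Sum>k'<M. if k' = k then \<Sum>a\<in>A. (v (hid k' a))\<^sup>2 else 0)"
      by (rule sum.cong) auto
    also have "\<dots> = \<gamma>\<^sup>2" using k by (simp add: v_def block_norm[OF th])
    finally show ?thesis .
  qed
  have one: "(\<Sum>x\<in>X. g i x) = 1" if "i \<noteq> l" "i \<noteq> l'" for i
    using that vect_unit[OF th] by (simp add: g_def v_def)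
  have "(\<Sum>f\<in>tuples n. (power_state n v f)\<^sup>2 * of_bool (f l \<notin> X0 \<and> lab (f l) = k \<and> f l' \<notin> X0 \<and> lab (f l') = k))
      = (\<Sum>f\<in>tuples n. \<Prod>i<n. g i (f i))"
  proof (rule sum.cong[OF refl])
    fix f
    have "(\<Prod>i<n. if i = l \<or> i = l' then G i else 1) = G l * G l'" for G :: "nat \<Rightarrow> real"
      using prod_subset_if[of "{..<n}" "{l, l'}" G] l by simp
    from this[of "\<lambda>i. of_bool (f i \<notin> X0 \<and> lab (f i) = k)"]
    show "(power_state n v f)\<^sup>2 * of_bool (f l \<notin> X0 \<and> lab (f l) = k \<and> f l' \<notin> X0 \<and> lab (f l') = k) = (\<Prod>i<n. g i (f i))"
      unfolding g_def prod.distrib power_state_def prod_power_distrib by (simp flip: of_bool_conj add: conj_assoc)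
  qed
  also have "\<dots> = (\<Prod>i<n. \<Sum>x\<in>X. g i x)" by (rule sum_tuples_prod)
  also have "\<dots> = (\<Prod>i<n. if i \<in> {l, l'} then \<gamma>\<^sup>2 else 1)"
    by (rule prod.cong) (use blk one in auto)
  also have "\<dots> = (\<Prod>i\<in>{l, l'}. \<gamma>\<^sup>2)"
    using l prod_subset_if[of "{..<n}" "{l, l'}" "\<lambda>i. \<gamma>\<^sup>2"] by simp
  also have "\<dots> = \<gamma> ^ 4" using l(3) by (simp flip: power_add)
  finally show ?thesis by (simp add: v_def)
qed

text \<open>Union bound over at most n^2 pairs of positions and M blocks. As \<gamma>^2 M is at most
  1, the discarded squared mass is at most n^2 / M.\<close>

lemma collision_mass:
  assumes th: "\<theta> \<in> \<Theta>" "\<omega> \<in> choices"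
  shows "nrm (tuples n) (\<lambda>f. of_real (power_state n (vect \<theta> \<omega>) f) - of_real (dstate n \<theta> \<omega> f)) \<le> real n / sqrt (real M)"
proof -
  let ?p = "\<lambda>f. (power_state n (vect \<theta> \<omega>) f)\<^sup>2"
  let ?c = "\<lambda>f l l' k. of_bool (f l \<notin> X0 \<and> lab (f l) = k \<and> f l' \<notin> X0 \<and> lab (f l') = k) :: real"
  have \<gamma>: "\<gamma>\<^sup>2 * real M \<le> 1" using t_norm sum_nonneg[of X0 "\<lambda>x. (t x)\<^sup>2"] by simp
  have "(nrm (tuples n) (\<lambda>f. of_real (power_state n (vect \<theta> \<omega>) f) - of_real (dstate n \<theta> \<omega> f)))\<^sup>2
     = (\<Sum>f\<in>tuples n. ?p f * of_bool (\<not> distinct_labels n f))"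
    unfolding nrm_sq by (rule sum.cong) (simp_all add: dstate_eq)
  also have "\<dots> \<le> (\<Sum>f\<in>tuples n. \<Sum>l<n. \<Sum>l'\<in>{..<n} - {l}. \<Sum>k<M. ?p f * ?c f l l' k)"
  proof (rule sum_mono)
    fix f assume f: "f \<in> tuples n"
    show "?p f * of_bool (\<not> distinct_labels n f) \<le> (\<Sum>l<n. \<Sum>l'\<in>{..<n} - {l}. \<Sum>k<M. ?p f * ?c f l l' k)"
    proof (cases "distinct_labels n f")
      case True
      then show ?thesis by (simp add: sum_nonneg)
    next
      case False
      then obtain l l' where l: "l < n" "l' < n" "l \<noteq> l'" "f l \<notin> X0" "f l' \<notin> X0" "lab (f l) = lab (f l')"
        by (auto simp: distinct_labels_def inj_on_def hpos_def)
      have k: "lab (f l) < M" using hid_cover tuples_mem[OF f l(1)] l(4) by auto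
      have "?p f = ?p f * ?c f l l' (lab (f l))" using l by simp
      also have "\<dots> \<le> (\<Sum>k<M. ?p f * ?c f l l' k)"
        by (rule member_le_sum) (use k in auto)
      also have "\<dots> \<le> (\<Sum>l'\<in>{..<n} - {l}. \<Sum>k<M. ?p f * ?c f l l' k)"
        by (rule member_le_sum) (use l in \<open>auto intro!: sum_nonneg\<close>)
      also have "\<dots> \<le> (\<Sum>l<n. \<Sum>l'\<in>{..<n} - {l}. \<Sum>k<M. ?p f * ?c f l l' k)"
        by (rule member_le_sum) (use l in \<open>auto intro!: sum_nonneg\<close>)
      finally show ?thesis using False by simp
    qed
  qed
  also have "\<dots> = (\<Sum>l<n. \<Sum>l'\<in>{..<n} - {l}. \<Sum>k<M. \<Sum>f\<in>tuples n. ?p f * ?c f l l' k)"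
  proof -
    have "(\<Sum>f\<in>tuples n. \<Sum>l<n. \<Sum>l'\<in>{..<n} - {l}. \<Sum>k<M. ?p f * ?c f l l' k)
      = (\<Sum>l<n. \<Sum>f\<in>tuples n. \<Sum>l'\<in>{..<n} - {l}. \<Sum>k<M. ?p f * ?c f l l' k)" by (rule sum.swap)
    also have "\<dots> = (\<Sum>l<n. \<Sum>l'\<in>{..<n} - {l}. \<Sum>f\<in>tuples n. \<Sum>k<M. ?p f * ?c f l l' k)"
      by (intro sum.cong refl sum.swap)
    also have "\<dots> = (\<Sum>l<n. \<Sum>l'\<in>{..<n} - {l}. \<Sum>k<M. \<Sum>f\<in>tuples n. ?p f * ?c f l l' k)"
      by (intro sum.cong refl sum.swap)
    finally show ?thesis .
  qed
  also have "\<dots> = (\<Sum>l<n. \<Sum>l'\<in>{..<n} - {l}. \<Sum>k<M. \<gamma> ^ 4)"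
    by (intro sum.cong refl collision_pair[OF th]) auto
  also have "\<dots> \<le> (\<Sum>l<n. \<Sum>l'<n. \<Sum>k<M. \<gamma> ^ 4)"
    by (intro sum_mono sum_mono2) auto
  also have "\<dots> = (real n)\<^sup>2 * ((\<gamma>\<^sup>2 * real M) * (\<gamma>\<^sup>2 * real M)) / real M"
    using M_pos by (simp add: power2_eq_square power4_eq_xxxx)
  also have "\<dots> \<le> (real n)\<^sup>2 * (1 * 1) / real M"
    by (intro divide_right_mono mult_left_mono mult_mono \<gamma>) auto
  also have "\<dots> = (real n / sqrt (real M))\<^sup>2" by (simp add: power_divide)
  finally show ?thesis by (rule power2_le_imp_le) simp
qed

end

section \<open>Second moments over the hidden choices and acceptance as a quadratic form\<close>

lemma sum_mult_le_sqrt: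
  fixes f g :: "'i \<Rightarrow> real"
  shows "\<bar>\<Sum>i\<in>I. f i * g i\<bar> \<le> sqrt (\<Sum>i\<in>I. (f i)\<^sup>2) * sqrt (\<Sum>i\<in>I. (g i)\<^sup>2)"
proof -
  have "\<bar>\<Sum>i\<in>I. f i * g i\<bar> \<le> (\<Sum>i\<in>I. \<bar>f i\<bar> * \<bar>g i\<bar>)"
    by (rule order_trans[OF sum_abs]) (simp add: abs_mult)
  also have "\<dots> \<le> L2_set f I * L2_set g I" by (rule L2_set_mult_ineq)
  finally show ?thesis by (simp add: L2_set_def)
qed

context hidden_ensemble
begin

definition bnorm :: "nat \<Rightarrow> nat set \<times> (nat \<Rightarrow> 'a) \<Rightarrow> real" where
  "bnorm n i = (\<Sum>f\<in>tuples n. (basis n i f)\<^sup>2)"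

lemma bnorm_nonneg [simp]: "0 \<le> bnorm n i"
  by (simp add: bnorm_def sum_nonneg)

lemma basis_orthogonal:
  assumes "i \<in> configs" "j \<in> configs" "i \<noteq> j"
  shows "basis n i f * basis n j f = 0"
  using assms inj_onD[OF graph_inj, of i j] by (auto simp: basis_def)

text \<open>Distinct configurations have disjoint supports, so the identity holds pointwise in f
  before summation.\<close>

lemma sum_basis_sq:
  assumes J: "J \<subseteq> configs"
  shows "(\<Sum>f\<in>tuples n. (\<Sum>i\<in>J. c i * basis n i f)\<^sup>2) = (\<Sum>i\<in>J. (c i)\<^sup>2 * bnorm n i)"
proof -
  have fJ: "finite J" using J finite_configs by (rule finite_subset)
  have "(\<Sum>i\<in>J. c i * basis n i f)\<^sup>2 = (\<Sum>i\<in>J. (c i)\<^sup>2 * (basis n i f)\<^sup>2)" for f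
  proof -
    have "(\<Sum>i\<in>J. c i * basis n i f)\<^sup>2 = (\<Sum>i\<in>J. \<Sum>j\<in>J. (c i * c j) * (basis n i f * basis n j f))"
      by (simp add: power2_eq_square sum_product mult_ac)
    also have "\<dots> = (\<Sum>i\<in>J. \<Sum>j\<in>J. if j = i then (c i)\<^sup>2 * (basis n i f)\<^sup>2 else 0)"
    proof (intro sum.cong refl)
      fix i j assume "i \<in> J" "j \<in> J"
      then show "(c i * c j) * (basis n i f * basis n j f) = (if j = i then (c i)\<^sup>2 * (basis n i f)\<^sup>2 else 0)"
        using basis_orthogonal[OF subsetD[OF J] subsetD[OF J], of i j n f] by (cases "j = i") (simp_all add: power2_eq_square)
    qed
    finally show ?thesis using fJ by simp
  qed
  then show ?thesis
    by (simp add: bnorm_def sum_distrib_left sum.swap[of _ J "tuples n"])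
qed

text \<open>Swapping the values \<open>a k\<close> and \<open>a' k\<close> inside every block k of K
  is an involution on tuples. It carries one configuration to the other and leaves labels and known
  amplitudes alone. One inequality suffices by symmetry.\<close>

lemma bnorm_const:
  assumes K: "K \<subseteq> {..<M}" and a: "a \<in> PiE K (\<lambda>_. A)" and a': "a' \<in> PiE K (\<lambda>_. A)"
  shows "bnorm n (K, a) = bnorm n (K, a')"
proof -
  have eq: "bnorm n (K, a) \<le> bnorm n (K, a')" if a: "a \<in> PiE K (\<lambda>_. A)" and a': "a' \<in> PiE K (\<lambda>_. A)" for a a'
  proof -
    define \<beta> where "\<beta> x = (if x \<in> X0 \<or> lab x \<notin> K then x else hid (lab x) (transpose (a (lab x)) (a' (lab x)) (cmp x)))" for x
    have tA: "transpose (a k) (a' k) c \<in> A" if "k \<in> K" "c \<in> A" for k c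
      using that a a' by (auto simp: transpose_def PiE_def)
    have \<beta>1: "\<beta> x \<in> X - X0" "lab (\<beta> x) = lab x" "\<beta> (\<beta> x) = x" if "x \<in> X - X0" for x
    proof -
      have x: "lab x < M" "cmp x \<in> A" "hid (lab x) (cmp x) = x" using hid_cover[OF that] by auto
      show "\<beta> x \<in> X - X0" "lab (\<beta> x) = lab x" "\<beta> (\<beta> x) = x"
        using that x tA[of "lab x" "cmp x"] hid_mem[of "lab x"] lab_hid[of "lab x"] cmp_hid[of "lab x"]
        by (auto simp: \<beta>_def)
    qed
    have \<beta>0: "\<beta> x = x" if "x \<in> X0" for x using that by (simp add: \<beta>_def)
    have \<beta>X: "\<beta> x \<in> X" "\<beta> (\<beta> x) = x" "\<beta> x \<in> X0 \<longleftrightarrow> x \<in> X0" if "x \<in> X" for x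
      using \<beta>1[of x] \<beta>0[of x] that by (cases "x \<in> X0"; auto)+
    define F where "F f = restrict (\<lambda>l. \<beta> (f l)) {..<n}" for f
    have F: "F f \<in> tuples n" "F (F f) = f" if "f \<in> tuples n" for f
      using that \<beta>X tuples_mem[OF that] unfolding F_def tuples_def by (auto simp: PiE_def extensional_def fun_eq_iff)
    have Fl: "F f l = \<beta> (f l)" if "l < n" for f l using that by (simp add: F_def)
    have basisF: "basis n (K, a') (F f) = basis n (K, a) f"
      if f: "f \<in> tuples n" and ne: "distinct_labels n f" "f ` hpos n f = graph (K, a)" for f
    proof -
      have hp: "hpos n (F f) = hpos n f"
        using \<beta>X tuples_mem[OF f] by (auto simp: hpos_def Fl)
      have hX: "f l \<in> X - X0" "l < n" if "l \<in> hpos n f" for l using that tuples_mem[OF f] by (auto simp: hpos_def)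
      have 1: "distinct_labels n (F f)"
        using ne(1) hX \<beta>1 unfolding distinct_labels_def hp inj_on_def by (simp add: Fl)
      have "F f ` hpos n f = \<beta> ` (f ` hpos n f)"
        unfolding image_image using hX by (intro image_cong) (auto simp: Fl)
      also have "\<dots> = graph (K, a')"
        unfolding ne(2) graph_def image_image fst_conv snd_conv
      proof (rule image_cong[OF refl])
        fix k assume k: "k \<in> K"
        have "a k \<in> A" "k < M" "a' k \<in> A" using k a a' K by auto
        then show "\<beta> (hid k (a k)) = hid k (a' k)"
          using k hid_mem lab_hid cmp_hid by (simp add: \<beta>_def)
      qed
      finally have 2: "F f ` hpos n f = graph (K, a')" .
      have "known_weight n (F f) = known_weight n f"
        unfolding known_weight_def hp by (rule prod.cong) (auto simp: Fl hpos_def \<beta>0)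
      with 1 2 ne show ?thesis by (simp add: basis_def hp)
    qed
    have "bnorm n (K, a) = (\<Sum>f\<in>{f\<in>tuples n. distinct_labels n f \<and> f ` hpos n f = graph (K, a)}. (basis n (K, a) f)\<^sup>2)"
      unfolding bnorm_def by (rule sum.mono_neutral_right) (auto simp: basis_def)
    also have "\<dots> = (\<Sum>f\<in>{f\<in>tuples n. distinct_labels n f \<and> f ` hpos n f = graph (K, a)}. (basis n (K, a') (F f))\<^sup>2)"
      by (rule sum.cong) (auto simp: basisF)
    also have "\<dots> = (\<Sum>f\<in>F ` {f\<in>tuples n. distinct_labels n f \<and> f ` hpos n f = graph (K, a)}. (basis n (K, a') f)\<^sup>2)"
      by (subst sum.reindex) (auto simp: o_def intro!: inj_on_inverseI[of _ F] F(2))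
    also have "\<dots> \<le> bnorm n (K, a')"
      unfolding bnorm_def by (rule sum_mono2) (auto simp: F(1))
    finally show ?thesis .
  qed
  show ?thesis using eq[OF a a'] eq[OF a' a] by simp
qed

definition cov :: "'th \<Rightarrow> nat set \<times> (nat \<Rightarrow> 'a) \<Rightarrow> nat set \<times> (nat \<Rightarrow> 'a) \<Rightarrow> real" where
  "cov \<theta> i j = (if fst i = fst j then \<Prod>k\<in>fst i. \<gamma>\<^sup>2 * \<tau> \<theta> (snd i k) (snd j k) else 0)"

text \<open>The blocks are chosen independently, so the sum over \<open>choices\<close> factors. A
  block occupied in only one of the two configurations contributes a mean, which is 0; hence
  different sets K do not interfere.\<close>

lemma coef_cov:
  assumes \<theta>: "\<theta> \<in> \<Theta>" and i: "i \<in> configs" and j: "j \<in> configs"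
  shows "(\<Sum>\<omega>\<in>choices. coef \<theta> \<omega> i * coef \<theta> \<omega> j) = real (card choices) * cov \<theta> i j"
proof -
  define g where "g = (\<lambda>k w. (if k \<in> fst i then \<gamma> * h \<theta> w (snd i k) else 1) * (if k \<in> fst j then \<gamma> * h \<theta> w (snd j k) else 1))"
  define c where "c = real (card \<Omega>)"
  have prod_if: "(\<Prod>k\<in>fst p. F k) = (\<Prod>k<M. if k \<in> fst p then F k else 1)" if "p \<in> configs" for p and F :: "nat \<Rightarrow> real"
    using prod_subset_if[of "{..<M}" "fst p" F] configsD(1)[OF that] by simp
  have "(\<Sum>\<omega>\<in>choices. coef \<theta> \<omega> i * coef \<theta> \<omega> j) = (\<Sum>\<omega>\<in>choices. \<Prod>k<M. g k (\<omega> k))"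
    by (simp only: coef_def prod_if[OF i] prod_if[OF j] g_def prod.distrib[symmetric])
  also have "\<dots> = (\<Prod>k<M. \<Sum>w\<in>\<Omega>. g k w)"
    unfolding choices_def using prod_sum_PiE[of "{..<M}" "\<lambda>_. \<Omega>" g] fin\<Omega> by simp
  also have "\<dots> = c ^ M * cov \<theta> i j"
  proof (cases "fst i = fst j")
    case False
    then obtain k where k: "k < M" "k \<in> fst i \<longleftrightarrow> k \<notin> fst j"
      using configsD(1)[OF i] configsD(1)[OF j] by blast
    have "(\<Sum>w\<in>\<Omega>. g k w) = 0"
      using k(2) h_mean[OF \<theta>] configsD(4)[OF i] configsD(4)[OF j]
      by (cases "k \<in> fst i") (simp_all add: g_def flip: sum_distrib_left)
    then have "(\<Prod>k<M. \<Sum>w\<in>\<Omega>. g k w) = 0" using k(1) by (intro prod_zero) auto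
    then show ?thesis using False by (simp add: cov_def)
  next
    case True
    have "(\<Sum>w\<in>\<Omega>. g k w) = c * (if k \<in> fst i then \<gamma>\<^sup>2 * \<tau> \<theta> (snd i k) (snd j k) else 1)" for k
    proof (cases "k \<in> fst i")
      case kt: True
      have "(\<Sum>w\<in>\<Omega>. g k w) = \<gamma>\<^sup>2 * (\<Sum>w\<in>\<Omega>. h \<theta> w (snd i k) * h \<theta> w (snd j k))"
        using kt True by (simp add: g_def sum_distrib_left power2_eq_square mult_ac)
      then show ?thesis
        using kt True h_cov[OF \<theta> configsD(4)[OF i kt]] configsD(4)[OF j] by (simp add: c_def)
    qed (use True in \<open>simp add: g_def c_def\<close>)
    then have "(\<Prod>k<M. \<Sum>w\<in>\<Omega>. g k w) = c ^ M * (\<Prod>k<M. if k \<in> fst i then \<gamma>\<^sup>2 * \<tau> \<theta> (snd i k) (snd j k) else 1)"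
      by (simp add: prod.distrib)
    then show ?thesis using True prod_if[OF i] by (simp add: cov_def)
  qed
  finally show ?thesis by (simp add: card_choices c_def)
qed

definition amp :: "nat \<Rightarrow> nat set \<times> (nat \<Rightarrow> 'a) \<Rightarrow> (nat \<Rightarrow> 'x) \<times> ('x \<times> 'r) \<Rightarrow> complex" where
  "amp n i = (\<lambda>(f, j). sim_run n (\<lambda>f. of_real (basis n i f)) T f j)"

text \<open>The accepting measurement written in the evolved basis. Taking real parts is harmless:
  the coefficients are real, so an acceptance probability is the real part of the quadratic
  form.\<close>

definition gram :: "nat \<Rightarrow> ('x \<times> 'r) set \<Rightarrow> nat set \<times> (nat \<Rightarrow> 'a) \<Rightarrow> nat set \<times> (nat \<Rightarrow> 'a) \<Rightarrow> real" where
  "gram n B i j = Re (\<Sum>y\<in>tuples n \<times> B. cnj (amp n i y) * amp n j y)"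

lemma amp_sum:
  "sim_run n (\<lambda>f. of_real (\<Sum>i\<in>J. c i * basis n i f)) T f j = (\<Sum>i\<in>J. of_real (c i) * amp n i (f, j))"
  using sim_run_sum[where n=n and c="\<lambda>i. complex_of_real (c i)" and \<xi>="\<lambda>i f. of_real (basis n i f)" and S=J and t=T and f=f and j=j]
  by (simp add: amp_def)

lemma accept_combination:
  "accept n B (\<lambda>f. of_real (\<Sum>i\<in>J. c i * basis n i f)) = (\<Sum>i\<in>J. \<Sum>j\<in>J. c i * c j * gram n B i j)"
proof -
  have "complex_of_real (accept n B (\<lambda>f. of_real (\<Sum>i\<in>J. c i * basis n i f)))
     = (\<Sum>y\<in>tuples n \<times> B. cnj (\<Sum>i\<in>J. of_real (c i) * amp n i y) * (\<Sum>j\<in>J. of_real (c j) * amp n j y))"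
    unfolding accept_def of_real_nrm_sq amp_sum by (simp only: case_prod_unfold prod.collapse)
  also have "\<dots> = (\<Sum>y\<in>tuples n \<times> B. \<Sum>i\<in>J. \<Sum>j\<in>J. of_real (c i * c j) * (cnj (amp n i y) * amp n j y))"
    unfolding cnj_sum sum_product by (intro sum.cong refl) simp
  also have "\<dots> = (\<Sum>i\<in>J. \<Sum>j\<in>J. of_real (c i * c j) * (\<Sum>y\<in>tuples n \<times> B. cnj (amp n i y) * amp n j y))"
    by (simp only: sum_distrib_left sum.swap[of _ J "tuples n \<times> B"])
  finally have "Re (complex_of_real (accept n B (\<lambda>f. of_real (\<Sum>i\<in>J. c i * basis n i f))))
     = Re (\<Sum>i\<in>J. \<Sum>j\<in>J. of_real (c i * c j) * (\<Sum>y\<in>tuples n \<times> B. cnj (amp n i y) * amp n j y))"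
    by (rule arg_cong)
  then show ?thesis
    unfolding Re_sum gram_def by simp
qed

text \<open>A combination of basis vectors is symmetric, hence evolves isometrically; this is how
  the evolved vectors inherit the orthogonality of the initial ones.\<close>

lemma nrm_amp_combination:
  assumes J: "J \<subseteq> configs"
  shows "(nrm (tuples n \<times> (X \<times> R)) (\<lambda>y. \<Sum>i\<in>J. of_real (c i) * amp n i y))\<^sup>2 = (\<Sum>i\<in>J. (c i)\<^sup>2 * bnorm n i)"
proof -
  let ?\<xi> = "\<lambda>f. complex_of_real (\<Sum>i\<in>J. c i * basis n i f)"
  have "symmetric n (\<lambda>f (_::unit). ?\<xi> f)"
    using basis_symmetric[of n] unfolding symmetric_def fun_eq_iff by simp
  then have "(ext n (sim_run n ?\<xi> T))\<^sup>2 = (\<Sum>f\<in>tuples n. (cmod (?\<xi> f))\<^sup>2)"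
    by (rule ext_sim_run) simp
  also have "\<dots> = (\<Sum>i\<in>J. (c i)\<^sup>2 * bnorm n i)"
    unfolding norm_of_real power2_abs by (rule sum_basis_sq[OF J])
  finally show ?thesis
    unfolding ext_def amp_sum by (simp only: case_prod_unfold prod.collapse)
qed

text \<open>Bessel's inequality for the evolved basis states, which stay orthogonal.\<close>
lemma gram_bessel:
  assumes J: "J \<subseteq> configs" and i: "i \<in> configs" and B: "B \<subseteq> X \<times> R"
    and S: "\<And>j. j \<in> J \<Longrightarrow> bnorm n j = S" "bnorm n i = S"
  shows "(\<Sum>j\<in>J. (gram n B i j)\<^sup>2) \<le> S\<^sup>2"
proof -
  let ?A = "tuples n \<times> (X \<times> R)"
  let ?B = "tuples n \<times> B"
  define Z where "Z = (\<Sum>j\<in>J. (gram n B i j)\<^sup>2)"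
  have Z0: "0 \<le> Z" by (simp add: Z_def sum_nonneg)
  have S0: "0 \<le> S" using S(2) bnorm_nonneg[of n i] by simp
  have sub: "?B \<subseteq> ?A" "finite ?A" using B finX finR by auto
  define u where "u = (\<lambda>y. \<Sum>j\<in>J. of_real (gram n B i j) * amp n j y)"
  have nu: "(nrm ?A u)\<^sup>2 = Z * S"
    unfolding u_def nrm_amp_combination[OF J] Z_def using S(1) by (simp add: sum_distrib_right)
  have ni: "(nrm ?A (amp n i))\<^sup>2 = S"
    using nrm_amp_combination[of "{i}" n "\<lambda>_. 1"] i S(2) by simp
  have "Z = Re (\<Sum>y\<in>?B. cnj (amp n i y) * u y)"
  proof -
    have "(\<Sum>y\<in>?B. cnj (amp n i y) * u y) = (\<Sum>j\<in>J. of_real (gram n B i j) * (\<Sum>y\<in>?B. cnj (amp n i y) * amp n j y))"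
      unfolding u_def sum_distrib_left by (subst sum.swap) (simp only: mult.left_commute)
    then show ?thesis by (simp add: Z_def gram_def power2_eq_square)
  qed
  also have "\<dots> \<le> cmod (\<Sum>y\<in>?B. cnj (amp n i y) * u y)" by (rule complex_Re_le_cmod)
  also have "\<dots> \<le> nrm ?B (\<lambda>y. cnj (amp n i y)) * nrm ?B u" by (rule inner_le_nrm)
  also have "\<dots> \<le> nrm ?A (amp n i) * nrm ?A u"
  proof (rule mult_mono)
    show "nrm ?B (\<lambda>y. cnj (amp n i y)) \<le> nrm ?A (amp n i)"
      using nrm_mono_set[OF sub(2,1), of "amp n i"] by (simp add: nrm_eq_sqrt)
  qed (simp_all add: nrm_mono_set[OF sub(2,1)])
  finally have "Z\<^sup>2 \<le> (nrm ?A (amp n i) * nrm ?A u)\<^sup>2" using Z0 by (intro power_mono)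
  also have "\<dots> = S * (Z * S)" by (simp only: power_mult_distrib ni nu)
  finally have "Z * Z \<le> S\<^sup>2 * Z" by (simp add: power2_eq_square mult_ac)
  then show ?thesis
    using Z0 S0 unfolding Z_def[symmetric] by (cases "Z = 0") auto
qed

section \<open>Statistics of the set of occupied blocks\<close>

lemma sum_configs: "(\<Sum>i\<in>configs. F i) = (\<Sum>K\<in>Pow {..<M}. \<Sum>a\<in>PiE K (\<lambda>_. A). F (K, a))"
  unfolding configs_def by (subst sum.Sigma) (auto intro!: finite_PiE intro: finite_subset simp: finA)

text \<open>The Hilbert-Schmidt inner product of the two covariance matrices.\<close>

definition ip :: "'th \<Rightarrow> 'th \<Rightarrow> real" where
  "ip \<theta> \<theta>' = (\<Sum>a\<in>A. \<Sum>b\<in>A. \<tau> \<theta> a b * \<tau> \<theta>' a b)"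

lemma sum_PiE_pairs:
  fixes F :: "'a \<Rightarrow> 'a \<Rightarrow> real"
  assumes "finite K"
  shows "(\<Sum>a\<in>PiE K (\<lambda>_. A). \<Sum>b\<in>PiE K (\<lambda>_. A). \<Prod>k\<in>K. F (a k) (b k)) = (\<Sum>a\<in>A. \<Sum>b\<in>A. F a b) ^ card K"
proof -
  have "(\<Sum>b\<in>PiE K (\<lambda>_. A). \<Prod>k\<in>K. F (a k) (b k)) = (\<Prod>k\<in>K. \<Sum>b\<in>A. F (a k) b)" for a
    using prod_sum_PiE[of K "\<lambda>_. A" "\<lambda>k b. F (a k) b"] assms finA by simp
  then show ?thesis
    using prod_sum_PiE[of K "\<lambda>_. A" "\<lambda>k a. \<Sum>b\<in>A. F a b"] assms finA by simp
qed

lemma trace_one: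
  assumes "\<theta> \<in> \<Theta>"
  shows "(\<Sum>a\<in>A. \<tau> \<theta> a a) = 1"
proof -
  have "real (card \<Omega>) * (\<Sum>a\<in>A. \<tau> \<theta> a a) = (\<Sum>a\<in>A. \<Sum>w\<in>\<Omega>. (h \<theta> w a)\<^sup>2)"
    unfolding sum_distrib_left using h_cov[OF assms] by (simp add: power2_eq_square)
  also have "\<dots> = real (card \<Omega>)"
    by (subst sum.swap) (simp add: h_norm[OF assms])
  finally show ?thesis using fin\<Omega> ne\<Omega> by simp
qed

text \<open>Under the squared amplitudes of the collision-free part, (\<gamma>^2)^card K times
  \<open>bnorm\<close> is the probability that K is the set of occupied blocks, since the squares of
  the components of \<open>h\<close> sum to 1 in each block. Scaling every coefficient by a power of
  sqrt z inserts the generating variable for the number of hidden positions.\<close>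

lemma weight_sum:
  assumes \<theta>: "\<theta> \<in> \<Theta>" and \<omega>: "\<omega> \<in> choices" and a0: "a0 \<in> A" and z: "0 \<le> z"
  shows "(\<Sum>K\<in>Pow {..<M}. ((\<gamma>\<^sup>2) ^ card K * bnorm n (K, \<lambda>k\<in>K. a0)) * z ^ card K)
    = (\<Sum>f\<in>tuples n. if distinct_labels n f then z ^ card (hpos n f) * (power_state n (vect \<theta> \<omega>) f)\<^sup>2 else 0)"
proof -
  define y where "y = sqrt z"
  have y: "(y ^ c)\<^sup>2 = z ^ c" for c
  proof -
    have "(y ^ c)\<^sup>2 = (y\<^sup>2) ^ c" by (simp only: power_mult[symmetric] mult.commute)
    then show ?thesis using z by (simp add: y_def)
  qed
  have "(\<Sum>i\<in>configs. (coef \<theta> \<omega> i * y ^ card (fst i))\<^sup>2 * bnorm n i)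
     = (\<Sum>K\<in>Pow {..<M}. ((\<gamma>\<^sup>2) ^ card K * bnorm n (K, \<lambda>k\<in>K. a0)) * z ^ card K)"
    unfolding sum_configs
  proof (rule sum.cong[OF refl])
    fix K assume "K \<in> Pow {..<M}"
    then have K: "K \<subseteq> {..<M}" "finite K" by (auto intro: finite_subset)
    have "(\<Sum>a\<in>PiE K (\<lambda>_. A). (coef \<theta> \<omega> (K, a) * y ^ card (fst (K, a)))\<^sup>2 * bnorm n (K, a))
        = (\<Sum>a\<in>PiE K (\<lambda>_. A). (\<Prod>k\<in>K. \<gamma>\<^sup>2 * (h \<theta> (\<omega> k) (a k))\<^sup>2) * (bnorm n (K, \<lambda>k\<in>K. a0) * z ^ card K))"
    proof (rule sum.cong[OF refl])
      fix a assume "a \<in> PiE K (\<lambda>_. A)"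
      then have b: "bnorm n (K, a) = bnorm n (K, \<lambda>k\<in>K. a0)" by (rule bnorm_const[OF K(1)]) (use a0 in auto)
      have c: "(coef \<theta> \<omega> (K, a))\<^sup>2 = (\<Prod>k\<in>K. \<gamma>\<^sup>2 * (h \<theta> (\<omega> k) (a k))\<^sup>2)"
        by (simp only: coef_def fst_conv snd_conv power_mult_distrib[symmetric] prod_power_distrib)
      show "(coef \<theta> \<omega> (K, a) * y ^ card (fst (K, a)))\<^sup>2 * bnorm n (K, a)
        = (\<Prod>k\<in>K. \<gamma>\<^sup>2 * (h \<theta> (\<omega> k) (a k))\<^sup>2) * (bnorm n (K, \<lambda>k\<in>K. a0) * z ^ card K)"
        unfolding power_mult_distrib[of "coef _ _ _"] c y b fst_conv by (simp only: mult_ac)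
    qed
    also have "\<dots> = (\<Prod>k\<in>K. \<Sum>a\<in>A. \<gamma>\<^sup>2 * (h \<theta> (\<omega> k) a)\<^sup>2) * (bnorm n (K, \<lambda>k\<in>K. a0) * z ^ card K)"
      unfolding sum_distrib_right[symmetric]
      using prod_sum_PiE[of K "\<lambda>_. A" "\<lambda>k a. \<gamma>\<^sup>2 * (h \<theta> (\<omega> k) a)\<^sup>2"] K(2) finA by simp
    also have "(\<Prod>k\<in>K. \<Sum>a\<in>A. \<gamma>\<^sup>2 * (h \<theta> (\<omega> k) a)\<^sup>2) = (\<Prod>k\<in>K. \<gamma>\<^sup>2)"
      using h_norm[OF \<theta> choices_mem[OF \<omega>]] K(1) by (intro prod.cong) (auto simp flip: sum_distrib_left)
    finally show "(\<Sum>a\<in>PiE K (\<lambda>_. A). (coef \<theta> \<omega> (K, a) * y ^ card (fst (K, a)))\<^sup>2 * bnorm n (K, a))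
      = ((\<gamma>\<^sup>2) ^ card K * bnorm n (K, \<lambda>k\<in>K. a0)) * z ^ card K"
      by (simp only: prod_constant mult.assoc)
  qed
  moreover have "(\<Sum>i\<in>configs. (coef \<theta> \<omega> i * y ^ card (fst i))\<^sup>2 * bnorm n i)
     = (\<Sum>f\<in>tuples n. (\<Sum>i\<in>configs. (coef \<theta> \<omega> i * y ^ card (fst i)) * basis n i f)\<^sup>2)"
    by (rule sum_basis_sq[symmetric]) simp
  moreover have "\<dots> = (\<Sum>f\<in>tuples n. if distinct_labels n f then z ^ card (hpos n f) * (power_state n (vect \<theta> \<omega>) f)\<^sup>2 else 0)"
    by (rule sum.cong) (auto simp: scaled_sum_basis power_mult_distrib y)
  ultimately show ?thesis by simp
qed

text \<open>Without the restriction to distinct labels the number of hidden positions is binomial,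
  with n trials and success probability \<gamma>^2 M; the right-hand side is its generating
  function.\<close>

lemma weight_sum_le:
  assumes \<theta>: "\<theta> \<in> \<Theta>" and a0: "a0 \<in> A" and z: "0 \<le> z"
  shows "(\<Sum>K\<in>Pow {..<M}. ((\<gamma>\<^sup>2) ^ card K * bnorm n (K, \<lambda>k\<in>K. a0)) * z ^ card K) \<le> (1 + \<gamma>\<^sup>2 * real M * (z - 1)) ^ n"
proof -
  obtain \<omega> where \<omega>: "\<omega> \<in> choices" using card_choices_pos by fastforce
  let ?v = "vect \<theta> \<omega>"
  define g where "g = (\<lambda>x. (?v x)\<^sup>2 * (if x \<in> X0 then 1 else z))"
  have "(\<Sum>x\<in>X. g x) = (\<Sum>x\<in>X0. (t x)\<^sup>2) + (\<Sum>k<M. \<Sum>a\<in>A. (?v (hid k a))\<^sup>2 * z)"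
    unfolding sum_X_split using hid_mem by (intro arg_cong2[where f="(+)"] sum.cong refl) (auto simp: g_def vect_def)
  also have "\<dots> = (\<Sum>x\<in>X0. (t x)\<^sup>2) + \<gamma>\<^sup>2 * real M * z"
  proof -
    have "(\<Sum>k<M. \<Sum>a\<in>A. (?v (hid k a))\<^sup>2 * z) = (\<Sum>k<M. \<gamma>\<^sup>2 * z)"
      by (rule sum.cong) (simp_all add: sum_distrib_right[symmetric] block_norm[OF \<theta> \<omega>])
    then show ?thesis by simp
  qed
  also have "\<dots> = 1 + \<gamma>\<^sup>2 * real M * (z - 1)" using t_norm by (simp add: algebra_simps)
  finally have g: "(\<Sum>x\<in>X. g x) = 1 + \<gamma>\<^sup>2 * real M * (z - 1)" .
  have "(\<Sum>K\<in>Pow {..<M}. ((\<gamma>\<^sup>2) ^ card K * bnorm n (K, \<lambda>k\<in>K. a0)) * z ^ card K)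
     \<le> (\<Sum>f\<in>tuples n. z ^ card (hpos n f) * (power_state n ?v f)\<^sup>2)"
    unfolding weight_sum[OF \<theta> \<omega> a0 z] using z by (intro sum_mono) auto
  also have "\<dots> = (\<Sum>f\<in>tuples n. \<Prod>l<n. g (f l))"
  proof (rule sum.cong[OF refl])
    fix f
    have "(\<Prod>l<n. if f l \<in> X0 then 1 else z) = (\<Prod>l<n. if l \<in> hpos n f then z else 1)"
      by (rule prod.cong) (auto simp: hpos_def)
    also have "\<dots> = (\<Prod>l\<in>hpos n f. z)"
      by (rule prod_subset_if[symmetric]) (auto simp: hpos_def)
    finally have "(\<Prod>l<n. if f l \<in> X0 then 1 else z) = z ^ card (hpos n f)" by simp
    then show "z ^ card (hpos n f) * (power_state n ?v f)\<^sup>2 = (\<Prod>l<n. g (f l))"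
      by (simp add: g_def prod.distrib power_state_def prod_power_distrib)
  qed
  also have "\<dots> = (\<Sum>x\<in>X. g x) ^ n"
    by (subst sum_tuples_prod) simp
  finally show ?thesis unfolding g .
qed

lemma weight_sum_ge:
  assumes \<theta>: "\<theta> \<in> \<Theta>" and a0: "a0 \<in> A"
  shows "1 - (real n)\<^sup>2 / real M \<le> (\<Sum>K\<in>Pow {..<M}. (\<gamma>\<^sup>2) ^ card K * bnorm n (K, \<lambda>k\<in>K. a0))"
proof -
  obtain \<omega> where \<omega>: "\<omega> \<in> choices" using card_choices_pos by fastforce
  let ?p = "power_state n (vect \<theta> \<omega>)" and ?d = "dstate n \<theta> \<omega>"
  have "(\<Sum>f\<in>tuples n. (?p f - ?d f)\<^sup>2) \<le> (real n / sqrt (real M))\<^sup>2"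
    using power_mono[OF collision_mass[OF \<theta> \<omega>, of n] nrm_nonneg, of 2]
    unfolding nrm_sq of_real_diff[symmetric] norm_of_real power2_abs .
  then have "1 - (real n)\<^sup>2 / real M \<le> (\<Sum>f\<in>tuples n. (?p f)\<^sup>2) - (\<Sum>f\<in>tuples n. (?p f - ?d f)\<^sup>2)"
    by (simp add: sum_power_state[OF vect_unit[OF \<theta> \<omega>]] power_divide)
  also have "\<dots> = (\<Sum>f\<in>tuples n. if distinct_labels n f then 1 ^ card (hpos n f) * (?p f)\<^sup>2 else 0)"
    unfolding sum_subtractf[symmetric] by (rule sum.cong) (auto simp: dstate_eq)
  also have "\<dots> = (\<Sum>K\<in>Pow {..<M}. (\<gamma>\<^sup>2) ^ card K * bnorm n (K, \<lambda>k\<in>K. a0))"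
    using weight_sum[OF \<theta> \<omega> a0, of 1 n] by simp
  finally show ?thesis .
qed

lemma nrm_dstate_le_1:
  assumes "\<theta> \<in> \<Theta>" "\<omega> \<in> choices"
  shows "nrm (tuples n) (\<lambda>f. of_real (dstate n \<theta> \<omega> f)) \<le> 1"
proof -
  have "(nrm (tuples n) (\<lambda>f. of_real (dstate n \<theta> \<omega> f)))\<^sup>2 \<le> (\<Sum>f\<in>tuples n. (power_state n (vect \<theta> \<omega>) f)\<^sup>2)"
    unfolding nrm_sq by (rule sum_mono) (simp add: dstate_eq)
  then show ?thesis using sum_power_state[OF vect_unit[OF assms]] by (simp add: power_le_one_iff abs_square_le_1)
qed

definition avg_accept :: "('x \<times> 'r) set \<Rightarrow> 'th \<Rightarrow> real" where
  "avg_accept B \<theta> = (\<Sum>\<omega>\<in>choices. (nrm B (run (vect \<theta> \<omega>) T))\<^sup>2) / real (card choices)"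

text \<open>Copies replace queries, then the collision part is discarded. What remains is quadratic
  in the coefficients, so averaging over \<open>choices\<close> sees only their second
  moments.\<close>

lemma avg_accept_approx:
  assumes \<theta>: "\<theta> \<in> \<Theta>" and B: "B \<subseteq> X \<times> R"
  shows "\<bar>avg_accept B \<theta> - (\<Sum>i\<in>configs. \<Sum>j\<in>configs. cov \<theta> i j * gram n B i j)\<bar>
     \<le> 4 * real T / sqrt (real n + 1) + 2 * real n / sqrt (real M)"
proof -
  let ?e = "4 * real T / sqrt (real n + 1) + 2 * real n / sqrt (real M)"
  define N where "N = real (card choices)"
  have N: "0 < N" unfolding N_def by (rule card_choices_pos)
  let ?d = "\<lambda>\<omega>. accept n B (\<lambda>f. of_real (dstate n \<theta> \<omega> f))"
  have each: "\<bar>(nrm B (run (vect \<theta> \<omega>) T))\<^sup>2 - ?d \<omega>\<bar> \<le> ?e" if \<omega>: "\<omega> \<in> choices" for \<omega>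
  proof -
    let ?p = "\<lambda>f. complex_of_real (power_state n (vect \<theta> \<omega>) f)"
    let ?q = "\<lambda>f. complex_of_real (dstate n \<theta> \<omega> f)"
    have np: "nrm (tuples n) ?p = 1"
      using sum_power_state[OF vect_unit[OF \<theta> \<omega>], of n] by (simp add: nrm_eq_sqrt)
    have "\<bar>accept n B ?p - accept n B ?q\<bar> \<le> nrm (tuples n) (\<lambda>f. ?p f - ?q f) * (nrm (tuples n) ?p + nrm (tuples n) ?q)"
      by (rule accept_diff[OF symmetric_of_real symmetric_complex[OF dstate_symmetric] B])
    also have "\<dots> \<le> (real n / sqrt (real M)) * (1 + 1)"
      using collision_mass[OF \<theta> \<omega>, of n] nrm_dstate_le_1[OF \<theta> \<omega>, of n] np
      by (intro mult_mono) auto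
    also have "\<dots> = 2 * real n / sqrt (real M)" by simp
    finally show ?thesis using accept_sim[OF vect_unit[OF \<theta> \<omega>] B, of n] by linarith
  qed
  have "(\<Sum>\<omega>\<in>choices. ?d \<omega>) = (\<Sum>\<omega>\<in>choices. \<Sum>i\<in>configs. \<Sum>j\<in>configs. coef \<theta> \<omega> i * coef \<theta> \<omega> j * gram n B i j)"
    unfolding dstate_def accept_combination ..
  also have "\<dots> = (\<Sum>i\<in>configs. \<Sum>j\<in>configs. (\<Sum>\<omega>\<in>choices. coef \<theta> \<omega> i * coef \<theta> \<omega> j) * gram n B i j)"
    by (simp only: sum_distrib_right sum.swap[of _ configs choices])
  also have "\<dots> = N * (\<Sum>i\<in>configs. \<Sum>j\<in>configs. cov \<theta> i j * gram n B i j)"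
    unfolding sum_distrib_left by (intro sum.cong refl) (simp add: coef_cov[OF \<theta>] N_def)
  finally have eq: "(\<Sum>i\<in>configs. \<Sum>j\<in>configs. cov \<theta> i j * gram n B i j) = (\<Sum>\<omega>\<in>choices. ?d \<omega>) / N"
    using N by (simp add: field_simps)
  have "\<bar>avg_accept B \<theta> - (\<Sum>i\<in>configs. \<Sum>j\<in>configs. cov \<theta> i j * gram n B i j)\<bar>
     = \<bar>\<Sum>\<omega>\<in>choices. (nrm B (run (vect \<theta> \<omega>) T))\<^sup>2 - ?d \<omega>\<bar> / N"
    unfolding eq avg_accept_def N_def[symmetric] using N by (simp add: sum_subtractf diff_divide_distrib[symmetric])
  also have "\<dots> \<le> (\<Sum>\<omega>\<in>choices. ?e) / N"
    using N each by (intro divide_right_mono order_trans[OF sum_abs] sum_mono) auto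
  also have "\<dots> = ?e" using N by (simp only: sum_constant N_def[symmetric]) simp
  finally show ?thesis .
qed

text \<open>For each K the averaged tensor power of \<open>\<tau> \<theta>\<close> is compared with
  that of the maximally mixed reference. Cauchy-Schwarz pairs the Hilbert-Schmidt norm of the
  difference with the Bessel bound on \<open>gram\<close>. The resulting chi-square quantities are
  averaged over K by the binomial generating function, which is where the hypothesis on \<chi>
  enters.\<close>

theorem avg_accept_diff:
  assumes \<Theta>': "\<Theta>' \<subseteq> \<Theta>" "finite \<Theta>'" "\<Theta>' \<noteq> {}" and \<theta>0: "\<theta>0 \<in> \<Theta>"
    and ref: "\<And>a b. a \<in> A \<Longrightarrow> b \<in> A \<Longrightarrow> \<tau> \<theta>0 a b = (if a = b then 1 / real (card A) else 0)"
    and B: "B \<subseteq> X \<times> R" and \<gamma>0: "\<gamma> \<noteq> 0" and \<chi>0: "0 \<le> \<chi>"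
    and ip_nonneg: "\<And>\<theta> \<theta>'. \<theta> \<in> \<Theta>' \<Longrightarrow> \<theta>' \<in> \<Theta>' \<Longrightarrow> 0 \<le> ip \<theta> \<theta>'"
    and \<chi>: "(\<Sum>\<theta>\<in>\<Theta>'. \<Sum>\<theta>'\<in>\<Theta>'. (1 + \<gamma>\<^sup>2 * real M * (real (card A) * ip \<theta> \<theta>' - 1)) ^ n) \<le> (1 + \<chi>) * (real (card \<Theta>'))\<^sup>2"
  shows "\<bar>(\<Sum>\<theta>\<in>\<Theta>'. avg_accept B \<theta>) / real (card \<Theta>') - avg_accept B \<theta>0\<bar>
    \<le> 8 * real T / sqrt (real n + 1) + 5 * real n / sqrt (real M) + sqrt \<chi>"
proof -
  define N where "N = real (card \<Theta>')"
  have N: "0 < N" using \<Theta>' by (simp add: N_def card_gt_0_iff)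
  define Q where "Q = real (card A)"
  have Q: "0 < Q" using finA neA by (simp add: Q_def card_gt_0_iff)
  obtain a0 where a0: "a0 \<in> A" using neA by blast
  define E where "E = (\<lambda>\<theta>. \<Sum>i\<in>configs. \<Sum>j\<in>configs. cov \<theta> i j * gram n B i j)"
  define pr where "pr = (\<lambda>\<theta> (K :: nat set) a b. \<Prod>k\<in>K. \<gamma>\<^sup>2 * \<tau> \<theta> (a k) (b k))"
  let ?P = "\<lambda>K. PiE K (\<lambda>_. A)"
  have E: "E \<theta> = (\<Sum>K\<in>Pow {..<M}. \<Sum>a\<in>?P K. \<Sum>b\<in>?P K. pr \<theta> K a b * gram n B (K, a) (K, b))" for \<theta>
  proof -
    have "E \<theta> = (\<Sum>K\<in>Pow {..<M}. \<Sum>a\<in>?P K. \<Sum>K'\<in>Pow {..<M}. \<Sum>b\<in>?P K'. cov \<theta> (K, a) (K', b) * gram n B (K, a) (K', b))"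
      unfolding E_def sum_configs ..
    also have "\<dots> = (\<Sum>K\<in>Pow {..<M}. \<Sum>a\<in>?P K. \<Sum>K'\<in>Pow {..<M}. if K' = K then \<Sum>b\<in>?P K. pr \<theta> K a b * gram n B (K, a) (K, b) else 0)"
      by (intro sum.cong refl) (auto simp: cov_def pr_def)
    also have "\<dots> = (\<Sum>K\<in>Pow {..<M}. \<Sum>a\<in>?P K. \<Sum>b\<in>?P K. pr \<theta> K a b * gram n B (K, a) (K, b))"
      by (intro sum.cong refl) simp
    finally show ?thesis .
  qed
  define D where "D = (\<lambda>K a b. (\<Sum>\<theta>\<in>\<Theta>'. pr \<theta> K a b) / N - pr \<theta>0 K a b)"
  \<comment> \<open>Against a multiple of the identity only the trace is seen, so the cross terms of
    the square below do not depend on \<theta>.\<close>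
  have ip0: "ip \<theta> \<theta>0 = 1 / Q" if "\<theta> \<in> \<Theta>" for \<theta>
  proof -
    have "ip \<theta> \<theta>0 = (\<Sum>a\<in>A. \<Sum>b\<in>A. if b = a then \<tau> \<theta> a a / Q else 0)"
      unfolding ip_def by (intro sum.cong refl) (auto simp: ref Q_def)
    also have "\<dots> = (\<Sum>a\<in>A. \<tau> \<theta> a a) / Q" using finA by (simp add: sum_divide_distrib)
    finally show ?thesis by (simp add: trace_one[OF that])
  qed
  have prod_ip: "(\<Sum>a\<in>?P K. \<Sum>b\<in>?P K. pr \<theta> K a b * pr \<theta>' K a b) = (\<gamma> ^ 4) ^ card K * ip \<theta> \<theta>' ^ card K" if "finite K" for K \<theta> \<theta>'
  proof -
    have "(\<Sum>a\<in>?P K. \<Sum>b\<in>?P K. pr \<theta> K a b * pr \<theta>' K a b)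
       = (\<Sum>a\<in>?P K. \<Sum>b\<in>?P K. \<Prod>k\<in>K. \<gamma> ^ 4 * (\<tau> \<theta> (a k) (b k) * \<tau> \<theta>' (a k) (b k)))"
      unfolding pr_def prod.distrib[symmetric] by (intro sum.cong prod.cong refl) (simp add: power2_eq_square power4_eq_xxxx)
    also have "\<dots> = (\<Sum>a\<in>A. \<Sum>b\<in>A. \<gamma> ^ 4 * (\<tau> \<theta> a b * \<tau> \<theta>' a b)) ^ card K"
      by (rule sum_PiE_pairs[OF that])
    finally show ?thesis
      by (simp only: sum_distrib_left[symmetric] ip_def[symmetric] power_mult_distrib)
  qed
  \<comment> \<open>The chi-square divergence of the averaged c-fold tensor power from the maximally
    mixed state of the same size.\<close>
  define x where "x = (\<lambda>c. (\<Sum>\<theta>\<in>\<Theta>'. \<Sum>\<theta>'\<in>\<Theta>'. (Q * ip \<theta> \<theta>') ^ c) / N\<^sup>2 - 1)"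
  have Dsq: "(\<Sum>a\<in>?P K. \<Sum>b\<in>?P K. (D K a b)\<^sup>2) = (\<gamma> ^ 4) ^ card K * (x (card K) / Q ^ card K)"
    if K: "finite K" for K
  proof -
    let ?g = "(\<gamma> ^ 4) ^ card K"
    have D: "(D K a b)\<^sup>2 = (\<Sum>\<theta>\<in>\<Theta>'. \<Sum>\<theta>'\<in>\<Theta>'. pr \<theta> K a b * pr \<theta>' K a b) / N\<^sup>2
      - 2 * (\<Sum>\<theta>\<in>\<Theta>'. pr \<theta> K a b * pr \<theta>0 K a b) / N + pr \<theta>0 K a b * pr \<theta>0 K a b" for a b
      unfolding D_def power2_diff sum_product[symmetric] sum_distrib_right[symmetric] power_divide
      by (simp add: power2_eq_square)
    have split: "(\<Sum>a\<in>?P K. \<Sum>b\<in>?P K. U a b / N\<^sup>2 - 2 * W a b / N + Z a b)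
      = (\<Sum>a\<in>?P K. \<Sum>b\<in>?P K. U a b) / N\<^sup>2 - 2 * (\<Sum>a\<in>?P K. \<Sum>b\<in>?P K. W a b) / N + (\<Sum>a\<in>?P K. \<Sum>b\<in>?P K. Z a b)"
      for U W Z :: "(nat \<Rightarrow> 'a) \<Rightarrow> (nat \<Rightarrow> 'a) \<Rightarrow> real"
      by (simp add: sum.distrib sum_subtractf sum_divide_distrib sum_distrib_left)
    have "(\<Sum>a\<in>?P K. \<Sum>b\<in>?P K. (D K a b)\<^sup>2)
      = (\<Sum>a\<in>?P K. \<Sum>b\<in>?P K. \<Sum>\<theta>\<in>\<Theta>'. \<Sum>\<theta>'\<in>\<Theta>'. pr \<theta> K a b * pr \<theta>' K a b) / N\<^sup>2
      - 2 * (\<Sum>a\<in>?P K. \<Sum>b\<in>?P K. \<Sum>\<theta>\<in>\<Theta>'. pr \<theta> K a b * pr \<theta>0 K a b) / N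
      + (\<Sum>a\<in>?P K. \<Sum>b\<in>?P K. pr \<theta>0 K a b * pr \<theta>0 K a b)"
      unfolding D by (rule split)
    also have "(\<Sum>a\<in>?P K. \<Sum>b\<in>?P K. \<Sum>\<theta>\<in>\<Theta>'. \<Sum>\<theta>'\<in>\<Theta>'. pr \<theta> K a b * pr \<theta>' K a b)
      = (\<Sum>\<theta>\<in>\<Theta>'. \<Sum>\<theta>'\<in>\<Theta>'. \<Sum>a\<in>?P K. \<Sum>b\<in>?P K. pr \<theta> K a b * pr \<theta>' K a b)"
      by (simp only: sum.swap[of _ "\<Theta>'" "?P K"])
    also have "\<dots> = ?g * (\<Sum>\<theta>\<in>\<Theta>'. \<Sum>\<theta>'\<in>\<Theta>'. ip \<theta> \<theta>' ^ card K)"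
      by (simp only: prod_ip[OF K] sum_distrib_left)
    also have "(\<Sum>\<theta>\<in>\<Theta>'. \<Sum>\<theta>'\<in>\<Theta>'. ip \<theta> \<theta>' ^ card K) = (\<Sum>\<theta>\<in>\<Theta>'. \<Sum>\<theta>'\<in>\<Theta>'. (Q * ip \<theta> \<theta>') ^ card K) / Q ^ card K"
      using Q by (simp only: power_mult_distrib sum_distrib_left[symmetric]) simp
    also have "(\<Sum>a\<in>?P K. \<Sum>b\<in>?P K. \<Sum>\<theta>\<in>\<Theta>'. pr \<theta> K a b * pr \<theta>0 K a b)
      = (\<Sum>\<theta>\<in>\<Theta>'. \<Sum>a\<in>?P K. \<Sum>b\<in>?P K. pr \<theta> K a b * pr \<theta>0 K a b)"
      by (simp only: sum.swap[of _ "\<Theta>'" "?P K"])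
    also have "\<dots> = (\<Sum>\<theta>\<in>\<Theta>'. ?g * (1 / Q) ^ card K)"
      using \<Theta>'(1) by (intro sum.cong refl) (auto simp: prod_ip[OF K] ip0)
    also have "\<dots> = N * (?g * (1 / Q) ^ card K)" by (simp add: N_def)
    also have "(\<Sum>a\<in>?P K. \<Sum>b\<in>?P K. pr \<theta>0 K a b * pr \<theta>0 K a b) = ?g * (1 / Q) ^ card K"
      by (simp only: prod_ip[OF K] ip0[OF \<theta>0])
    also have "?g * ((\<Sum>\<theta>\<in>\<Theta>'. \<Sum>\<theta>'\<in>\<Theta>'. (Q * ip \<theta> \<theta>') ^ card K) / Q ^ card K) / N\<^sup>2
         - 2 * (N * (?g * (1 / Q) ^ card K)) / N + ?g * (1 / Q) ^ card K
       = ?g * (x (card K) / Q ^ card K)"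
      using N Q by (simp add: x_def power_divide field_simps)
    finally show ?thesis .
  qed
  have x0: "0 \<le> x (card K)" if K: "finite K" for K :: "nat set"
  proof -
    have "0 \<le> (\<gamma> ^ 4) ^ card K * (x (card K) / Q ^ card K)"
      unfolding Dsq[OF K, symmetric] by (intro sum_nonneg) auto
    moreover have "0 < (\<gamma> ^ 4) ^ card K" using \<gamma>0 by simp
    moreover have "0 < Q ^ card K" using Q by simp
    ultimately show ?thesis by (auto simp: zero_le_mult_iff zero_le_divide_iff)
  qed
  define S where "S = (\<lambda>K. bnorm n (K, \<lambda>k\<in>K. a0))"
  have block: "\<bar>\<Sum>a\<in>?P K. \<Sum>b\<in>?P K. D K a b * gram n B (K, a) (K, b)\<bar> \<le> sqrt (x (card K)) * ((\<gamma>\<^sup>2) ^ card K * S K)"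
    if "K \<in> Pow {..<M}" for K
  proof -
    have K: "K \<subseteq> {..<M}" "finite K" using that by (auto intro: finite_subset)
    have fP: "finite (?P K)" using K(2) finA by (intro finite_PiE) auto
    have cP: "real (card (?P K)) = Q ^ card K" using K(2) by (simp add: card_PiE Q_def)
    have bS: "bnorm n (K, a) = S K" if "a \<in> ?P K" for a
      unfolding S_def by (rule bnorm_const[OF K(1) that]) (use a0 in auto)
    have conf: "(K, a) \<in> configs" if "a \<in> ?P K" for a using that K by (simp add: configs_def)
    have G: "(\<Sum>a\<in>?P K. \<Sum>b\<in>?P K. (gram n B (K, a) (K, b))\<^sup>2) \<le> Q ^ card K * (S K)\<^sup>2"
    proof -
      have "(\<Sum>b\<in>?P K. (gram n B (K, a) (K, b))\<^sup>2) \<le> (S K)\<^sup>2" if a: "a \<in> ?P K" for a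
      proof -
        have "(\<Sum>b\<in>?P K. (gram n B (K, a) (K, b))\<^sup>2) = (\<Sum>j\<in>Pair K ` ?P K. (gram n B (K, a) j)\<^sup>2)"
          by (subst sum.reindex) (auto simp: inj_on_def)
        also have "\<dots> \<le> (S K)\<^sup>2"
          by (rule gram_bessel) (use conf a bS B in auto)
        finally show ?thesis .
      qed
      then have "(\<Sum>a\<in>?P K. \<Sum>b\<in>?P K. (gram n B (K, a) (K, b))\<^sup>2) \<le> (\<Sum>a\<in>?P K. (S K)\<^sup>2)" by (rule sum_mono)
      then show ?thesis by (simp add: cP)
    qed
    have S0: "0 \<le> S K" by (simp add: S_def)
    have CS: "\<bar>\<Sum>a\<in>?P K. \<Sum>b\<in>?P K. D K a b * gram n B (K, a) (K, b)\<bar>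
      \<le> sqrt (\<Sum>a\<in>?P K. \<Sum>b\<in>?P K. (D K a b)\<^sup>2) * sqrt (\<Sum>a\<in>?P K. \<Sum>b\<in>?P K. (gram n B (K, a) (K, b))\<^sup>2)"
      using sum_mult_le_sqrt[of "\<lambda>(a, b). D K a b" "\<lambda>(a, b). gram n B (K, a) (K, b)" "?P K \<times> ?P K"]
      by (simp add: sum.cartesian_product case_prod_unfold)
    have "sqrt (\<Sum>a\<in>?P K. \<Sum>b\<in>?P K. (D K a b)\<^sup>2) * sqrt (\<Sum>a\<in>?P K. \<Sum>b\<in>?P K. (gram n B (K, a) (K, b))\<^sup>2)
      \<le> sqrt ((\<gamma> ^ 4) ^ card K * (x (card K) / Q ^ card K)) * sqrt (Q ^ card K * (S K)\<^sup>2)"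
      unfolding Dsq[OF K(2)] using G x0[OF K(2)] Q
      by (intro mult_left_mono real_sqrt_le_mono) (auto intro!: mult_nonneg_nonneg zero_le_even_power)
    \<comment> \<open>The dimension Q ^ card K, lost by summing the Bessel bound over all rows, is
      exactly the one gained from the Hilbert-Schmidt norm of a near-uniform state.\<close>
    also have "\<dots> = sqrt (((\<gamma>\<^sup>2) ^ card K)\<^sup>2 * x (card K) * (S K)\<^sup>2)"
    proof -
      have g4: "(\<gamma> ^ 4) ^ card K = ((\<gamma>\<^sup>2) ^ card K)\<^sup>2"
        by (simp add: power_mult[symmetric])
      have "y\<^sup>2 * (u / Q ^ card K) * (Q ^ card K * z) = y\<^sup>2 * u * z" for y u z
        using Q by simp
      then show ?thesis unfolding g4 real_sqrt_mult[symmetric] by simp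
    qed
    also have "\<dots> = sqrt (x (card K)) * ((\<gamma>\<^sup>2) ^ card K * S K)"
      unfolding real_sqrt_mult real_sqrt_abs using S0 by simp
    finally show ?thesis using CS by linarith
  qed
  have "(\<Sum>\<theta>\<in>\<Theta>'. E \<theta>) / N - E \<theta>0 = (\<Sum>K\<in>Pow {..<M}. \<Sum>a\<in>?P K. \<Sum>b\<in>?P K. D K a b * gram n B (K, a) (K, b))"
  proof -
    have "(\<Sum>\<theta>\<in>\<Theta>'. E \<theta>) = (\<Sum>K\<in>Pow {..<M}. \<Sum>a\<in>?P K. \<Sum>b\<in>?P K. (\<Sum>\<theta>\<in>\<Theta>'. pr \<theta> K a b) * gram n B (K, a) (K, b))"
    proof -
      have "(\<Sum>\<theta>\<in>\<Theta>'. E \<theta>) = (\<Sum>K\<in>Pow {..<M}. \<Sum>\<theta>\<in>\<Theta>'. \<Sum>a\<in>?P K. \<Sum>b\<in>?P K. pr \<theta> K a b * gram n B (K, a) (K, b))"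
        unfolding E by (rule sum.swap)
      also have "\<dots> = (\<Sum>K\<in>Pow {..<M}. \<Sum>a\<in>?P K. \<Sum>\<theta>\<in>\<Theta>'. \<Sum>b\<in>?P K. pr \<theta> K a b * gram n B (K, a) (K, b))"
        by (intro sum.cong refl sum.swap)
      also have "\<dots> = (\<Sum>K\<in>Pow {..<M}. \<Sum>a\<in>?P K. \<Sum>b\<in>?P K. \<Sum>\<theta>\<in>\<Theta>'. pr \<theta> K a b * gram n B (K, a) (K, b))"
        by (intro sum.cong refl sum.swap)
      finally show ?thesis by (simp only: sum_distrib_right)
    qed
    then show ?thesis
      by (simp only: E[of \<theta>0] D_def left_diff_distrib times_divide_eq_left sum_subtractf sum_divide_distrib[symmetric])
  qed
  also have "\<bar>\<dots>\<bar> \<le> (\<Sum>K\<in>Pow {..<M}. sqrt (x (card K)) * ((\<gamma>\<^sup>2) ^ card K * S K))"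
    by (rule order_trans[OF sum_abs]) (intro sum_mono block)
  also have "\<dots> \<le> sqrt \<chi> + real n / sqrt (real M)"
  proof -
    define w where "w = (\<lambda>K. (\<gamma>\<^sup>2) ^ card K * S K)"
    have w0: "0 \<le> w K" for K by (simp add: w_def S_def)
    have x0': "0 \<le> x (card K)" if "K \<in> Pow {..<M}" for K using that by (intro x0) (auto intro: finite_subset)
    have w1: "(\<Sum>K\<in>Pow {..<M}. w K) \<le> 1"
      using weight_sum_le[OF \<theta>0 a0, of 1 n] by (simp add: w_def S_def)
    have gen: "(\<Sum>K\<in>Pow {..<M}. w K * z ^ card K) \<le> (1 + \<gamma>\<^sup>2 * real M * (z - 1)) ^ n" if "0 \<le> z" for z
      using weight_sum_le[OF \<theta>0 a0 that, of n] by (simp add: w_def S_def)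
    have "(\<Sum>K\<in>Pow {..<M}. w K * x (card K))
       = (\<Sum>\<theta>\<in>\<Theta>'. \<Sum>\<theta>'\<in>\<Theta>'. \<Sum>K\<in>Pow {..<M}. w K * (Q * ip \<theta> \<theta>') ^ card K) / N\<^sup>2 - (\<Sum>K\<in>Pow {..<M}. w K)"
    proof -
      have "(\<Sum>K\<in>Pow {..<M}. w K * x (card K))
        = (\<Sum>K\<in>Pow {..<M}. \<Sum>\<theta>\<in>\<Theta>'. \<Sum>\<theta>'\<in>\<Theta>'. w K * (Q * ip \<theta> \<theta>') ^ card K) / N\<^sup>2 - (\<Sum>K\<in>Pow {..<M}. w K)"
        unfolding x_def right_diff_distrib sum_subtractf times_divide_eq_right sum_divide_distrib[symmetric] sum_distrib_left by simp
      moreover have "(\<Sum>K\<in>Pow {..<M}. \<Sum>\<theta>\<in>\<Theta>'. \<Sum>\<theta>'\<in>\<Theta>'. w K * (Q * ip \<theta> \<theta>') ^ card K)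
        = (\<Sum>\<theta>\<in>\<Theta>'. \<Sum>\<theta>'\<in>\<Theta>'. \<Sum>K\<in>Pow {..<M}. w K * (Q * ip \<theta> \<theta>') ^ card K)"
      proof -
        have "(\<Sum>K\<in>Pow {..<M}. \<Sum>\<theta>\<in>\<Theta>'. \<Sum>\<theta>'\<in>\<Theta>'. w K * (Q * ip \<theta> \<theta>') ^ card K)
           = (\<Sum>\<theta>\<in>\<Theta>'. \<Sum>K\<in>Pow {..<M}. \<Sum>\<theta>'\<in>\<Theta>'. w K * (Q * ip \<theta> \<theta>') ^ card K)" by (rule sum.swap)
        also have "\<dots> = (\<Sum>\<theta>\<in>\<Theta>'. \<Sum>\<theta>'\<in>\<Theta>'. \<Sum>K\<in>Pow {..<M}. w K * (Q * ip \<theta> \<theta>') ^ card K)"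
          by (intro sum.cong refl sum.swap)
        finally show ?thesis .
      qed
      ultimately show ?thesis by simp
    qed
    \<comment> \<open>The positive part uses the upper bound of the generating function. The
      subtracted total weight falls short of 1 by the collision mass, and this defect adds n^2 /
      M.\<close>
    also have "\<dots> \<le> (\<Sum>\<theta>\<in>\<Theta>'. \<Sum>\<theta>'\<in>\<Theta>'. (1 + \<gamma>\<^sup>2 * real M * (Q * ip \<theta> \<theta>' - 1)) ^ n) / N\<^sup>2 - (1 - (real n)\<^sup>2 / real M)"
    proof (intro diff_mono divide_right_mono sum_mono gen)
      show "1 - (real n)\<^sup>2 / real M \<le> (\<Sum>K\<in>Pow {..<M}. w K)"
        using weight_sum_ge[OF \<theta>0 a0, of n] by (simp add: w_def S_def)
    qed (use ip_nonneg Q in auto)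
    also have "\<dots> \<le> (1 + \<chi>) * N\<^sup>2 / N\<^sup>2 - (1 - (real n)\<^sup>2 / real M)"
      using \<chi> unfolding Q_def[symmetric] N_def[symmetric] by (intro diff_right_mono divide_right_mono) auto
    also have "\<dots> = \<chi> + (real n)\<^sup>2 / real M" using N by simp
    finally have wx: "(\<Sum>K\<in>Pow {..<M}. w K * x (card K)) \<le> \<chi> + (real n)\<^sup>2 / real M" .
    \<comment> \<open>As the weights sum to at most 1, Cauchy-Schwarz moves the square root outside
      the average over K.\<close>
    have "(\<Sum>K\<in>Pow {..<M}. sqrt (x (card K)) * w K) = (\<Sum>K\<in>Pow {..<M}. sqrt (w K) * sqrt (w K * x (card K)))"
      by (rule sum.cong) (simp_all add: real_sqrt_mult w0)
    also have "\<dots> \<le> sqrt (\<Sum>K\<in>Pow {..<M}. (sqrt (w K))\<^sup>2) * sqrt (\<Sum>K\<in>Pow {..<M}. (sqrt (w K * x (card K)))\<^sup>2)"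
      using sum_mult_le_sqrt[of "\<lambda>K. sqrt (w K)" "\<lambda>K. sqrt (w K * x (card K))" "Pow {..<M}"] by linarith
    also have "(\<Sum>K\<in>Pow {..<M}. (sqrt (w K * x (card K)))\<^sup>2) = (\<Sum>K\<in>Pow {..<M}. w K * x (card K))"
      by (rule sum.cong) (simp_all add: w0 x0')
    also have "(\<Sum>K\<in>Pow {..<M}. (sqrt (w K))\<^sup>2) = (\<Sum>K\<in>Pow {..<M}. w K)"
      by (simp add: w0)
    also have "sqrt (\<Sum>K\<in>Pow {..<M}. w K) * sqrt (\<Sum>K\<in>Pow {..<M}. w K * x (card K)) \<le> 1 * sqrt (\<chi> + (real n)\<^sup>2 / real M)"
      using w1 wx w0 x0' by (intro mult_mono real_sqrt_le_mono) (auto intro!: sum_nonneg mult_nonneg_nonneg)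
    also have "\<dots> \<le> sqrt \<chi> + sqrt ((real n)\<^sup>2 / real M)"
      using \<chi>0 by (simp add: sqrt_add_le_add_sqrt)
    finally show ?thesis by (simp add: w_def real_sqrt_divide)
  qed
  finally have main: "\<bar>(\<Sum>\<theta>\<in>\<Theta>'. E \<theta>) / N - E \<theta>0\<bar> \<le> sqrt \<chi> + real n / sqrt (real M)" .
  \<comment> \<open>This error is paid for the family and again for the reference, giving 8 T and 4
    n; the fifth n comes from the collision defect in \<open>main\<close>.\<close>
  let ?e = "4 * real T / sqrt (real n + 1) + 2 * real n / sqrt (real M)"
  have approx: "\<bar>avg_accept B \<theta> - E \<theta>\<bar> \<le> ?e" if "\<theta> \<in> \<Theta>" for \<theta>
    unfolding E_def by (rule avg_accept_approx[OF that B])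
  have "\<bar>(\<Sum>\<theta>\<in>\<Theta>'. avg_accept B \<theta>) / N - (\<Sum>\<theta>\<in>\<Theta>'. E \<theta>) / N\<bar> = \<bar>\<Sum>\<theta>\<in>\<Theta>'. avg_accept B \<theta> - E \<theta>\<bar> / N"
    using N by (simp add: sum_subtractf diff_divide_distrib[symmetric])
  also have "\<dots> \<le> (\<Sum>\<theta>\<in>\<Theta>'. ?e) / N"
    using N approx \<Theta>'(1) by (intro divide_right_mono order_trans[OF sum_abs] sum_mono) auto
  also have "\<dots> = ?e" using N by (simp only: sum_constant N_def[symmetric]) simp
  finally have "\<bar>(\<Sum>\<theta>\<in>\<Theta>'. avg_accept B \<theta>) / N - (\<Sum>\<theta>\<in>\<Theta>'. E \<theta>) / N\<bar> \<le> ?e" .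
  with main approx[OF \<theta>0] show ?thesis unfolding N_def by linarith
qed

end

section \<open>From the matrix model to query algorithms\<close>

lemma mat_adjoint_carrier [simp]: "A \<in> carrier_mat n m \<Longrightarrow> mat_adjoint A \<in> carrier_mat m n"
  unfolding mat_adjoint_def by auto

lemma mat_adjoint_index:
  "i < dim_col A \<Longrightarrow> j < dim_row A \<Longrightarrow> mat_adjoint A $$ (i, j) = cnj (A $$ (j, i))" for A :: "complex mat"
  unfolding mat_adjoint_def mat_of_rows_def by simp

lemma mult_mat_vec_index_sum:
  "A \<in> carrier_mat n m \<Longrightarrow> x \<in> carrier_vec m \<Longrightarrow> i < n \<Longrightarrow> (A *\<^sub>v x) $ i = (\<Sum>j<m. A $$ (i, j) * x $ j)"
  by (simp add: scalar_prod_def atLeast0LessThan)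

lemma mult_mat_index_sum:
  "A \<in> carrier_mat n m \<Longrightarrow> B \<in> carrier_mat m l \<Longrightarrow> i < n \<Longrightarrow> j < l \<Longrightarrow>
    (A * B) $$ (i, j) = (\<Sum>k<m. A $$ (i, k) * B $$ (k, j))"
  by (simp add: scalar_prod_def atLeast0LessThan)

lemma unitary_columns:
  assumes "unitary_mat n U" "i < n" "j < n"
  shows "(\<Sum>l<n. cnj (U $$ (l, i)) * U $$ (l, j)) = (if i = j then 1 else 0)"
proof -
  have U: "U \<in> carrier_mat n n" using assms by (simp add: unitary_mat_def)
  have "(mat_adjoint U * U) $$ (i, j) = (\<Sum>l<n. cnj (U $$ (l, i)) * U $$ (l, j))"
    using U assms by (subst mult_mat_index_sum[of _ n n _ n]) (auto simp: mat_adjoint_index)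
  moreover have "mat_adjoint U * U = 1\<^sub>m n" using assms by (simp add: unitary_mat_def)
  ultimately show ?thesis using assms by simp
qed

lemma unitary_isometry:
  assumes "unitary_mat n U"
  shows "nrm {..<n} (\<lambda>l. \<Sum>i<n. U $$ (l, i) * \<phi> i) = nrm {..<n} \<phi>"
proof -
  have "complex_of_real ((nrm {..<n} (\<lambda>l. \<Sum>i<n. U $$ (l, i) * \<phi> i))\<^sup>2)
     = (\<Sum>l<n. \<Sum>i<n. \<Sum>j<n. cnj (\<phi> i) * \<phi> j * (cnj (U $$ (l, i)) * U $$ (l, j)))"
    unfolding of_real_nrm_sq cnj_sum sum_product by (intro sum.cong refl) simp
  also have "\<dots> = (\<Sum>i<n. \<Sum>l<n. \<Sum>j<n. cnj (\<phi> i) * \<phi> j * (cnj (U $$ (l, i)) * U $$ (l, j)))"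
    by (rule sum.swap)
  also have "\<dots> = (\<Sum>i<n. \<Sum>j<n. \<Sum>l<n. cnj (\<phi> i) * \<phi> j * (cnj (U $$ (l, i)) * U $$ (l, j)))"
    by (intro sum.cong refl sum.swap)
  also have "\<dots> = (\<Sum>i<n. \<Sum>j<n. if i = j then cnj (\<phi> i) * \<phi> i else 0)"
    unfolding sum_distrib_left[symmetric] by (intro sum.cong refl) (simp add: unitary_columns[OF assms])
  also have "\<dots> = complex_of_real ((nrm {..<n} \<phi>)\<^sup>2)" unfolding of_real_nrm_sq by simp
  finally have "(nrm {..<n} (\<lambda>l. \<Sum>i<n. U $$ (l, i) * \<phi> i))\<^sup>2 = (nrm {..<n} \<phi>)\<^sup>2"
    unfolding of_real_eq_iff .
  then show ?thesis by simp
qed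

section \<open>Reflection oracles and the layout of the registers\<close>

definition refl_mat :: "nat \<Rightarrow> (nat \<Rightarrow> real) \<Rightarrow> complex mat" where
  "refl_mat n v = mat n n (\<lambda>(i, j). (if i = j then 1 else 0) - 2 * of_real (v i) * of_real (v j))"

lemma refl_mat_carrier [simp]: "refl_mat n v \<in> carrier_mat n n"
  by (simp add: refl_mat_def)

lemma mat_adjoint_refl_mat: "mat_adjoint (refl_mat n v) = refl_mat n v"
proof (rule eq_matI)
  fix i j assume "i < dim_row (refl_mat n v)" "j < dim_col (refl_mat n v)"
  then show "mat_adjoint (refl_mat n v) $$ (i, j) = refl_mat n v $$ (i, j)"
    by (subst mat_adjoint_index) (auto simp: refl_mat_def)
next
  have "mat_adjoint (refl_mat n v) \<in> carrier_mat n n" by simp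
  then show "dim_row (mat_adjoint (refl_mat n v)) = dim_row (refl_mat n v)"
    "dim_col (mat_adjoint (refl_mat n v)) = dim_col (refl_mat n v)"
    unfolding carrier_mat_def by (simp_all add: refl_mat_def)
qed

lemma refl_mat_unitary:
  assumes "(\<Sum>x<n. (v x)\<^sup>2) = 1"
  shows "unitary_mat n (refl_mat n v)"
proof -
  have v1: "(\<Sum>x<n. complex_of_real (v x) * of_real (v x)) = 1"
    using arg_cong[OF assms, of complex_of_real] by (simp add: power2_eq_square)
  have "refl_mat n v * refl_mat n v = 1\<^sub>m n"
  proof (rule eq_matI)
    fix i j assume "i < dim_row (1\<^sub>m n :: complex mat)" "j < dim_col (1\<^sub>m n :: complex mat)"
    then have ij: "i < n" "j < n" by auto
    have "(refl_mat n v * refl_mat n v) $$ (i, j)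
      = (\<Sum>k<n. ((if i = k then 1 else 0) - 2 * of_real (v i) * of_real (v k)) * ((if k = j then 1 else 0) - 2 * of_real (v k) * of_real (v j)))"
      using ij by (subst mult_mat_index_sum[of _ n n _ n]) (auto simp: refl_mat_def)
    also have "\<dots> = (\<Sum>k<n. (if i = k then (if i = j then 1 else 0) - 2 * of_real (v i) * of_real (v j) else 0)
        - (if k = j then 2 * of_real (v i) * of_real (v j) else 0)
        + (4 * of_real (v i) * of_real (v j)) * (complex_of_real (v k) * of_real (v k)))"
      by (intro sum.cong refl) (auto simp: algebra_simps)
    also have "\<dots> = (if i = j then 1 else 0)"
      unfolding sum.distrib sum_subtractf sum_distrib_left[symmetric] v1 using ij by simp
    finally show "(refl_mat n v * refl_mat n v) $$ (i, j) = 1\<^sub>m n $$ (i, j)" using ij by simp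
  qed (auto simp: refl_mat_def)
  then show ?thesis by (simp add: unitary_mat_def mat_adjoint_refl_mat)
qed

text \<open>The position of a basis vector in the register order of \<open>ctrl_gate\<close>:
  control qubit, oracle space, ancilla. The argument lists the oracle index first so as to match X
  times R.\<close>

definition enc :: "nat \<Rightarrow> nat \<Rightarrow> nat \<times> (nat \<times> nat) \<Rightarrow> nat" where
  "enc N k = (\<lambda>(x, (c, w)). (c * N + x) * k + w)"

lemma enc_less: "x < N \<Longrightarrow> c < 2 \<Longrightarrow> w < k \<Longrightarrow> enc N k (x, (c, w)) < 2 * N * k"
proof -
  assume a: "x < N" "c < 2" "w < k"
  have "c * N + x + 1 \<le> 2 * N" using a by (cases c) auto
  then have "(c * N + x + 1) * k \<le> 2 * N * k" by (rule mult_le_mono1)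
  then show ?thesis using a by (simp add: enc_def algebra_simps)
qed

lemma enc_decode:
  assumes "x < N" "w < k"
  shows "enc N k (x, (c, w)) div k = c * N + x" "enc N k (x, (c, w)) mod k = w"
    "(enc N k (x, (c, w)) div k) mod N = x" "enc N k (x, (c, w)) div (N * k) = c"
    "enc N k (x, (c, w)) mod (N * k) = x * k + w"
proof -
  show 1: "enc N k (x, (c, w)) div k = c * N + x" "enc N k (x, (c, w)) mod k = w"
    using assms by (simp_all add: enc_def)
  then show "(enc N k (x, (c, w)) div k) mod N = x" using assms by simp
  have "enc N k (x, (c, w)) div (k * N) = (enc N k (x, (c, w)) div k) div N" by (rule div_mult2_eq)
  also have "\<dots> = c" using assms 1 by simp
  finally show 2: "enc N k (x, (c, w)) div (N * k) = c" by (simp add: mult.commute)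
  have "enc N k (x, (c, w)) = c * (N * k) + (x * k + w)" by (simp add: enc_def algebra_simps)
  then show "enc N k (x, (c, w)) mod (N * k) = x * k + w"
    using 2 div_mult_mod_eq[of "enc N k (x, (c, w))" "N * k"] by simp
qed

lemma sum_enc:
  "(\<Sum>i<2 * N * k. F i) = (\<Sum>j\<in>{..<N} \<times> ({..<2} \<times> {..<k}). F (enc N k j))"
proof -
  let ?d = "\<lambda>i. ((i div k) mod N, (i div (N * k), i mod k))"
  have 1: "?d i \<in> {..<N} \<times> ({..<2} \<times> {..<k})" "enc N k (?d i) = i" if i: "i < 2 * N * k" for i
  proof -
    have pos: "0 < N" "0 < k" using i by (auto intro: gr0I)
    have "i div (N * k) < 2" using i by (simp add: less_mult_imp_div_less mult.assoc)
    then show "?d i \<in> {..<N} \<times> ({..<2} \<times> {..<k})" using pos by simp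
    have "i div (N * k) = (i div k) div N" by (metis div_mult2_eq mult.commute)
    then show "enc N k (?d i) = i" by (simp add: enc_def)
  qed
  have 2: "enc N k j < 2 * N * k" "?d (enc N k j) = j" if "j \<in> {..<N} \<times> ({..<2} \<times> {..<k})" for j
    using that enc_less enc_decode by auto
  show ?thesis
    by (rule sum.reindex_bij_witness[where i="enc N k" and j="?d"]) (use 1 2 in auto)
qed

lemma ctrl_gate_carrier: "G \<in> carrier_mat N N \<Longrightarrow> ctrl_gate k G \<in> carrier_mat (2 * N * k) (2 * N * k)"
  by (simp add: ctrl_gate_def kron_def mat_diag_def mult.assoc)

lemma kron_index:
  "i < dim_row A * dim_row B \<Longrightarrow> j < dim_col A * dim_col B \<Longrightarrow>
    kron A B $$ (i, j) = A $$ (i div dim_row B, j div dim_col B) * B $$ (i mod dim_row B, j mod dim_col B)"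
  by (simp add: kron_def)

lemma ctrl_gate_entry:
  assumes G: "G \<in> carrier_mat N N" and x: "x < N" "c < 2" "w < k" and y: "y < N" "c' < 2" "w' < k"
  shows "ctrl_gate k G $$ (enc N k (x, (c, w)), enc N k (y, (c', w')))
    = (if c = c' \<and> w = w' then (if c = 1 then G $$ (x, y) else if x = y then 1 else 0) else 0)"
proof -
  define i where "i = enc N k (x, (c, w))"
  define j where "j = enc N k (y, (c', w'))"
  have l: "i < 2 * (N * k)" "j < 2 * (N * k)"
    using enc_less[OF x] enc_less[OF y] by (simp_all add: i_def j_def mult.assoc)
  have s: "x * k + w < N * k" "y * k + w' < N * k"
    using enc_less[of x N 1 w k] enc_less[of y N 1 w' k] x y by (simp_all add: enc_def algebra_simps)
  have dm: "i div (N * k) = c" "j div (N * k) = c'" "i mod (N * k) = x * k + w" "j mod (N * k) = y * k + w'"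
    using enc_decode[OF x(1,3)] enc_decode[OF y(1,3)] by (simp_all only: i_def j_def)
  have dm': "(x * k + w) div k = x" "(y * k + w') div k = y" "(x * k + w) mod k = w" "(y * k + w') mod k = w'"
    using x y by simp_all
  have e: "(x * k + w = y * k + w') \<longleftrightarrow> x = y \<and> w = w'"
    using dm' by metis
  have dims: "dim_row G = N" "dim_col G = N" using G by auto
  have diag: "(mat_diag 2 h :: complex mat) $$ (c, c') = (if c = c' then h c else 0)" for h
    using x y by (simp add: mat_diag_def)
  have K: "kron (mat_diag 2 h) D $$ (i, j) = (if c = c' then h c else 0) * D $$ (x * k + w, y * k + w')"
    if "D \<in> carrier_mat (N * k) (N * k)" for h :: "nat \<Rightarrow> complex" and D
  proof -
    have D: "dim_row D = N * k" "dim_col D = N * k" using that by auto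
    have M: "dim_row (mat_diag 2 h) = 2" "dim_col (mat_diag 2 h) = 2" by (simp_all add: mat_diag_def)
    show ?thesis by (subst kron_index) (simp_all only: D M l dm diag)
  qed
  have G': "kron G (1\<^sub>m k) $$ (x * k + w, y * k + w') = G $$ (x, y) * (if w = w' then 1 else 0)"
    by (subst kron_index) (use s x y in \<open>simp_all add: dims dm'\<close>)
  have cG: "kron G (1\<^sub>m k) \<in> carrier_mat (N * k) (N * k)" by (simp add: kron_def dims)
  have O: "(1\<^sub>m (N * k) :: complex mat) $$ (x * k + w, y * k + w') = (if x = y \<and> w = w' then 1 else 0)"
    by (simp add: s e)
  have "ctrl_gate k G $$ (i, j) = (if c = c' then (if c = 0 then 1 else 0) else 0) * (if x = y \<and> w = w' then 1 else 0)
     + (if c = c' then (if c = 1 then 1 else 0) else 0) * (G $$ (x, y) * (if w = w' then 1 else 0))"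
    unfolding ctrl_gate_def dims
    by (subst index_add_mat(1))
       (use l in \<open>simp_all only: K[OF cG] K[OF one_carrier_mat] O G'\<close>, simp_all add: kron_def dims mat_diag_def)
  moreover have "c = 0 \<or> c = 1" using x by auto
  ultimately show ?thesis unfolding i_def[symmetric] j_def[symmetric] by auto
qed

lemma ctrl_gate_apply:
  assumes G: "G \<in> carrier_mat N N" and s: "s \<in> carrier_vec (2 * N * k)" and x: "x < N" "c < 2" "w < k"
  shows "(ctrl_gate k G *\<^sub>v s) $ enc N k (x, (c, w))
    = (if c = 1 then \<Sum>y<N. G $$ (x, y) * s $ enc N k (y, (c, w)) else s $ enc N k (x, (c, w)))"
proof -
  have "(ctrl_gate k G *\<^sub>v s) $ enc N k (x, (c, w))
     = (\<Sum>j\<in>{..<N} \<times> ({..<2} \<times> {..<k}). ctrl_gate k G $$ (enc N k (x, (c, w)), enc N k j) * s $ enc N k j)"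
    by (subst mult_mat_vec_index_sum[OF ctrl_gate_carrier[OF G] s enc_less[OF x]]) (rule sum_enc)
  also have "\<dots> = (\<Sum>y<N. \<Sum>c'<2. \<Sum>w'<k. ctrl_gate k G $$ (enc N k (x, (c, w)), enc N k (y, (c', w'))) * s $ enc N k (y, (c', w')))"
    by (simp add: sum.cartesian_product)
  also have "\<dots> = (\<Sum>y<N. \<Sum>c'<2. \<Sum>w'<k. if w' = w then (if c' = c then (if c = 1 then G $$ (x, y) else if x = y then 1 else 0) * s $ enc N k (y, (c, w)) else 0) else 0)"
    by (intro sum.cong refl) (simp add: ctrl_gate_entry[OF G x])
  also have "\<dots> = (\<Sum>y<N. (if c = 1 then G $$ (x, y) else if x = y then 1 else 0) * s $ enc N k (y, (c, w)))"
    using x by (simp add: sum.delta)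
  also have "\<dots> = (if c = 1 then \<Sum>y<N. G $$ (x, y) * s $ enc N k (y, (c, w)) else s $ enc N k (x, (c, w)))"
    using x by (simp add: if_distrib[of "\<lambda>z. z * _"] cong: if_cong)
  finally show ?thesis .
qed

lemma alg_state_carrier:
  assumes "\<And>t. t \<le> T \<Longrightarrow> V t \<in> carrier_mat (2 * d * m * k) (2 * d * m * k)" "t \<le> T"
  shows "alg_state d m k V qinv U t \<in> carrier_vec (2 * d * m * k)"
  using assms(2)
proof (cases t)
  case 0
  then show ?thesis using assms(1)[of 0] by (simp add: mult_mat_vec_carrier)
next
  case (Suc s)
  then have "V t \<in> carrier_mat (2 * d * m * k) (2 * d * m * k)" using assms by simp
  then have "dim_row (V t) = 2 * d * m * k" by auto
  then show ?thesis using Suc by (intro carrier_vecI) simp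
qed

text \<open>Along \<open>enc\<close> the matrix evolution agrees entry by entry with the abstract
  \<open>run\<close>. A reflection is its own adjoint, so both values of \<open>qinv\<close> apply
  the same gate, and the first unitary together with the initial unit vector becomes
  \<open>\<phi>0\<close>.\<close>

lemma estimable_algorithm:
  assumes est: "renyi_estimable \<alpha> d \<epsilon> T" and d: "1 \<le> d" and m: "1 \<le> m"
  defines "X \<equiv> {..<d * m}"
  obtains R R1 :: "(nat \<times> nat) set" and V \<phi>0 g
  where "query_algorithm X R V \<phi>0 T"
    "\<And>v. (\<Sum>x\<in>X. (v x)\<^sup>2) = 1 \<Longrightarrow>
      2 / 3 \<le> (nrm {j \<in> X \<times> R. \<bar>g j - renyi_entropy \<alpha> d (oracle_state d m (refl_mat (d * m) v))\<bar> \<le> \<epsilon>}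
        (query_algorithm.run X R R1 V \<phi>0 v T))\<^sup>2"
proof -
  define N where "N = d * m"
  obtain k V qinv f where k: "1 \<le> k" and V: "\<And>t. t \<le> T \<Longrightarrow> unitary_mat (2 * d * m * k) (V t)"
    and succ: "\<And>U. unitary_mat (d * m) U \<Longrightarrow>
      2 / 3 \<le> success_prob d m k V qinv f U T (renyi_entropy \<alpha> d (oracle_state d m U)) \<epsilon>"
    using est m unfolding renyi_estimable_def by blast
  define L where "L = 2 * N * k"
  have L: "2 * d * m * k = L" by (simp add: L_def N_def mult.assoc)
  have L0: "0 < L" using d m k by (simp add: L_def N_def)
  note V = V[unfolded L]
  have Vc: "V t \<in> carrier_mat L L" if "t \<le> T" for t using V[OF that] by (simp add: unitary_mat_def)
  define R where "R = {..<2::nat} \<times> {..<k}"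
  define R1 where "R1 = {1::nat} \<times> {..<k}"
  let ?e = "enc N k"
  define W where "W = (\<lambda>t j i. V t $$ (?e j, ?e i))"
  define \<phi>0 where "\<phi>0 = (\<lambda>j. (V 0 *\<^sub>v unit_vec L 0) $ ?e j)"
  have X: "X = {..<N}" by (simp add: X_def N_def)
  have sumL: "(\<Sum>i<L. F i) = (\<Sum>j\<in>X \<times> R. F (?e j))" for F :: "nat \<Rightarrow> 'b::comm_monoid_add"
    unfolding L_def X R_def by (rule sum_enc)
  have nrmL: "nrm {..<L} F = nrm (X \<times> R) (\<lambda>j. F (?e j))" for F
    unfolding nrm_eq_sqrt sumL ..
  have eL: "?e j < L" if "j \<in> X \<times> R" for j
    using that enc_less unfolding L_def X R_def by auto
  have inj: "inj_on ?e (X \<times> R)"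
    by (rule inj_on_inverseI[where g="\<lambda>i. ((i div k) mod N, (i div (N * k), i mod k))"])
       (auto simp: X R_def enc_decode)
  interpret A: query_algorithm X R R1 W \<phi>0 T
  proof
    show "finite X" "finite R" by (auto simp: X R_def)
    fix t :: nat and \<phi> :: "nat \<times> nat \<times> nat \<Rightarrow> complex" assume "0 < t" "t \<le> T"
    \<comment> \<open>Unitarity concerns functions of matrix indices, isometry functions on X times
      R; this transports \<phi> along the injective map \<open>enc\<close>.\<close>
    define \<psi> where "\<psi> = (\<lambda>l. \<phi> (SOME i. i \<in> X \<times> R \<and> ?e i = l))"
    have \<psi>: "\<psi> (?e j) = \<phi> j" if "j \<in> X \<times> R" for j
    proof -
      have "(SOME i. i \<in> X \<times> R \<and> ?e i = ?e j) = j"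
        by (rule some_equality) (use that inj_onD[OF inj] in auto)
      then show ?thesis by (simp add: \<psi>_def)
    qed
    have "nrm {..<L} (\<lambda>l. \<Sum>i<L. V t $$ (l, i) * \<psi> i) = nrm {..<L} \<psi>"
      by (rule unitary_isometry[OF V[OF \<open>t \<le> T\<close>]])
    moreover have "nrm {..<L} (\<lambda>l. \<Sum>i<L. V t $$ (l, i) * \<psi> i) = nrm (X \<times> R) (\<lambda>j. \<Sum>i\<in>X \<times> R. W t j i * \<phi> i)"
      unfolding nrmL sumL W_def by (intro nrm_cong sum.cong refl) (simp add: \<psi>)
    moreover have "nrm {..<L} \<psi> = nrm (X \<times> R) \<phi>"
      unfolding nrmL by (intro nrm_cong) (simp add: \<psi>)
    ultimately show "nrm (X \<times> R) (\<lambda>j. \<Sum>i\<in>X \<times> R. W t j i * \<phi> i) = nrm (X \<times> R) \<phi>" by simp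
  next
    have "nrm (X \<times> R) \<phi>0 = nrm {..<L} (\<lambda>l. (V 0 *\<^sub>v unit_vec L 0) $ l)"
      unfolding nrmL \<phi>0_def ..
    also have "\<dots> = nrm {..<L} (\<lambda>l. \<Sum>i<L. V 0 $$ (l, i) * (if i = 0 then 1 else 0))"
      by (rule nrm_cong, subst mult_mat_vec_index_sum[OF Vc[OF le0] unit_vec_carrier]) (auto simp: unit_vec_def)
    also have "\<dots> = nrm {..<L} (\<lambda>i. if i = 0 then 1 else 0)" by (rule unitary_isometry[OF V[OF le0]])
    also have "\<dots> = 1" using L0 by (simp add: nrm_eq_sqrt if_distrib[of "\<lambda>z. (cmod z)\<^sup>2"] cong: if_cong)
    finally show "nrm (X \<times> R) \<phi>0 = 1" .
  qed
  have state: "alg_state d m k V qinv (refl_mat (d * m) v) t $ ?e j = A.run v t j"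
    if "t \<le> T" "j \<in> X \<times> R" for v t j
    using that
  proof (induction t arbitrary: j)
    case 0
    show ?case unfolding A.run.simps alg_state.simps L by (simp only: \<phi>0_def)
  next
    case (Suc t)
    let ?s = "alg_state d m k V qinv (refl_mat (d * m) v) t"
    let ?G = "refl_mat N v"
    have s: "?s \<in> carrier_vec L"
      using alg_state_carrier[of T V d m k t] Vc Suc.prems by (simp add: L)
    have G: "?G \<in> carrier_mat N N" by simp
    have cs: "ctrl_gate k ?G *\<^sub>v ?s \<in> carrier_vec L"
      using ctrl_gate_carrier[OF G, of k] s by (simp add: L_def)
    have gate: "(ctrl_gate k ?G *\<^sub>v ?s) $ ?e i = A.refl_query v (A.run v t) i" if i: "i \<in> X \<times> R" for i
    proof -
      obtain x c w where xcw: "i = (x, (c, w))" "x < N" "c < 2" "w < k" using i by (auto simp: X R_def)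
      have IH: "?s $ ?e (y, (c, w)) = A.run v t (y, (c, w))" if "y < N" for y
        by (rule Suc.IH) (use Suc.prems that xcw in \<open>auto simp: X R_def\<close>)
      show ?thesis
      proof (cases "c = 1")
        case True
        have "(ctrl_gate k ?G *\<^sub>v ?s) $ ?e i = (\<Sum>y<N. ?G $$ (x, y) * A.run v t (y, (c, w)))"
          unfolding xcw(1) ctrl_gate_apply[OF G s[unfolded L_def] xcw(2-4)] if_P[OF True]
          by (intro sum.cong refl) (simp only: IH lessThan_iff)
        also have "\<dots> = (\<Sum>y<N. (if x = y then A.run v t (x, (c, w)) else 0) - 2 * of_real (v x) * (of_real (v y) * A.run v t (y, (c, w))))"
          using xcw by (intro sum.cong refl) (simp add: refl_mat_def algebra_simps)
        also have "\<dots> = A.refl_query v (A.run v t) i"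
          using True xcw unfolding sum_subtractf sum_distrib_left[symmetric]
          unfolding A.refl_query_def by (simp add: R1_def X)
        finally show ?thesis .
      next
        case False
        then show ?thesis
          unfolding xcw(1) ctrl_gate_apply[OF G s[unfolded L_def] xcw(2-4)] if_not_P[OF False] IH[OF xcw(2)]
          unfolding A.refl_query_def by (simp add: R1_def)
      qed
    qed
    have "alg_state d m k V qinv (refl_mat (d * m) v) (Suc t) $ ?e j = (V (Suc t) *\<^sub>v (ctrl_gate k ?G *\<^sub>v ?s)) $ ?e j"
      by (simp only: alg_state.simps mat_adjoint_refl_mat N_def if_cancel)
    also have "\<dots> = (\<Sum>i<L. V (Suc t) $$ (?e j, i) * (ctrl_gate k ?G *\<^sub>v ?s) $ i)"
      by (rule mult_mat_vec_index_sum[OF Vc[OF Suc.prems(1)] cs eL[OF Suc.prems(2)]])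
    also have "\<dots> = (\<Sum>i\<in>X \<times> R. W (Suc t) j i * A.refl_query v (A.run v t) i)"
    proof -
      have Wd: "V (Suc t) $$ (?e j, ?e i) = W (Suc t) j i" for i by (simp add: W_def)
      show ?thesis unfolding sumL by (intro sum.cong refl) (simp only: gate Wd)
    qed
    also have "\<dots> = A.run v (Suc t) j" by (simp add: A.app_def)
    finally show ?case .
  qed
  show ?thesis
  proof (rule that[of R W \<phi>0 "\<lambda>j. f (?e j)" R1])
    show "query_algorithm X R W \<phi>0 T" by (rule A.query_algorithm_axioms)
    fix v :: "nat \<Rightarrow> real" assume v: "(\<Sum>x\<in>X. (v x)\<^sup>2) = 1"
    let ?U = "refl_mat (d * m) v"
    let ?S = "renyi_entropy \<alpha> d (oracle_state d m ?U)"
    have "2 / 3 \<le> success_prob d m k V qinv f ?U T ?S \<epsilon>"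
      by (rule succ[OF refl_mat_unitary]) (use v in \<open>simp add: X_def\<close>)
    also have "\<dots> = (\<Sum>l<L. if \<bar>f l - ?S\<bar> \<le> \<epsilon> then (cmod (alg_state d m k V qinv ?U T $ l))\<^sup>2 else 0)"
    proof -
      have "{j. j < L \<and> \<bar>f j - ?S\<bar> \<le> \<epsilon>} = {j \<in> {..<L}. \<bar>f j - ?S\<bar> \<le> \<epsilon>}" by auto
      then show ?thesis unfolding success_prob_def L by (simp only: sum.inter_filter[OF finite_lessThan])
    qed
    also have "\<dots> = (\<Sum>j\<in>X \<times> R. if \<bar>f (?e j) - ?S\<bar> \<le> \<epsilon> then (cmod (A.run v T j))\<^sup>2 else 0)"
      unfolding sumL by (intro sum.cong refl) (simp add: state)
    also have "\<dots> = (nrm {j \<in> X \<times> R. \<bar>f (?e j) - ?S\<bar> \<le> \<epsilon>} (A.run v T))\<^sup>2"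
      unfolding nrm_sq by (rule sum.inter_filter[symmetric]) (simp add: A.finX A.finR)
    finally show "2 / 3 \<le> (nrm {j \<in> X \<times> R. \<bar>f (?e j) - ?S\<bar> \<le> \<epsilon>} (A.run v T))\<^sup>2" .
  qed
qed

section \<open>Spectra, traces of powers and entropies of explicit states\<close>

lemma proots_linear_list: "proots (\<Prod>a\<leftarrow>as. [:- a, 1:]) = mset as"
  for as :: "complex list"
proof (induction as)
  case (Cons a as)
  have "(\<Prod>a\<leftarrow>as. [:- a, 1:]) \<noteq> 0" by (auto simp: prod_list_zero_iff)
  then show ?case using Cons unfolding list.map prod_list.Cons by (subst proots_mult) simp_all
qed simp

text \<open>The multiset of eigenvalues is recovered from the characteristic polynomial and hence
  does not depend on the diagonalisation. This gives the uniqueness behind the definite description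
  in \<open>trace_pow\<close>.\<close>

lemma unitary_diag_similar:
  assumes W: "unitary_mat d W" and \<rho>: "\<rho> = W * mat_diag d l * mat_adjoint W"
  shows "proots (char_poly \<rho>) = mset (map l [0..<d])"
proof -
  have Wc: "W \<in> carrier_mat d d" using W by (simp add: unitary_mat_def)
  have "similar_mat \<rho> (mat_diag d l)"
  proof (rule similar_matI[of _ _ W "mat_adjoint W" d])
    have "mat_diag d l \<in> carrier_mat d d" "mat_adjoint W \<in> carrier_mat d d" using Wc by simp_all
    moreover from this have "\<rho> \<in> carrier_mat d d" unfolding \<rho> using Wc by (intro mult_carrier_mat[of _ d d])
    ultimately show "{\<rho>, mat_diag d l, W, mat_adjoint W} \<subseteq> carrier_mat d d" using Wc by simp
  qed (use W \<rho> in \<open>simp_all add: unitary_mat_def\<close>)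
  then have "char_poly \<rho> = char_poly (mat_diag d l)" by (rule char_poly_similar)
  also have "\<dots> = (\<Prod>a\<leftarrow>diag_mat (mat_diag d l). [:- a, 1:])"
    by (rule char_poly_upper_triangular[of _ d]) (auto simp: upper_triangular_def mat_diag_def)
  also have "diag_mat (mat_diag d l) = map l [0..<d]"
    by (auto simp: diag_mat_def mat_diag_def intro!: nth_equalityI)
  finally show ?thesis by (simp only: proots_linear_list)
qed

lemma trace_pow_eq:
  assumes W: "unitary_mat d W" and l: "\<And>i. i < d \<Longrightarrow> 0 \<le> lam i"
    and \<rho>: "\<rho> = W * mat_diag d (\<lambda>i. complex_of_real (lam i)) * mat_adjoint W"
  shows "trace_pow \<alpha> d \<rho> = (\<Sum>i<d. lam i powr \<alpha>)"
  unfolding trace_pow_def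
proof (rule the_equality)
  show "\<exists>W lam'. unitary_mat d W \<and> (\<forall>i<d. 0 \<le> lam' i) \<and>
      \<rho> = W * mat_diag d (\<lambda>i. complex_of_real (lam' i)) * mat_adjoint W \<and> (\<Sum>i<d. lam i powr \<alpha>) = (\<Sum>i<d. lam' i powr \<alpha>)"
    using W l \<rho> by blast
next
  fix s assume "\<exists>W lam'. unitary_mat d W \<and> (\<forall>i<d. 0 \<le> lam' i) \<and>
      \<rho> = W * mat_diag d (\<lambda>i. complex_of_real (lam' i)) * mat_adjoint W \<and> s = (\<Sum>i<d. lam' i powr \<alpha>)"
  then obtain W' lam' where W': "unitary_mat d W'"
      "\<rho> = W' * mat_diag d (\<lambda>i. complex_of_real (lam' i)) * mat_adjoint W'" and s: "s = (\<Sum>i<d. lam' i powr \<alpha>)"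
    by blast
  have sum: "(\<Sum>i<d. f i powr \<alpha>) = (\<Sum>z\<in>#mset (map (\<lambda>i. complex_of_real (f i)) [0..<d]). Re z powr \<alpha>)" for f
  proof -
    have "(\<Sum>z\<in>#mset (map (\<lambda>i. complex_of_real (f i)) [0..<d]). Re z powr \<alpha>) = sum_mset (mset (map (\<lambda>i. f i powr \<alpha>) [0..<d]))"
      by (simp flip: mset_map add: o_def)
    also have "\<dots> = (\<Sum>i<d. f i powr \<alpha>)"
      unfolding sum_mset_sum_list by (simp add: interv_sum_list_conv_sum_set_nat atLeast0LessThan)
    finally show ?thesis ..
  qed
  show "s = (\<Sum>i<d. lam i powr \<alpha>)"
    unfolding s sum unitary_diag_similar[OF W', symmetric] unitary_diag_similar[OF W \<rho>, symmetric] ..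
qed

definition real_mat :: "nat \<Rightarrow> (nat \<Rightarrow> nat \<Rightarrow> real) \<Rightarrow> complex mat" where
  "real_mat d F = mat d d (\<lambda>(i, j). complex_of_real (F i j))"

lemma real_mat_carrier [simp]: "real_mat d F \<in> carrier_mat d d"
  by (simp add: real_mat_def)

lemma real_mat_mult: "real_mat d F * real_mat d G = real_mat d (\<lambda>i j. \<Sum>k<d. F i k * G k j)"
  by (rule eq_matI) (auto simp: real_mat_def scalar_prod_def atLeast0LessThan)

text \<open>Every state below is diagonalised by a real symmetric matrix that is its own inverse:
  the identity, a Householder reflection, or a combination of a diagonal sign matrix with a
  matching. A single matrix then serves as \<open>W\<close> and as its adjoint.\<close>

lemma trace_pow_involution:
  assumes sym: "\<And>i j. i < d \<Longrightarrow> j < d \<Longrightarrow> W i j = W j i"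
    and inv: "\<And>i j. i < d \<Longrightarrow> j < d \<Longrightarrow> (\<Sum>k<d. W i k * W k j) = (if i = j then 1 else 0)"
    and l: "\<And>i. i < d \<Longrightarrow> 0 \<le> lam i"
    and F: "\<And>i j. i < d \<Longrightarrow> j < d \<Longrightarrow> F i j = (\<Sum>k<d. W i k * lam k * W k j)"
  shows "trace_pow \<alpha> d (real_mat d F) = (\<Sum>i<d. lam i powr \<alpha>)"
proof (rule trace_pow_eq[where W="real_mat d W"])
  have adj: "mat_adjoint (real_mat d W) = real_mat d W"
  proof (rule eq_matI)
    fix i j assume "i < dim_row (real_mat d W)" "j < dim_col (real_mat d W)"
    then show "mat_adjoint (real_mat d W) $$ (i, j) = real_mat d W $$ (i, j)"
      using sym by (subst mat_adjoint_index) (auto simp: real_mat_def)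
  next
    have "mat_adjoint (real_mat d W) \<in> carrier_mat d d" by simp
    then show "dim_row (mat_adjoint (real_mat d W)) = dim_row (real_mat d W)"
      "dim_col (mat_adjoint (real_mat d W)) = dim_col (real_mat d W)"
      unfolding carrier_mat_def by (simp_all add: real_mat_def)
  qed
  have "real_mat d W * real_mat d W = 1\<^sub>m d"
    unfolding real_mat_mult by (rule eq_matI) (simp_all add: real_mat_def inv del: of_real_sum of_real_mult)
  then show "unitary_mat d (real_mat d W)" by (simp add: unitary_mat_def adj)
  have "real_mat d W * mat_diag d (\<lambda>i. complex_of_real (lam i)) = real_mat d (\<lambda>i j. W i j * lam j)"
    by (subst mat_diag_mult_right[of _ d d]) (auto simp: real_mat_def)
  then show "real_mat d F = real_mat d W * mat_diag d (\<lambda>i. complex_of_real (lam i)) * mat_adjoint (real_mat d W)"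
    unfolding adj by (simp only: real_mat_mult) (auto simp: real_mat_def F intro!: eq_matI)
qed (fact l)

lemma trace_pow_diag:
  assumes l: "\<And>i. i < d \<Longrightarrow> 0 \<le> lam i"
  shows "trace_pow \<alpha> d (real_mat d (\<lambda>i j. if i = j then lam i else 0)) = (\<Sum>i<d. lam i powr \<alpha>)"
  by (rule trace_pow_involution[where W="\<lambda>i j. if i = j then 1 else 0"])
     (use l in \<open>auto simp: if_distrib[of "\<lambda>z. z * _"] cong: if_cong\<close>)

definition query_vec :: "(nat \<Rightarrow> real) \<Rightarrow> nat \<Rightarrow> real" where
  "query_vec \<psi> x = ((if x = 0 then 1 else 0) - \<psi> x) / sqrt 2"

lemma query_vec_unit:
  assumes "(\<Sum>x<n. (\<psi> x)\<^sup>2) = 1" "\<psi> 0 = 0" "0 < n"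
  shows "(\<Sum>x<n. (query_vec \<psi> x)\<^sup>2) = 1"
proof -
  have "(\<Sum>x<n. (query_vec \<psi> x)\<^sup>2) = (\<Sum>x<n. (if x = 0 then 1 / 2 else 0) + (\<psi> x)\<^sup>2 / 2)"
    using assms(2) by (intro sum.cong) (auto simp: query_vec_def power_divide)
  also have "\<dots> = 1"
    using assms by (simp add: sum.distrib flip: sum_divide_distrib)
  finally show ?thesis .
qed

text \<open>As psi vanishes at 0, twice v times its entry at 0 is e_0 - psi, so column 0 of the
  reflection is psi itself. The oracle state is the reduced state of that column.\<close>

lemma oracle_state_query_vec:
  assumes \<psi>: "\<psi> 0 = 0" and dm: "0 < d" "0 < m"
  shows "oracle_state d m (refl_mat (d * m) (query_vec \<psi>)) = real_mat d (\<lambda>i j. \<Sum>k<m. \<psi> (i * m + k) * \<psi> (j * m + k))"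
proof -
  have col: "refl_mat (d * m) (query_vec \<psi>) $$ (i * m + k, 0) = complex_of_real (\<psi> (i * m + k))" if "i < d" "k < m" for i k
  proof -
    have "(i + 1) * m \<le> d * m" using that by (intro mult_le_mono1) simp
    then have lt: "i * m + k < d * m" using that by simp
    have "2 * query_vec \<psi> x * query_vec \<psi> 0 = (if x = 0 then 1 else 0) - \<psi> x" for x
      using \<psi> by (simp add: query_vec_def)
    then have "2 * complex_of_real (query_vec \<psi> x) * complex_of_real (query_vec \<psi> 0) = of_real ((if x = 0 then 1 else 0) - \<psi> x)" for x
      by (metis of_real_mult of_real_numeral)
    then show ?thesis using lt dm unfolding refl_mat_def by simp
  qed
  show ?thesis
    by (rule eq_matI) (auto simp: oracle_state_def real_mat_def col)
qed

section \<open>Two-point bounds\<close>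

definition state_entropy :: "real \<Rightarrow> nat \<Rightarrow> nat \<Rightarrow> (nat \<Rightarrow> real) \<Rightarrow> real" where
  "state_entropy \<alpha> d m \<psi> = renyi_entropy \<alpha> d (real_mat d (\<lambda>i j. \<Sum>k<m. \<psi> (i * m + k) * \<psi> (j * m + k)))"

definition query_state :: "nat \<Rightarrow> (nat \<Rightarrow> real) \<Rightarrow> bool" where
  "query_state n \<psi> \<longleftrightarrow> \<psi> 0 = 0 \<and> (\<Sum>x<n. (\<psi> x)\<^sup>2) = 1"

text \<open>The acceptance event asks whether the estimate is compatible with the entropy S.\<close>
lemma estimable_distinguishes:
  assumes est: "renyi_estimable \<alpha> d \<epsilon> T" and d: "1 \<le> d" and m: "1 \<le> m"
  obtains R R1 :: "(nat \<times> nat) set" and V \<phi>0 B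
  where "query_algorithm {..<d * m} R V \<phi>0 T" "B \<subseteq> {..<d * m} \<times> R"
    "\<And>\<psi>. query_state (d * m) \<psi> \<Longrightarrow> state_entropy \<alpha> d m \<psi> = S \<Longrightarrow>
      2 / 3 \<le> (nrm B (query_algorithm.run {..<d * m} R R1 V \<phi>0 (query_vec \<psi>) T))\<^sup>2"
    "\<And>\<psi>. query_state (d * m) \<psi> \<Longrightarrow> 2 * \<epsilon> < \<bar>state_entropy \<alpha> d m \<psi> - S\<bar> \<Longrightarrow>
      (nrm B (query_algorithm.run {..<d * m} R R1 V \<phi>0 (query_vec \<psi>) T))\<^sup>2 \<le> 1 / 3"
proof -
  let ?X = "{..<d * m}"
  obtain R R1 :: "(nat \<times> nat) set" and V \<phi>0 g where alg: "query_algorithm ?X R V \<phi>0 T"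
    and succ: "\<And>v. (\<Sum>x\<in>?X. (v x)\<^sup>2) = 1 \<Longrightarrow>
      2 / 3 \<le> (nrm {j \<in> ?X \<times> R. \<bar>g j - renyi_entropy \<alpha> d (oracle_state d m (refl_mat (d * m) v))\<bar> \<le> \<epsilon>}
        (query_algorithm.run ?X R R1 V \<phi>0 v T))\<^sup>2"
    by (rule estimable_algorithm[OF est d m]) (rule that)
  interpret A: query_algorithm ?X R R1 V \<phi>0 T by (rule alg)
  have v: "(\<Sum>x\<in>?X. (query_vec \<psi> x)\<^sup>2) = 1" if "query_state (d * m) \<psi>" for \<psi>
    using that d m by (intro query_vec_unit) (auto simp: query_state_def)
  define Acc where "Acc = (\<lambda>S. {j \<in> ?X \<times> R. \<bar>g j - S\<bar> \<le> \<epsilon>})"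
  have acc: "2 / 3 \<le> (nrm (Acc (state_entropy \<alpha> d m \<psi>)) (A.run (query_vec \<psi>) T))\<^sup>2"
    if q: "query_state (d * m) \<psi>" for \<psi>
  proof -
    have "oracle_state d m (refl_mat (d * m) (query_vec \<psi>)) = real_mat d (\<lambda>i j. \<Sum>k<m. \<psi> (i * m + k) * \<psi> (j * m + k))"
      by (rule oracle_state_query_vec) (use q d m in \<open>auto simp: query_state_def\<close>)
    then show ?thesis using succ[OF v[OF q]] by (simp only: Acc_def state_entropy_def)
  qed
  show ?thesis
  proof (rule that[of R V \<phi>0 "Acc S" R1])
    fix \<psi> assume q: "query_state (d * m) \<psi>" and far: "2 * \<epsilon> < \<bar>state_entropy \<alpha> d m \<psi> - S\<bar>"
    let ?B = "Acc (state_entropy \<alpha> d m \<psi>)" and ?f = "A.run (query_vec \<psi>) T"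
    have fin: "finite (?X \<times> R)" using A.finR by simp
    have sub: "Acc S \<subseteq> ?X \<times> R" "?B \<subseteq> ?X \<times> R" by (auto simp: Acc_def)
    \<comment> \<open>Entropies more than 2 \<epsilon> apart have disjoint acceptance windows. The
      window of the true entropy holds at least 2/3 of the probability, leaving at most 1/3 for
      \<open>Acc S\<close>.\<close>
    have disj: "Acc S \<inter> ?B = {}" using far by (auto simp: Acc_def)
    have "(nrm (Acc S) ?f)\<^sup>2 + (nrm ?B ?f)\<^sup>2 = (\<Sum>j\<in>Acc S \<union> ?B. (cmod (?f j))\<^sup>2)"
      unfolding nrm_sq using sub fin disj by (intro sum.union_disjoint[symmetric]) (auto intro: finite_subset)
    also have "\<dots> \<le> (nrm (?X \<times> R) ?f)\<^sup>2"
      unfolding nrm_sq using sub fin by (intro sum_mono2) auto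
    also have "\<dots> = 1" by (simp add: A.nrm_run[OF v[OF q]])
    finally show "(nrm (Acc S) ?f)\<^sup>2 \<le> 1 / 3" using acc[OF q] by simp
  qed (use alg acc in \<open>auto simp: Acc_def\<close>)
qed

text \<open>Passing from psi to \<open>query_vec\<close> halves squared distances, whence the factor
  2 in the hypothesis. The acceptance probabilities differ by at least 1/3 and by at most 8 T
  \<delta>.\<close>

lemma two_point_bound:
  assumes est: "renyi_estimable \<alpha> d \<epsilon> T" and d: "1 \<le> d" and m: "1 \<le> m"
    and \<psi>: "query_state (d * m) \<psi>" "query_state (d * m) \<psi>'"
    and far: "2 * \<epsilon> < \<bar>state_entropy \<alpha> d m \<psi> - state_entropy \<alpha> d m \<psi>'\<bar>"
    and close: "(\<Sum>x<d * m. (\<psi> x - \<psi>' x)\<^sup>2) \<le> 2 * \<delta>\<^sup>2" "0 \<le> \<delta>"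
  shows "1 \<le> 24 * real T * \<delta>"
proof -
  let ?X = "{..<d * m}"
  obtain R R1 :: "(nat \<times> nat) set" and V \<phi>0 B where alg: "query_algorithm ?X R V \<phi>0 T" and B: "B \<subseteq> ?X \<times> R"
    and yes: "\<And>\<psi>. query_state (d * m) \<psi> \<Longrightarrow> state_entropy \<alpha> d m \<psi> = state_entropy \<alpha> d m \<psi>' \<Longrightarrow>
      2 / 3 \<le> (nrm B (query_algorithm.run ?X R R1 V \<phi>0 (query_vec \<psi>) T))\<^sup>2"
    and no: "\<And>\<psi>. query_state (d * m) \<psi> \<Longrightarrow> 2 * \<epsilon> < \<bar>state_entropy \<alpha> d m \<psi> - state_entropy \<alpha> d m \<psi>'\<bar> \<Longrightarrow>
      (nrm B (query_algorithm.run ?X R R1 V \<phi>0 (query_vec \<psi>) T))\<^sup>2 \<le> 1 / 3"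
    by (rule estimable_distinguishes[OF est d m, of "state_entropy \<alpha> d m \<psi>'"]) (rule that)
  interpret A: query_algorithm ?X R R1 V \<phi>0 T by (rule alg)
  have v: "(\<Sum>x\<in>?X. (query_vec \<psi> x)\<^sup>2) = 1" if "query_state (d * m) \<psi>" for \<psi>
    using that d m by (intro query_vec_unit) (auto simp: query_state_def)
  have "(\<Sum>x\<in>?X. (query_vec \<psi>' x - query_vec \<psi> x)\<^sup>2) = (\<Sum>x<d * m. (\<psi> x - \<psi>' x)\<^sup>2 / 2)"
  proof (rule sum.cong[OF refl])
    fix x
    have "query_vec \<psi>' x - query_vec \<psi> x = (\<psi> x - \<psi>' x) / sqrt 2"
      unfolding query_vec_def diff_divide_distrib by simp
    then show "(query_vec \<psi>' x - query_vec \<psi> x)\<^sup>2 = (\<psi> x - \<psi>' x)\<^sup>2 / 2"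
      by (simp add: power_divide)
  qed
  also have "\<dots> \<le> \<delta>\<^sup>2" using close(1) by (simp flip: sum_divide_distrib)
  finally have n: "nrm ?X (\<lambda>x. of_real (query_vec \<psi>' x - query_vec \<psi> x)) \<le> \<delta>"
    using close(2) by (subst nrm_le_iff) (simp_all only: norm_of_real power2_abs)
  have "1 / 3 \<le> \<bar>(nrm B (A.run (query_vec \<psi>') T))\<^sup>2 - (nrm B (A.run (query_vec \<psi>) T))\<^sup>2\<bar>"
    using yes[OF \<psi>(2) refl] no[OF \<psi>(1) far] by linarith
  also have "\<dots> \<le> 8 * real T * nrm ?X (\<lambda>x. of_real (query_vec \<psi>' x - query_vec \<psi> x))"
    by (rule A.accept_perturb[OF v[OF \<psi>(2)] v[OF \<psi>(1)] B])
  also have "\<dots> \<le> 8 * real T * \<delta>" using n by (intro mult_left_mono) auto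
  finally show ?thesis by simp
qed

section \<open>Diagonal states with one exceptional eigenvalue\<close>

lemma sum_prod_index: "(\<Sum>x<d * m. F x) = (\<Sum>i<d. \<Sum>k<m. F (i * m + k))" for F :: "nat \<Rightarrow> 'a::comm_monoid_add"
proof -
  have "(\<Sum>x<d * m. F x) = (\<Sum>i<d. sum F {i * m..<i * m + m})" by (rule sum.nat_group[symmetric])
  also have "\<dots> = (\<Sum>i<d. \<Sum>k<m. F (i * m + k))"
  proof (rule sum.cong[OF refl])
    fix i
    show "sum F {i * m..<i * m + m} = (\<Sum>k<m. F (i * m + k))"
      by (rule sum.reindex_bij_witness[where i="\<lambda>k. i * m + k" and j="\<lambda>x. x - i * m"]) auto
  qed
  finally show ?thesis .
qed

text \<open>A purification, with purifier dimension d, of the diagonal state with eigenvalue 1 - p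
  on the last level and p / (d - 1) on the others. Row i uses column i + 1 and only the last row
  uses column 0, which keeps index 0 empty as \<open>query_state\<close> demands.\<close>

definition spike_state :: "nat \<Rightarrow> real \<Rightarrow> nat \<Rightarrow> real" where
  "spike_state d p x = (if x div d = d - 1 \<and> x mod d = 0 then sqrt (1 - p)
     else if x div d < d - 1 \<and> x mod d = x div d + 1 then sqrt (p / real (d - 1)) else 0)"

definition spike_trace :: "real \<Rightarrow> nat \<Rightarrow> real \<Rightarrow> real" where
  "spike_trace \<alpha> q p = (1 - p) powr \<alpha> + real q powr (1 - \<alpha>) * p powr \<alpha>"

lemma spike_state_entry:
  assumes "i < d" "k < d"
  shows "spike_state d p (i * d + k) = (if k = (if i = d - 1 then 0 else i + 1)
     then (if i = d - 1 then sqrt (1 - p) else sqrt (p / real (d - 1))) else 0)"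
proof -
  have "(i * d + k) div d = i" "(i * d + k) mod d = k" using assms by simp_all
  then have "spike_state d p (i * d + k) = (if i = d - 1 \<and> k = 0 then sqrt (1 - p)
     else if i < d - 1 \<and> k = i + 1 then sqrt (p / real (d - 1)) else 0)" by (simp only: spike_state_def)
  moreover have "i < d - 1 \<longleftrightarrow> i \<noteq> d - 1" using assms by arith
  ultimately show ?thesis by simp
qed

lemma sum_spike:
  fixes G :: "real \<Rightarrow> real"
  assumes d: "2 \<le> d" and z: "G 0 = 0"
  shows "(\<Sum>x<d * d. G (spike_state d p x)) = G (sqrt (1 - p)) + real (d - 1) * G (sqrt (p / real (d - 1)))"
proof -
  define q where "q = d - 1"
  have q: "d - 1 = q" "0 < q" "q < d" "card {..<d} = q + 1" "\<And>i. i < d \<Longrightarrow> i \<noteq> q \<Longrightarrow> i + 1 < d"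
    using d by (auto simp: q_def)
  note entry = spike_state_entry[of _ d, unfolded q(1)]
  have sum_rows: "(\<Sum>i<d. if i = q then a else b) = a + real q * b" for a b :: real
  proof -
    have "(\<Sum>i<d. if i = q then a else b) = (\<Sum>i<d. b + (if i = q then a - b else 0))" by (rule sum.cong) auto
    also have "\<dots> = real d * b + (a - b)" using q by (simp add: sum.distrib)
    also have "real d = real q + 1" using q(4) by simp
    finally show ?thesis by (simp add: algebra_simps)
  qed
  have row: "(\<Sum>k<d. G (spike_state d p (i * d + k))) = (if i = q then G (sqrt (1 - p)) else G (sqrt (p / real q)))" if "i < d" for i
  proof -
    have "(\<Sum>k<d. G (spike_state d p (i * d + k))) = (\<Sum>k<d. if k = (if i = q then 0 else i + 1) then
        (if i = q then G (sqrt (1 - p)) else G (sqrt (p / real q))) else 0)"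
      using that z by (intro sum.cong refl) (simp add: entry)
    then show ?thesis using that q(2,3,5) by (simp add: sum.delta)
  qed
  have "(\<Sum>x<d * d. G (spike_state d p x)) = (\<Sum>i<d. if i = q then G (sqrt (1 - p)) else G (sqrt (p / real q)))"
    unfolding sum_prod_index by (intro sum.cong refl) (simp add: row)
  then show ?thesis unfolding q(1) by (simp only: sum_rows)
qed

lemma spike_query_state:
  assumes "2 \<le> d" "0 \<le> p" "p \<le> 1"
  shows "query_state (d * d) (spike_state d p)"
proof -
  have "(\<Sum>x<d * d. (spike_state d p x)\<^sup>2) = 1"
    using sum_spike[OF assms(1), of "\<lambda>z. z\<^sup>2" p] assms by simp
  then show ?thesis using assms(1) by (simp add: query_state_def spike_state_def)
qed

lemma spike_entropy:
  assumes d: "2 \<le> d" and p: "0 \<le> p" "p \<le> 1"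
  shows "state_entropy \<alpha> d d (spike_state d p) = ln (spike_trace \<alpha> (d - 1) p) / (1 - \<alpha>)"
proof -
  define q where "q = d - 1"
  have q: "d - 1 = q" "0 < q" "q < d" "card {..<d} = q + 1" "\<And>i. i < d \<Longrightarrow> i \<noteq> q \<Longrightarrow> i + 1 < d"
    using d by (auto simp: q_def)
  note entry = spike_state_entry[of _ d, unfolded q(1)]
  have sum_rows: "(\<Sum>i<d. if i = q then a else b) = a + real q * b" for a b :: real
  proof -
    have "(\<Sum>i<d. if i = q then a else b) = (\<Sum>i<d. b + (if i = q then a - b else 0))" by (rule sum.cong) auto
    also have "\<dots> = real d * b + (a - b)" using q by (simp add: sum.distrib)
    also have "real d = real q + 1" using q(4) by simp
    finally show ?thesis by (simp add: algebra_simps)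
  qed
  let ?lam = "\<lambda>i. if i = q then 1 - p else p / real q"
  have "(\<Sum>k<d. spike_state d p (i * d + k) * spike_state d p (j * d + k)) = (if i = j then ?lam i else 0)"
    if "i < d" "j < d" for i j
  proof -
    have "(\<Sum>k<d. spike_state d p (i * d + k) * spike_state d p (j * d + k))
      = (\<Sum>k<d. if k = (if i = q then 0 else i + 1) then (if i = j then ?lam i else 0) else 0)"
      using that p by (intro sum.cong refl) (auto simp: entry)
    then show ?thesis using that q(2,3,5) by (simp add: sum.delta)
  qed
  then have "real_mat d (\<lambda>i j. \<Sum>k<d. spike_state d p (i * d + k) * spike_state d p (j * d + k))
     = real_mat d (\<lambda>i j. if i = j then ?lam i else 0)"
    by (intro eq_matI) (auto simp: real_mat_def simp del: of_real_sum of_real_mult)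
  then have "state_entropy \<alpha> d d (spike_state d p) = ln (\<Sum>i<d. ?lam i powr \<alpha>) / (1 - \<alpha>)"
    unfolding state_entropy_def renyi_entropy_def using trace_pow_diag[of d ?lam \<alpha>] p by simp
  also have "(\<Sum>i<d. ?lam i powr \<alpha>) = spike_trace \<alpha> q p"
  proof -
    have "(\<Sum>i<d. ?lam i powr \<alpha>) = (\<Sum>i<d. if i = q then (1 - p) powr \<alpha> else (p / real q) powr \<alpha>)"
      by (rule sum.cong) auto
    then show ?thesis using q(2) p by (simp add: sum_rows spike_trace_def powr_divide powr_diff)
  qed
  finally show ?thesis unfolding q(1) .
qed

lemma spike_distance:
  assumes d: "2 \<le> d" and p: "0 \<le> p" "p \<le> 1" and p': "0 \<le> p'" "p' \<le> 1"
  shows "(\<Sum>x<d * d. (spike_state d p x - spike_state d p' x)\<^sup>2) = (sqrt (1 - p) - sqrt (1 - p'))\<^sup>2 + (sqrt p - sqrt p')\<^sup>2"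
proof -
  define q where "q = d - 1"
  have q: "d - 1 = q" "0 < q" "q < d" "card {..<d} = q + 1" "\<And>i. i < d \<Longrightarrow> i \<noteq> q \<Longrightarrow> i + 1 < d"
    using d by (auto simp: q_def)
  note entry = spike_state_entry[of _ d, unfolded q(1)]
  have sum_rows: "(\<Sum>i<d. if i = q then a else b) = a + real q * b" for a b :: real
  proof -
    have "(\<Sum>i<d. if i = q then a else b) = (\<Sum>i<d. b + (if i = q then a - b else 0))" by (rule sum.cong) auto
    also have "\<dots> = real d * b + (a - b)" using q by (simp add: sum.distrib)
    also have "real d = real q + 1" using q(4) by simp
    finally show ?thesis by (simp add: algebra_simps)
  qed
  have row: "(\<Sum>k<d. (spike_state d p (i * d + k) - spike_state d p' (i * d + k))\<^sup>2)
    = (if i = q then (sqrt (1 - p) - sqrt (1 - p'))\<^sup>2 else (sqrt (p / real q) - sqrt (p' / real q))\<^sup>2)" if "i < d" for i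
  proof -
    have "(\<Sum>k<d. (spike_state d p (i * d + k) - spike_state d p' (i * d + k))\<^sup>2) = (\<Sum>k<d. if k = (if i = q then 0 else i + 1) then
        (if i = q then (sqrt (1 - p) - sqrt (1 - p'))\<^sup>2 else (sqrt (p / real q) - sqrt (p' / real q))\<^sup>2) else 0)"
      using that by (intro sum.cong refl) (simp add: entry)
    then show ?thesis using that q(2,3,5) by (simp add: sum.delta)
  qed
  have "(\<Sum>x<d * d. (spike_state d p x - spike_state d p' x)\<^sup>2)
     = (\<Sum>i<d. if i = q then (sqrt (1 - p) - sqrt (1 - p'))\<^sup>2 else (sqrt (p / real q) - sqrt (p' / real q))\<^sup>2)"
    unfolding sum_prod_index by (intro sum.cong refl) (simp add: row)
  also have "\<dots> = (sqrt (1 - p) - sqrt (1 - p'))\<^sup>2 + real q * (sqrt (p / real q) - sqrt (p' / real q))\<^sup>2"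
    by (rule sum_rows)
  also have "real q * (sqrt (p / real q) - sqrt (p' / real q))\<^sup>2 = (sqrt p - sqrt p')\<^sup>2"
    using q(2) by (simp only: real_sqrt_divide diff_divide_distrib[symmetric] power_divide) simp
  finally show ?thesis .
qed

lemma spike_bound:
  assumes est: "renyi_estimable \<alpha> d \<epsilon> T" and d: "2 \<le> d" and p: "0 \<le> p" "p \<le> 1" and p': "0 \<le> p'" "p' \<le> 1"
    and far: "2 * \<epsilon> * \<bar>1 - \<alpha>\<bar> < \<bar>ln (spike_trace \<alpha> (d - 1) p) - ln (spike_trace \<alpha> (d - 1) p')\<bar>" and \<alpha>: "\<alpha> \<noteq> 1"
    and close: "(sqrt (1 - p) - sqrt (1 - p'))\<^sup>2 + (sqrt p - sqrt p')\<^sup>2 \<le> 2 * \<delta>\<^sup>2" "0 \<le> \<delta>"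
  shows "1 \<le> 24 * real T * \<delta>"
proof (rule two_point_bound[OF est _ _ spike_query_state[OF d p] spike_query_state[OF d p']])
  have "2 * \<epsilon> < \<bar>ln (spike_trace \<alpha> (d - 1) p) - ln (spike_trace \<alpha> (d - 1) p')\<bar> / \<bar>1 - \<alpha>\<bar>"
    using far \<alpha> by (subst pos_less_divide_eq) auto
  then show "2 * \<epsilon> < \<bar>state_entropy \<alpha> d d (spike_state d p) - state_entropy \<alpha> d d (spike_state d p')\<bar>"
    unfolding spike_entropy[OF d p] spike_entropy[OF d p'] by (simp only: abs_divide diff_divide_distrib[symmetric])
  show "(\<Sum>x<d * d. (spike_state d p x - spike_state d p' x)\<^sup>2) \<le> 2 * \<delta>\<^sup>2"
    unfolding spike_distance[OF d p p'] by (rule close(1))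
qed (use d close(2) in simp_all)

text \<open>Returns from d - 1, the number of bulk eigenvalues, to d at the cost of a constant
  factor.\<close>

lemma half_powr_le:
  assumes "2 \<le> d" "0 \<le> \<beta>"
  shows "(1 / 2) powr \<beta> * real d powr \<beta> \<le> real (d - 1) powr \<beta>"
proof -
  have "(1 / 2) powr \<beta> * real d powr \<beta> = (real d / 2) powr \<beta>" by (simp add: powr_divide)
  also have "\<dots> \<le> real (d - 1) powr \<beta>" using assms by (intro powr_mono2) (auto simp: of_nat_diff)
  finally show ?thesis .
qed

lemma ln_one_plus_ge_half: "0 \<le> z \<Longrightarrow> z \<le> 1 / 2 \<Longrightarrow> z / 2 \<le> ln (1 + z)" for z :: real
proof -
  assume z: "0 \<le> z" "z \<le> 1 / 2"
  have "z * z \<le> z * (1 / 2)" using z by (intro mult_left_mono)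
  then have "z / 2 \<le> z - z\<^sup>2" by (simp add: power2_eq_square)
  also have "\<dots> \<le> ln (1 + z)" using z by (intro ln_one_plus_pos_lower_bound) auto
  finally show ?thesis .
qed

lemma sqrt_diff_sq_le:
  fixes a b :: real
  assumes "0 < a" "0 \<le> b"
  shows "(sqrt a - sqrt b)\<^sup>2 \<le> (a - b)\<^sup>2 / a"
proof -
  have "(a - b)\<^sup>2 = (sqrt a - sqrt b)\<^sup>2 * (sqrt a + sqrt b)\<^sup>2"
    using assms by (simp add: power_mult_distrib[symmetric] square_diff_square_factored[symmetric] power2_eq_square algebra_simps)
  moreover have "a \<le> (sqrt a + sqrt b)\<^sup>2"
    using assms power_mono[of "sqrt a" "sqrt a + sqrt b" 2] by simp
  ultimately have "(sqrt a - sqrt b)\<^sup>2 * a \<le> (a - b)\<^sup>2"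
    by (simp add: mult_left_mono)
  then show ?thesis using assms by (simp add: pos_le_divide_eq)
qed

text \<open>A pure state is compared with a state whose bulk has total weight p. For \<alpha> < 1
  the bulk contributes q^(1-\<alpha>) p^\<alpha> to the trace, so a very small p produces a change
  of order \<epsilon>, while the two states are only about sqrt p apart.\<close>

lemma lower_bound_near_pure:
  assumes \<alpha>: "0 < \<alpha>" "\<alpha> < 1"
  shows "\<exists>c>0. \<exists>\<epsilon>0>0. \<forall>d \<epsilon> T. 2 \<le> d \<and> 0 < \<epsilon> \<and> \<epsilon> < \<epsilon>0 \<and> renyi_estimable \<alpha> d \<epsilon> T \<longrightarrow>
    c * (real d powr (1 / (2 * \<alpha>) - 1 / 2) / \<epsilon> powr (1 / (2 * \<alpha>))) \<le> real T"
proof -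
  define \<beta> where "\<beta> = 1 / (2 * \<alpha>) - 1 / 2"
  have \<beta>: "0 \<le> \<beta>" "(1 - \<alpha>) / \<alpha> / 2 = \<beta>" using \<alpha> by (simp_all add: \<beta>_def field_simps)
  \<comment> \<open>Small enough to force p \<le> y / 2 below, so that the loss 1 - (1 -
    p)^\<alpha>, which is at most p, consumes no more than half of the gain y.\<close>
  define \<epsilon>0 :: real where "\<epsilon>0 = (1 / 16) * (1 / 2) powr (\<alpha> / (1 - \<alpha>))"
  define c where "c = (1 / 2) powr \<beta> / (24 * 16 powr (1 / (2 * \<alpha>)))"
  have bound: "c * (real d powr \<beta> / \<epsilon> powr (1 / (2 * \<alpha>))) \<le> real T"
    if h: "2 \<le> d" "0 < \<epsilon>" "\<epsilon> < \<epsilon>0" "renyi_estimable \<alpha> d \<epsilon> T" for d \<epsilon> T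
  proof -
    define q where "q = d - 1"
    have q: "1 \<le> real q" using h(1) by (simp add: q_def)
    \<comment> \<open>One factor 2 is lost to the shrinking large eigenvalue and one to the
      logarithm. The remaining 4 \<epsilon> exceeds the required separation 2 \<epsilon> (1 -
      \<alpha>).\<close>
    define y where "y = 16 * \<epsilon>"
    have y0: "0 < y" using h by (simp add: y_def)
    have "y < (1 / 2) powr (\<alpha> / (1 - \<alpha>))" using h(3) by (simp add: y_def \<epsilon>0_def)
    then have "y powr ((1 - \<alpha>) / \<alpha>) \<le> ((1 / 2) powr (\<alpha> / (1 - \<alpha>))) powr ((1 - \<alpha>) / \<alpha>)"
      using y0 \<alpha> by (intro powr_mono2) auto
    also have "\<dots> = 1 / 2" using \<alpha> by (simp add: powr_powr)
    finally have y1: "y powr ((1 - \<alpha>) / \<alpha>) \<le> 1 / 2" .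
    have y2: "y \<le> 1"
    proof (rule ccontr)
      assume "\<not> y \<le> 1"
      then have "1 \<le> y powr ((1 - \<alpha>) / \<alpha>)" using \<alpha> by (intro ge_one_powr_ge_zero) auto
      then show False using y1 by simp
    qed
    define p where "p = y powr (1 / \<alpha>) * real q powr (- ((1 - \<alpha>) / \<alpha>))"
    have p0: "0 < p" using y0 q by (simp add: p_def)
    have "p \<le> y powr (1 / \<alpha>) * 1"
      unfolding p_def using q \<alpha> powr_mono[of "- ((1 - \<alpha>) / \<alpha>)" 0 "real q"] by (intro mult_left_mono) auto
    also have "\<dots> = y powr (1 + (1 - \<alpha>) / \<alpha>)" using \<alpha> by (simp add: field_simps)
    also have "\<dots> = y * y powr ((1 - \<alpha>) / \<alpha>)" using y0 by (simp add: powr_add)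
    also have "\<dots> \<le> y * (1 / 2)" using y0 y1 by (intro mult_left_mono) auto
    finally have py: "p \<le> y / 2" by simp
    have p1: "p \<le> 1" using py y2 by simp
    have mass: "real q powr (1 - \<alpha>) * p powr \<alpha> = y"
    proof -
      have "p powr \<alpha> = y * real q powr (- (1 - \<alpha>))"
        using y0 q \<alpha> by (simp add: p_def powr_mult powr_powr)
      then show ?thesis using q by (simp add: powr_add[symmetric] mult.left_commute)
    qed
    have t0: "spike_trace \<alpha> q 0 = 1" by (simp add: spike_trace_def)
    have "(1 - p) powr 1 \<le> (1 - p) powr \<alpha>"
      using p0 p1 \<alpha> by (intro powr_mono') auto
    then have tp: "1 + y / 2 \<le> spike_trace \<alpha> q p"
      using p1 py by (simp add: spike_trace_def mass)
    have "y / 2 / 2 \<le> ln (1 + y / 2)" using y0 y2 by (intro ln_one_plus_ge_half) auto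
    also have "\<dots> \<le> ln (spike_trace \<alpha> q p)" using tp y0 by simp
    finally have far: "4 * \<epsilon> \<le> ln (spike_trace \<alpha> q p)" by (simp add: y_def)
    have "2 * \<epsilon> * (1 - \<alpha>) \<le> 2 * \<epsilon> * 1" using h(2) \<alpha> by (intro mult_left_mono) auto
    then have far': "2 * \<epsilon> * \<bar>1 - \<alpha>\<bar> < \<bar>ln (spike_trace \<alpha> (d - 1) p) - ln (spike_trace \<alpha> (d - 1) 0)\<bar>"
    proof -
      have "2 * \<epsilon> * \<bar>1 - \<alpha>\<bar> < ln (spike_trace \<alpha> q p)"
        using far h(2) \<alpha> \<open>2 * \<epsilon> * (1 - \<alpha>) \<le> 2 * \<epsilon> * 1\<close> by linarith
      then show ?thesis unfolding q_def[symmetric] t0 by simp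
    qed
    have close: "(sqrt (1 - p) - sqrt (1 - 0))\<^sup>2 + (sqrt p - sqrt 0)\<^sup>2 \<le> 2 * (sqrt p)\<^sup>2"
    proof -
      define s where "s = sqrt (1 - p)"
      have s: "0 \<le> s" "s \<le> 1" "s\<^sup>2 = 1 - p" using p0 p1 by (auto simp: s_def)
      have "(s - 1)\<^sup>2 = (1 - s) * (1 - s)" by (simp add: power2_eq_square algebra_simps)
      also have "\<dots> \<le> (1 - s) * (1 + s)" using s by (intro mult_left_mono) auto
      also have "\<dots> = p" using s(3) by (simp add: power2_eq_square algebra_simps)
      finally show ?thesis using p0 by (simp add: s_def[symmetric])
    qed
    have "1 \<le> 24 * real T * sqrt p"
      by (rule spike_bound[OF h(4,1) _ _ _ _ far' _ close]) (use p0 p1 \<alpha> in auto)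
    then have T: "1 / (24 * sqrt p) \<le> real T" using p0 by (simp add: field_simps)
    have "sqrt p = y powr (1 / (2 * \<alpha>)) * real q powr (- \<beta>)"
    proof -
      have "sqrt p = p powr (1 / 2)" using p0 by (simp add: powr_half_sqrt)
      also have "\<dots> = y powr (1 / \<alpha> * (1 / 2)) * real q powr (- ((1 - \<alpha>) / \<alpha>) * (1 / 2))"
        unfolding p_def using y0 q by (subst powr_mult) (simp_all only: powr_powr powr_ge_zero)
      also have "1 / \<alpha> * (1 / 2) = 1 / (2 * \<alpha>)" by simp
      also have "- ((1 - \<alpha>) / \<alpha>) * (1 / 2) = - \<beta>" using \<beta>(2) by simp
      finally show ?thesis .
    qed
    also have "y powr (1 / (2 * \<alpha>)) = 16 powr (1 / (2 * \<alpha>)) * \<epsilon> powr (1 / (2 * \<alpha>))"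
      using h(2) by (simp add: y_def powr_mult)
    finally have sp: "sqrt p = 16 powr (1 / (2 * \<alpha>)) * \<epsilon> powr (1 / (2 * \<alpha>)) * real q powr (- \<beta>)" .
    have "1 / (24 * sqrt p) = real q powr \<beta> / (24 * 16 powr (1 / (2 * \<alpha>)) * \<epsilon> powr (1 / (2 * \<alpha>)))"
      unfolding sp powr_minus_divide by simp
    moreover have "c * (real d powr \<beta> / \<epsilon> powr (1 / (2 * \<alpha>)))
        = ((1 / 2) powr \<beta> * real d powr \<beta>) / (24 * 16 powr (1 / (2 * \<alpha>)) * \<epsilon> powr (1 / (2 * \<alpha>)))"
      by (simp add: c_def)
    moreover have "\<dots> \<le> real q powr \<beta> / (24 * 16 powr (1 / (2 * \<alpha>)) * \<epsilon> powr (1 / (2 * \<alpha>)))"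
      using half_powr_le[OF h(1) \<beta>(1)] by (intro divide_right_mono) (auto simp: q_def)
    ultimately show ?thesis using T by linarith
  qed
  have "0 < c" "0 < \<epsilon>0" by (simp_all add: c_def \<epsilon>0_def)
  then show ?thesis using bound unfolding \<beta>_def by blast
qed

lemma powr_tangent:
  fixes x y \<alpha> :: real
  assumes "0 < y" "y \<le> x" "1 < \<alpha>"
  shows "\<alpha> * y powr (\<alpha> - 1) * (x - y) \<le> x powr \<alpha> - y powr \<alpha>"
    and "x powr \<alpha> - y powr \<alpha> \<le> \<alpha> * x powr (\<alpha> - 1) * (x - y)"
proof -
  have "\<exists>z. y \<le> z \<and> z \<le> x \<and> x powr \<alpha> - y powr \<alpha> = (x - y) * (\<alpha> * z powr (\<alpha> - 1))"
  proof (cases "x = y")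
    case False
    then have "y < x" using assms by simp
    have "\<exists>z. y < z \<and> z < x \<and> x powr \<alpha> - y powr \<alpha> = (x - y) * (\<alpha> * z powr (\<alpha> - 1))"
      by (rule MVT2[OF \<open>y < x\<close>]) (use assms in \<open>auto intro!: has_real_derivative_powr\<close>)
    then show ?thesis by (meson less_imp_le)
  qed (use assms in auto)
  then obtain z where z: "y \<le> z" "z \<le> x" "x powr \<alpha> - y powr \<alpha> = (x - y) * (\<alpha> * z powr (\<alpha> - 1))" by blast
  have "y powr (\<alpha> - 1) \<le> z powr (\<alpha> - 1)" "z powr (\<alpha> - 1) \<le> x powr (\<alpha> - 1)"
    using z assms by (auto intro!: powr_mono2)
  then have "(x - y) * (\<alpha> * y powr (\<alpha> - 1)) \<le> (x - y) * (\<alpha> * z powr (\<alpha> - 1))"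
    "(x - y) * (\<alpha> * z powr (\<alpha> - 1)) \<le> (x - y) * (\<alpha> * x powr (\<alpha> - 1))"
    using assms by (auto intro!: mult_left_mono)
  then show "\<alpha> * y powr (\<alpha> - 1) * (x - y) \<le> x powr \<alpha> - y powr \<alpha>"
    "x powr \<alpha> - y powr \<alpha> \<le> \<alpha> * x powr (\<alpha> - 1) * (x - y)"
    unfolding z(3) by (simp_all add: mult_ac)
qed

text \<open>The spike l is placed where l^\<alpha> is comparable with the bulk contribution of order
  q^(1-\<alpha>), that is at order q^(-e) with e = 1 - 1/\<alpha>. Shrinking it by a relative amount
  x of order \<epsilon> moves the logarithm of the trace by order x, but moves the state only by
  about sqrt l times x.\<close>

lemma lower_bound_spike_precision:
  assumes \<alpha>: "1 < \<alpha>"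
  shows "\<exists>c>0. \<exists>\<epsilon>0>0. \<forall>d \<epsilon> T. 2 \<le> d \<and> 0 < \<epsilon> \<and> \<epsilon> < \<epsilon>0 \<and> renyi_estimable \<alpha> d \<epsilon> T \<longrightarrow>
    c * (real d powr (1 / 2 - 1 / (2 * \<alpha>)) / \<epsilon>) \<le> real T"
proof -
  define \<beta> where "\<beta> = 1 / 2 - 1 / (2 * \<alpha>)"
  have \<beta>: "0 \<le> \<beta>" using \<alpha> by (simp add: \<beta>_def field_simps)
  \<comment> \<open>The number 7/9 bounds the ratio of a bulk eigenvalue to the spike, as shown in
    \<open>ratio\<close>; the extreme case is q = 1 with spike 9/16. Weight lost by the spike goes
    to the bulk, and \<open>\<kappa>0\<close> is the fraction of the change of the trace that is
    left.\<close>
  define \<kappa>0 :: real where "\<kappa>0 = 1 - (7 / 9) powr (\<alpha> - 1)"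
  have "(7 / 9) powr (\<alpha> - 1) < (1::real) powr (\<alpha> - 1)" using \<alpha> by (intro powr_less_mono2) auto
  then have \<kappa>0: "0 < \<kappa>0" by (simp add: \<kappa>0_def)
  define K where "K = \<alpha> * \<kappa>0 * (3 / 4) powr \<alpha> / (1 + (4 / 3) powr \<alpha>)"
  have K: "0 < K" using \<alpha> \<kappa>0 by (simp add: K_def add_pos_nonneg)
  \<comment> \<open>Makes K x equal to 4 (\<alpha> - 1) \<epsilon>, twice the required
    separation.\<close>
  define \<kappa> where "\<kappa> = 4 * (\<alpha> - 1) / K"
  have \<kappa>: "0 < \<kappa>" using \<alpha> K by (simp add: \<kappa>_def)
  define c where "c = (1 / 2) powr \<beta> / (48 * \<kappa>)"
  have bound: "c * (real d powr \<beta> / \<epsilon>) \<le> real T"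
    if h: "2 \<le> d" "0 < \<epsilon>" "\<epsilon> < 1 / (4 * \<kappa>)" "renyi_estimable \<alpha> d \<epsilon> T" for d \<epsilon> T
  proof -
    define q where "q = d - 1"
    have q: "1 \<le> real q" using h(1) by (simp add: q_def)
    define x where "x = \<kappa> * \<epsilon>"
    have x: "0 < x" "x \<le> 1 / 4" using h \<kappa> by (auto simp: x_def field_simps)
    define e where "e = 1 - 1 / \<alpha>"
    have e: "0 < e" "e * \<alpha> = \<alpha> - 1" "e / 2 = \<beta>" using \<alpha> by (auto simp: e_def \<beta>_def field_simps)
    \<comment> \<open>The cap 3/4 keeps 1 - l bounded away from 0 for small q. In both cases l stays
      between 3/4 and 2 times q^(-e).\<close>
    define l where "l = min (3 / 4) (2 * real q powr (- e))"
    have qe: "0 < real q powr (- e)" "real q powr (- e) \<le> 1"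
      using q e powr_mono[of "- e" 0 "real q"] by auto
    have l: "0 < l" "l \<le> 3 / 4" "l \<le> 2 * real q powr (- e)" "(3 / 4) * real q powr (- e) \<le> l"
      using qe by (auto simp: l_def)
    define l' where "l' = l * (1 - x)"
    have l': "0 < l'" "l' \<le> l" "(3 / 4) * l \<le> l'"
      using l x by (auto simp: l'_def mult_le_cancel_left1 mult.commute)
    have ratio: "(1 - l') / real q \<le> (7 / 9) * l'"
    proof -
      have "(1 - l') \<le> (7 / 9) * (l' * real q)"
      proof (cases "l = 3 / 4")
        case True
        have "l' * 1 \<le> l' * real q" using l'(1) q by (intro mult_left_mono) auto
        moreover have "9 / 16 \<le> l'" using l'(3) True by simp
        ultimately show ?thesis by linarith
      next
        case False
        then have leq: "l = 2 * real q powr (- e)" by (simp add: l_def min_def split: if_splits)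
        have "1 \<le> real q powr (1 - e)" using q \<alpha> by (intro ge_one_powr_ge_zero) (auto simp: e_def)
        also have "\<dots> = real q powr (- e) * real q" using q powr_add[of "real q" "- e" 1] by simp
        finally have "2 \<le> l * real q" by (simp add: leq)
        moreover have "(3 / 4) * l * real q \<le> l' * real q" using l'(3) by (intro mult_right_mono) auto
        ultimately show ?thesis using l'(1) by simp
      qed
      then show ?thesis using q by (simp add: field_simps)
    qed
    \<comment> \<open>\<open>spike_trace\<close> takes the weight of the bulk as its argument; F
      takes that of the spike.\<close>
    define F where "F = (\<lambda>p. spike_trace \<alpha> q (1 - p))"
    have F: "F p = p powr \<alpha> + real q powr (1 - \<alpha>) * (1 - p) powr \<alpha>" for p by (simp add: F_def spike_trace_def)
    have l1: "l' < 1" "l < 1" using l l' by auto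
    \<comment> \<open>Tangent bounds: the spike loses at least \<alpha> (l - l') times the power
      \<alpha> - 1 of l', and the bulk gains at most the same expression with its eigenvalue (1 -
      l') / q in place of l'.\<close>
    have gap: "\<alpha> * \<kappa>0 * x * l' powr \<alpha> \<le> F l - F l'"
    proof -
      have 1: "\<alpha> * l' powr (\<alpha> - 1) * (l - l') \<le> l powr \<alpha> - l' powr \<alpha>"
        by (rule powr_tangent(1)) (use l' \<alpha> in auto)
      have 2: "(1 - l') powr \<alpha> - (1 - l) powr \<alpha> \<le> \<alpha> * (1 - l') powr (\<alpha> - 1) * (l - l')"
        using powr_tangent(2)[of "1 - l" "1 - l'" \<alpha>] l1 l' \<alpha> by simp
      have "real q powr (1 - \<alpha>) * ((1 - l') powr \<alpha> - (1 - l) powr \<alpha>)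
         \<le> real q powr (1 - \<alpha>) * (\<alpha> * (1 - l') powr (\<alpha> - 1) * (l - l'))"
        using 2 by (intro mult_left_mono) auto
      also have "\<dots> = \<alpha> * (l - l') * ((1 - l') / real q) powr (\<alpha> - 1)"
      proof -
        have "real q powr (1 - \<alpha>) = 1 / real q powr (\<alpha> - 1)"
          using powr_minus_divide[of "real q" "\<alpha> - 1"] by simp
        then show ?thesis using q l1 by (simp add: powr_divide)
      qed
      also have "\<dots> \<le> \<alpha> * (l - l') * ((7 / 9) * l') powr (\<alpha> - 1)"
        using ratio l1 l' q \<alpha> by (intro mult_left_mono powr_mono2) auto
      also have "\<dots> = \<alpha> * (l - l') * l' powr (\<alpha> - 1) * (7 / 9) powr (\<alpha> - 1)"
        using powr_mult[of "7 / 9" l' "\<alpha> - 1"] l' by (simp only: mult_ac)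
      finally have "\<alpha> * (l - l') * l' powr (\<alpha> - 1) * \<kappa>0 \<le> F l - F l'"
        using 1 by (simp add: F \<kappa>0_def algebra_simps)
      moreover have "\<alpha> * \<kappa>0 * x * l' powr \<alpha> \<le> \<alpha> * (l - l') * l' powr (\<alpha> - 1) * \<kappa>0"
      proof -
        have "x * l' powr \<alpha> = x * (l' * l' powr (\<alpha> - 1))" using powr_mult_base[of l' "\<alpha> - 1"] l'(1) by simp
        also have "\<dots> \<le> x * (l * l' powr (\<alpha> - 1))" using l' x by (intro mult_left_mono mult_right_mono) auto
        also have "\<dots> = (l - l') * l' powr (\<alpha> - 1)" by (simp add: l'_def algebra_simps)
        finally have "(\<alpha> * \<kappa>0) * (x * l' powr \<alpha>) \<le> (\<alpha> * \<kappa>0) * ((l - l') * l' powr (\<alpha> - 1))"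
          using \<alpha> \<kappa>0 by (intro mult_left_mono) auto
        then show ?thesis by (simp add: mult_ac)
      qed
      ultimately show ?thesis by linarith
    qed
    have F'0: "0 < F l'"
      unfolding F using l' q by (intro add_pos_nonneg) auto
    have F0: "0 < F l"
      unfolding F using l q by (intro add_pos_nonneg) auto
    have Fle: "F l \<le> l powr \<alpha> * (1 + (4 / 3) powr \<alpha>)"
    proof -
      have "real q powr (1 - \<alpha>) * (1 - l) powr \<alpha> \<le> real q powr (1 - \<alpha>) * 1 powr \<alpha>"
        using l1 l \<alpha> by (intro mult_left_mono powr_mono2) auto
      also have "\<dots> = (real q powr (- e)) powr \<alpha>" using e(2) by (simp add: powr_powr)
      also have "\<dots> \<le> ((4 / 3) * l) powr \<alpha>" using l qe \<alpha> by (intro powr_mono2) auto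
      also have "\<dots> = (4 / 3) powr \<alpha> * l powr \<alpha>" by (rule powr_mult)
      finally show ?thesis by (simp add: F algebra_simps)
    qed
    have "K * x \<le> (F l - F l') / F l"
    proof -
      have "K * x * F l \<le> K * x * (l powr \<alpha> * (1 + (4 / 3) powr \<alpha>))"
        using K x Fle by (intro mult_left_mono) auto
      also have "\<dots> = \<alpha> * \<kappa>0 * x * ((3 / 4) * l) powr \<alpha>"
      proof -
        have "0 < 1 + (4 / 3 :: real) powr \<alpha>" by (intro add_pos_nonneg) auto
        moreover have "((3 / 4) * l) powr \<alpha> = (3 / 4) powr \<alpha> * l powr \<alpha>" by (rule powr_mult)
        ultimately show ?thesis by (simp add: K_def)
      qed
      also have "\<dots> \<le> \<alpha> * \<kappa>0 * x * l' powr \<alpha>"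
        using l l' \<alpha> \<kappa>0 x by (intro mult_left_mono powr_mono2) auto
      also have "\<dots> \<le> F l - F l'" by (rule gap)
      finally show ?thesis using F0 by (simp add: pos_le_divide_eq)
    qed
    also have "\<dots> = 1 - F l' / F l" using F0 by (simp add: diff_divide_distrib)
    also have "\<dots> \<le> - ln (F l' / F l)"
      using ln_le_minus_one[of "F l' / F l"] F0 F'0 by simp
    also have "\<dots> = ln (F l) - ln (F l')" using F0 F'0 by (simp add: ln_div)
    finally have "4 * (\<alpha> - 1) * \<epsilon> \<le> ln (F l) - ln (F l')"
      using K by (simp add: x_def \<kappa>_def)
    moreover have "2 * \<epsilon> * (\<alpha> - 1) < 4 * (\<alpha> - 1) * \<epsilon>" using h(2) \<alpha> by simp
    ultimately have far: "2 * \<epsilon> * \<bar>1 - \<alpha>\<bar> < \<bar>ln (spike_trace \<alpha> (d - 1) (1 - l)) - ln (spike_trace \<alpha> (d - 1) (1 - l'))\<bar>"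
      using \<alpha> by (simp add: F_def q_def)
    define \<delta> where "\<delta> = sqrt (2 * l) * x"
    have close: "(sqrt (1 - (1 - l)) - sqrt (1 - (1 - l')))\<^sup>2 + (sqrt (1 - l) - sqrt (1 - l'))\<^sup>2 \<le> 2 * \<delta>\<^sup>2"
    proof -
      have "(sqrt l - sqrt l')\<^sup>2 \<le> (l - l')\<^sup>2 / l" using l l' by (intro sqrt_diff_sq_le) auto
      also have "\<dots> = l * x\<^sup>2" using l by (simp add: l'_def power2_eq_square field_simps)
      finally have 1: "(sqrt l - sqrt l')\<^sup>2 \<le> l * x\<^sup>2" .
      have "(sqrt (1 - l) - sqrt (1 - l'))\<^sup>2 \<le> ((1 - l) - (1 - l'))\<^sup>2 / (1 - l)"
        using l1 by (intro sqrt_diff_sq_le) auto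
      also have "\<dots> = (l * x)\<^sup>2 / (1 - l)" by (simp add: l'_def power2_eq_square algebra_simps)
      also have "\<dots> \<le> (l * x)\<^sup>2 / (1 / 4)" using l by (intro divide_left_mono) auto
      also have "\<dots> = 4 * l * (l * x\<^sup>2)" by (simp add: power2_eq_square)
      also have "\<dots> \<le> 3 * (l * x\<^sup>2)" using l by (intro mult_right_mono) auto
      finally have "(sqrt (1 - l) - sqrt (1 - l'))\<^sup>2 \<le> 3 * (l * x\<^sup>2)" .
      then show ?thesis using 1 l by (simp add: \<delta>_def power_mult_distrib)
    qed
    have "1 \<le> 24 * real T * \<delta>"
      by (rule spike_bound[OF h(4,1) _ _ _ _ far _ close]) (use l l' l1 \<alpha> x in \<open>auto simp: \<delta>_def\<close>)
    also have "\<dots> \<le> 24 * real T * (2 * real q powr (- \<beta>) * x)"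
    proof -
      have "sqrt (2 * l) \<le> sqrt (4 * real q powr (- e))" using l by (intro real_sqrt_le_mono) auto
      also have "\<dots> = 2 * real q powr (- \<beta>)"
        using e(3) by (simp add: real_sqrt_mult powr_half_sqrt[symmetric] powr_powr)
      finally show ?thesis unfolding \<delta>_def using x by (intro mult_left_mono mult_right_mono) auto
    qed
    finally have "1 \<le> 48 * \<kappa> * \<epsilon> * real T * real q powr (- \<beta>)" by (simp add: x_def mult_ac)
    then have "real q powr \<beta> \<le> 48 * \<kappa> * \<epsilon> * real T"
      using q by (simp add: powr_minus field_simps)
    then have "(1 / 2) powr \<beta> * real d powr \<beta> \<le> 48 * \<kappa> * \<epsilon> * real T"
      using half_powr_le[OF h(1) \<beta>] by (simp add: q_def)
    then show ?thesis using \<kappa> h(2) by (simp add: c_def field_simps)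
  qed
  have "0 < c" "0 < 1 / (4 * \<kappa>)" using \<kappa> by (simp_all add: c_def)
  then show ?thesis using bound unfolding \<beta>_def by blast
qed

section \<open>Hidden families of density matrices\<close>

lemma shift_sum:
  fixes G :: "nat \<Rightarrow> 'b::comm_monoid_add"
  assumes sh: "sh < q"
  shows "(\<Sum>b<q. G ((b + sh) mod q)) = (\<Sum>c<q. G c)"
proof (rule sum.reindex_bij_witness[where i="\<lambda>c. (c + (q - sh)) mod q" and j="\<lambda>b. (b + sh) mod q"])
  fix b assume b: "b \<in> {..<q}"
  have "((b + sh) mod q + (q - sh)) mod q = (b + sh + (q - sh)) mod q" by (rule mod_add_left_eq)
  also have "b + sh + (q - sh) = b + q" using sh by simp
  finally show "((b + sh) mod q + (q - sh)) mod q = b" using b by simp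
next
  fix c assume c: "c \<in> {..<q}"
  have "((c + (q - sh)) mod q + sh) mod q = (c + (q - sh) + sh) mod q" by (rule mod_add_left_eq)
  also have "c + (q - sh) + sh = c + q" using sh by simp
  finally show "((c + (q - sh)) mod q + sh) mod q = c" using c by simp
qed (use sh in auto)

lemma shift_inj:
  fixes b :: nat
  assumes "sh < q" "b < q" "b' < q"
  shows "(b + sh) mod q = (b' + sh) mod q \<longleftrightarrow> b = b'"
proof
  assume eq: "(b + sh) mod q = (b' + sh) mod q"
  have "x = ((x + sh) mod q + (q - sh)) mod q" if "x < q" for x
  proof -
    have "((x + sh) mod q + (q - sh)) mod q = (x + sh + (q - sh)) mod q" by (rule mod_add_left_eq)
    also have "x + sh + (q - sh) = x + q" using assms by simp
    finally show ?thesis using that by simp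
  qed
  then show "b = b'" using eq assms by metis
qed simp

definition signs :: "nat \<Rightarrow> (nat \<Rightarrow> real) set" where
  "signs q = PiE {..<q} (\<lambda>_. {- 1, 1})"

lemma finite_signs [simp]: "finite (signs q)"
  unfolding signs_def by (intro finite_PiE) auto

lemma card_signs: "card (signs q) = 2 ^ q"
  unfolding signs_def by (subst card_PiE) (auto simp: numeral_2_eq_2)

lemma signs_sq: "s \<in> signs q \<Longrightarrow> c < q \<Longrightarrow> s c * s c = 1"
  by (auto simp: signs_def PiE_def Pi_def)

lemma sum_signs_prod: "(\<Sum>s\<in>signs q. \<Prod>l<q. g l (s l)) = (\<Prod>l<q. g l (- 1) + g l 1)" for g :: "nat \<Rightarrow> real \<Rightarrow> real"
  unfolding signs_def using prod_sum_PiE[of "{..<q}" "\<lambda>_. {- 1, 1}" g] by simp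

lemma sum_signs:
  assumes "c < q"
  shows "(\<Sum>s\<in>signs q. s c) = 0"
proof -
  have "(\<Sum>s\<in>signs q. s c) = (\<Sum>s\<in>signs q. \<Prod>l<q. if l = c then s l else 1)"
    using assms by simp
  also have "\<dots> = (\<Prod>l<q. (if l = c then - 1 else 1) + (if l = c then 1 else 1))"
    by (rule sum_signs_prod)
  also have "\<dots> = 0" using assms by (intro prod_zero) auto
  finally show ?thesis .
qed

lemma sum_signs_pair:
  assumes c: "c < q" "c' < q"
  shows "(\<Sum>s\<in>signs q. s c * s c') = (if c = c' then 2 ^ q else 0)"
proof (cases "c = c'")
  case True
  then have "(\<Sum>s\<in>signs q. s c * s c') = (\<Sum>s\<in>signs q. 1)"
    using signs_sq c by (intro sum.cong) auto
  then show ?thesis using True by (simp add: card_signs)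
next
  case False
  have "(\<Sum>s\<in>signs q. s c * s c') = (\<Sum>s\<in>signs q. \<Prod>l<q. (if l = c then s l else 1) * (if l = c' then s l else 1))"
    using c by (simp add: prod.distrib)
  also have "\<dots> = (\<Prod>l<q. (if l = c then - 1 else 1) * (if l = c' then - 1 else 1) + (if l = c then 1 else 1) * (if l = c' then 1 else 1))"
    by (rule sum_signs_prod)
  also have "\<dots> = 0" using c False by (intro prod_zero) auto
  finally show ?thesis using False by simp
qed

text \<open>The product of M with its transpose, that is, the reduced state of the vector whose
  amplitude matrix is M.\<close>

definition marginal :: "nat \<Rightarrow> (nat \<Rightarrow> nat \<Rightarrow> real) \<Rightarrow> nat \<Rightarrow> nat \<Rightarrow> real" where
  "marginal q M i j = (\<Sum>c<q. M i c * M j c)"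

text \<open>A random unitary one-design on the columns: a cyclic shift followed by random signs.\<close>
definition scrambled :: "nat \<Rightarrow> (nat \<Rightarrow> nat \<Rightarrow> real) \<Rightarrow> nat \<times> (nat \<Rightarrow> real) \<Rightarrow> nat \<times> nat \<Rightarrow> real" where
  "scrambled q M = (\<lambda>(sh, s) (i, b). M i ((b + sh) mod q) * s ((b + sh) mod q))"

text \<open>Shift and signs act on the purifying side only. Thus every single choice, and not just
  the average, has the same reduced state and the same entropy.\<close>

lemma scrambled_marginal:
  assumes "sh < q" "s \<in> signs q"
  shows "(\<Sum>b<q. scrambled q M (sh, s) (i, b) * scrambled q M (sh, s) (j, b)) = marginal q M i j"
proof -
  have "(\<Sum>b<q. scrambled q M (sh, s) (i, b) * scrambled q M (sh, s) (j, b))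
     = (\<Sum>b<q. (\<lambda>c. (M i c * M j c) * (s c * s c)) ((b + sh) mod q))"
    by (simp add: scrambled_def mult_ac)
  also have "\<dots> = (\<Sum>c<q. (M i c * M j c) * (s c * s c))" by (rule shift_sum[OF assms(1)])
  also have "\<dots> = marginal q M i j"
    unfolding marginal_def by (rule sum.cong) (simp_all add: signs_sq[OF assms(2)])
  finally show ?thesis .
qed

lemma scrambled_mean:
  assumes "b < q"
  shows "(\<Sum>w\<in>{..<q} \<times> signs q. scrambled q M w (i, b)) = 0"
proof -
  have "(\<Sum>w\<in>{..<q} \<times> signs q. scrambled q M w (i, b)) = (\<Sum>sh<q. \<Sum>s\<in>signs q. M i ((b + sh) mod q) * s ((b + sh) mod q))"
    by (simp add: scrambled_def sum.cartesian_product case_prod_unfold)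
  also have "\<dots> = 0"
    unfolding sum_distrib_left[symmetric] using assms by (intro sum.neutral) (auto simp: sum_signs)
  finally show ?thesis .
qed

text \<open>The signs remove products of different columns and the shift averages the remaining ones
  over all columns. The covariance is \<open>marginal\<close> tensored with the maximally mixed
  state of the q columns.\<close>

lemma scrambled_cov:
  assumes b: "b < q" "b' < q"
  shows "(\<Sum>w\<in>{..<q} \<times> signs q. scrambled q M w (i, b) * scrambled q M w (j, b'))
    = real (card ({..<q} \<times> signs q)) * (if b = b' then marginal q M i j / real q else 0)"
proof -
  let ?c = "\<lambda>b sh. (b + sh) mod q"
  have "(\<Sum>w\<in>{..<q} \<times> signs q. scrambled q M w (i, b) * scrambled q M w (j, b'))
    = (\<Sum>sh<q. \<Sum>s\<in>signs q. (M i (?c b sh) * M j (?c b' sh)) * (s (?c b sh) * s (?c b' sh)))"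
    by (simp add: scrambled_def sum.cartesian_product case_prod_unfold mult_ac)
  also have "\<dots> = (\<Sum>sh<q. (M i (?c b sh) * M j (?c b' sh)) * (if b = b' then 2 ^ q else 0))"
    unfolding sum_distrib_left[symmetric] using b
    by (intro sum.cong refl) (simp add: sum_signs_pair shift_inj)
  also have "\<dots> = (if b = b' then (\<Sum>sh<q. (\<lambda>c. M i c * M j c) ((sh + b) mod q)) * 2 ^ q else 0)"
    by (simp add: sum_distrib_right add.commute)
  also have "(\<Sum>sh<q. (\<lambda>c. M i c * M j c) ((sh + b) mod q)) = marginal q M i j"
    unfolding marginal_def by (rule shift_sum[OF b(1)])
  finally show ?thesis using b by (simp add: card_cartesian_product card_signs)
qed

text \<open>The last level absorbs the weight 1 - p, so that the hidden part can be made rare; for p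
  = 1 that level is empty.\<close>

definition embedded_state :: "nat \<Rightarrow> nat \<Rightarrow> real \<Rightarrow> (nat \<Rightarrow> nat \<Rightarrow> real) \<Rightarrow> complex mat" where
  "embedded_state d q p \<sigma> = real_mat d (\<lambda>i j. if i < q \<and> j < q then p * \<sigma> i j else if i = j \<and> i = d - 1 then 1 - p else 0)"

text \<open>An estimator would separate the reference from the family by 1/3 in mean acceptance
  probability, whereas \<open>avg_accept_diff\<close>, applied to the scrambled purifications,
  allows at most 1/4.\<close>

lemma hidden_family_bound:
  fixes Mt :: "'th \<Rightarrow> nat \<Rightarrow> nat \<Rightarrow> real"
  assumes est: "renyi_estimable \<alpha> d \<epsilon> T" and d: "2 \<le> d" and q: "1 \<le> q" "q \<le> d - 1" and p: "0 < p" "p \<le> 1"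
    and fin: "finite \<Theta>'" "\<Theta>' \<noteq> {}"
    and tr: "\<And>\<theta>. \<theta> \<in> insert \<theta>0 \<Theta>' \<Longrightarrow> (\<Sum>i<q. marginal q (Mt \<theta>) i i) = 1"
    and ref: "\<And>i j. i < q \<Longrightarrow> j < q \<Longrightarrow> marginal q (Mt \<theta>0) i j = (if i = j then 1 / real q else 0)"
    and far: "\<And>\<theta>. \<theta> \<in> \<Theta>' \<Longrightarrow> 2 * \<epsilon> < \<bar>renyi_entropy \<alpha> d (embedded_state d q p (marginal q (Mt \<theta>)))
        - renyi_entropy \<alpha> d (embedded_state d q p (marginal q (Mt \<theta>0)))\<bar>"
    and overlap_nonneg: "\<And>\<theta> \<theta>'. \<theta> \<in> \<Theta>' \<Longrightarrow> \<theta>' \<in> \<Theta>' \<Longrightarrow> 0 \<le> (\<Sum>i<q. \<Sum>j<q. marginal q (Mt \<theta>) i j * marginal q (Mt \<theta>') i j)"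
    and moment: "(\<Sum>\<theta>\<in>\<Theta>'. \<Sum>\<theta>'\<in>\<Theta>'. (1 + p / 2 * (real q * (\<Sum>i<q. \<Sum>j<q. marginal q (Mt \<theta>) i j * marginal q (Mt \<theta>') i j) - 1)) ^ (9216 * T\<^sup>2))
        \<le> (1 + 1 / 144) * (real (card \<Theta>'))\<^sup>2"
  shows False
proof -
  \<comment> \<open>As 9216 = 96^2, the term 8 T / sqrt (n + 1) is at most 1/12. Likewise M exceeds
    (60 n)^2, which makes 5 n / sqrt M at most 1/12. With sqrt (1/144) the total is 1/4.\<close>
  define n where "n = 9216 * T\<^sup>2"
  define M where "M = 3600 * n\<^sup>2 + 1"
  \<comment> \<open>One purifier column for the known amplitudes, followed by M blocks of q
    columns.\<close>
  define m where "m = Suc (M * q)"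
  define X where "X = {..<d * m}"
  \<comment> \<open>Negative because psi enters \<open>query_vec\<close> with a minus sign; the
    total block weight is p / 2 because \<open>query_vec\<close> halves the squared norm of
    psi.\<close>
  define \<gamma> where "\<gamma> = - sqrt (p / (2 * real M))"
  have M0: "0 < M" by (simp add: M_def)
  have m1: "1 \<le> m" by (simp add: m_def)
  have \<gamma>2: "\<gamma>\<^sup>2 * real M = p / 2" using p M0 by (simp add: \<gamma>_def)
  define S where "S = (\<lambda>\<theta>. renyi_entropy \<alpha> d (embedded_state d q p (marginal q (Mt \<theta>))))"
  obtain R R1 :: "(nat \<times> nat) set" and V \<phi>0 B where alg: "query_algorithm {..<d * m} R V \<phi>0 T" and B: "B \<subseteq> {..<d * m} \<times> R"
    and yes: "\<And>\<psi>. query_state (d * m) \<psi> \<Longrightarrow> state_entropy \<alpha> d m \<psi> = S \<theta>0 \<Longrightarrow>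
      2 / 3 \<le> (nrm B (query_algorithm.run {..<d * m} R R1 V \<phi>0 (query_vec \<psi>) T))\<^sup>2"
    and no: "\<And>\<psi>. query_state (d * m) \<psi> \<Longrightarrow> 2 * \<epsilon> < \<bar>state_entropy \<alpha> d m \<psi> - S \<theta>0\<bar> \<Longrightarrow>
      (nrm B (query_algorithm.run {..<d * m} R R1 V \<phi>0 (query_vec \<psi>) T))\<^sup>2 \<le> 1 / 3"
    by (rule estimable_distinguishes[OF est _ m1, of "S \<theta>0"]) (use d in simp, rule that)
  \<comment> \<open>Hidden points lie in rows below q and columns from 1 on. The known part is the
    rest, in particular index 0 and the point of the last level in column 0.\<close>
  define X0 where "X0 = {x \<in> X. \<not> (x div m < q \<and> 0 < x mod m)}"
  define hid where "hid = (\<lambda>k (i, b). i * m + Suc (k * q + b))"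
  define lab where "lab = (\<lambda>x. (x mod m - 1) div q)"
  define cmp where "cmp = (\<lambda>x. (x div m, (x mod m - 1) mod q))"
  define A where "A = {..<q} \<times> {..<q}"
  \<comment> \<open>The values of \<open>query_vec\<close> at the known points: the contribution of
    e_0, and minus the amplitude sqrt (1 - p) of the last level over sqrt 2.\<close>
  define t where "t = (\<lambda>x. if x = 0 then 1 / sqrt 2 else if x = (d - 1) * m then - sqrt (1 - p) / sqrt 2 else (0::real))"
  define \<Omega> where "\<Omega> = {..<q} \<times> signs q"
  define h where "h = (\<lambda>\<theta>. scrambled q (Mt \<theta>))"
  define \<tau> where "\<tau> = (\<lambda>\<theta> (i, b :: nat) (j, b' :: nat). if b = b' then marginal q (Mt \<theta>) i j / real q else 0)"
  have pos_lt: "Suc (k * q + b) < m" if "k < M" "b < q" for k b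
  proof -
    have "(k + 1) * q \<le> M * q" using that by (intro mult_le_mono1) simp
    then show ?thesis using that by (simp add: m_def)
  qed
  have row_lt: "i * m + k < d * m" if "i < d" "k < m" for i k
  proof -
    have "(i + 1) * m \<le> d * m" using that by (intro mult_le_mono1) simp
    then show ?thesis using that by simp
  qed
  have decode: "(i * m + k) div m = i" "(i * m + k) mod m = k" if "k < m" for i k
    using that by simp_all
  have hid_props: "hid k (i, b) \<in> X - X0" "lab (hid k (i, b)) = k" "cmp (hid k (i, b)) = (i, b)"
    if "k < M" "i < q" "b < q" for k i b
    using that q row_lt[of i "Suc (k * q + b)"] pos_lt[of k b] decode[OF pos_lt[of k b], of i]
    by (simp_all add: hid_def X_def X0_def lab_def cmp_def)
  have \<Omega>mem: "fst w < q" "snd w \<in> signs q" if "w \<in> \<Omega>" for w using that by (auto simp: \<Omega>_def)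
  have last: "(d - 1) * m \<noteq> 0" "(d - 1) * m \<in> X0" "0 \<in> X0"
    using d m1 row_lt[of "d - 1" 0] row_lt[of 0 0] by (auto simp: X0_def X_def)
  interpret H: hidden_ensemble X R R1 V \<phi>0 T X0 hid lab cmp M A t \<gamma> \<Omega> "insert \<theta>0 \<Theta>'" h \<tau>
  proof (intro hidden_ensemble.intro hidden_ensemble_axioms.intro)
    show "query_algorithm X R V \<phi>0 T" unfolding X_def by (rule alg)
    show "X0 \<subseteq> X" by (auto simp: X0_def)
    have "0 \<in> {..<q}" using q by simp
    then show "finite A" "A \<noteq> {}" by (auto simp: A_def)
    show "finite \<Omega>" by (simp add: \<Omega>_def)
    have "signs q \<noteq> {}" using card_signs[of q] by (metis card.empty power_not_zero zero_neq_numeral)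
    with \<open>0 \<in> {..<q}\<close> show "\<Omega> \<noteq> {}" by (auto simp: \<Omega>_def)
    show "0 < M" by (rule M0)
    fix x assume x: "x \<in> X - X0"
    then have x': "x div m < q" "0 < x mod m" by (auto simp: X0_def)
    have "x mod m < m" using m1 by simp
    moreover have "m = M * q + 1" by (simp add: m_def)
    ultimately have "x mod m - 1 < M * q" using x'(2) by linarith
    then have 1: "lab x < M" by (simp add: lab_def less_mult_imp_div_less)
    have 2: "cmp x \<in> A" using x' q by (simp add: cmp_def A_def)
    have "lab x * q + (x mod m - 1) mod q = x mod m - 1" by (simp add: lab_def)
    moreover have "hid (lab x) (cmp x) = x div m * m + Suc (lab x * q + (x mod m - 1) mod q)"
      by (simp only: hid_def cmp_def prod.case)
    moreover have "Suc (x mod m - 1) = x mod m" using x'(2) by simp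
    ultimately have "hid (lab x) (cmp x) = x" by (simp only: div_mult_mod_eq)
    with 1 2 show "lab x < M \<and> cmp x \<in> A \<and> hid (lab x) (cmp x) = x" by simp
  next
    fix \<theta> w assume \<theta>: "\<theta> \<in> insert \<theta>0 \<Theta>'" and w: "w \<in> \<Omega>"
    obtain sh s where ws: "w = (sh, s)" "sh < q" "s \<in> signs q" using w by (auto simp: \<Omega>_def)
    have "(\<Sum>a\<in>A. (h \<theta> w a)\<^sup>2) = (\<Sum>i<q. \<Sum>b<q. scrambled q (Mt \<theta>) (sh, s) (i, b) * scrambled q (Mt \<theta>) (sh, s) (i, b))"
      by (simp add: A_def h_def ws(1) power2_eq_square sum.cartesian_product case_prod_unfold)
    also have "\<dots> = 1" unfolding scrambled_marginal[OF ws(2,3)] by (rule tr[OF \<theta>])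
    finally show "(\<Sum>a\<in>A. (h \<theta> w a)\<^sup>2) = 1" .
  next
    fix \<theta> a assume "a \<in> A"
    then show "(\<Sum>w\<in>\<Omega>. h \<theta> w a) = 0"
      using scrambled_mean by (auto simp: A_def h_def \<Omega>_def)
  next
    fix \<theta> a b assume ab: "a \<in> A" "b \<in> A"
    obtain i c j c' where "a = (i, c)" "b = (j, c')" "c < q" "c' < q" using ab by (auto simp: A_def)
    then show "(\<Sum>w\<in>\<Omega>. h \<theta> w a * h \<theta> w b) = real (card \<Omega>) * \<tau> \<theta> a b"
      unfolding h_def \<Omega>_def \<tau>_def by (simp only: scrambled_cov prod.case)
  next
    have "(\<Sum>x\<in>X0. (t x)\<^sup>2) = (\<Sum>x\<in>{0, (d - 1) * m}. (t x)\<^sup>2)"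
      by (rule sum.mono_neutral_right) (use last in \<open>auto simp: X0_def X_def t_def\<close>)
    also have "\<dots> = 1 / 2 + (1 - p) / 2"
      using last(1) p by (simp add: t_def power_divide)
    finally show "(\<Sum>x\<in>X0. (t x)\<^sup>2) + \<gamma>\<^sup>2 * real M = 1" unfolding \<gamma>2 by (simp add: field_simps)
  qed (use hid_props in \<open>auto simp: A_def\<close>)
  \<comment> \<open>Solves \<open>query_vec\<close> for psi, so that statements about
    \<open>H.vect\<close> become statements about states.\<close>
  define \<psi> where "\<psi> = (\<lambda>\<theta> \<omega> x. (if x = 0 then 1 else 0) - sqrt 2 * H.vect \<theta> \<omega> x)"
  have qv: "query_vec (\<psi> \<theta> \<omega>) = H.vect \<theta> \<omega>" for \<theta> \<omega>
    by (auto simp: query_vec_def \<psi>_def fun_eq_iff)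
  have vX0: "H.vect \<theta> \<omega> x = t x" if "x \<in> X0" for \<theta> \<omega> x
    using that by (simp add: H.vect_def)
  have v0: "H.vect \<theta> \<omega> 0 = 1 / sqrt 2" for \<theta> \<omega> 
    unfolding vX0[OF last(3)] by (simp add: t_def)
  have \<psi>0: "\<psi> \<theta> \<omega> 0 = 0" for \<theta> \<omega> by (simp add: \<psi>_def v0)
  have state: "query_state (d * m) (\<psi> \<theta> \<omega>)" if "\<theta> \<in> insert \<theta>0 \<Theta>'" "\<omega> \<in> H.choices" for \<theta> \<omega>
  proof -
    have "(\<Sum>x<d * m. (\<psi> \<theta> \<omega> x)\<^sup>2) = (\<Sum>x\<in>X. (if x = 0 then 1 - 2 * sqrt 2 * H.vect \<theta> \<omega> 0 else 0) + 2 * (H.vect \<theta> \<omega> x)\<^sup>2)"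
      unfolding X_def by (intro sum.cong refl) (auto simp: \<psi>_def power2_diff power_mult_distrib)
    also have "\<dots> = 1"
      using H.vect_unit[OF that] last(3) H.X0 H.finX by (simp add: sum.distrib v0 subset_iff flip: sum_distrib_left)
    finally show ?thesis by (simp add: query_state_def \<psi>0)
  qed
  have \<psi>last: "\<psi> \<theta> \<omega> (i * m) = (if i = d - 1 then sqrt (1 - p) else 0)" if "i < d" for \<theta> \<omega> i
  proof (cases "i = 0")
    case True
    then show ?thesis using \<psi>0 d by simp
  next
    case False
    then have "i * m \<noteq> 0" using m1 by simp
    moreover have iX0: "i * m \<in> X0" using row_lt[of i 0] that m1 by (simp add: X0_def X_def)
    moreover have "i * m = (d - 1) * m \<longleftrightarrow> i = d - 1" using m1 by simp
    ultimately have "t (i * m) = (if i = d - 1 then - sqrt (1 - p) / sqrt 2 else 0)" "(if i * m = 0 then 1 else 0) = (0::real)"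
      unfolding t_def by (simp_all only: if_False)
    then show ?thesis unfolding \<psi>_def vX0[OF iX0] by simp
  qed
  have \<psi>hid: "\<psi> \<theta> \<omega> (i * m + Suc (k * q + b)) = (if i < q then sqrt (p / real M) * scrambled q (Mt \<theta>) (\<omega> k) (i, b) else 0)"
    if "i < d" "k < M" "b < q" for \<theta> \<omega> i k b
  proof (cases "i < q")
    case True
    have "\<psi> \<theta> \<omega> (hid k (i, b)) = - sqrt 2 * (\<gamma> * h \<theta> (\<omega> k) (i, b))"
      using H.vect_hid[of k "(i, b)" \<theta> \<omega>] that True by (simp add: \<psi>_def A_def hid_def)
    also have "\<dots> = sqrt (p / real M) * scrambled q (Mt \<theta>) (\<omega> k) (i, b)"
    proof -
      have "sqrt 2 * sqrt (p / (2 * real M)) = sqrt (p / real M)"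
        unfolding real_sqrt_mult[symmetric] by simp
      then show ?thesis by (simp add: \<gamma>_def h_def)
    qed
    finally show ?thesis using True by (simp add: hid_def)
  next
    case False
    let ?x = "i * m + Suc (k * q + b)"
    have xX0: "?x \<in> X0" using False that row_lt[OF that(1) pos_lt[OF that(2,3)]] decode[OF pos_lt[OF that(2,3)], of i]
      by (simp add: X0_def X_def)
    have "?x \<noteq> (d - 1) * m"
    proof
      assume "?x = (d - 1) * m"
      then have "?x mod m = 0" by simp
      then show False unfolding decode(2)[OF pos_lt[OF that(2,3)]] by simp
    qed
    then have "t ?x = 0" by (simp add: t_def)
    then show ?thesis using False unfolding \<psi>_def vX0[OF xX0] by simp
  qed
  have ent: "state_entropy \<alpha> d m (\<psi> \<theta> \<omega>) = S \<theta>" if \<omega>: "\<omega> \<in> H.choices" for \<theta> \<omega>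
  proof -
    have "(\<Sum>k<m. \<psi> \<theta> \<omega> (i * m + k) * \<psi> \<theta> \<omega> (j * m + k))
       = (if i < q \<and> j < q then p * marginal q (Mt \<theta>) i j else if i = j \<and> i = d - 1 then 1 - p else 0)"
      if ij: "i < d" "j < d" for i j
    proof -
      have "(\<Sum>k<m. \<psi> \<theta> \<omega> (i * m + k) * \<psi> \<theta> \<omega> (j * m + k)) = \<psi> \<theta> \<omega> (i * m) * \<psi> \<theta> \<omega> (j * m)
        + (\<Sum>k<M * q. \<psi> \<theta> \<omega> (i * m + Suc k) * \<psi> \<theta> \<omega> (j * m + Suc k))"
      proof -
        have "(\<Sum>k<m. G k) = G 0 + (\<Sum>k<M * q. G (Suc k))" for G :: "nat \<Rightarrow> real"
          unfolding m_def by (rule sum.lessThan_Suc_shift)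
        from this[of "\<lambda>k. \<psi> \<theta> \<omega> (i * m + k) * \<psi> \<theta> \<omega> (j * m + k)"] show ?thesis by simp
      qed
      also have "(\<Sum>k<M * q. \<psi> \<theta> \<omega> (i * m + Suc k) * \<psi> \<theta> \<omega> (j * m + Suc k))
        = (\<Sum>k<M. \<Sum>b<q. \<psi> \<theta> \<omega> (i * m + Suc (k * q + b)) * \<psi> \<theta> \<omega> (j * m + Suc (k * q + b)))"
        by (rule sum_prod_index)
      also have "\<dots> = (\<Sum>k<M. if i < q \<and> j < q then p / real M * marginal q (Mt \<theta>) i j else 0)"
      proof (rule sum.cong[OF refl])
        fix k assume k: "k \<in> {..<M}"
        obtain sh s where ws: "\<omega> k = (sh, s)" "sh < q" "s \<in> signs q"
          using H.choices_mem[OF \<omega>, of k] k by (cases "\<omega> k") (auto simp: \<Omega>_def)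
        show "(\<Sum>b<q. \<psi> \<theta> \<omega> (i * m + Suc (k * q + b)) * \<psi> \<theta> \<omega> (j * m + Suc (k * q + b)))
          = (if i < q \<and> j < q then p / real M * marginal q (Mt \<theta>) i j else 0)"
        proof (cases "i < q \<and> j < q")
          case True
          have "(\<Sum>b<q. \<psi> \<theta> \<omega> (i * m + Suc (k * q + b)) * \<psi> \<theta> \<omega> (j * m + Suc (k * q + b)))
            = (\<Sum>b<q. p / real M * (scrambled q (Mt \<theta>) (sh, s) (i, b) * scrambled q (Mt \<theta>) (sh, s) (j, b)))"
          proof (rule sum.cong[OF refl])
            fix b assume "b \<in> {..<q}"
            then have "\<psi> \<theta> \<omega> (i * m + Suc (k * q + b)) * \<psi> \<theta> \<omega> (j * m + Suc (k * q + b))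
              = (sqrt (p / real M) * sqrt (p / real M)) * (scrambled q (Mt \<theta>) (sh, s) (i, b) * scrambled q (Mt \<theta>) (sh, s) (j, b))"
              using \<psi>hid[OF ij(1)] \<psi>hid[OF ij(2)] k True ws(1) by (simp only: lessThan_iff if_True mult_ac)
            then show "\<psi> \<theta> \<omega> (i * m + Suc (k * q + b)) * \<psi> \<theta> \<omega> (j * m + Suc (k * q + b))
              = p / real M * (scrambled q (Mt \<theta>) (sh, s) (i, b) * scrambled q (Mt \<theta>) (sh, s) (j, b))"
              using p by simp
          qed
          then show ?thesis using True by (simp only: sum_distrib_left[symmetric] scrambled_marginal[OF ws(2,3)] simp_thms if_True)
        next
          case False
          have "\<psi> \<theta> \<omega> (i * m + Suc (k * q + b)) * \<psi> \<theta> \<omega> (j * m + Suc (k * q + b)) = 0" if "b < q" for b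
            using \<psi>hid[OF ij(1)] \<psi>hid[OF ij(2)] k that False by auto
          then show ?thesis using False by (simp only: if_False) (intro sum.neutral, simp)
        qed
      qed
      also have "\<dots> = (if i < q \<and> j < q then p * marginal q (Mt \<theta>) i j else 0)"
        using M0 by simp
      finally show ?thesis
        using \<psi>last[OF ij(1)] \<psi>last[OF ij(2)] q(2) p d by auto
    qed
    then have "real_mat d (\<lambda>i j. \<Sum>k<m. \<psi> \<theta> \<omega> (i * m + k) * \<psi> \<theta> \<omega> (j * m + k)) = embedded_state d q p (marginal q (Mt \<theta>))"
      unfolding embedded_state_def by (intro eq_matI) (simp_all add: real_mat_def del: of_real_sum of_real_mult)
    then show ?thesis by (simp add: state_entropy_def S_def)
  qed
  have N0: "0 < real (card H.choices)" by (rule H.card_choices_pos)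
  have "2 / 3 \<le> H.avg_accept B \<theta>0"
  proof -
    have "(\<Sum>\<omega>\<in>H.choices. 2 / 3) \<le> (\<Sum>\<omega>\<in>H.choices. (nrm B (H.run (H.vect \<theta>0 \<omega>) T))\<^sup>2)"
      using yes[OF state ent] by (intro sum_mono) (simp add: qv X_def)
    then show ?thesis unfolding H.avg_accept_def using N0 by (simp add: field_simps)
  qed
  moreover have "(\<Sum>\<theta>\<in>\<Theta>'. H.avg_accept B \<theta>) / real (card \<Theta>') \<le> 1 / 3"
  proof -
    have "H.avg_accept B \<theta> \<le> 1 / 3" if \<theta>: "\<theta> \<in> \<Theta>'" for \<theta>
    proof -
      have "(\<Sum>\<omega>\<in>H.choices. (nrm B (H.run (H.vect \<theta> \<omega>) T))\<^sup>2) \<le> (\<Sum>\<omega>\<in>H.choices. 1 / 3)"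
      proof (rule sum_mono)
        fix \<omega> assume \<omega>: "\<omega> \<in> H.choices"
        show "(nrm B (H.run (H.vect \<theta> \<omega>) T))\<^sup>2 \<le> 1 / 3"
          using no[OF state[OF _ \<omega>], of \<theta>] ent[OF \<omega>, of \<theta>] far[OF \<theta>] \<theta> by (simp add: qv X_def S_def)
      qed
      then show ?thesis unfolding H.avg_accept_def using N0 by (simp add: field_simps)
    qed
    then have "(\<Sum>\<theta>\<in>\<Theta>'. H.avg_accept B \<theta>) \<le> (\<Sum>\<theta>\<in>\<Theta>'. 1 / 3)" by (rule sum_mono)
    then show ?thesis using fin by (simp add: field_simps card_gt_0_iff)
  qed
  moreover have "\<bar>(\<Sum>\<theta>\<in>\<Theta>'. H.avg_accept B \<theta>) / real (card \<Theta>') - H.avg_accept B \<theta>0\<bar>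
    \<le> 8 * real T / sqrt (real n + 1) + 5 * real n / sqrt (real M) + sqrt (1 / 144)"
  proof -
    \<comment> \<open>Both covariances carry the factor I / q on the columns, whose inner product
      with itself is 1 / q.\<close>
    have ip: "H.ip \<theta> \<theta>' = (\<Sum>i<q. \<Sum>j<q. marginal q (Mt \<theta>) i j * marginal q (Mt \<theta>') i j) / real q" for \<theta> \<theta>'
    proof -
      have "H.ip \<theta> \<theta>' = (\<Sum>i<q. \<Sum>b<q. \<Sum>j<q. \<Sum>b'<q. if b' = b then marginal q (Mt \<theta>) i j * marginal q (Mt \<theta>') i j / (real q)\<^sup>2 else 0)"
        unfolding H.ip_def unfolding A_def sum.cartesian_product'
        by (intro sum.cong refl) (simp add: \<tau>_def power2_eq_square)
      also have "\<dots> = (\<Sum>i<q. \<Sum>b<q. \<Sum>j<q. marginal q (Mt \<theta>) i j * marginal q (Mt \<theta>') i j / (real q)\<^sup>2)"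
        by (intro sum.cong refl) simp
      also have "\<dots> = (\<Sum>i<q. \<Sum>j<q. marginal q (Mt \<theta>) i j * marginal q (Mt \<theta>') i j) / real q"
        using q by (simp add: power2_eq_square sum_divide_distrib[symmetric])
      finally show ?thesis .
    qed
    have cA: "real (card A) = (real q)\<^sup>2" by (simp add: A_def power2_eq_square)
    show ?thesis
    proof (rule H.avg_accept_diff)
      fix a b assume "a \<in> A" "b \<in> A"
      then show "\<tau> \<theta>0 a b = (if a = b then 1 / real (card A) else 0)"
        unfolding cA by (auto simp: A_def \<tau>_def ref power2_eq_square split: if_splits)
    next
      show "(\<Sum>\<theta>\<in>\<Theta>'. \<Sum>\<theta>'\<in>\<Theta>'. (1 + \<gamma>\<^sup>2 * real M * (real (card A) * H.ip \<theta> \<theta>' - 1)) ^ n) \<le> (1 + 1 / 144) * (real (card \<Theta>'))\<^sup>2"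
        using moment q unfolding \<gamma>2 cA ip n_def by (simp add: power2_eq_square)
    next
      fix \<theta> \<theta>' assume "\<theta> \<in> \<Theta>'" "\<theta>' \<in> \<Theta>'"
      then show "0 \<le> H.ip \<theta> \<theta>'" unfolding ip using overlap_nonneg by simp
    qed (use fin B p M0 in \<open>auto simp: X_def \<gamma>_def\<close>)
  qed
  moreover have "8 * real T / sqrt (real n + 1) \<le> 1 / 12"
  proof -
    have "96 * real T \<le> sqrt (real n + 1)"
      by (rule real_le_rsqrt) (simp add: n_def power_mult_distrib)
    moreover have "0 < sqrt (real n + 1)" by simp
    ultimately show ?thesis by (simp add: pos_divide_le_eq)
  qed
  moreover have "5 * real n / sqrt (real M) \<le> 1 / 12"
  proof -
    have "60 * real n \<le> sqrt (real M)"
      by (rule real_le_rsqrt) (simp add: M_def power_mult_distrib)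
    moreover have "0 < sqrt (real M)" using M0 by simp
    ultimately show ?thesis by (simp add: pos_divide_le_eq)
  qed
  moreover have "sqrt (1 / 144) = (1 / 12 :: real)"
    by (rule real_sqrt_unique) (simp_all add: power2_eq_square)
  ultimately show False by linarith
qed

section \<open>Moments of random signs and random permutations\<close>

lemma cosh_le_exp_half_sq: "cosh u \<le> exp (u\<^sup>2 / 2)" for u :: real
proof -
  let ?f = "\<lambda>n. if even n then u ^ n /\<^sub>R fact n else 0"
  have sm: "strict_mono (\<lambda>n::nat. 2 * n)" by (rule strict_monoI) simp
  have z: "?f n = 0" if "n \<notin> range (\<lambda>n::nat. 2 * n)" for n 
  proof -
    have "\<not> even n"
    proof
      assume "even n"
      then obtain m where "n = 2 * m" by (rule evenE)
      with that show False by simp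
    qed
    then show ?thesis by simp
  qed
  have "(\<lambda>n. ?f (2 * n)) sums cosh u \<longleftrightarrow> ?f sums cosh u"
    by (rule sums_mono_reindex[OF sm]) (rule z)
  then have "(\<lambda>n. ?f (2 * n)) sums cosh u" by (simp only: cosh_converges)
  moreover have "?f (2 * n) = u ^ (2 * n) / fact (2 * n)" for n by (simp add: divide_inverse)
  ultimately have c2: "(\<lambda>n. u ^ (2 * n) / fact (2 * n)) sums cosh u" by (simp only:)
  have e: "(\<lambda>n. (u\<^sup>2 / 2) ^ n / fact n) sums exp (u\<^sup>2 / 2)"
  proof -
    have "x /\<^sub>R fact n = x / fact n" for x :: real and n by (simp add: divide_inverse)
    then show ?thesis using exp_converges[of "u\<^sup>2 / 2"] by (simp only:)
  qed
  \<comment> \<open>The inequality of denominators that lets the two power series be compared term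
    by term.\<close>
  have f: "2 ^ n * fact n \<le> (fact (2 * n) :: real)" for n
  proof (induction n)
    case (Suc n)
    have "2 ^ Suc n * fact (Suc n) = (2 * real n + 2) * (2 ^ n * fact n)" by (simp add: algebra_simps)
    also have "\<dots> \<le> (2 * real n + 2) * fact (2 * n)" using Suc by (intro mult_left_mono) auto
    also have "\<dots> \<le> (2 * real n + 2) * ((2 * real n + 1) * fact (2 * n))"
      by (intro mult_left_mono) (auto simp: mult_le_cancel_right1)
    also have "\<dots> = fact (2 * Suc n)" by (simp add: algebra_simps)
    finally show ?case .
  qed simp
  show ?thesis
  proof (rule sums_le[OF _ c2 e])
    fix n
    have "u ^ (2 * n) / fact (2 * n) \<le> u ^ (2 * n) / (2 ^ n * fact n)"
      by (intro divide_left_mono f) (auto simp: zero_le_even_power)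
    then show "u ^ (2 * n) / fact (2 * n) \<le> (u\<^sup>2 / 2) ^ n / fact n"
      by (simp add: power_mult power_divide)
  qed
qed

lemma even_power_le_cosh: "u ^ (2 * k) / fact (2 * k) \<le> cosh u" for u :: real
proof -
  let ?f = "\<lambda>n. if even n then u ^ n /\<^sub>R fact n else 0"
  have c: "?f sums cosh u" by (rule cosh_converges)
  have "sum ?f {2 * k} \<le> suminf ?f"
    by (rule sum_le_suminf[OF sums_summable[OF c]]) (auto simp: zero_le_even_power)
  then show ?thesis using sums_unique[OF c] by (simp add: divide_inverse mult.commute)
qed

lemma sum_signs_exp:
  "(\<Sum>s\<in>signs q. exp (\<Sum>i<q. u i * s i)) = 2 ^ q * (\<Prod>i<q. cosh (u i))"
proof -
  have "(\<Sum>s\<in>signs q. exp (\<Sum>i<q. u i * s i)) = (\<Sum>s\<in>signs q. \<Prod>i<q. exp (u i * s i))"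
    by (simp add: exp_sum)
  also have "\<dots> = (\<Prod>i<q. exp (u i * (- 1)) + exp (u i * 1))" by (rule sum_signs_prod)
  also have "\<dots> = (\<Prod>i<q. 2 * cosh (u i))"
    by (rule prod.cong) (simp_all add: cosh_field_def)
  finally show ?thesis by (simp add: prod.distrib)
qed

lemma fact_double_le: "fact (2 * k) \<le> (fact k * (2 * real k) ^ k :: real)"
proof -
  have "fact (k + j) \<le> (fact k * (2 * real k) ^ j :: real)" if "j \<le> k" for j
    using that
  proof (induction j)
    case (Suc j)
    have "fact (k + Suc j) = real (k + Suc j) * fact (k + j)" by simp
    also have "\<dots> \<le> (2 * real k) * (fact k * (2 * real k) ^ j)"
    proof (rule mult_mono)
      show "real (k + Suc j) \<le> 2 * real k" using Suc.prems by simp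
      show "fact (k + j) \<le> (fact k * (2 * real k) ^ j :: real)" using Suc by simp
    qed simp_all
    also have "\<dots> = fact k * (2 * real k) ^ Suc j" by (simp only: power_Suc mult.left_commute)
    finally show ?case .
  qed simp
  from this[OF order.refl] show ?thesis by (simp only: mult_2)
qed

text \<open>Exponential moments: with Y the overlap, (u Y)^(2 k) / (2 k)! is at most cosh (u Y), and
  the mean of cosh (u Y) is at most exp (q u^2 / 2). The choice u^2 = 2 k / q makes the latter e^k,
  and \<open>fact_double_le\<close> leaves exactly k! after the factor (2 k)^k cancels.\<close>

lemma sign_overlap_moment:
  assumes q: "0 < q" and s': "s' \<in> signs q"
  shows "(\<Sum>s\<in>signs q. ((\<Sum>i<q. s i * s' i)\<^sup>2 / real q) ^ k) \<le> 2 ^ q * (fact k * exp 1 ^ k)"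
proof (cases "k = 0")
  case True
  then show ?thesis by (simp add: card_signs)
next
  case False
  define u where "u = sqrt (2 * real k / real q)"
  have u0: "0 < u" and u2: "u\<^sup>2 = 2 * real k / real q" using False q by (auto simp: u_def)
  have s1: "(s' i)\<^sup>2 = 1" if "i < q" for i using signs_sq[OF s' that] by (simp add: power2_eq_square)
  have ch: "(\<Sum>s\<in>signs q. cosh (u * (\<Sum>i<q. s i * s' i))) \<le> 2 ^ q * exp 1 ^ k"
  proof -
    have pr: "(\<Prod>i<q. cosh (v * s' i)) = cosh u ^ q" if v: "v = u \<or> v = - u" for v
    proof -
      have "cosh (v * s' i) = cosh u" if "i < q" for i
      proof -
        have "s' i = 1 \<or> s' i = - 1" using signs_sq[OF s' that] by (simp add: square_eq_1_iff)
        then show ?thesis using v by auto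
      qed
      then have "(\<Prod>i<q. cosh (v * s' i)) = (\<Prod>i<q. cosh u)" by (intro prod.cong) auto
      then show ?thesis by simp
    qed
    have pt: "cosh (u * (\<Sum>i<q. s i * s' i)) = (exp (\<Sum>i<q. (u * s' i) * s i) + exp (\<Sum>i<q. ((- u) * s' i) * s i)) / 2" for s
    proof -
      have lin: "(\<Sum>i<q. (v * s' i) * s i) = v * (\<Sum>i<q. s i * s' i)" for v
        unfolding sum_distrib_left by (rule sum.cong) simp_all
      then show ?thesis unfolding lin[of u] lin[of "- u"] by (simp add: cosh_field_def)
    qed
    have "(\<Sum>s\<in>signs q. cosh (u * (\<Sum>i<q. s i * s' i)))
        = ((\<Sum>s\<in>signs q. exp (\<Sum>i<q. (u * s' i) * s i)) + (\<Sum>s\<in>signs q. exp (\<Sum>i<q. ((- u) * s' i) * s i))) / 2"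
      unfolding pt sum_divide_distrib[symmetric] sum.distrib ..
    also have "\<dots> = 2 ^ q * cosh u ^ q"
    proof -
      have "(\<Prod>i<q. cosh (u * s' i)) = cosh u ^ q" "(\<Prod>i<q. cosh ((- u) * s' i)) = cosh u ^ q"
        by (rule pr; simp)+
      then show ?thesis
        unfolding sum_signs_exp[where u="\<lambda>i. u * s' i"] sum_signs_exp[where u="\<lambda>i. (- u) * s' i"] by (simp only:) simp
    qed
    also have "\<dots> \<le> 2 ^ q * exp (u\<^sup>2 / 2) ^ q"
      by (intro mult_left_mono power_mono cosh_le_exp_half_sq) (auto simp: cosh_real_nonneg)
    also have "exp (u\<^sup>2 / 2) ^ q = exp (real q * (u\<^sup>2 / 2))" by (rule exp_of_nat_mult[symmetric])
    also have "real q * (u\<^sup>2 / 2) = real k * 1" using q by (simp add: u2)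
    also have "exp (real k * 1) = exp 1 ^ k" by (rule exp_of_nat_mult)
    finally show ?thesis .
  qed
  have "(\<Sum>s\<in>signs q. ((\<Sum>i<q. s i * s' i)\<^sup>2 / real q) ^ k)
    \<le> (\<Sum>s\<in>signs q. fact k * cosh (u * (\<Sum>i<q. s i * s' i)))"
  proof (rule sum_mono)
    fix s
    define Y where "Y = (\<Sum>i<q. s i * s' i)"
    have "(u * Y) ^ (2 * k) \<le> fact (2 * k) * cosh (u * Y)"
      using even_power_le_cosh[of "u * Y" k] by (simp add: divide_le_eq mult.commute)
    also have "\<dots> \<le> (fact k * (2 * real k) ^ k) * cosh (u * Y)"
      by (intro mult_right_mono fact_double_le) (simp add: cosh_real_nonneg)
    also have "(u * Y) ^ (2 * k) = (u\<^sup>2) ^ k * (Y\<^sup>2) ^ k"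
      by (simp only: power_mult power_mult_distrib)
    finally have "(u\<^sup>2) ^ k * (Y\<^sup>2) ^ k \<le> (2 * real k) ^ k * (fact k * cosh (u * Y))"
      by (simp only: mult_ac)
    moreover have "(u\<^sup>2) ^ k * (Y\<^sup>2) ^ k = (2 * real k) ^ k * (Y\<^sup>2 / real q) ^ k"
      by (simp add: u2 power_divide)
    ultimately have "(2 * real k) ^ k * (Y\<^sup>2 / real q) ^ k \<le> (2 * real k) ^ k * (fact k * cosh (u * Y))" by simp
    then show "(Y\<^sup>2 / real q) ^ k \<le> fact k * cosh (u * Y)"
      using False by (subst (asm) mult_le_cancel_left_pos) auto
  qed
  also have "\<dots> = fact k * (\<Sum>s\<in>signs q. cosh (u * (\<Sum>i<q. s i * s' i)))" by (simp add: sum_distrib_left)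
  also have "\<dots> \<le> fact k * (2 ^ q * exp 1 ^ k)" using ch by (intro mult_left_mono) auto
  finally show ?thesis by (simp add: mult_ac)
qed

text \<open>In the binomial expansion the bound n^k / k! on the coefficients cancels the k! of the
  moments. What remains is a geometric series of ratio n \<kappa> e, at most 1/500, whose sum is
  below 1 + 1/144.\<close>

lemma sign_overlap_binomial:
  assumes q: "0 < q" and s': "s' \<in> signs q" and \<kappa>: "0 \<le> \<kappa>" "real n * \<kappa> \<le> 1 / 1500"
  shows "(\<Sum>s\<in>signs q. (1 + \<kappa> * ((\<Sum>i<q. s i * s' i)\<^sup>2 / real q)) ^ n) \<le> 2 ^ q * (1 + 1 / 144)"
proof -
  define \<rho> where "\<rho> = real n * \<kappa> * exp 1"
  have e3: "exp 1 \<le> (3::real)" by (rule exp_le)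
  have "\<rho> \<le> (1 / 1500) * 3" unfolding \<rho>_def using \<kappa> e3 by (intro mult_mono) auto
  then have \<rho>: "0 \<le> \<rho>" "\<rho> \<le> 1 / 500" using \<kappa> by (simp_all add: \<rho>_def)
  let ?Y = "\<lambda>s. (\<Sum>i<q. s i * s' i)\<^sup>2 / real q"
  have "(\<Sum>s\<in>signs q. (1 + \<kappa> * ?Y s) ^ n) = (\<Sum>s\<in>signs q. \<Sum>k\<le>n. real (n choose k) * \<kappa> ^ k * ?Y s ^ k)"
  proof -
    have "(1 + z) ^ n = (\<Sum>k\<le>n. real (n choose k) * z ^ k)" for z :: real
      using binomial_ring[of z 1 n] by (simp add: add.commute)
    then show ?thesis by (simp only: power_mult_distrib mult.assoc)
  qed
  also have "\<dots> = (\<Sum>k\<le>n. real (n choose k) * \<kappa> ^ k * (\<Sum>s\<in>signs q. ?Y s ^ k))"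
    by (subst sum.swap) (simp add: sum_distrib_left)
  also have "\<dots> \<le> (\<Sum>k\<le>n. (real n ^ k / fact k) * \<kappa> ^ k * (2 ^ q * (fact k * exp 1 ^ k)))"
  proof (rule sum_mono)
    fix k
    have "real (n choose k) * fact k \<le> real n ^ k"
      using binomial_fact_pow[of n k] by (metis of_nat_fact of_nat_le_iff of_nat_mult of_nat_power)
    then have "real (n choose k) \<le> real n ^ k / fact k" by (simp add: pos_le_divide_eq)
    then show "real (n choose k) * \<kappa> ^ k * (\<Sum>s\<in>signs q. ?Y s ^ k) \<le> (real n ^ k / fact k) * \<kappa> ^ k * (2 ^ q * (fact k * exp 1 ^ k))"
      using \<kappa>(1) sign_overlap_moment[OF q s', of k]
      by (intro mult_mono mult_right_mono) (auto intro!: sum_nonneg mult_nonneg_nonneg)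
  qed
  also have "\<dots> = 2 ^ q * (\<Sum>k\<le>n. \<rho> ^ k)"
    unfolding sum_distrib_left by (rule sum.cong) (simp_all add: \<rho>_def power_mult_distrib)
  also have "\<dots> \<le> 2 ^ q * (1 / (1 - \<rho>))"
  proof (rule mult_left_mono)
    have s: "summable (\<lambda>k. \<rho> ^ k)" using \<rho> by (intro summable_geometric) simp
    have "(\<Sum>k\<le>n. \<rho> ^ k) \<le> (\<Sum>k. \<rho> ^ k)"
      by (rule sum_le_suminf[OF s]) (use \<rho> in auto)
    also have "\<dots> = 1 / (1 - \<rho>)" using \<rho> by (intro suminf_geometric) simp
    finally show "(\<Sum>k\<le>n. \<rho> ^ k) \<le> 1 / (1 - \<rho>)" .
  qed simp
  also have "\<dots> \<le> 2 ^ q * (1 + 1 / 144)"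
    using \<rho> by (intro mult_left_mono) (auto simp: field_simps)
  finally show ?thesis .
qed

text \<open>Composition with the inverse of \<open>\<pi>0\<close> turns agreement on K into fixing K
  pointwise.\<close>

lemma card_permutations_agreeing:
  assumes \<pi>0: "\<pi>0 permutes {..<r}" and K: "K \<subseteq> {..<r}"
  shows "card {\<pi>. \<pi> permutes {..<r} \<and> (\<forall>i\<in>K. \<pi> i = \<pi>0 i)} \<le> fact (r - card K)"
proof -
  let ?P = "{\<pi>. \<pi> permutes {..<r} \<and> (\<forall>i\<in>K. \<pi> i = \<pi>0 i)}"
  let ?Q = "{\<pi>. \<pi> permutes ({..<r} - K)}"
  have inj: "inj_on (\<lambda>\<pi>. inv_into UNIV \<pi>0 \<circ> \<pi>) ?P"
  proof (rule inj_on_inverseI)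
    fix \<pi>
    show "\<pi>0 \<circ> (inv_into UNIV \<pi>0 \<circ> \<pi>) = \<pi>" using permutes_inverses(1)[OF \<pi>0] by (simp add: fun_eq_iff)
  qed
  have img: "(\<lambda>\<pi>. inv_into UNIV \<pi>0 \<circ> \<pi>) ` ?P \<subseteq> ?Q"
  proof (clarsimp)
    fix \<pi> assume \<pi>: "\<pi> permutes {..<r}" "\<forall>i\<in>K. \<pi> i = \<pi>0 i"
    show "(inv_into UNIV \<pi>0 \<circ> \<pi>) permutes ({..<r} - K)"
    proof (rule permutes_superset)
      show "(inv_into UNIV \<pi>0 \<circ> \<pi>) permutes {..<r}" by (rule permutes_compose[OF \<pi>(1) permutes_inv[OF \<pi>0]])
      fix x assume "x \<in> {..<r} - ({..<r} - K)"
      then show "(inv_into UNIV \<pi>0 \<circ> \<pi>) x = x" using \<pi>(2) permutes_inverses(2)[OF \<pi>0] by simp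
    qed
  qed
  have fQ: "finite ?Q" by (rule finite_permutations) simp
  have "card ?P = card ((\<lambda>\<pi>. inv_into UNIV \<pi>0 \<circ> \<pi>) ` ?P)" by (rule card_image[OF inj, symmetric])
  also have "\<dots> \<le> card ?Q" by (rule card_mono[OF fQ img])
  also have "\<dots> = fact (card ({..<r} - K))" by (rule card_permutations) auto
  also have "card ({..<r} - K) = r - card K" using K by (simp add: card_Diff_subset finite_subset)
  finally show ?thesis .
qed

text \<open>Expanding each factor as 1 plus (x - 1) times the indicator of agreement gives a sum
  over sets K of forced agreements. A set of size k leaves at most (r - k)! permutations, and r
  choose k times (r - k)! is r! / k!, so the exponential series appears.\<close>

lemma sum_agreements:
  assumes \<pi>0: "\<pi>0 permutes {..<r}" and x: "1 \<le> (x::real)"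
  shows "(\<Sum>\<pi> | \<pi> permutes {..<r}. \<Prod>i<r. if \<pi> i = \<pi>0 i then x else 1) \<le> fact r * exp (x - 1)"
proof -
  let ?P = "{\<pi>. \<pi> permutes {..<r}}"
  have fP: "finite ?P" by (rule finite_permutations) simp
  have "(\<Prod>i<r. if \<pi> i = \<pi>0 i then x else 1) = (\<Sum>K\<in>Pow {..<r}. (x - 1) ^ card K * of_bool (\<forall>i\<in>K. \<pi> i = \<pi>0 i))" for \<pi>
  proof -
    have "(\<Prod>i<r. if \<pi> i = \<pi>0 i then x else 1) = (\<Prod>i<r. (x - 1) * of_bool (\<pi> i = \<pi>0 i) + 1)"
      by (rule prod.cong) auto
    also have "\<dots> = (\<Sum>K\<in>Pow {..<r}. \<Prod>i\<in>K. (x - 1) * of_bool (\<pi> i = \<pi>0 i))"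
      by (simp add: prod_add)
    also have "\<dots> = (\<Sum>K\<in>Pow {..<r}. (x - 1) ^ card K * of_bool (\<forall>i\<in>K. \<pi> i = \<pi>0 i))"
    proof (rule sum.cong[OF refl])
      fix K assume "K \<in> Pow {..<r}"
      then have "finite K" by (auto intro: finite_subset)
      then have "(\<Prod>i\<in>K. of_bool (\<pi> i = \<pi>0 i) :: real) = of_bool (\<forall>i\<in>K. \<pi> i = \<pi>0 i)"
        by (induction K) auto
      then show "(\<Prod>i\<in>K. (x - 1) * of_bool (\<pi> i = \<pi>0 i)) = (x - 1) ^ card K * of_bool (\<forall>i\<in>K. \<pi> i = \<pi>0 i)"
        by (simp add: prod.distrib)
    qed
    finally show ?thesis .
  qed
  then have "(\<Sum>\<pi>\<in>?P. \<Prod>i<r. if \<pi> i = \<pi>0 i then x else 1)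
      = (\<Sum>K\<in>Pow {..<r}. (x - 1) ^ card K * (\<Sum>\<pi>\<in>?P. of_bool (\<forall>i\<in>K. \<pi> i = \<pi>0 i)))"
    by (simp only: sum_distrib_left sum.swap[of _ "Pow {..<r}" ?P])
  also have "\<dots> \<le> (\<Sum>K\<in>Pow {..<r}. (x - 1) ^ card K * fact (r - card K))"
  proof (intro sum_mono mult_left_mono)
    fix K assume K: "K \<in> Pow {..<r}"
    have "(\<Sum>\<pi>\<in>?P. of_bool (\<forall>i\<in>K. \<pi> i = \<pi>0 i) :: real) = real (card {\<pi>. \<pi> permutes {..<r} \<and> (\<forall>i\<in>K. \<pi> i = \<pi>0 i)})"
    proof -
      have "(\<Sum>\<pi>\<in>?P. of_bool (\<forall>i\<in>K. \<pi> i = \<pi>0 i) :: real) = (\<Sum>\<pi>\<in>?P. if \<forall>i\<in>K. \<pi> i = \<pi>0 i then 1 else 0)"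
        by (rule sum.cong) (simp_all only: of_bool_def)
      also have "\<dots> = (\<Sum>\<pi>\<in>{\<pi>\<in>?P. \<forall>i\<in>K. \<pi> i = \<pi>0 i}. 1)" by (rule sum.inter_filter[OF fP, symmetric])
      also have "\<dots> = real (card {\<pi>. \<pi> permutes {..<r} \<and> (\<forall>i\<in>K. \<pi> i = \<pi>0 i)})"
        by (simp only: real_of_card mem_Collect_eq)
      finally show ?thesis .
    qed
    also have "\<dots> \<le> real (fact (r - card K))"
      using card_permutations_agreeing[OF \<pi>0 PowD[OF K]] by (rule of_nat_mono)
    also have "\<dots> = fact (r - card K)" by (rule of_nat_fact)
    finally show "(\<Sum>\<pi>\<in>?P. of_bool (\<forall>i\<in>K. \<pi> i = \<pi>0 i) :: real) \<le> fact (r - card K)" .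
  qed (use x in simp)
  also have "\<dots> = (\<Sum>k\<le>r. real (r choose k) * ((x - 1) ^ k * fact (r - k)))"
  proof -
    have "(\<Sum>K\<in>Pow {..<r}. (x - 1) ^ card K * fact (r - card K) :: real)
      = (\<Sum>k\<le>r. \<Sum>K\<in>{K. K \<subseteq> {..<r} \<and> card K = k}. (x - 1) ^ card K * fact (r - card K))"
    proof -
      have "card K \<le> r" if "K \<in> Pow {..<r}" for K
        using card_mono[of "{..<r}" K] that by simp
      then have "card ` Pow {..<r} \<subseteq> {..r}" by auto
      then have "(\<Sum>k\<le>r. \<Sum>K\<in>{K \<in> Pow {..<r}. card K = k}. (x - 1) ^ card K * fact (r - card K))
        = (\<Sum>K\<in>Pow {..<r}. (x - 1) ^ card K * fact (r - card K) :: real)"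
        by (intro sum.group) auto
      then show ?thesis by (simp only: Pow_iff mem_Collect_eq)
    qed
    also have "\<dots> = (\<Sum>k\<le>r. real (r choose k) * ((x - 1) ^ k * fact (r - k)))"
    proof (rule sum.cong[OF refl])
      fix k
      have "(\<Sum>K\<in>{K. K \<subseteq> {..<r} \<and> card K = k}. (x - 1) ^ card K * fact (r - card K) :: real)
        = (\<Sum>K\<in>{K. K \<subseteq> {..<r} \<and> card K = k}. (x - 1) ^ k * fact (r - k))"
        by (rule sum.cong) auto
      also have "\<dots> = real (r choose k) * ((x - 1) ^ k * fact (r - k))"
        unfolding sum_constant using n_subsets[of "{..<r}" k] by simp
      finally show "(\<Sum>K\<in>{K. K \<subseteq> {..<r} \<and> card K = k}. (x - 1) ^ card K * fact (r - card K) :: real)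
        = real (r choose k) * ((x - 1) ^ k * fact (r - k))" .
    qed
    finally show ?thesis .
  qed
  also have "\<dots> = fact r * (\<Sum>k\<le>r. (x - 1) ^ k / fact k)"
    unfolding sum_distrib_left by (rule sum.cong) (simp_all add: binomial_fact)
  also have "\<dots> \<le> fact r * exp (x - 1)"
  proof (rule mult_left_mono)
    have e: "(\<lambda>k. (x - 1) ^ k /\<^sub>R fact k) sums exp (x - 1)" by (rule exp_converges)
    have "(\<Sum>k\<le>r. (x - 1) ^ k /\<^sub>R fact k) \<le> suminf (\<lambda>k. (x - 1) ^ k /\<^sub>R fact k)"
      by (rule sum_le_suminf[OF sums_summable[OF e]]) (use x in auto)
    moreover have "y /\<^sub>R fact k = y / fact k" for y :: real and k by (simp add: divide_inverse)
    ultimately show "(\<Sum>k\<le>r. (x - 1) ^ k / fact k) \<le> exp (x - 1)"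
      unfolding sums_unique[OF e, symmetric] by (simp only:)
  qed simp
  finally show ?thesis .
qed

text \<open>Summing over the signs first leaves a factor cosh u per agreement, independent of
  \<open>s0\<close>. The sum over permutations then gives exp (cosh u - 1), whose excess over 1 is
  of order u^2 only.\<close>

lemma signed_permutation_moment:
  assumes \<pi>0: "\<pi>0 permutes {..<r}" and s0: "s0 \<in> signs r" and u: "\<bar>u\<bar> \<le> 1 / 20"
  shows "(\<Sum>\<pi> | \<pi> permutes {..<r}. \<Sum>s\<in>signs r. exp (u * (\<Sum>i<r. if \<pi> i = \<pi>0 i then s i * s0 i else 0)))
    \<le> fact r * 2 ^ r * (1 + 1 / 144)"
proof -
  have "(\<Sum>s\<in>signs r. exp (u * (\<Sum>i<r. if \<pi> i = \<pi>0 i then s i * s0 i else 0)))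
     = 2 ^ r * (\<Prod>i<r. if \<pi> i = \<pi>0 i then cosh u else 1)" for \<pi>
  proof -
    have "(\<Sum>s\<in>signs r. exp (u * (\<Sum>i<r. if \<pi> i = \<pi>0 i then s i * s0 i else 0)))
       = (\<Sum>s\<in>signs r. exp (\<Sum>i<r. (if \<pi> i = \<pi>0 i then u * s0 i else 0) * s i))"
      unfolding sum_distrib_left by (intro sum.cong refl arg_cong[where f=exp]) auto
    also have "\<dots> = 2 ^ r * (\<Prod>i<r. cosh (if \<pi> i = \<pi>0 i then u * s0 i else 0))" by (rule sum_signs_exp)
    also have "(\<Prod>i<r. cosh (if \<pi> i = \<pi>0 i then u * s0 i else 0)) = (\<Prod>i<r. if \<pi> i = \<pi>0 i then cosh u else 1)"
    proof (rule prod.cong[OF refl])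
      fix i assume "i \<in> {..<r}"
      then have "s0 i = 1 \<or> s0 i = - 1" using signs_sq[OF s0] by (simp add: square_eq_1_iff)
      then show "cosh (if \<pi> i = \<pi>0 i then u * s0 i else 0) = (if \<pi> i = \<pi>0 i then cosh u else 1)" by auto
    qed
    finally show ?thesis .
  qed
  then have "(\<Sum>\<pi> | \<pi> permutes {..<r}. \<Sum>s\<in>signs r. exp (u * (\<Sum>i<r. if \<pi> i = \<pi>0 i then s i * s0 i else 0)))
    = 2 ^ r * (\<Sum>\<pi> | \<pi> permutes {..<r}. \<Prod>i<r. if \<pi> i = \<pi>0 i then cosh u else 1)"
    by (simp add: sum_distrib_left)
  also have "\<dots> \<le> 2 ^ r * (fact r * exp (cosh u - 1))"
    by (intro mult_left_mono sum_agreements[OF \<pi>0]) (auto simp: cosh_real_ge_1)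
  also have "\<dots> \<le> 2 ^ r * (fact r * (1 + 1 / 144))"
  proof -
    have "u\<^sup>2 \<le> (1 / 20)\<^sup>2" using u by (metis abs_le_square_iff abs_of_nonneg zero_le_divide_1_iff zero_le_numeral)
    then have u2: "u\<^sup>2 / 2 \<le> 1 / 800" by (simp add: power2_eq_square)
    have "cosh u \<le> exp (u\<^sup>2 / 2)" by (rule cosh_le_exp_half_sq)
    also have "\<dots> \<le> exp (1 / 800)" using u2 by simp
    also have "\<dots> \<le> 1 + 1 / 800 + (1 / 800)\<^sup>2" by (rule exp_bound) auto
    finally have c: "cosh u - 1 \<le> 1 / 400" by (simp add: power2_eq_square)
    have "exp (cosh u - 1) \<le> exp (1 / 400)" using c by simp
    also have "\<dots> \<le> 1 + 1 / 400 + (1 / 400)\<^sup>2" by (rule exp_bound) auto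
    also have "\<dots> \<le> 1 + 1 / (144::real)" by (simp add: power2_eq_square)
    finally show ?thesis by (intro mult_left_mono) auto
  qed
  finally show ?thesis by (simp add: mult_ac)
qed

text \<open>Extending W by the identity outside the hidden levels diagonalises the direct sum and
  keeps W a symmetric involution.\<close>

lemma entropy_embedded:
  assumes q: "q \<le> d - 1" "1 \<le> d" and p: "0 \<le> p" "p \<le> 1"
    and sym: "\<And>i j. i < q \<Longrightarrow> j < q \<Longrightarrow> W i j = W j i"
    and inv: "\<And>i j. i < q \<Longrightarrow> j < q \<Longrightarrow> (\<Sum>k<q. W i k * W k j) = (if i = j then 1 else 0)"
    and \<mu>: "\<And>i. i < q \<Longrightarrow> 0 \<le> \<mu> i"
    and \<sigma>: "\<And>i j. i < q \<Longrightarrow> j < q \<Longrightarrow> \<sigma> i j = (\<Sum>k<q. W i k * \<mu> k * W k j)"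
  shows "renyi_entropy \<alpha> d (embedded_state d q p \<sigma>) = ln (p powr \<alpha> * (\<Sum>i<q. \<mu> i powr \<alpha>) + (1 - p) powr \<alpha>) / (1 - \<alpha>)"
proof -
  define W' where "W' = (\<lambda>i j. if i < q \<and> j < q then W i j else if i = j then 1 else 0)"
  define l where "l = (\<lambda>i. if i < q then p * \<mu> i else if i = d - 1 then 1 - p else 0)"
  have qd: "q \<le> d" using q by simp
  have split: "(\<Sum>k<d. F k) = (\<Sum>k<q. F k) + (\<Sum>k=q..<d. F k)" for F :: "nat \<Rightarrow> real"
    using sum.atLeastLessThan_concat[of 0 q d F] qd by (simp add: atLeast0LessThan)
  have prod_eq: "(\<Sum>k<d. W' i k * g k * W' k j) = (if i < q \<and> j < q then \<Sum>k<q. W i k * g k * W k j else if i = j then g i else 0)"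
    if ij: "i < d" "j < d" for i j and g :: "nat \<Rightarrow> real"
  proof (cases "i < q \<and> j < q")
    case True
    have "(\<Sum>k=q..<d. W' i k * g k * W' k j) = 0"
      using True by (intro sum.neutral) (auto simp: W'_def)
    moreover have "(\<Sum>k<q. W' i k * g k * W' k j) = (\<Sum>k<q. W i k * g k * W k j)"
      using True by (intro sum.cong) (auto simp: W'_def)
    ultimately show ?thesis using True by (simp only: split simp_thms if_True add_0_right)
  next
    case False
    have "(\<Sum>k<d. W' i k * g k * W' k j) = (\<Sum>k<d. if k = i then (if i = j then g i else 0) else 0)"
      by (rule sum.cong) (use False in \<open>auto simp: W'_def\<close>)
    then show ?thesis unfolding if_not_P[OF False] using ij by simp
  qed
  have "trace_pow \<alpha> d (embedded_state d q p \<sigma>) = (\<Sum>i<d. l i powr \<alpha>)"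
    unfolding embedded_state_def
  proof (rule trace_pow_involution[where W=W'])
    fix i j assume ij: "i < d" "j < d"
    show "W' i j = W' j i" using sym by (auto simp: W'_def)
    have "(\<Sum>k<d. W' i k * W' k j) = (\<Sum>k<d. W' i k * 1 * W' k j)" by simp
    also have "\<dots> = (if i < q \<and> j < q then \<Sum>k<q. W i k * 1 * W k j else if i = j then 1 else 0)"
      by (rule prod_eq[OF ij])
    finally show "(\<Sum>k<d. W' i k * W' k j) = (if i = j then 1 else 0)" using inv by auto
    have "(\<Sum>k<d. W' i k * l k * W' k j) = (if i < q \<and> j < q then \<Sum>k<q. W i k * l k * W k j else if i = j then l i else 0)"
      by (rule prod_eq[OF ij])
    also have "(\<Sum>k<q. W i k * l k * W k j) = p * (\<Sum>k<q. W i k * \<mu> k * W k j)"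
      unfolding sum_distrib_left by (rule sum.cong) (auto simp: l_def)
    finally show "(if i < q \<and> j < q then p * \<sigma> i j else if i = j \<and> i = d - 1 then 1 - p else 0) = (\<Sum>k<d. W' i k * l k * W' k j)"
      using \<sigma> by (auto simp: l_def)
  next
    fix i assume "i < d"
    then show "0 \<le> l i" using \<mu> p by (auto simp: l_def)
  qed
  also have "\<dots> = (\<Sum>i<q. (p * \<mu> i) powr \<alpha>) + (1 - p) powr \<alpha>"
  proof -
    \<comment> \<open>Levels from q on, other than the last, have eigenvalue 0, and 0 powr \<alpha>
      is 0.\<close>
    have "(\<Sum>i=q..<d. l i powr \<alpha>) = (\<Sum>i=q..<d. if i = d - 1 then (1 - p) powr \<alpha> else 0)"
      by (rule sum.cong) (auto simp: l_def)
    moreover have "d - 1 \<in> {q..<d}" using q by auto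
    ultimately have "(\<Sum>i=q..<d. l i powr \<alpha>) = (1 - p) powr \<alpha>" by (simp only: sum.delta finite_atLeastLessThan if_True)
    moreover have "(\<Sum>i<q. l i powr \<alpha>) = (\<Sum>i<q. (p * \<mu> i) powr \<alpha>)" by (rule sum.cong) (auto simp: l_def)
    ultimately show ?thesis by (simp only: split)
  qed
  also have "(\<Sum>i<q. (p * \<mu> i) powr \<alpha>) = p powr \<alpha> * (\<Sum>i<q. \<mu> i powr \<alpha>)"
    unfolding sum_distrib_left using \<mu> p by (intro sum.cong refl powr_mult)
  finally show ?thesis by (simp add: renyi_entropy_def)
qed

section \<open>Signed perfect matchings and square roots of the hidden states\<close>

lemma sum_double: "(\<Sum>i<r + r. F i) = (\<Sum>i<r. F i) + (\<Sum>i<r. F (r + i))" for F :: "nat \<Rightarrow> real"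
proof -
  have "(\<Sum>i=r..<r + r. F i) = (\<Sum>i<r. F (r + i))"
    by (rule sum.reindex_bij_witness[where i="\<lambda>i. r + i" and j="\<lambda>i. i - r"]) auto
  then show ?thesis using sum.atLeastLessThan_concat[of 0 r "r + r" F] by (simp add: atLeast0LessThan)
qed

text \<open>The signed adjacency matrix of a perfect matching between the first r and the last r
  levels. It is symmetric, has zero diagonal and squares to the identity, and two independent random
  ones share few entries.\<close>

definition matching :: "nat \<Rightarrow> (nat \<Rightarrow> nat) \<times> (nat \<Rightarrow> real) \<Rightarrow> nat \<Rightarrow> nat \<Rightarrow> real" where
  "matching r = (\<lambda>(\<pi>, s) i j. if i < r \<and> r \<le> j then (if j = r + \<pi> i then s i else 0)
     else if r \<le> i \<and> j < r then (if i = r + \<pi> j then s j else 0) else 0)"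

definition matchings :: "nat \<Rightarrow> ((nat \<Rightarrow> nat) \<times> (nat \<Rightarrow> real)) set" where
  "matchings r = {\<pi>. \<pi> permutes {..<r}} \<times> signs r"

lemma finite_matchings: "finite (matchings r)"
  unfolding matchings_def by (intro finite_cartesian_product finite_permutations) auto

lemma card_matchings: "real (card (matchings r)) = fact r * 2 ^ r"
proof -
  have "card {\<pi>. \<pi> permutes {..<r}} = fact r" by (rule card_permutations) auto
  then show ?thesis by (simp add: matchings_def card_cartesian_product card_signs)
qed

lemma matching_entries:
  assumes "i < r" "j < r"
  shows "matching r (\<pi>, s) i j = 0" "matching r (\<pi>, s) (r + i) (r + j) = 0"
    "matching r (\<pi>, s) i (r + j) = (if j = \<pi> i then s i else 0)"
    "matching r (\<pi>, s) (r + i) j = (if i = \<pi> j then s j else 0)"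
  using assms by (simp_all add: matching_def)

lemma matching_sym: "matching r \<theta> i j = matching r \<theta> j i"
  by (cases \<theta>) (auto simp: matching_def)

lemma lt_double_cases:
  fixes i :: nat
  assumes "i < r + r" "\<And>i'. i' < r \<Longrightarrow> i = i' \<Longrightarrow> P" "\<And>i'. i' < r \<Longrightarrow> i = r + i' \<Longrightarrow> P"
  shows P
proof (cases "i < r")
  case False
  then have "i - r < r" "i = r + (i - r)" using assms(1) by auto
  then show ?thesis by (rule assms(3))
qed (use assms(2) in blast)

lemma matching_involution:
  assumes \<theta>: "\<theta> \<in> matchings r" and i: "i < r + r" and j: "j < r + r"
  shows "(\<Sum>k<r + r. matching r \<theta> i k * matching r \<theta> k j) = (if i = j then 1 else 0)"
proof -
  obtain \<pi> s where \<theta>': "\<theta> = (\<pi>, s)" "\<pi> permutes {..<r}" "s \<in> signs r" using \<theta> by (auto simp: matchings_def)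
  have \<pi>lt: "\<pi> a < r" if "a < r" for a using permutes_in_image[OF \<theta>'(2), of a] that by simp
  have \<pi>inj: "\<pi> a = \<pi> b \<longleftrightarrow> a = b" for a b using permutes_inj[OF \<theta>'(2)] by (simp add: inj_eq)
  note E = matching_entries[of _ r _ \<pi> s]
  have surj: "\<exists>a<r. \<pi> a = b" if "b < r" for b
  proof -
    have "b \<in> \<pi> ` {..<r}" using permutes_image[OF \<theta>'(2)] that by simp
    then show ?thesis by auto
  qed
  show ?thesis
  proof (rule lt_double_cases[OF i]; rule lt_double_cases[OF j])
    fix i' j' assume a: "i' < r" "i = i'" "j' < r" "j = j'"
    have "(\<Sum>k<r + r. matching r \<theta> i k * matching r \<theta> k j)
      = (\<Sum>k<r. (if k = \<pi> i' then s i' else 0) * (if k = \<pi> j' then s j' else 0))"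
      unfolding sum_double \<theta>'(1) a(2,4) using a E by simp
    also have "\<dots> = (\<Sum>k<r. if k = \<pi> i' then (if \<pi> i' = \<pi> j' then s i' * s j' else 0) else 0)"
      by (rule sum.cong) auto
    also have "\<dots> = (if i' = j' then 1 else 0)"
      using a \<pi>lt signs_sq[OF \<theta>'(3)] by (simp add: \<pi>inj)
    finally show ?thesis using a by simp
  next
    fix i' j' assume a: "i' < r" "i = i'" "j' < r" "j = r + j'"
    have "(\<Sum>k<r + r. matching r \<theta> i k * matching r \<theta> k j) = 0"
      unfolding sum_double \<theta>'(1) a(2,4) using a E by (auto intro!: sum.neutral)
    then show ?thesis using a by simp
  next
    fix i' j' assume a: "i' < r" "i = r + i'" "j' < r" "j = j'"
    have "(\<Sum>k<r + r. matching r \<theta> i k * matching r \<theta> k j) = 0"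
      unfolding sum_double \<theta>'(1) a(2,4) using a E by (auto intro!: sum.neutral)
    then show ?thesis using a by simp
  next
    fix i' j' assume a: "i' < r" "i = r + i'" "j' < r" "j = r + j'"
    obtain b where b: "b < r" "\<pi> b = i'" using surj[OF a(1)] by blast
    have "(\<Sum>k<r + r. matching r \<theta> i k * matching r \<theta> k j)
      = (\<Sum>k<r. (if i' = \<pi> k then s k else 0) * (if j' = \<pi> k then s k else 0))"
      unfolding sum_double \<theta>'(1) a(2,4) using a E by simp
    also have "\<dots> = (\<Sum>k<r. if k = b then (if i' = j' then s b * s b else 0) else 0)"
      unfolding b(2)[symmetric] \<pi>inj by (rule sum.cong) auto
    also have "\<dots> = (if i' = j' then 1 else 0)"
      using b signs_sq[OF \<theta>'(3)] by simp
    finally show ?thesis using a by simp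
  qed
qed

text \<open>Each agreement of the two permutations is seen twice, once above and once below the
  diagonal.\<close>

lemma matching_overlap:
  assumes "\<theta> \<in> matchings r" "\<theta>' \<in> matchings r"
  shows "(\<Sum>i<r + r. \<Sum>j<r + r. matching r \<theta> i j * matching r \<theta>' i j)
     = 2 * (\<Sum>i<r. if fst \<theta> i = fst \<theta>' i then snd \<theta> i * snd \<theta>' i else 0)"
proof -
  obtain \<pi> s where \<theta>: "\<theta> = (\<pi>, s)" "\<pi> permutes {..<r}" using assms by (auto simp: matchings_def)
  obtain \<pi>' s' where \<theta>': "\<theta>' = (\<pi>', s')" "\<pi>' permutes {..<r}" using assms by (auto simp: matchings_def)
  have \<pi>lt: "\<pi> a < r" if "a < r" for a using permutes_in_image[OF \<theta>(2), of a] that by simp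
  note E = matching_entries[of _ r _ \<pi> s] matching_entries[of _ r _ \<pi>' s']
  have row: "(\<Sum>j<r. (if j = \<pi> i then s i else 0) * (if j = \<pi>' i then s' i else 0)) = (if \<pi> i = \<pi>' i then s i * s' i else 0)" if "i < r" for i
  proof -
    have "(\<Sum>j<r. (if j = \<pi> i then s i else 0) * (if j = \<pi>' i then s' i else 0))
       = (\<Sum>j<r. if j = \<pi> i then (if \<pi> i = \<pi>' i then s i * s' i else 0) else 0)"
      by (rule sum.cong) auto
    then show ?thesis using \<pi>lt[OF that] by simp
  qed
  have 1: "(\<Sum>i<r. \<Sum>j<r + r. matching r \<theta> i j * matching r \<theta>' i j) = (\<Sum>i<r. if \<pi> i = \<pi>' i then s i * s' i else 0)"
  proof (rule sum.cong[OF refl])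
    fix i assume "i \<in> {..<r}"
    then have i: "i < r" by simp
    have "(\<Sum>j<r + r. matching r \<theta> i j * matching r \<theta>' i j) = (\<Sum>j<r. (if j = \<pi> i then s i else 0) * (if j = \<pi>' i then s' i else 0))"
      unfolding sum_double \<theta>(1) \<theta>'(1) using E i by simp
    then show "(\<Sum>j<r + r. matching r \<theta> i j * matching r \<theta>' i j) = (if \<pi> i = \<pi>' i then s i * s' i else 0)"
      by (simp only: row[OF i])
  qed
  have 2: "(\<Sum>i<r. \<Sum>j<r + r. matching r \<theta> (r + i) j * matching r \<theta>' (r + i) j) = (\<Sum>i<r. if \<pi> i = \<pi>' i then s i * s' i else 0)"
  proof -
    have "(\<Sum>i<r. \<Sum>j<r + r. matching r \<theta> (r + i) j * matching r \<theta>' (r + i) j)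
       = (\<Sum>i<r. \<Sum>j<r. (if i = \<pi> j then s j else 0) * (if i = \<pi>' j then s' j else 0))"
      unfolding sum_double \<theta>(1) \<theta>'(1) using E by (intro sum.cong refl) simp
    also have "\<dots> = (\<Sum>j<r. \<Sum>i<r. (if i = \<pi> j then s j else 0) * (if i = \<pi>' j then s' j else 0))" by (rule sum.swap)
    finally show ?thesis using row by simp
  qed
  have "(\<Sum>i<r + r. \<Sum>j<r + r. matching r \<theta> i j * matching r \<theta>' i j) = 2 * (\<Sum>i<r. if \<pi> i = \<pi>' i then s i * s' i else 0)"
    using 1 2 sum_double[of "\<lambda>i. \<Sum>j<r + r. matching r \<theta> i j * matching r \<theta>' i j" r] by linarith
  then show ?thesis by (simp only: \<theta>(1) \<theta>'(1) fst_conv snd_conv)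
qed

text \<open>The hidden states are affine in a matrix Z whose square is affine in Z, so they have
  symmetric square roots that are affine in Z as well.\<close>

definition affine_root :: "nat \<Rightarrow> real \<Rightarrow> real \<Rightarrow> (nat \<Rightarrow> nat \<Rightarrow> real) \<Rightarrow> nat \<Rightarrow> nat \<Rightarrow> real" where
  "affine_root q a b Z i j = ((if i = j then a else 0) + b * Z i j) / sqrt (real q)"

text \<open>The relation with parameters u and w covers involutions (u = 1, w = 0), used for
  matchings, and projections (u = 0, w = 1), used for sign vectors.\<close>

lemma marginal_affine_root:
  assumes sym: "\<And>i j. Z i j = Z j i"
    and sq: "\<And>i j. i < q \<Longrightarrow> j < q \<Longrightarrow> (\<Sum>k<q. Z i k * Z k j) = (if i = j then u else 0) + w * Z i j"
    and ij: "i < q" "j < q"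
  shows "marginal q (affine_root q a b Z) i j = ((if i = j then a\<^sup>2 + b\<^sup>2 * u else 0) + (2 * a * b + b\<^sup>2 * w) * Z i j) / real q"
proof -
  have "marginal q (affine_root q a b Z) i j = (\<Sum>c<q. ((if i = c then a else 0) + b * Z i c) * ((if j = c then a else 0) + b * Z j c)) / real q"
    unfolding marginal_def affine_root_def sum_divide_distrib by (intro sum.cong refl) (simp flip: real_sqrt_mult)
  also have "(\<Sum>c<q. ((if i = c then a else 0) + b * Z i c) * ((if j = c then a else 0) + b * Z j c))
     = (\<Sum>c<q. (if c = i then (if i = j then a\<^sup>2 else 0) + a * b * Z i j else 0) + (if c = j then a * b * Z i j else 0) + b\<^sup>2 * (Z i c * Z c j))"
    by (intro sum.cong refl) (auto simp: power2_eq_square algebra_simps sym[of j])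
  also have "\<dots> = (if i = j then a\<^sup>2 else 0) + a * b * Z i j + a * b * Z i j + b\<^sup>2 * ((if i = j then u else 0) + w * Z i j)"
    unfolding sum.distrib sum_distrib_left[symmetric] sq[OF ij] using ij by simp
  also have "\<dots> = (if i = j then a\<^sup>2 + b\<^sup>2 * u else 0) + (2 * a * b + b\<^sup>2 * w) * Z i j"
    by (simp add: algebra_simps)
  finally show ?thesis .
qed

section \<open>Lower bounds from the two families\<close>

lemma uniform_root:
  assumes "i < q" "j < q"
  shows "marginal q (affine_root q 1 0 (\<lambda>_ _. 0)) i j = (if i = j then 1 / real q else 0)"
  using marginal_affine_root[where Z="\<lambda>_ _. 0" and q=q and u=0 and w=0 and a=1 and b=0 and i=i and j=j] assms by simp

lemma entropy_embedded_cong: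
  assumes "\<And>i j. i < q \<Longrightarrow> j < q \<Longrightarrow> \<sigma> i j = \<sigma>' i j"
  shows "embedded_state d q p \<sigma> = embedded_state d q p \<sigma>'"
  unfolding embedded_state_def real_mat_def using assms by (intro cong_mat) auto

lemma entropy_uniform:
  assumes q: "1 \<le> q" "q \<le> d - 1" "1 \<le> d" and p: "0 \<le> p" "p \<le> 1"
  shows "renyi_entropy \<alpha> d (embedded_state d q p (\<lambda>i j. if i = j then 1 / real q else 0))
    = ln (p powr \<alpha> * real q powr (1 - \<alpha>) + (1 - p) powr \<alpha>) / (1 - \<alpha>)"
proof -
  have "(\<Sum>k<q. (if i = k then 1 else 0) * g k * (if k = j then 1 else 0)) = (if i = j then g i else 0)"
    if "i < q" for i j and g :: "nat \<Rightarrow> real"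
  proof -
    have "(\<Sum>k<q. (if i = k then 1 else 0) * g k * (if k = j then 1 else 0)) = (\<Sum>k<q. if k = i then (if i = j then g i else 0) else 0)"
      by (rule sum.cong) auto
    then show ?thesis using that by simp
  qed
  note id = this this[where g="\<lambda>_. 1", simplified]
  have "(\<Sum>i<q. (1 / real q) powr \<alpha>) = real q powr (1 - \<alpha>)"
    using q by (simp add: powr_divide powr_diff)
  moreover have "renyi_entropy \<alpha> d (embedded_state d q p (\<lambda>i j. if i = j then 1 / real q else 0))
    = ln (p powr \<alpha> * (\<Sum>i<q. (1 / real q) powr \<alpha>) + (1 - p) powr \<alpha>) / (1 - \<alpha>)"
    by (rule entropy_embedded[where W="\<lambda>i j. if i = j then 1 else 0"]) (use q p in \<open>auto simp: id(1) id(2) simp del: times_divide_eq_right times_divide_eq_left\<close>)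
  ultimately show ?thesis by simp
qed

text \<open>The factor by which the trace of the \<alpha>-th power changes when half of the
  eigenvalues grow and half shrink by the relative amount \<eta>.\<close>

definition spread :: "real \<Rightarrow> real \<Rightarrow> real" where
  "spread \<alpha> \<eta> = ((1 + \<eta>) powr \<alpha> + (1 - \<eta>) powr \<alpha>) / 2"

text \<open>The diagonal matrix \<open>sg\<close> has square I and anticommutes with Z. Hence W,
  their sum over sqrt 2, is a symmetric involution that conjugates \<open>sg\<close> into Z, as a
  Hadamard matrix does for Pauli matrices. The eigenvalues of I + \<eta> Z are therefore 1 + \<eta>
  and 1 - \<eta>, each r times.\<close>

lemma entropy_matching:
  assumes r: "1 \<le> r" "r + r \<le> d - 1" "1 \<le> d" and p: "0 \<le> p" "p \<le> 1" and \<theta>: "\<theta> \<in> matchings r" and \<eta>: "0 \<le> \<eta>" "\<eta> \<le> 1"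
  shows "renyi_entropy \<alpha> d (embedded_state d (r + r) p (\<lambda>i j. ((if i = j then 1 else 0) + \<eta> * matching r \<theta> i j) / real (r + r)))
    = ln (p powr \<alpha> * (real (r + r) powr (1 - \<alpha>) * spread \<alpha> \<eta>) + (1 - p) powr \<alpha>) / (1 - \<alpha>)"
proof -
  define q where "q = r + r"
  have q0: "0 < real q" using r by (simp add: q_def)
  define Z where "Z = matching r \<theta>"
  define sg where "sg = (\<lambda>i. if i < r then 1 else (- 1::real))"
  define W where "W = (\<lambda>i j. ((if i = j then sg i else 0) + Z i j) / sqrt 2)"
  have sg2: "sg i * sg i = 1" for i by (simp add: sg_def)
  have anti: "Z i j * sg j = - (sg i * Z i j)" if "i < q" "j < q" for i j
    by (cases \<theta>) (auto simp: Z_def sg_def matching_def)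
  have Zsq: "(\<Sum>k<q. Z i k * Z k j) = (if i = j then 1 else 0)" if "i < q" "j < q" for i j
    using matching_involution[OF \<theta>] that by (simp add: Z_def q_def)
  have WmW: "(\<Sum>k<q. W i k * m k * W k j) = ((if i = j then m i else 0) + sg i * m i * Z i j + Z i j * m j * sg j + (\<Sum>k<q. Z i k * m k * Z k j)) / 2"
    if ij: "i < q" "j < q" for i j m
  proof -
    have "(\<Sum>k<q. W i k * m k * W k j) = (\<Sum>k<q. (if k = i then (if i = j then m i else 0) + sg i * m i * Z i j else 0)
        + (if k = j then Z i j * m j * sg j else 0) + Z i k * m k * Z k j) / 2"
      unfolding sum_divide_distrib
    proof (rule sum.cong[OF refl])
      fix k
      have "W i k * m k * W k j = (((if i = k then sg i else 0) + Z i k) * m k * ((if k = j then sg k else 0) + Z k j)) / 2"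
        by (simp add: W_def field_simps)
      also have "((if i = k then sg i else 0) + Z i k) * m k * ((if k = j then sg k else 0) + Z k j)
        = (if k = i then (if i = j then m i else 0) + sg i * m i * Z i j else 0) + (if k = j then Z i j * m j * sg j else 0) + Z i k * m k * Z k j"
        using sg2[of k] by (auto simp: algebra_simps)
      finally show "W i k * m k * W k j = ((if k = i then (if i = j then m i else 0) + sg i * m i * Z i j else 0)
        + (if k = j then Z i j * m j * sg j else 0) + Z i k * m k * Z k j) / 2" .
    qed
    then show ?thesis using ij by (simp add: sum.distrib)
  qed
  have id: "(\<Sum>k<q. W i k * W k j) = (if i = j then 1 else 0)" if ij: "i < q" "j < q" for i j
    using WmW[OF ij, of "\<lambda>_. 1"] anti[OF ij] Zsq[OF ij] by simp
  have sgn: "(\<Sum>k<q. W i k * sg k * W k j) = Z i j" if ij: "i < q" "j < q" for i j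
  proof -
    have "(\<Sum>k<q. Z i k * sg k * Z k j) = (\<Sum>k<q. - sg i * (Z i k * Z k j))"
      by (rule sum.cong) (simp_all add: anti[OF ij(1)])
    also have "\<dots> = - sg i * (if i = j then 1 else 0)" unfolding sum_distrib_left[symmetric] Zsq[OF ij] ..
    finally show ?thesis
      unfolding WmW[OF ij] using sg2[of i] sg2[of j] by (auto simp: mult.assoc)
  qed
  define \<mu> where "\<mu> = (\<lambda>i. (1 + \<eta> * sg i) / real q)"
  have spec: "((if i = j then 1 else 0) + \<eta> * Z i j) / real q = (\<Sum>k<q. W i k * \<mu> k * W k j)" if ij: "i < q" "j < q" for i j
  proof -
    have "(\<Sum>k<q. W i k * \<mu> k * W k j) = (\<Sum>k<q. W i k * W k j + \<eta> * (W i k * sg k * W k j)) / real q"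
      unfolding sum_divide_distrib by (rule sum.cong) (simp_all add: \<mu>_def algebra_simps add_divide_distrib)
    also have "\<dots> = ((if i = j then 1 else 0) + \<eta> * Z i j) / real q"
      unfolding sum.distrib sum_distrib_left[symmetric] id[OF ij] sgn[OF ij] ..
    finally show ?thesis ..
  qed
  have "renyi_entropy \<alpha> d (embedded_state d q p (\<lambda>i j. ((if i = j then 1 else 0) + \<eta> * Z i j) / real q))
     = ln (p powr \<alpha> * (\<Sum>i<q. \<mu> i powr \<alpha>) + (1 - p) powr \<alpha>) / (1 - \<alpha>)"
  proof (rule entropy_embedded[where W=W])
    fix i j assume "i < q" "j < q"
    show "W i j = W j i" by (simp add: W_def Z_def matching_sym[of r \<theta> i j])
  next
    fix i
    show "0 \<le> \<mu> i" using \<eta> by (auto simp: \<mu>_def sg_def)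
  qed (use r p id spec in \<open>auto simp: q_def\<close>)
  also have "(\<Sum>i<q. \<mu> i powr \<alpha>) = real q powr (1 - \<alpha>) * spread \<alpha> \<eta>"
  proof -
    have "(\<Sum>i<q. \<mu> i powr \<alpha>) = (\<Sum>i<r. ((1 + \<eta>) / real q) powr \<alpha>) + (\<Sum>i<r. ((1 - \<eta>) / real q) powr \<alpha>)"
      unfolding q_def sum_double by (intro arg_cong2[where f="(+)"] sum.cong refl) (simp_all add: \<mu>_def sg_def q_def)
    also have "\<dots> = real r * (((1 + \<eta>) powr \<alpha> + (1 - \<eta>) powr \<alpha>) / real q powr \<alpha>)"
      unfolding powr_divide by (simp add: add_divide_distrib distrib_left)
    also have "real r = real q / 2" by (simp add: q_def)
    also have "real q / 2 * (((1 + \<eta>) powr \<alpha> + (1 - \<eta>) powr \<alpha>) / real q powr \<alpha>) = real q powr (1 - \<alpha>) * spread \<alpha> \<eta>"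
      using q0 by (simp add: spread_def powr_diff)
    finally show ?thesis .
  qed
  finally show ?thesis unfolding Z_def q_def .
qed

text \<open>The scaled overlap of two members is 1 + (\<eta>^2 / r) X with X the signed number of
  agreements, so the moment in \<open>hidden_family_bound\<close> is at most the mean of exp (u X)
  with u = n (p / 2) \<eta>^2 / r. Were r larger than claimed, u would be at most 1/20; the constant
  is 20 * 9216 / 2.\<close>

lemma matching_family_bound:
  assumes est: "renyi_estimable \<alpha> d \<epsilon> T" and \<alpha>: "\<alpha> \<noteq> 1"
    and r: "1 \<le> r" "r + r \<le> d - 1" and p: "0 < p" "p \<le> 1" and \<eta>: "0 < \<eta>" "\<eta> \<le> 1 / 2"
    and far: "2 * \<epsilon> * \<bar>1 - \<alpha>\<bar> < \<bar>ln (p powr \<alpha> * (real (r + r) powr (1 - \<alpha>) * spread \<alpha> \<eta>) + (1 - p) powr \<alpha>)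
       - ln (p powr \<alpha> * real (r + r) powr (1 - \<alpha>) + (1 - p) powr \<alpha>)\<bar>"
  shows "real r < 92160 * (real T)\<^sup>2 * (p * \<eta>\<^sup>2)"
proof (rule ccontr)
  assume "\<not> ?thesis"
  then have small: "92160 * (real T)\<^sup>2 * (p * \<eta>\<^sup>2) \<le> real r" by simp
  define q where "q = r + r"
  have q0: "0 < real q" "1 \<le> q" "q \<le> d - 1" "real q = 2 * real r" using r by (simp_all add: q_def)
  have d: "2 \<le> d" using r by simp
  define n where "n = 9216 * T\<^sup>2"
  \<comment> \<open>Then a + b and a - b are the roots of 1 + \<eta> and 1 - \<eta>, so a I + b Z is
    the square root of I + \<eta> Z.\<close>
  define a where "a = (sqrt (1 + \<eta>) + sqrt (1 - \<eta>)) / 2"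
  define b where "b = (sqrt (1 + \<eta>) - sqrt (1 - \<eta>)) / 2"
  have sq: "sqrt (1 + \<eta>) * sqrt (1 + \<eta>) = 1 + \<eta>" "sqrt (1 - \<eta>) * sqrt (1 - \<eta>) = 1 - \<eta>" using \<eta> by simp_all
  have ab: "a\<^sup>2 + b\<^sup>2 * 1 = 1" "2 * a * b + b\<^sup>2 * 0 = \<eta>"
    unfolding a_def b_def power2_eq_square using sq by (simp_all add: field_simps)
  define Mt where "Mt = (\<lambda>\<theta>. case \<theta> of None \<Rightarrow> affine_root q 1 0 (\<lambda>_ _. 0) | Some \<theta> \<Rightarrow> affine_root q a b (matching r \<theta>))"
  have m0: "marginal q (Mt None) i j = (if i = j then 1 / real q else 0)" if "i < q" "j < q" for i j
    unfolding Mt_def using uniform_root[OF that] by simp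
  have m1: "marginal q (Mt (Some \<theta>)) i j = ((if i = j then 1 else 0) + \<eta> * matching r \<theta> i j) / real q"
    if \<theta>: "\<theta> \<in> matchings r" and ij: "i < q" "j < q" for \<theta> i j
  proof -
    have "marginal q (affine_root q a b (matching r \<theta>)) i j
      = ((if i = j then a\<^sup>2 + b\<^sup>2 * 1 else 0) + (2 * a * b + b\<^sup>2 * 0) * matching r \<theta> i j) / real q"
      by (rule marginal_affine_root) (use matching_sym matching_involution[OF \<theta>] ij in \<open>auto simp: q_def\<close>)
    then show ?thesis unfolding ab by (simp add: Mt_def)
  qed
  have diag0: "matching r \<theta> i i = 0" for \<theta> i by (cases \<theta>) (auto simp: matching_def)
  define X where "X = (\<lambda>\<theta> \<theta>' :: (nat \<Rightarrow> nat) \<times> (nat \<Rightarrow> real). \<Sum>i<r. if fst \<theta> i = fst \<theta>' i then snd \<theta> i * snd \<theta>' i else 0)"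
  have overlap: "real q * (\<Sum>i<q. \<Sum>j<q. marginal q (Mt (Some \<theta>)) i j * marginal q (Mt (Some \<theta>')) i j) = 1 + \<eta>\<^sup>2 / real r * X \<theta> \<theta>'"
    if \<theta>: "\<theta> \<in> matchings r" "\<theta>' \<in> matchings r" for \<theta> \<theta>'
  proof -
    have "(\<Sum>i<q. \<Sum>j<q. marginal q (Mt (Some \<theta>)) i j * marginal q (Mt (Some \<theta>')) i j)
      = (\<Sum>i<q. \<Sum>j<q. (if j = i then 1 else 0) + \<eta>\<^sup>2 * (matching r \<theta> i j * matching r \<theta>' i j)) / (real q)\<^sup>2"
      unfolding sum_divide_distrib
    proof (intro sum.cong refl)
      fix i j assume "i \<in> {..<q}" "j \<in> {..<q}"
      then have ij: "i < q" "j < q" by auto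
      show "marginal q (Mt (Some \<theta>)) i j * marginal q (Mt (Some \<theta>')) i j
        = ((if j = i then 1 else 0) + \<eta>\<^sup>2 * (matching r \<theta> i j * matching r \<theta>' i j)) / (real q)\<^sup>2"
        unfolding m1[OF \<theta>(1) ij] m1[OF \<theta>(2) ij] by (simp add: diag0 power2_eq_square)
    qed
    also have "\<dots> = (real q + \<eta>\<^sup>2 * (2 * X \<theta> \<theta>')) / (real q)\<^sup>2"
      using matching_overlap[OF \<theta>] unfolding sum.distrib sum_distrib_left[symmetric] by (simp add: q_def X_def)
    finally have ov: "(\<Sum>i<q. \<Sum>j<q. marginal q (Mt (Some \<theta>)) i j * marginal q (Mt (Some \<theta>')) i j) = (real q + \<eta>\<^sup>2 * (2 * X \<theta> \<theta>')) / (real q)\<^sup>2" .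
    have r0: "0 < real r" using r by simp
    show ?thesis unfolding ov q0(4) power2_eq_square using r0 by (simp add: field_simps)
  qed
  have Xbound: "\<bar>X \<theta> \<theta>'\<bar> \<le> real r" if \<theta>: "\<theta> \<in> matchings r" "\<theta>' \<in> matchings r" for \<theta> \<theta>'
  proof -
    have "\<bar>snd \<theta>'' i\<bar> = 1" if "\<theta>'' \<in> matchings r" "i < r" for \<theta>'' i
    proof -
      have "snd \<theta>'' \<in> signs r" using that(1) by (auto simp: matchings_def)
      from signs_sq[OF this that(2)] have "snd \<theta>'' i = 1 \<or> snd \<theta>'' i = - 1" by (simp add: square_eq_1_iff)
      then show ?thesis by auto
    qed
    then have "\<bar>if fst \<theta> i = fst \<theta>' i then snd \<theta> i * snd \<theta>' i else 0\<bar> \<le> 1" if "i < r" for i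
      using \<theta> that by (auto simp: abs_mult)
    then have "\<bar>X \<theta> \<theta>'\<bar> \<le> (\<Sum>i<r. 1)"
      unfolding X_def by (intro order_trans[OF sum_abs] sum_mono) auto
    then show ?thesis by simp
  qed
  \<comment> \<open>Keeps the base 1 + y nonnegative, so that 1 + y \<le> exp y may be raised to the
    n-th power; it also makes the overlaps nonnegative.\<close>
  have scaled: "\<bar>\<eta>\<^sup>2 / real r * X \<theta> \<theta>'\<bar> \<le> 1 / 4" if \<theta>: "\<theta> \<in> matchings r" "\<theta>' \<in> matchings r" for \<theta> \<theta>'
  proof -
    have "\<eta>\<^sup>2 \<le> (1 / 2)\<^sup>2" using \<eta> by (intro power_mono) auto
    then have e: "\<eta>\<^sup>2 \<le> 1 / 4" by (simp add: power2_eq_square)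
    have "\<bar>\<eta>\<^sup>2 / real r * X \<theta> \<theta>'\<bar> = \<eta>\<^sup>2 / real r * \<bar>X \<theta> \<theta>'\<bar>" by (simp add: abs_mult)
    also have "\<dots> \<le> \<eta>\<^sup>2 / real r * real r" using Xbound[OF \<theta>] by (intro mult_left_mono) auto
    also have "\<dots> = \<eta>\<^sup>2" using r by simp
    finally show ?thesis using e by linarith
  qed
  have E0: "renyi_entropy \<alpha> d (embedded_state d q p (marginal q (Mt None))) = ln (p powr \<alpha> * real q powr (1 - \<alpha>) + (1 - p) powr \<alpha>) / (1 - \<alpha>)"
    using entropy_embedded_cong[of q "marginal q (Mt None)" "\<lambda>i j. if i = j then 1 / real q else 0" d p] m0
      entropy_uniform[OF q0(2,3) _ less_imp_le[OF p(1)] p(2), of \<alpha>] d by simp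
  have E1: "renyi_entropy \<alpha> d (embedded_state d q p (marginal q (Mt (Some \<theta>))))
     = ln (p powr \<alpha> * (real q powr (1 - \<alpha>) * spread \<alpha> \<eta>) + (1 - p) powr \<alpha>) / (1 - \<alpha>)" if \<theta>: "\<theta> \<in> matchings r" for \<theta>
    using entropy_embedded_cong[of q "marginal q (Mt (Some \<theta>))" "\<lambda>i j. ((if i = j then 1 else 0) + \<eta> * matching r \<theta> i j) / real q" d p] m1[OF \<theta>]
      entropy_matching[OF r _ less_imp_le[OF p(1)] p(2) \<theta>, of \<eta> \<alpha>] d \<eta> by (simp add: q_def)
  show False
  proof (rule hidden_family_bound[OF est d q0(2,3) p, of "Some ` matchings r" None Mt])
    show "finite (Some ` matchings r)" using finite_matchings by simp
    have "real (card (matchings r)) \<noteq> 0" by (simp add: card_matchings)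
    then show "Some ` matchings r \<noteq> {}" by auto
  next
    fix \<theta> assume "\<theta> \<in> insert None (Some ` matchings r)"
    then show "(\<Sum>i<q. marginal q (Mt \<theta>) i i) = 1"
      using q0 by (auto simp: m0 m1 diag0)
  next
    fix \<theta> assume "\<theta> \<in> Some ` matchings r"
    then obtain \<theta>' where \<theta>': "\<theta> = Some \<theta>'" "\<theta>' \<in> matchings r" by auto
    have "2 * \<epsilon> < \<bar>ln (p powr \<alpha> * (real q powr (1 - \<alpha>) * spread \<alpha> \<eta>) + (1 - p) powr \<alpha>)
       - ln (p powr \<alpha> * real q powr (1 - \<alpha>) + (1 - p) powr \<alpha>)\<bar> / \<bar>1 - \<alpha>\<bar>"
      using far \<alpha> unfolding q_def by (subst pos_less_divide_eq) auto
    then show "2 * \<epsilon> < \<bar>renyi_entropy \<alpha> d (embedded_state d q p (marginal q (Mt \<theta>))) - renyi_entropy \<alpha> d (embedded_state d q p (marginal q (Mt None)))\<bar>"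
      unfolding \<theta>'(1) E0 E1[OF \<theta>'(2)] by (simp only: abs_divide diff_divide_distrib[symmetric])
  next
    fix \<theta> \<theta>' assume "\<theta> \<in> Some ` matchings r" "\<theta>' \<in> Some ` matchings r"
    then obtain \<theta>1 \<theta>2 where \<theta>: "\<theta> = Some \<theta>1" "\<theta>1 \<in> matchings r" "\<theta>' = Some \<theta>2" "\<theta>2 \<in> matchings r" by auto
    have "0 \<le> real q * (\<Sum>i<q. \<Sum>j<q. marginal q (Mt \<theta>) i j * marginal q (Mt \<theta>') i j)"
      unfolding \<theta>(1,3) overlap[OF \<theta>(2,4)] using scaled[OF \<theta>(2,4)] by linarith
    then show "0 \<le> (\<Sum>i<q. \<Sum>j<q. marginal q (Mt \<theta>) i j * marginal q (Mt \<theta>') i j)"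
      using q0 by (simp add: zero_le_mult_iff)
  next
    define u where "u = real n * (p / 2) * (\<eta>\<^sup>2 / real r)"
    have u0: "0 \<le> u" using p by (simp add: u_def)
    have "20 * u * real r = 92160 * (real T)\<^sup>2 * (p * \<eta>\<^sup>2)" using r by (simp add: u_def n_def)
    with small have "(20 * u) * real r \<le> 1 * real r" by linarith
    then have "20 * u \<le> 1" using r by (simp only: mult_le_cancel_right)
    with u0 have u: "\<bar>u\<bar> \<le> 1 / 20" by linarith
    have summand: "(1 + p / 2 * (real q * (\<Sum>i<q. \<Sum>j<q. marginal q (Mt (Some \<theta>)) i j * marginal q (Mt (Some \<theta>')) i j) - 1)) ^ n \<le> exp (u * X \<theta> \<theta>')"
      if \<theta>: "\<theta> \<in> matchings r" "\<theta>' \<in> matchings r" for \<theta> \<theta>'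
    proof -
      define y where "y = p / 2 * (\<eta>\<^sup>2 / real r * X \<theta> \<theta>')"
      have "\<bar>y\<bar> \<le> 1 / 2 * (1 / 4)"
        unfolding y_def abs_mult[of "p / 2"] using p scaled[OF \<theta>] by (intro mult_mono) auto
      then have "0 \<le> 1 + y" by linarith
      then have "(1 + y) ^ n \<le> exp y ^ n" by (intro power_mono exp_ge_add_one_self)
      also have "\<dots> = exp (u * X \<theta> \<theta>')" by (simp add: u_def y_def mult_ac flip: exp_of_nat_mult)
      finally show ?thesis unfolding overlap[OF \<theta>] y_def by simp
    qed
    have inner: "(\<Sum>\<theta>\<in>matchings r. exp (u * X \<theta> \<theta>')) \<le> fact r * 2 ^ r * (1 + 1 / 144)" if \<theta>': "\<theta>' \<in> matchings r" for \<theta>'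
    proof -
      have p': "fst \<theta>' permutes {..<r}" "snd \<theta>' \<in> signs r" using \<theta>' by (auto simp: matchings_def)
      have "(\<Sum>\<theta>\<in>matchings r. exp (u * X \<theta> \<theta>'))
        = (\<Sum>\<pi> | \<pi> permutes {..<r}. \<Sum>s\<in>signs r. exp (u * (\<Sum>i<r. if \<pi> i = fst \<theta>' i then s i * snd \<theta>' i else 0)))"
        by (simp add: matchings_def X_def sum.cartesian_product case_prod_unfold)
      also have "\<dots> \<le> fact r * 2 ^ r * (1 + 1 / 144)" by (rule signed_permutation_moment[OF p' u])
      finally show ?thesis .
    qed
    have cardS: "card (Some ` matchings r) = card (matchings r)" by (rule card_image) simp
    have "(\<Sum>\<theta>\<in>Some ` matchings r. \<Sum>\<theta>'\<in>Some ` matchings r.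
        (1 + p / 2 * (real q * (\<Sum>i<q. \<Sum>j<q. marginal q (Mt \<theta>) i j * marginal q (Mt \<theta>') i j) - 1)) ^ n)
      = (\<Sum>\<theta>\<in>matchings r. \<Sum>\<theta>'\<in>matchings r.
        (1 + p / 2 * (real q * (\<Sum>i<q. \<Sum>j<q. marginal q (Mt (Some \<theta>)) i j * marginal q (Mt (Some \<theta>')) i j) - 1)) ^ n)"
      by (simp add: sum.reindex)
    also have "\<dots> \<le> (\<Sum>\<theta>\<in>matchings r. \<Sum>\<theta>'\<in>matchings r. exp (u * X \<theta> \<theta>'))"
      by (intro sum_mono summand)
    also have "\<dots> = (\<Sum>\<theta>'\<in>matchings r. \<Sum>\<theta>\<in>matchings r. exp (u * X \<theta> \<theta>'))" by (rule sum.swap)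
    also have "\<dots> \<le> (\<Sum>\<theta>'\<in>matchings r. fact r * 2 ^ r * (1 + 1 / 144))" by (rule sum_mono) (rule inner)
    also have "\<dots> = (1 + 1 / 144) * (real (card (matchings r)))\<^sup>2"
      by (simp add: card_matchings power2_eq_square)
    finally show "(\<Sum>\<theta>\<in>Some ` matchings r. \<Sum>\<theta>'\<in>Some ` matchings r.
        (1 + p / 2 * (real q * (\<Sum>i<q. \<Sum>j<q. marginal q (Mt \<theta>) i j * marginal q (Mt \<theta>') i j) - 1)) ^ (9216 * T\<^sup>2))
      \<le> (1 + 1 / 144) * (real (card (Some ` matchings r)))\<^sup>2" unfolding n_def cardS .
  qed (use m0 in auto)
qed

lemma householder_involution:
  fixes w :: "nat \<Rightarrow> real"
  assumes \<nu>: "(\<Sum>k<q. w k * w k) = \<nu>" "\<nu> \<noteq> 0" and ij: "i < q" "j < q"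
  shows "(\<Sum>k<q. ((if i = k then 1 else 0) - 2 / \<nu> * (w i * w k)) * ((if k = j then 1 else 0) - 2 / \<nu> * (w k * w j)))
    = (if i = j then 1 else 0)"
proof -
  define c where "c = 2 / \<nu>"
  have c: "c * c * \<nu> = 2 * c" using \<nu>(2) by (simp add: c_def)
  have "(\<Sum>k<q. ((if i = k then 1 else 0) - c * (w i * w k)) * ((if k = j then 1 else 0) - c * (w k * w j)))
    = (\<Sum>k<q. (if k = i then (if i = j then 1 else 0) - c * (w i * w j) else 0) + (if k = j then - (c * (w i * w j)) else 0)
        + c * c * (w i * w j) * (w k * w k))"
    by (rule sum.cong) (auto simp: algebra_simps)
  also have "\<dots> = (if i = j then 1 else 0) - c * (w i * w j) - c * (w i * w j) + (c * c * \<nu>) * (w i * w j)"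
    unfolding sum.distrib sum_distrib_left[symmetric] \<nu>(1) using ij by simp
  also have "\<dots> = (if i = j then 1 else 0)" unfolding c by simp
  finally show ?thesis unfolding c_def .
qed

text \<open>A Householder reflection exchanging e_0 with a unit vector along s diagonalises the
  mixture.\<close>

lemma entropy_rank_one_mixture:
  assumes q: "1 \<le> q" "q \<le> d - 1" "1 \<le> d" and s: "s \<in> signs q" and \<tau>: "0 \<le> \<tau>" "\<tau> \<le> 1"
  shows "renyi_entropy \<alpha> d (embedded_state d q 1 (\<lambda>i j. ((if i = j then 1 - \<tau> else 0) + \<tau> * (s i * s j)) / real q))
    = ln (((1 - \<tau>) / real q + \<tau>) powr \<alpha> + real (q - 1) * ((1 - \<tau>) / real q) powr \<alpha>) / (1 - \<alpha>)"
proof -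
  define t where "t = 1 / sqrt (real q)"
  have t: "0 < t" "t * t = 1 / real q" "real q * (t * t) = 1" using q by (simp_all add: t_def flip: real_sqrt_mult)
  \<comment> \<open>The sign makes the entry at 0 negative, so e_0 - \<phi> has squared norm 2 + 2 t
    and does not vanish even when q = 1.\<close>
  define \<phi> where "\<phi> = (\<lambda>i. - (s 0 * s i * t))"
  define w where "w = (\<lambda>i. (if i = 0 then 1 else 0) - \<phi> i)"
  define \<nu> where "\<nu> = 2 + 2 * t"
  have s2: "s i * s i = 1" if "i < q" for i by (rule signs_sq[OF s that])
  have s0: "s 0 * s 0 = 1" using s2[of 0] q by simp
  have \<phi>\<phi>: "\<phi> i * \<phi> j = s i * s j / real q" for i j
  proof -
    have "\<phi> i * \<phi> j = (s 0 * s 0) * (s i * s j) * (t * t)" by (simp add: \<phi>_def)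
    then show ?thesis by (simp add: s0 t)
  qed
  have \<phi>0: "\<phi> 0 = - t" by (simp add: \<phi>_def s0)
  have norm_w: "(\<Sum>k<q. w k * w k) = \<nu>"
  proof -
    have "(\<Sum>k<q. w k * w k) = (\<Sum>k<q. (if k = 0 then 1 + 2 * t else 0) + 1 / real q)"
      by (rule sum.cong) (auto simp: w_def algebra_simps \<phi>0 \<phi>\<phi> s2 t)
    then show ?thesis using q by (simp add: sum.distrib \<nu>_def)
  qed
  have \<nu>: "\<nu> \<noteq> 0" using t by (simp add: \<nu>_def)
  define W where "W = (\<lambda>i k. (if i = k then 1 else 0) - 2 / \<nu> * (w i * w k))"
  have W0: "W i 0 = \<phi> i" "W 0 i = \<phi> i" for i
  proof -
    have "2 / \<nu> * w 0 = 1" using \<nu> by (simp add: w_def \<phi>0 \<nu>_def field_simps)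
    then have "2 / \<nu> * (w i * w 0) = w i" by (metis mult.assoc mult.commute mult.right_neutral)
    then show "W i 0 = \<phi> i" "W 0 i = \<phi> i" by (auto simp: W_def w_def mult.commute)
  qed
  define \<mu> where "\<mu> = (\<lambda>k::nat. (1 - \<tau>) / real q + (if k = 0 then \<tau> else 0))"
  have inv: "(\<Sum>k<q. W i k * W k j) = (if i = j then 1 else 0)" if "i < q" "j < q" for i j
    unfolding W_def by (rule householder_involution[OF norm_w \<nu> that])
  have "renyi_entropy \<alpha> d (embedded_state d q 1 (\<lambda>i j. ((if i = j then 1 - \<tau> else 0) + \<tau> * (s i * s j)) / real q))
    = ln (1 powr \<alpha> * (\<Sum>i<q. \<mu> i powr \<alpha>) + (1 - 1) powr \<alpha>) / (1 - \<alpha>)"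
  proof (rule entropy_embedded[where W=W])
    fix i j assume ij: "i < q" "j < q"
    show "W i j = W j i" by (simp add: W_def mult.commute)
    show "(\<Sum>k<q. W i k * W k j) = (if i = j then 1 else 0)" by (rule inv[OF ij])
    have "(\<Sum>k<q. W i k * \<mu> k * W k j) = (\<Sum>k<q. (1 - \<tau>) / real q * (W i k * W k j) + (if k = 0 then \<tau> * (W i 0 * W 0 j) else 0))"
      by (rule sum.cong) (auto simp: \<mu>_def algebra_simps)
    also have "\<dots> = (1 - \<tau>) / real q * (if i = j then 1 else 0) + \<tau> * (s i * s j / real q)"
      unfolding sum.distrib sum_distrib_left[symmetric] inv[OF ij] W0 \<phi>\<phi> using q by simp
    finally show "((if i = j then 1 - \<tau> else 0) + \<tau> * (s i * s j)) / real q = (\<Sum>k<q. W i k * \<mu> k * W k j)"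
      by (simp add: add_divide_distrib)
  next
    fix i show "0 \<le> \<mu> i" using \<tau> by (auto simp: \<mu>_def)
  qed (use q in auto)
  also have "(\<Sum>i<q. \<mu> i powr \<alpha>) = ((1 - \<tau>) / real q + \<tau>) powr \<alpha> + real (q - 1) * ((1 - \<tau>) / real q) powr \<alpha>"
  proof -
    obtain q' where q': "q = Suc q'" using q by (cases q) auto
    show ?thesis unfolding q' by (subst sum.lessThan_Suc_shift) (simp add: \<mu>_def q')
  qed
  finally show ?thesis by simp
qed

text \<open>The scaled overlap of two members is 1 - \<tau>^2 + \<tau>^2 X^2 / q with X the inner
  product of the sign vectors. Discarding the negative term leaves the moment of
  \<open>sign_overlap_binomial\<close> with \<kappa> = \<tau>^2 / 2; the constant 6912000 is 1500 *
  9216 / 2.\<close>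

lemma rank_one_family_bound:
  assumes est: "renyi_estimable \<alpha> d \<epsilon> T" and \<alpha>: "\<alpha> \<noteq> 1" and d: "2 \<le> d" and \<tau>: "0 \<le> \<tau>" "\<tau> \<le> 1"
    and far: "2 * \<epsilon> * \<bar>1 - \<alpha>\<bar> < \<bar>ln (((1 - \<tau>) / real (d - 1) + \<tau>) powr \<alpha> + real (d - 2) * ((1 - \<tau>) / real (d - 1)) powr \<alpha>)
       - ln (real (d - 1) powr (1 - \<alpha>))\<bar>"
  shows "1 < 6912000 * (real T)\<^sup>2 * \<tau>\<^sup>2"
proof (rule ccontr)
  assume "\<not> ?thesis"
  then have small: "6912000 * (real T)\<^sup>2 * \<tau>\<^sup>2 \<le> 1" by simp
  define q where "q = d - 1"
  have q: "1 \<le> q" "q \<le> d - 1" "1 \<le> d" "0 < real q" "d - 2 = q - 1" using d by (simp_all add: q_def)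
  define n where "n = 9216 * T\<^sup>2"
  \<comment> \<open>Here a and a + b are the roots of the two eigenvalues 1 - \<tau> and 1 - \<tau>
    + \<tau> q of q times the state.\<close>
  define a where "a = sqrt (1 - \<tau>)"
  define b where "b = sqrt (1 - \<tau> + \<tau> * real q) - a"
  have "0 \<le> \<tau> * real q" using \<tau> by simp
  then have ab: "a\<^sup>2 + b\<^sup>2 * 0 = 1 - \<tau>" "(a + b)\<^sup>2 = 1 - \<tau> + \<tau> * real q" using \<tau> by (simp_all add: a_def b_def)
  then have ab': "2 * a * b + b\<^sup>2 * 1 = \<tau> * real q" by (simp add: power2_sum)
  define Mt where "Mt = (\<lambda>\<theta>. case \<theta> of None \<Rightarrow> affine_root q 1 0 (\<lambda>_ _. 0) | Some s \<Rightarrow> affine_root q a b (\<lambda>i j. s i * s j / real q))"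
  have m0: "marginal q (Mt None) i j = (if i = j then 1 / real q else 0)" if "i < q" "j < q" for i j
    unfolding Mt_def using uniform_root[OF that] by simp
  have m1: "marginal q (Mt (Some s)) i j = ((if i = j then 1 - \<tau> else 0) + \<tau> * (s i * s j)) / real q"
    if s: "s \<in> signs q" and ij: "i < q" "j < q" for s i j
  proof -
    have "marginal q (affine_root q a b (\<lambda>i j. s i * s j / real q)) i j
      = ((if i = j then a\<^sup>2 + b\<^sup>2 * 0 else 0) + (2 * a * b + b\<^sup>2 * 1) * (s i * s j / real q)) / real q"
    proof (rule marginal_affine_root)
      fix i j :: nat assume "i < q" "j < q"
      have "(\<Sum>k<q. s i * s k / real q * (s k * s j / real q)) = (\<Sum>k<q. s i * s j / (real q * real q) * (s k * s k))"
        by (rule sum.cong) (simp_all add: field_simps)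
      also have "\<dots> = (\<Sum>k<q. s i * s j / (real q * real q))" by (rule sum.cong) (simp_all add: signs_sq[OF s])
      also have "\<dots> = s i * s j / real q" using q by simp
      finally show "(\<Sum>k<q. s i * s k / real q * (s k * s j / real q)) = (if i = j then 0 else 0) + 1 * (s i * s j / real q)" by simp
    qed (use ij in auto)
    then show ?thesis unfolding ab ab' using q by (simp add: Mt_def)
  qed
  define X where "X = (\<lambda>s s' :: nat \<Rightarrow> real. \<Sum>i<q. s i * s' i)"
  have overlap: "real q * (\<Sum>i<q. \<Sum>j<q. marginal q (Mt (Some s)) i j * marginal q (Mt (Some s')) i j) = 1 - \<tau>\<^sup>2 + \<tau>\<^sup>2 * ((X s s')\<^sup>2 / real q)"
    if s: "s \<in> signs q" "s' \<in> signs q" for s s'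
  proof -
    have "(\<Sum>i<q. \<Sum>j<q. marginal q (Mt (Some s)) i j * marginal q (Mt (Some s')) i j)
      = (\<Sum>i<q. \<Sum>j<q. (if j = i then 1 - \<tau>\<^sup>2 else 0) + \<tau>\<^sup>2 * ((s i * s' i) * (s j * s' j))) / (real q)\<^sup>2"
      unfolding sum_divide_distrib
    proof (intro sum.cong refl)
      fix i j assume "i \<in> {..<q}" "j \<in> {..<q}"
      then have ij: "i < q" "j < q" by auto
      have "((if i = j then 1 - \<tau> else 0) + \<tau> * (s i * s j)) * ((if i = j then 1 - \<tau> else 0) + \<tau> * (s' i * s' j))
        = (if j = i then 1 - \<tau>\<^sup>2 else 0) + \<tau>\<^sup>2 * ((s i * s' i) * (s j * s' j))"
      proof (cases "i = j")
        case True
        have "s i * s i = 1" "s' i * s' i = 1" using signs_sq s ij by blast+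
        then show ?thesis using True by (simp add: power2_eq_square mult_ac)
      qed (simp add: power2_eq_square mult_ac)
      then show "marginal q (Mt (Some s)) i j * marginal q (Mt (Some s')) i j
        = ((if j = i then 1 - \<tau>\<^sup>2 else 0) + \<tau>\<^sup>2 * ((s i * s' i) * (s j * s' j))) / (real q)\<^sup>2"
        unfolding m1[OF s(1) ij] m1[OF s(2) ij] times_divide_times_eq power2_eq_square[of "real q"] by (rule arg_cong)
    qed
    also have "(\<Sum>i<q. \<Sum>j<q. (if j = i then 1 - \<tau>\<^sup>2 else 0) + \<tau>\<^sup>2 * ((s i * s' i) * (s j * s' j))) = real q * (1 - \<tau>\<^sup>2) + \<tau>\<^sup>2 * (X s s')\<^sup>2"
      unfolding sum.distrib sum_distrib_left[symmetric] X_def power2_eq_square[of "sum _ _"] sum_product by simp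
    finally have ov: "(\<Sum>i<q. \<Sum>j<q. marginal q (Mt (Some s)) i j * marginal q (Mt (Some s')) i j) = (real q * (1 - \<tau>\<^sup>2) + \<tau>\<^sup>2 * (X s s')\<^sup>2) / (real q)\<^sup>2" .
    show ?thesis unfolding ov using q by (simp add: field_simps power2_eq_square[of "real q"])
  qed
  have \<tau>2: "0 \<le> \<tau>\<^sup>2" "\<tau>\<^sup>2 \<le> 1" using \<tau> by (simp_all add: power_le_one)
  have ov_ge: "0 \<le> \<tau>\<^sup>2 * ((X s s')\<^sup>2 / real q)" for s s' using \<tau>2 by simp
  have slack: "0 \<le> 1 - x + y" "0 \<le> 1 + y / 2 - x / 2" if "x \<le> 1" "0 \<le> y" for x y :: real
    using that by simp_all
  have E0: "renyi_entropy \<alpha> d (embedded_state d q 1 (marginal q (Mt None))) = ln (real q powr (1 - \<alpha>)) / (1 - \<alpha>)"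
    using entropy_embedded_cong[of q "marginal q (Mt None)" "\<lambda>i j. if i = j then 1 / real q else 0" d 1] m0
      entropy_uniform[OF q(1-3), of 1 \<alpha>] by simp
  have E1: "renyi_entropy \<alpha> d (embedded_state d q 1 (marginal q (Mt (Some s))))
     = ln (((1 - \<tau>) / real q + \<tau>) powr \<alpha> + real (q - 1) * ((1 - \<tau>) / real q) powr \<alpha>) / (1 - \<alpha>)" if s: "s \<in> signs q" for s
    using entropy_embedded_cong[of q "marginal q (Mt (Some s))" "\<lambda>i j. ((if i = j then 1 - \<tau> else 0) + \<tau> * (s i * s j)) / real q" d 1] m1[OF s]
      entropy_rank_one_mixture[OF q(1-3) s \<tau>, of \<alpha>] by simp
  have one: "0 < (1::real)" "(1::real) \<le> 1" by simp_all
  show False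
  proof (rule hidden_family_bound[OF est d q(1,2) one, of "Some ` signs q" None Mt])
    show "finite (Some ` signs q)" by simp
    have "card (signs q) \<noteq> 0" by (simp add: card_signs)
    then show "Some ` signs q \<noteq> {}" by auto
  next
    fix \<theta> assume \<theta>: "\<theta> \<in> insert None (Some ` signs q)"
    show "(\<Sum>i<q. marginal q (Mt \<theta>) i i) = 1"
    proof (cases \<theta>)
      case None
      then show ?thesis using q by (simp add: m0)
    next
      case (Some s)
      with \<theta> have s: "s \<in> signs q" by auto
      have "(\<Sum>i<q. marginal q (Mt \<theta>) i i) = (\<Sum>i<q. 1 / real q)"
        unfolding Some by (rule sum.cong) (simp_all add: m1[OF s] signs_sq[OF s])
      then show ?thesis using q by simp
    qed
  next
    fix \<theta> assume "\<theta> \<in> Some ` signs q"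
    then obtain s where s: "\<theta> = Some s" "s \<in> signs q" by auto
    have "2 * \<epsilon> < \<bar>ln (((1 - \<tau>) / real q + \<tau>) powr \<alpha> + real (q - 1) * ((1 - \<tau>) / real q) powr \<alpha>)
       - ln (real q powr (1 - \<alpha>))\<bar> / \<bar>1 - \<alpha>\<bar>"
      using far \<alpha> unfolding q(5) q_def[symmetric] by (subst pos_less_divide_eq) auto
    then show "2 * \<epsilon> < \<bar>renyi_entropy \<alpha> d (embedded_state d q 1 (marginal q (Mt \<theta>))) - renyi_entropy \<alpha> d (embedded_state d q 1 (marginal q (Mt None)))\<bar>"
      unfolding s(1) E0 E1[OF s(2)] by (simp only: abs_divide diff_divide_distrib[symmetric])
  next
    fix \<theta> \<theta>' assume "\<theta> \<in> Some ` signs q" "\<theta>' \<in> Some ` signs q"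
    then obtain s s' where s: "\<theta> = Some s" "s \<in> signs q" "\<theta>' = Some s'" "s' \<in> signs q" by auto
    have "0 \<le> real q * (\<Sum>i<q. \<Sum>j<q. marginal q (Mt \<theta>) i j * marginal q (Mt \<theta>') i j)"
      unfolding s(1,3) overlap[OF s(2,4)] by (rule slack(1)[OF \<tau>2(2) ov_ge])
    then show "0 \<le> (\<Sum>i<q. \<Sum>j<q. marginal q (Mt \<theta>) i j * marginal q (Mt \<theta>') i j)"
      using q by (simp add: zero_le_mult_iff)
  next
    define \<kappa> where "\<kappa> = \<tau>\<^sup>2 / 2"
    have \<kappa>: "0 \<le> \<kappa>" "real n * \<kappa> \<le> 1 / 1500" using small by (simp_all add: \<kappa>_def n_def mult_ac)
    have base: "(1 + 1 / 2 * (real q * (\<Sum>i<q. \<Sum>j<q. marginal q (Mt (Some s)) i j * marginal q (Mt (Some s')) i j) - 1)) ^ n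
      \<le> (1 + \<kappa> * ((X s s')\<^sup>2 / real q)) ^ n"
      if s: "s \<in> signs q" "s' \<in> signs q" for s s'
    proof (rule power_mono)
      have e: "1 + 1 / 2 * (real q * (\<Sum>i<q. \<Sum>j<q. marginal q (Mt (Some s)) i j * marginal q (Mt (Some s')) i j) - 1)
        = 1 + \<tau>\<^sup>2 * ((X s s')\<^sup>2 / real q) / 2 - \<tau>\<^sup>2 / 2" unfolding overlap[OF s] by (simp add: field_simps)
      show "1 + 1 / 2 * (real q * (\<Sum>i<q. \<Sum>j<q. marginal q (Mt (Some s)) i j * marginal q (Mt (Some s')) i j) - 1) \<le> 1 + \<kappa> * ((X s s')\<^sup>2 / real q)"
        unfolding e using \<tau>2 by (simp add: \<kappa>_def mult.commute)
      show "0 \<le> 1 + 1 / 2 * (real q * (\<Sum>i<q. \<Sum>j<q. marginal q (Mt (Some s)) i j * marginal q (Mt (Some s')) i j) - 1)"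
        unfolding e by (rule slack(2)[OF \<tau>2(2) ov_ge])
    qed
    have cardS: "card (Some ` signs q) = card (signs q)" by (rule card_image) simp
    have "(\<Sum>\<theta>\<in>Some ` signs q. \<Sum>\<theta>'\<in>Some ` signs q.
        (1 + 1 / 2 * (real q * (\<Sum>i<q. \<Sum>j<q. marginal q (Mt \<theta>) i j * marginal q (Mt \<theta>') i j) - 1)) ^ n)
      = (\<Sum>s\<in>signs q. \<Sum>s'\<in>signs q.
        (1 + 1 / 2 * (real q * (\<Sum>i<q. \<Sum>j<q. marginal q (Mt (Some s)) i j * marginal q (Mt (Some s')) i j) - 1)) ^ n)"
      by (simp add: sum.reindex)
    also have "\<dots> \<le> (\<Sum>s\<in>signs q. \<Sum>s'\<in>signs q. (1 + \<kappa> * ((X s s')\<^sup>2 / real q)) ^ n)"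
      by (intro sum_mono base)
    also have "\<dots> = (\<Sum>s'\<in>signs q. \<Sum>s\<in>signs q. (1 + \<kappa> * ((X s s')\<^sup>2 / real q)) ^ n)" by (rule sum.swap)
    also have "\<dots> \<le> (\<Sum>s'\<in>signs q. 2 ^ q * (1 + 1 / 144))"
      unfolding X_def by (rule sum_mono) (rule sign_overlap_binomial[OF _ _ \<kappa>], use q in auto)
    also have "\<dots> = (1 + 1 / 144) * (real (card (signs q)))\<^sup>2"
      by (simp add: card_signs power2_eq_square)
    finally show "(\<Sum>\<theta>\<in>Some ` signs q. \<Sum>\<theta>'\<in>Some ` signs q.
        (1 + 1 / 2 * (real q * (\<Sum>i<q. \<Sum>j<q. marginal q (Mt \<theta>) i j * marginal q (Mt \<theta>') i j) - 1)) ^ (9216 * T\<^sup>2))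
      \<le> (1 + 1 / 144) * (real (card (Some ` signs q)))\<^sup>2" unfolding n_def cardS .
  qed (use m0 in auto)
qed

section \<open>Asymptotics\<close>

text \<open>On this interval the logarithm of x is at most ln 2 in absolute value, which handles
  exponents of either sign at once.\<close>

lemma powr_ge_half_powr_abs:
  fixes x b :: real
  assumes "1 / 2 \<le> x" "x \<le> 2"
  shows "(1 / 2) powr \<bar>b\<bar> \<le> x powr b"
proof -
  have x: "0 < x" using assms by simp
  have "ln (1 / 2) \<le> ln x" using assms(1) x by (intro ln_mono) auto
  moreover have "ln x \<le> ln 2" using assms(2) x by (intro ln_mono) auto
  moreover have half: "ln (1 / 2) = - ln (2::real)" using ln_inverse[of "2::real"] by (simp only: inverse_eq_divide)
  ultimately have "\<bar>ln x\<bar> \<le> ln 2" by linarith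
  then have "\<bar>b\<bar> * \<bar>ln x\<bar> \<le> \<bar>b\<bar> * ln 2" by (rule mult_left_mono) (rule abs_ge_zero)
  moreover have "- \<bar>b * ln x\<bar> \<le> b * ln x" by linarith
  ultimately have "\<bar>b\<bar> * ln (1 / 2) \<le> b * ln x" unfolding half abs_mult by linarith
  then have "exp (\<bar>b\<bar> * ln (1 / 2)) \<le> exp (b * ln x)" by (rule exp_le_cancel_iff[THEN iffD2])
  then show ?thesis using x by (simp only: powr_def) simp
qed

text \<open>\<open>spread\<close> is even in \<eta>, so the first-order term vanishes and
  Maclaurin's theorem leaves the second derivative. On the range of \<eta> this derivative has the
  constant sign of \<alpha> (\<alpha> - 1) and is bounded away from 0.\<close>

lemma spread_deviation:
  assumes \<eta>: "0 < \<eta>" "\<eta> \<le> 1 / 2"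
  shows "\<bar>\<alpha> * (\<alpha> - 1)\<bar> / 2 * (1 / 2) powr \<bar>\<alpha> - 2\<bar> * \<eta>\<^sup>2 \<le> \<bar>spread \<alpha> \<eta> - 1\<bar>"
proof -
  define df where "df = (\<lambda>m t. if m = 0 then (1 + t) powr \<alpha> + (1 - t) powr \<alpha>
     else if m = Suc 0 then \<alpha> * (1 + t) powr (\<alpha> - 1) - \<alpha> * (1 - t) powr (\<alpha> - 1)
     else \<alpha> * (\<alpha> - 1) * ((1 + t) powr (\<alpha> - 2) + (1 - t) powr (\<alpha> - 2)))"
  have deriv: "DERIV (df m) t :> df (Suc m) t" if m: "m < 2" and "0 \<le> t" "t \<le> \<eta>" for m t
  proof -
    have t: "0 < 1 + t" "0 < 1 - t" using that \<eta> by auto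
    consider "m = 0" | "m = 1" using m by linarith
    then show ?thesis
    proof cases
      case 1
      have "((\<lambda>t. (1 + t) powr \<alpha> + (1 - t) powr \<alpha>) has_real_derivative (\<alpha> * (1 + t) powr (\<alpha> - 1) - \<alpha> * (1 - t) powr (\<alpha> - 1))) (at t)"
        using t by (auto intro!: derivative_eq_intros)
      then show ?thesis using 1 by (simp add: df_def)
    next
      case 2
      have "((\<lambda>t. \<alpha> * (1 + t) powr (\<alpha> - 1) - \<alpha> * (1 - t) powr (\<alpha> - 1)) has_real_derivative
          (\<alpha> * ((\<alpha> - 1) * (1 + t) powr (\<alpha> - 1 - 1)) + \<alpha> * ((\<alpha> - 1) * (1 - t) powr (\<alpha> - 1 - 1)))) (at t)"
        using t by (auto intro!: derivative_eq_intros)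
      then show ?thesis using 2 by (simp add: df_def algebra_simps)
    qed
  qed
  obtain t where t: "0 < t" "t < \<eta>" and eq: "df 0 \<eta> = (\<Sum>m<2. df m 0 / fact m * \<eta> ^ m) + df 2 t / fact 2 * \<eta> ^ 2"
    using Maclaurin[of \<eta> 2 df "df 0"] \<eta> deriv by auto
  define D where "D = (1 + t) powr (\<alpha> - 2) + (1 - t) powr (\<alpha> - 2)"
  define h :: real where "h = (1 / 2) powr \<bar>\<alpha> - 2\<bar>"
  have h0: "0 < h" by (simp add: h_def)
  have "h \<le> (1 + t) powr (\<alpha> - 2)" "h \<le> (1 - t) powr (\<alpha> - 2)"
    unfolding h_def using t \<eta> by (intro powr_ge_half_powr_abs; simp)+
  then have D: "2 * h \<le> D" unfolding D_def by linarith
  with h0 have D0: "0 < D" by linarith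
  have "df 0 \<eta> = 2 + \<alpha> * (\<alpha> - 1) * D / 2 * \<eta>\<^sup>2"
    unfolding eq D_def by (simp add: df_def numeral_2_eq_2)
  moreover have "df 0 \<eta> = 2 * spread \<alpha> \<eta>" by (simp add: spread_def df_def)
  ultimately have dev: "spread \<alpha> \<eta> - 1 = \<alpha> * (\<alpha> - 1) * (D / 4 * \<eta>\<^sup>2)" by simp
  have eq': "\<bar>spread \<alpha> \<eta> - 1\<bar> = \<bar>\<alpha> * (\<alpha> - 1)\<bar> * (D / 4 * \<eta>\<^sup>2)"
    unfolding dev abs_mult[of _ "D / 4 * \<eta>\<^sup>2"] using D0 by simp
  have "\<bar>\<alpha> * (\<alpha> - 1)\<bar> * (h / 2 * \<eta>\<^sup>2) \<le> \<bar>\<alpha> * (\<alpha> - 1)\<bar> * (D / 4 * \<eta>\<^sup>2)"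
    using D by (intro mult_left_mono mult_right_mono) auto
  then show ?thesis unfolding eq' h_def[symmetric] by (simp only: times_divide_eq_left times_divide_eq_right mult.assoc)
qed

lemma spread_le:
  assumes "0 \<le> \<alpha>" "0 \<le> \<eta>" "\<eta> \<le> 1"
  shows "spread \<alpha> \<eta> \<le> 2 powr \<alpha>"
proof -
  have "(1 + \<eta>) powr \<alpha> \<le> 2 powr \<alpha>" "(1 - \<eta>) powr \<alpha> \<le> 2 powr \<alpha>"
    using assms by (intro powr_mono2; simp)+
  then show ?thesis by (simp add: spread_def)
qed

lemma spread_pos: "\<bar>\<eta>\<bar> < 1 \<Longrightarrow> 0 < spread \<alpha> \<eta>"
  by (auto simp: spread_def intro!: add_pos_pos)

text \<open>Turns a change of the trace into a change of its logarithm whatever the direction. Only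
  for g above 1 is a factor lost, namely g itself, which is at most B.\<close>

lemma abs_ln_ge:
  fixes g B :: real
  assumes "0 < g" "g \<le> B" "1 \<le> B"
  shows "\<bar>g - 1\<bar> / B \<le> \<bar>ln g\<bar>"
proof (cases "1 \<le> g")
  case True
  have "ln (1 / g) \<le> 1 / g - 1" using assms by (intro ln_le_minus_one) simp
  then have "1 - 1 / g \<le> ln g" using assms by (simp add: ln_div)
  moreover have "(g - 1) / B \<le> (g - 1) / g" using True assms by (intro divide_left_mono) auto
  moreover have "(g - 1) / g = 1 - 1 / g" using assms by (simp add: field_simps)
  ultimately show ?thesis using True by simp
next
  case False
  have "ln g \<le> g - 1" using assms by (intro ln_le_minus_one) simp
  moreover have "(1 - g) / B \<le> (1 - g) / 1" using False assms by (intro divide_left_mono) auto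
  ultimately show ?thesis using False by simp
qed

text \<open>A is the contribution of the hidden part to the trace and B that of the last level. As A
  is at least a quarter of A + B, multiplying it by s changes the total by a relative amount of at
  least a quarter of the difference between s and 1.\<close>

lemma abs_ln_mixture_ge:
  fixes A B s M :: real
  assumes A: "1 / 2 \<le> A" and B: "0 \<le> B" "A + B \<le> 2" and s: "0 < s" "s \<le> M" and M: "1 \<le> M"
  shows "\<bar>s - 1\<bar> / (4 * M) \<le> \<bar>ln (A * s + B) - ln (A + B)\<bar>"
proof -
  define g where "g = (A * s + B) / (A + B)"
  have pos: "0 < A * s" "0 < A * s + B" "0 < A + B" using A B s by (auto intro!: add_pos_nonneg)
  have "A * s + B \<le> A * M + B * M" using A B s M by (intro add_mono mult_left_mono mult_le_cancel_left1[THEN iffD2]) auto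
  then have "g \<le> M" using pos by (simp add: g_def pos_divide_le_eq algebra_simps)
  then have "\<bar>g - 1\<bar> / M \<le> \<bar>ln g\<bar>" using pos M by (intro abs_ln_ge) (simp_all add: g_def)
  moreover have "\<bar>s - 1\<bar> / 4 \<le> \<bar>g - 1\<bar>"
  proof -
    have "g - 1 = A / (A + B) * (s - 1)" using pos by (simp add: g_def field_simps)
    then have "\<bar>g - 1\<bar> = A / (A + B) * \<bar>s - 1\<bar>" using A pos by (simp add: abs_mult)
    moreover have "1 / 4 \<le> A / (A + B)" using A B pos by (simp add: pos_le_divide_eq)
    ultimately show ?thesis using mult_right_mono[of "1/4" "A / (A + B)" "\<bar>s - 1\<bar>"] by simp
  qed
  then have "\<bar>s - 1\<bar> / 4 / M \<le> \<bar>g - 1\<bar> / M" using M by (intro divide_right_mono) auto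
  moreover have "ln g = ln (A * s + B) - ln (A + B)" using pos by (simp add: g_def ln_div)
  ultimately show ?thesis by simp
qed

section \<open>Combination of lower bounds up to constants\<close>

definition query_lower_bound :: "real \<Rightarrow> (nat \<Rightarrow> real \<Rightarrow> real) \<Rightarrow> bool" where
  "query_lower_bound \<alpha> X \<longleftrightarrow> (\<exists>c>0. \<exists>\<epsilon>0>0. \<forall>d::nat. \<forall>\<epsilon>::real. \<forall>T::nat.
     d \<ge> 2 \<and> 0 < \<epsilon> \<and> \<epsilon> < \<epsilon>0 \<and> renyi_estimable \<alpha> d \<epsilon> T \<longrightarrow> real T \<ge> c * X d \<epsilon>)"

lemma query_lower_boundI:
  assumes "0 < c" "0 < \<epsilon>0"
    and "\<And>d \<epsilon> T. 2 \<le> d \<Longrightarrow> 0 < \<epsilon> \<Longrightarrow> \<epsilon> < \<epsilon>0 \<Longrightarrow> renyi_estimable \<alpha> d \<epsilon> T \<Longrightarrow> c * X d \<epsilon> \<le> real T"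
  shows "query_lower_bound \<alpha> X"
  unfolding query_lower_bound_def
  by (rule exI[of _ c], rule conjI[OF assms(1)], rule exI[of _ \<epsilon>0], rule conjI[OF assms(2)]) (auto intro: assms(3))

text \<open>The same T obeys both bounds, so up to a constant it dominates their sum, for \<epsilon>
  in the common range. This serves both to add terms and to patch together constructions that cover
  different ranges of d and \<epsilon>.\<close>

lemma query_lower_bound_dominated:
  assumes X: "query_lower_bound \<alpha> X" and Y: "query_lower_bound \<alpha> Y" and k: "0 < k" "0 < \<epsilon>1"
    and dom: "\<And>d \<epsilon>. 2 \<le> d \<Longrightarrow> 0 < \<epsilon> \<Longrightarrow> \<epsilon> < \<epsilon>1 \<Longrightarrow> Z d \<epsilon> \<le> k * (X d \<epsilon> + Y d \<epsilon>)"
  shows "query_lower_bound \<alpha> Z"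
proof -
  obtain c \<epsilon>c where c: "0 < c" "0 < \<epsilon>c" and cX: "\<forall>d \<epsilon> T. d \<ge> 2 \<and> 0 < \<epsilon> \<and> \<epsilon> < \<epsilon>c \<and> renyi_estimable \<alpha> d \<epsilon> T \<longrightarrow> real T \<ge> c * X d \<epsilon>"
    using X unfolding query_lower_bound_def by (elim exE conjE) (rule that)
  obtain b \<epsilon>b where b: "0 < b" "0 < \<epsilon>b" and bY: "\<forall>d \<epsilon> T. d \<ge> 2 \<and> 0 < \<epsilon> \<and> \<epsilon> < \<epsilon>b \<and> renyi_estimable \<alpha> d \<epsilon> T \<longrightarrow> real T \<ge> b * Y d \<epsilon>"
    using Y unfolding query_lower_bound_def by (elim exE conjE) (rule that)
  define e where "e = k * (1 / c + 1 / b)"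
  have e: "0 < e" using k c(1) b(1) by (simp add: e_def add_pos_pos)
  show ?thesis
  proof (rule query_lower_boundI[of "1 / e" "min \<epsilon>1 (min \<epsilon>c \<epsilon>b)"])
    fix d \<epsilon> T assume h: "2 \<le> d" "0 < \<epsilon>" "\<epsilon> < min \<epsilon>1 (min \<epsilon>c \<epsilon>b)" "renyi_estimable \<alpha> d \<epsilon> T"
    have "X d \<epsilon> \<le> real T / c" using cX[rule_format, of d \<epsilon> T] h c(1) by (simp add: pos_le_divide_eq mult.commute)
    moreover have "Y d \<epsilon> \<le> real T / b" using bY[rule_format, of d \<epsilon> T] h b(1) by (simp add: pos_le_divide_eq mult.commute)
    ultimately have "k * (X d \<epsilon> + Y d \<epsilon>) \<le> k * (real T / c + real T / b)" using k by (intro mult_left_mono add_mono) auto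
    then have "Z d \<epsilon> \<le> k * (real T / c + real T / b)" using dom[of d \<epsilon>] h by simp
    also have "\<dots> = e * real T" by (simp add: e_def algebra_simps)
    finally show "1 / e * Z d \<epsilon> \<le> real T" using e by (simp add: pos_divide_le_eq mult.commute)
  qed (use e k c b in auto)
qed

lemma query_lower_bound_add:
  assumes "query_lower_bound \<alpha> X" "query_lower_bound \<alpha> Y"
  shows "query_lower_bound \<alpha> (\<lambda>d \<epsilon>. X d \<epsilon> + Y d \<epsilon>)"
  by (rule query_lower_bound_dominated[OF assms, of 1 1]) auto

lemma half_dimension:
  fixes d :: nat
  assumes "3 \<le> d"
  obtains r where "1 \<le> r" "r + r \<le> d - 1" "d \<le> 4 * r"
proof
  show "1 \<le> (d - 1) div 2" "(d - 1) div 2 + (d - 1) div 2 \<le> d - 1" "d \<le> 4 * ((d - 1) div 2)"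
    using assms by presburger+
qed

text \<open>With p = 1 the entropy changes by the logarithm of \<open>spread\<close> over 1 -
  \<alpha>, of order \<eta>^2. Taking \<eta>^2 of order \<epsilon> makes the matching bound read d =
  O(T^2 \<epsilon>). The value 0 at d = 2 reflects that a matching inside d - 1 levels needs d \<ge>
  3.\<close>

lemma lower_bound_matching_precision:
  assumes \<alpha>: "0 < \<alpha>" "\<alpha> \<noteq> 1"
  shows "query_lower_bound \<alpha> (\<lambda>d \<epsilon>. if d = 2 then 0 else sqrt (real d) / sqrt \<epsilon>)"
proof -
  define k where "k = \<bar>\<alpha> * (\<alpha> - 1)\<bar> / 2 * (1 / 2) powr \<bar>\<alpha> - 2\<bar>"
  \<comment> \<open>Makes k \<eta>^2 / 2 powr \<alpha> equal to 4 |1 - \<alpha>| \<epsilon>, twice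
    the required separation.\<close>
  define C where "C = 4 * \<bar>1 - \<alpha>\<bar> * 2 powr \<alpha> / k"
  have k: "0 < k" using \<alpha> by (simp add: k_def)
  have C: "0 < C" "k * C / 2 powr \<alpha> = 4 * \<bar>1 - \<alpha>\<bar>" using \<alpha> k by (simp_all add: C_def)
  show ?thesis
  proof (rule query_lower_boundI[of "1 / sqrt (368640 * C)" "1 / (4 * C)"])
    fix d \<epsilon> T assume h: "2 \<le> d" "0 < \<epsilon>" "\<epsilon> < 1 / (4 * C)" and est: "renyi_estimable \<alpha> d \<epsilon> T"
    show "1 / sqrt (368640 * C) * (if d = 2 then 0 else sqrt (real d) / sqrt \<epsilon>) \<le> real T"
    proof (cases "d = 2")
      case False
      then have "3 \<le> d" using h by simp
      then obtain r where r: "1 \<le> r" "r + r \<le> d - 1" "d \<le> 4 * r" by (rule half_dimension)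
      define \<eta> where "\<eta> = sqrt (C * \<epsilon>)"
      have \<eta>2: "\<eta>\<^sup>2 = C * \<epsilon>" using h C by (simp add: \<eta>_def)
      have "C * \<epsilon> \<le> 1 / 4" using h C by (simp add: pos_less_divide_eq mult_ac)
      then have "sqrt (C * \<epsilon>) \<le> sqrt (1 / 4)" by (rule real_sqrt_le_mono)
      then have \<eta>: "0 < \<eta>" "\<eta> \<le> 1 / 2" using h C by (simp_all add: \<eta>_def real_sqrt_divide)
      have dev: "k * \<eta>\<^sup>2 \<le> \<bar>spread \<alpha> \<eta> - 1\<bar>" using spread_deviation[OF \<eta>, of \<alpha>] \<alpha> by (simp add: k_def)
      have s0: "0 < spread \<alpha> \<eta>" using \<eta> by (intro spread_pos) simp
      have "4 * \<bar>1 - \<alpha>\<bar> * \<epsilon> = k * \<eta>\<^sup>2 / 2 powr \<alpha>" unfolding \<eta>2 C(2)[symmetric] by simp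
      also have "\<dots> \<le> \<bar>spread \<alpha> \<eta> - 1\<bar> / 2 powr \<alpha>" by (rule divide_right_mono[OF dev]) simp
      also have "\<dots> \<le> \<bar>ln (spread \<alpha> \<eta>)\<bar>"
        using \<eta> \<alpha> s0 by (intro abs_ln_ge spread_le) (auto simp: ge_one_powr_ge_zero)
      finally have gap: "4 * \<bar>1 - \<alpha>\<bar> * \<epsilon> \<le> \<bar>ln (spread \<alpha> \<eta>)\<bar>" .
      have "0 < \<bar>1 - \<alpha>\<bar> * \<epsilon>" using h \<alpha> by simp
      then have far: "2 * \<epsilon> * \<bar>1 - \<alpha>\<bar> < \<bar>ln (spread \<alpha> \<eta>)\<bar>" using gap by (simp add: mult_ac)
      have q0: "0 < real (r + r)" using r by simp
      have one: "0 < (1::real)" "(1::real) \<le> 1" by simp_all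
      have "real r < 92160 * (real T)\<^sup>2 * (1 * \<eta>\<^sup>2)"
      proof (rule matching_family_bound[OF est \<alpha>(2) r(1,2) one \<eta>])
        show "2 * \<epsilon> * \<bar>1 - \<alpha>\<bar> < \<bar>ln (1 powr \<alpha> * (real (r + r) powr (1 - \<alpha>) * spread \<alpha> \<eta>) + (1 - 1) powr \<alpha>)
           - ln (1 powr \<alpha> * real (r + r) powr (1 - \<alpha>) + (1 - 1) powr \<alpha>)\<bar>"
          using far q0 s0 by (simp add: ln_mult)
      qed
      moreover have "real d \<le> 4 * real r" using r(3) by (simp flip: of_nat_le_iff)
      ultimately have "real d \<le> 368640 * C * (real T)\<^sup>2 * \<epsilon>" by (simp add: \<eta>2 mult_ac)
      then have "real d / \<epsilon> \<le> 368640 * C * (real T)\<^sup>2" using h by (simp add: pos_divide_le_eq)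
      then have "sqrt (real d / \<epsilon>) \<le> sqrt (368640 * C * (real T)\<^sup>2)" by (rule real_sqrt_le_mono)
      also have "\<dots> = sqrt (368640 * C) * real T" by (simp add: real_sqrt_mult)
      finally have "sqrt (real d) / sqrt \<epsilon> \<le> sqrt (368640 * C) * real T" by (simp only: real_sqrt_divide)
      moreover have "0 < sqrt (368640 * C)" using C by simp
      ultimately show ?thesis using False by (simp only: if_False times_divide_eq_left mult_1_left pos_divide_le_eq mult.commute[of "real T"])
    qed simp
  qed (use C in auto)
qed

text \<open>The choice of p makes p^\<alpha> d^(1-\<alpha>) equal to 1, so a hidden part of small
  trace p still contributes a constant fraction to the trace of the power. A fixed \<eta> = 1/2 then
  moves the entropy by a constant, and the matching bound reads d = O(T^2 p).\<close>

lemma lower_bound_matching_dimension: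
  assumes \<alpha>: "0 < \<alpha>" "\<alpha> < 1"
  shows "query_lower_bound \<alpha> (\<lambda>d \<epsilon>. if d = 2 then 0 else real d powr (1 / (2 * \<alpha>)))"
proof -
  define k where "k = \<bar>\<alpha> * (\<alpha> - 1)\<bar> / 2 * (1 / 2) powr \<bar>\<alpha> - 2\<bar> * (1 / 2)\<^sup>2"
  define s where "s = spread \<alpha> (1 / 2)"
  define e where "e = k / (4 * 2 powr \<alpha>)"
  have k: "0 < k" "k \<le> \<bar>s - 1\<bar>" using \<alpha> spread_deviation[of "1 / 2" \<alpha>] by (auto simp: k_def s_def)
  have s: "0 < s" "s \<le> 2 powr \<alpha>" unfolding s_def using \<alpha> by (auto intro!: spread_pos spread_le)
  have e: "0 < e" using k by (simp add: e_def)
  show ?thesis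
  proof (rule query_lower_boundI[of "1 / 304" "e / (2 * (1 - \<alpha>))"])
    fix d \<epsilon> T assume h: "2 \<le> d" "0 < \<epsilon>" "\<epsilon> < e / (2 * (1 - \<alpha>))" and est: "renyi_estimable \<alpha> d \<epsilon> T"
    show "1 / 304 * (if d = 2 then 0 else real d powr (1 / (2 * \<alpha>))) \<le> real T"
    proof (cases "d = 2")
      case False
      then have "3 \<le> d" using h by simp
      then obtain r where r: "1 \<le> r" "r + r \<le> d - 1" "d \<le> 4 * r" by (rule half_dimension)
      have d4: "real d \<le> 4 * real r" using r(3) by (simp flip: of_nat_le_iff)
      have d2: "2 * real r \<le> real d" using r(2) h by linarith
      have d0: "1 \<le> real d" "0 < real d" using h by auto
      define p where "p = real d powr (- ((1 - \<alpha>) / \<alpha>))"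
      have p: "0 < p" "p \<le> 1"
      proof -
        show "0 < p" using d0 by (simp add: p_def)
        have "real d powr (- ((1 - \<alpha>) / \<alpha>)) \<le> real d powr 0" using d0 \<alpha> by (intro powr_mono) auto
        then show "p \<le> 1" using d0 by (simp add: p_def)
      qed
      define A where "A = p powr \<alpha> * real (r + r) powr (1 - \<alpha>)"
      define B where "B = (1 - p) powr \<alpha>"
      have "p powr \<alpha> = inverse (real d) powr (1 - \<alpha>)"
        using \<alpha> d0 by (simp add: p_def powr_powr inverse_powr flip: powr_minus)
      then have A_eq: "A = (inverse (real d) * real (r + r)) powr (1 - \<alpha>)" unfolding A_def powr_mult by simp
      have ratio: "1 / 2 \<le> inverse (real d) * real (r + r)" "inverse (real d) * real (r + r) \<le> 1"
        using d4 d2 d0 by (simp_all add: field_simps)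
      have "(1 / 2) powr 1 \<le> (1 / 2 :: real) powr (1 - \<alpha>)" using \<alpha> by (intro powr_mono') auto
      also have "\<dots> \<le> A" unfolding A_eq using ratio \<alpha> by (intro powr_mono2) auto
      finally have A: "1 / 2 \<le> A" by simp
      have "A \<le> 1" unfolding A_eq using ratio \<alpha> by (intro powr_le1) auto
      moreover have "B \<le> 1" unfolding B_def using p \<alpha> by (intro powr_le1) auto
      ultimately have AB: "0 \<le> B" "A + B \<le> 2" by (simp_all add: B_def)
      have M: "1 \<le> 2 powr \<alpha>" using \<alpha> by (intro ge_one_powr_ge_zero) auto
      have "2 * \<epsilon> * \<bar>1 - \<alpha>\<bar> < e" using h \<alpha> by (simp add: pos_less_divide_eq mult_ac)
      also have "e \<le> \<bar>s - 1\<bar> / (4 * 2 powr \<alpha>)" unfolding e_def using k by (intro divide_right_mono) auto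
      also have "\<dots> \<le> \<bar>ln (A * s + B) - ln (A + B)\<bar>" by (rule abs_ln_mixture_ge[OF A AB s M])
      finally have far: "2 * \<epsilon> * \<bar>1 - \<alpha>\<bar> < \<bar>ln (p powr \<alpha> * (real (r + r) powr (1 - \<alpha>) * spread \<alpha> (1 / 2)) + (1 - p) powr \<alpha>)
           - ln (p powr \<alpha> * real (r + r) powr (1 - \<alpha>) + (1 - p) powr \<alpha>)\<bar>"
        by (simp only: A_def B_def s_def mult.assoc)
      have "real r < 92160 * (real T)\<^sup>2 * (p * (1 / 2)\<^sup>2)"
        by (rule matching_family_bound[OF est _ r(1,2) p _ _ far]) (use \<alpha> in auto)
      then have "real d \<le> 92160 * (real T)\<^sup>2 * p" using d4 by (simp add: power2_eq_square mult_ac)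
      then have "real d * (1 / p) \<le> 92160 * (real T)\<^sup>2" using p by (simp add: pos_divide_le_eq)
      moreover have "real d * (1 / p) = real d powr (1 / \<alpha>)"
      proof -
        have "1 / p = real d powr ((1 - \<alpha>) / \<alpha>)" by (simp add: p_def powr_minus_divide)
        then have "real d * (1 / p) = real d powr (1 + (1 - \<alpha>) / \<alpha>)" using d0 by (simp add: powr_add)
        also have "1 + (1 - \<alpha>) / \<alpha> = 1 / \<alpha>" using \<alpha> by (simp add: field_simps)
        finally show ?thesis .
      qed
      moreover have "(real d powr (1 / (2 * \<alpha>)))\<^sup>2 = real d powr (1 / \<alpha>)"
        by (simp add: power2_eq_square flip: powr_add)
      ultimately have "(real d powr (1 / (2 * \<alpha>)))\<^sup>2 \<le> 92160 * (real T)\<^sup>2" by simp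
      \<comment> \<open>The square of 304 is 92416, just above 92160.\<close>
      also have "\<dots> \<le> (304 * real T)\<^sup>2" by (simp add: power_mult_distrib)
      finally have "(real d powr (1 / (2 * \<alpha>)))\<^sup>2 \<le> (304 * real T)\<^sup>2" .
      then have "real d powr (1 / (2 * \<alpha>)) \<le> 304 * real T" by (rule power2_le_imp_le) simp
      then show ?thesis using False by simp
    qed simp
  qed (use e \<alpha> in auto)
qed

text \<open>With L = \<tau> q the mixture multiplies one eigenvalue of I / q by roughly L and
  shrinks the others. The trace gains about L^a, and by Bernoulli's inequality the others lose at
  most a L, both relative to q. The side condition says L \<ge> 4 a, which makes the gain dominate;
  the family bound then gives T of order at least 1 / \<tau> = q / L.\<close>

lemma lower_bound_rank_one:
  assumes a: "2 \<le> a"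
  shows "query_lower_bound (real a) (\<lambda>d \<epsilon>. if (4 * real a) ^ a \<le> 8 * real a * real (d - 1) * \<epsilon>
    then real d powr (1 - 1 / real a) / \<epsilon> powr (1 / real a) else 0)"
proof (rule query_lower_boundI[of "1 / (43200 * real a)" "1 / (8 * real a)"])
  fix d \<epsilon> T assume h: "2 \<le> d" "0 < \<epsilon>" "\<epsilon> < 1 / (8 * real a)" and est: "renyi_estimable (real a) d \<epsilon> T"
  show "1 / (43200 * real a) * (if (4 * real a) ^ a \<le> 8 * real a * real (d - 1) * \<epsilon>
    then real d powr (1 - 1 / real a) / \<epsilon> powr (1 / real a) else 0) \<le> real T"
  proof (cases "(4 * real a) ^ a \<le> 8 * real a * real (d - 1) * \<epsilon>")
    case True
    define q where "q = real (d - 1)"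
    have q: "1 \<le> q" "real d \<le> 2 * q" "q \<le> real d" "real (d - 2) = q - 1" using h by (auto simp: q_def of_nat_diff)
    have a0: "0 < real a" "2 \<le> real a" "a \<noteq> 0" using a by auto
    \<comment> \<open>The relative gain y / q is 8 a \<epsilon>. Half is reserved for the loss of
      the other eigenvalues and half for the logarithm, leaving 2 a \<epsilon>, more than 2
      \<epsilon> (a - 1).\<close>
    define y where "y = 8 * real a * q * \<epsilon>"
    have y0: "0 < y" using a0 q h by (simp add: y_def)
    define L where "L = y powr (1 / real a)"
    have L0: "0 < L" using y0 by (simp add: L_def)
    have La: "L ^ a = y" using y0 L0 a0 by (simp add: L_def powr_powr flip: powr_realpow)
    have e8: "8 * real a * \<epsilon> \<le> 1" using h a0 by (simp add: pos_less_divide_eq mult_ac)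
    have L4: "4 * real a \<le> L"
    proof (rule power_mono_iff[THEN iffD1])
      show "(4 * real a) ^ a \<le> L ^ a" using True unfolding La y_def q_def .
    qed (use L0 a in auto)
    have Lq: "L \<le> q"
    proof (rule power_mono_iff[THEN iffD1])
      have "y \<le> q * 1" unfolding y_def using mult_left_mono[OF e8, of q] q by (simp add: mult_ac)
      also have "\<dots> \<le> q ^ a" using q a by (simp add: self_le_power)
      finally show "L ^ a \<le> q ^ a" unfolding La .
    qed (use q L0 a in auto)
    define \<tau> where "\<tau> = L / q"
    have \<tau>: "0 \<le> \<tau>" "\<tau> \<le> 1" "\<tau> * q = L" using Lq L0 q by (simp_all add: \<tau>_def)
    define S where "S = ((1 - \<tau>) / q + \<tau>) powr real a + (q - 1) * ((1 - \<tau>) / q) powr real a"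
    have S: "q powr (1 - real a) * (1 + 4 * real a * \<epsilon>) \<le> S"
    proof -
      have pw: "(x / q) powr real a = q powr (1 - real a) / q * x ^ a" if "0 \<le> x" for x
      proof -
        have "x powr real a = x ^ a" using that a0 by (simp add: powr_realpow')
        then show ?thesis using q by (simp add: powr_divide powr_diff)
      qed
      have "(1 - \<tau>) / q + \<tau> = (1 - \<tau> + L) / q" using q \<tau>(3) by (simp add: field_simps)
      then have "S = q powr (1 - real a) / q * (1 - \<tau> + L) ^ a + (q - 1) * (q powr (1 - real a) / q * (1 - \<tau>) ^ a)"
        unfolding S_def using pw[of "1 - \<tau> + L"] pw[of "1 - \<tau>"] \<tau> L0 by simp
      then have S_eq: "S = q powr (1 - real a) / q * ((1 - \<tau> + L) ^ a + (q - 1) * (1 - \<tau>) ^ a)"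
        by (simp only: distrib_left mult.left_commute)
      have "1 + real a * (- \<tau>) \<le> (1 + - \<tau>) ^ a" using \<tau> by (intro Bernoulli_inequality) auto
      then have "(q - 1) * (1 - real a * \<tau>) \<le> (q - 1) * (1 - \<tau>) ^ a" using q by (intro mult_left_mono) auto
      moreover have "(q - 1) * (1 - real a * \<tau>) = q - 1 - real a * L + real a * \<tau>" using \<tau>(3) by (simp add: algebra_simps)
      moreover have "0 \<le> real a * \<tau>" using \<tau> by simp
      moreover have "L ^ a \<le> (1 - \<tau> + L) ^ a" using L0 \<tau> by (intro power_mono) auto
      moreover have "4 * (real a * L) \<le> y" "4 \<le> y"
      proof -
        have "L * L \<le> L ^ a" using a L4 a0 power_increasing[of 2 a L] by (simp add: power2_eq_square)
        moreover have "4 * real a * L \<le> L * L" using L4 L0 by (intro mult_right_mono) auto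
        moreover have "1 * 8 \<le> L * L" using L4 a0 by (intro mult_mono) auto
        ultimately show "4 * (real a * L) \<le> y" "4 \<le> y" using La by simp_all
      qed
      ultimately have "q + y / 2 \<le> (1 - \<tau> + L) ^ a + (q - 1) * (1 - \<tau>) ^ a" using La by linarith
      moreover have "q + y / 2 = q * (1 + 4 * real a * \<epsilon>)" by (simp add: y_def algebra_simps)
      ultimately have "q powr (1 - real a) / q * (q * (1 + 4 * real a * \<epsilon>)) \<le> S"
        unfolding S_eq using q by (intro mult_left_mono) auto
      then show ?thesis using q by simp
    qed
    have Q0: "0 < q powr (1 - real a)" using q by simp
    have z: "0 < 4 * real a * \<epsilon>" "4 * real a * \<epsilon> \<le> 1 / 2" using e8 h a0 by simp_all
    have z1: "0 < 1 + 4 * real a * \<epsilon>" using z by linarith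
    have "4 * real a * \<epsilon> / 2 \<le> ln (1 + 4 * real a * \<epsilon>)" by (rule ln_one_plus_ge_half) (use z in auto)
    also have "\<dots> = ln (q powr (1 - real a) * (1 + 4 * real a * \<epsilon>)) - ln (q powr (1 - real a))"
      using Q0 z1 by (simp add: ln_mult)
    also have "\<dots> \<le> ln S - ln (q powr (1 - real a))"
      by (intro diff_right_mono ln_mono S) (use Q0 z1 in \<open>auto intro!: order_less_le_trans[OF _ S]\<close>)
    finally have "2 * real a * \<epsilon> \<le> \<bar>ln S - ln (q powr (1 - real a))\<bar>" by linarith
    moreover have "2 * \<epsilon> * \<bar>1 - real a\<bar> < 2 * real a * \<epsilon>" using h a0 by simp
    ultimately have far: "2 * \<epsilon> * \<bar>1 - real a\<bar> < \<bar>ln S - ln (q powr (1 - real a))\<bar>" by linarith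
    have far': "2 * \<epsilon> * \<bar>1 - real a\<bar> < \<bar>ln (((1 - \<tau>) / real (d - 1) + \<tau>) powr real a + real (d - 2) * ((1 - \<tau>) / real (d - 1)) powr real a)
       - ln (real (d - 1) powr (1 - real a))\<bar>" using far unfolding S_def q(4) unfolding q_def .
    have a1: "real a \<noteq> 1" using a by simp
    have "1 < 6912000 * (real T)\<^sup>2 * \<tau>\<^sup>2"
      by (rule rank_one_family_bound[OF est a1 h(1) \<tau>(1,2) far'])
    \<comment> \<open>The square of 2700 is 7290000, above 6912000.\<close>
    also have "\<dots> \<le> (2700 * (real T * \<tau>))\<^sup>2" by (simp add: power_mult_distrib)
    finally have "1\<^sup>2 < (2700 * (real T * \<tau>))\<^sup>2" by simp
    then have "1 < 2700 * (real T * \<tau>)" by (rule power_less_imp_less_base) (use \<tau> in simp)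
    then have "q * 1 \<le> q * (2700 * (real T * \<tau>))" using q by (intro mult_left_mono) auto
    also have "\<dots> = 2700 * real T * L" by (simp add: \<tau>(3)[symmetric])
    finally have TL: "q \<le> 2700 * real T * L" by simp
    have "L = (8 * real a) powr (1 / real a) * (q powr (1 / real a) * \<epsilon> powr (1 / real a))"
      by (simp only: L_def y_def powr_mult mult.assoc)
    moreover have "(8 * real a) powr (1 / real a) \<le> (8 * real a) powr 1" using a0 by (intro powr_mono) auto
    ultimately have L_le: "L \<le> 8 * real a * (q powr (1 / real a) * \<epsilon> powr (1 / real a))" using a0 by (simp add: mult_right_mono)
    have dq: "real d powr (1 - 1 / real a) \<le> 2 * q powr (1 - 1 / real a)"
    proof -
      have "real d powr (1 - 1 / real a) \<le> (2 * q) powr (1 - 1 / real a)" using q a0 by (intro powr_mono2) auto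
      also have "\<dots> = 2 powr (1 - 1 / real a) * q powr (1 - 1 / real a)" by (rule powr_mult)
      also have "\<dots> \<le> 2 powr 1 * q powr (1 - 1 / real a)" using a0 by (intro mult_right_mono powr_mono) auto
      finally show ?thesis by simp
    qed
    have "q \<le> 21600 * real a * real T * \<epsilon> powr (1 / real a) * q powr (1 / real a)"
      using TL mult_left_mono[OF L_le, of "2700 * real T"] by (simp add: mult_ac)
    then have "q / q powr (1 / real a) \<le> 21600 * real a * real T * \<epsilon> powr (1 / real a)" using q by (simp add: pos_divide_le_eq)
    moreover have "q / q powr (1 / real a) = q powr (1 - 1 / real a)" using q by (simp add: powr_diff)
    ultimately have "real d powr (1 - 1 / real a) \<le> 43200 * real a * real T * \<epsilon> powr (1 / real a)" using dq by linarith
    moreover define Y where "Y = real d powr (1 - 1 / real a) / \<epsilon> powr (1 / real a)"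
    ultimately have "Y \<le> 43200 * real a * real T" using h by (simp add: pos_divide_le_eq)
    then show ?thesis unfolding if_P[OF True] Y_def[symmetric] using a0 by (simp add: pos_divide_le_eq mult_ac)
  qed simp
qed (use a in auto)

text \<open>At d = 2, where no matching fits, the given bound already dominates because its
  denominator y \<epsilon> is at most sqrt \<epsilon>.\<close>

lemma lower_bound_sqrt:
  assumes \<alpha>: "0 < \<alpha>" "\<alpha> \<noteq> 1" and X: "query_lower_bound \<alpha> (\<lambda>d \<epsilon>. real d powr x / y \<epsilon>)" and x: "0 \<le> x"
    and y: "\<And>\<epsilon>. 0 < \<epsilon> \<Longrightarrow> \<epsilon> < 1 \<Longrightarrow> 0 < y \<epsilon> \<and> y \<epsilon> \<le> sqrt \<epsilon>"
  shows "query_lower_bound \<alpha> (\<lambda>d \<epsilon>. sqrt (real d) / sqrt \<epsilon>)"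
proof (rule query_lower_bound_dominated[OF X lower_bound_matching_precision[OF \<alpha>], of 2 1])
  fix d :: nat and \<epsilon> :: real assume h: "2 \<le> d" "0 < \<epsilon>" "\<epsilon> < 1"
  have y0: "0 < y \<epsilon>" "y \<epsilon> \<le> sqrt \<epsilon>" using y h by auto
  have X0: "0 \<le> real d powr x / y \<epsilon>" using y0 by simp
  show "sqrt (real d) / sqrt \<epsilon> \<le> 2 * (real d powr x / y \<epsilon> + (if d = 2 then 0 else sqrt (real d) / sqrt \<epsilon>))"
  proof (cases "d = 2")
    case True
    have "sqrt 2 \<le> sqrt (4::real)" by (rule real_sqrt_le_mono) simp
    moreover have "2 powr 0 \<le> (2::real) powr x" using x by (intro powr_mono) auto
    ultimately have "sqrt 2 \<le> 2 * (2 powr x)" by simp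
    then have "sqrt 2 / sqrt \<epsilon> \<le> 2 * (2 powr x) / y \<epsilon>" using y0 by (intro frac_le) auto
    then show ?thesis using True by simp
  next
    case False
    have "0 \<le> sqrt (real d) / sqrt \<epsilon>" using h by simp
    then show ?thesis using False X0 by simp
  qed
qed auto

text \<open>The case d = 2 is again supplied by X: there the target is at most the constant 2 powr
  (1 / (2 \<alpha>)), while X is at least 1 for \<epsilon> < 1.\<close>

lemma lower_bound_dimension:
  assumes \<alpha>: "0 < \<alpha>" "\<alpha> < 1" and \<delta>: "0 < \<delta>"
    and X: "query_lower_bound \<alpha> (\<lambda>d \<epsilon>. real d powr (1 / (2 * \<alpha>) - 1 / 2) / \<epsilon> powr (1 / (2 * \<alpha>)))"
  shows "query_lower_bound \<alpha> (\<lambda>d \<epsilon>. real d powr (1 / (2 * \<alpha>) - \<delta>))"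
proof (rule query_lower_bound_dominated[OF X lower_bound_matching_dimension[OF \<alpha>], of "2 powr (1 / (2 * \<alpha>))" 1])
  fix d :: nat and \<epsilon> :: real assume h: "2 \<le> d" "0 < \<epsilon>" "\<epsilon> < 1"
  define k :: real where "k = 2 powr (1 / (2 * \<alpha>))"
  define Y where "Y = real d powr (1 / (2 * \<alpha>) - 1 / 2) / \<epsilon> powr (1 / (2 * \<alpha>))"
  have k: "1 \<le> k" unfolding k_def using \<alpha> by (intro ge_one_powr_ge_zero) auto
  have le: "real d powr (1 / (2 * \<alpha>) - \<delta>) \<le> real d powr (1 / (2 * \<alpha>))" using h \<delta> by (intro powr_mono) auto
  have "1 \<le> real d powr (1 / (2 * \<alpha>) - 1 / 2)" using h \<alpha> by (intro ge_one_powr_ge_zero) (auto simp: field_simps)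
  moreover have "\<epsilon> powr (1 / (2 * \<alpha>)) \<le> 1" using h \<alpha> by (intro powr_le1) auto
  ultimately have Y: "1 \<le> Y" unfolding Y_def using h by (simp add: pos_le_divide_eq)
  have "real d powr (1 / (2 * \<alpha>) - \<delta>) \<le> k * (Y + (if d = 2 then 0 else real d powr (1 / (2 * \<alpha>))))"
  proof (cases "d = 2")
    case True
    have "real d powr (1 / (2 * \<alpha>) - \<delta>) \<le> k" using le unfolding True k_def by (simp only: of_nat_numeral)
    moreover have "k * 1 \<le> k * (Y + 0)" using k Y by (intro mult_left_mono) auto
    ultimately show ?thesis unfolding if_P[OF True] by linarith
  next
    case False
    have "1 * (0 + real d powr (1 / (2 * \<alpha>))) \<le> k * (Y + real d powr (1 / (2 * \<alpha>)))"
      using k Y by (intro mult_mono add_right_mono) auto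
    then show ?thesis using le False by simp
  qed
  then show "real d powr (1 / (2 * \<alpha>) - \<delta>) \<le> 2 powr (1 / (2 * \<alpha>)) * (real d powr (1 / (2 * \<alpha>) - 1 / 2) / \<epsilon> powr (1 / (2 * \<alpha>))
      + (if d = 2 then 0 else real d powr (1 / (2 * \<alpha>))))"
    unfolding k_def Y_def .
qed auto

text \<open>Outside the range of the rank-one bound, d \<epsilon> is at most the constant K. The
  target equals the spike bound times (d \<epsilon>^2)^b with b between 0 and 1, so there it is at
  most K times the spike bound.\<close>

lemma lower_bound_integer_order:
  assumes a: "2 \<le> a" and X: "query_lower_bound (real a) (\<lambda>d \<epsilon>. real d powr (1 / 2 - 1 / (2 * real a)) / \<epsilon>)"
  shows "query_lower_bound (real a) (\<lambda>d \<epsilon>. real d powr (1 - 1 / real a) / \<epsilon> powr (1 / real a))"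
proof (rule query_lower_bound_dominated[OF X lower_bound_rank_one[OF a], of "(4 * real a) ^ a" 1])
  fix d :: nat and \<epsilon> :: real assume h: "2 \<le> d" "0 < \<epsilon>" "\<epsilon> < 1"
  define K where "K = (4 * real a) ^ a"
  define Z where "Z = real d powr (1 - 1 / real a) / \<epsilon> powr (1 / real a)"
  define b where "b = 1 / 2 - 1 / (2 * real a)"
  have a0: "2 \<le> real a" using a by simp
  have b: "0 \<le> b" "b \<le> 1" "b + b = 1 - 1 / real a" using a0 by (simp_all add: b_def field_simps)
  have K: "1 \<le> K" unfolding K_def using a0 by (intro one_le_power) simp
  have Z0: "0 \<le> Z" by (simp add: Z_def)
  have X0: "0 \<le> real d powr b / \<epsilon>" using h by simp
  have "Z \<le> K * (real d powr b / \<epsilon> + (if K \<le> 8 * real a * real (d - 1) * \<epsilon> then Z else 0))"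
  proof (cases "K \<le> 8 * real a * real (d - 1) * \<epsilon>")
    case True
    have "1 * (0 + Z) \<le> K * (real d powr b / \<epsilon> + Z)" using K Z0 X0 by (intro mult_mono add_right_mono) auto
    then show ?thesis using True by simp
  next
    case False
    have "real d \<le> 2 * real (d - 1)" using h by (simp add: of_nat_diff)
    also have "\<dots> \<le> 8 * real a * real (d - 1)" using a0 by (intro mult_right_mono) auto
    finally have "real d * \<epsilon> \<le> 8 * real a * real (d - 1) * \<epsilon>" using h by (intro mult_right_mono) auto
    then have "real d * \<epsilon> \<le> K" using False by linarith
    moreover have "real d * \<epsilon> * \<epsilon> \<le> real d * \<epsilon> * 1" using h by (intro mult_left_mono) auto
    ultimately have dK: "real d * \<epsilon> * \<epsilon> \<le> K" by linarith
    have "real d powr b * (\<epsilon> powr b * \<epsilon> powr b) = (real d * \<epsilon> * \<epsilon>) powr b" by (simp only: powr_mult mult.assoc)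
    also have "\<dots> \<le> K powr b" using dK h b by (intro powr_mono2) auto
    also have "\<dots> \<le> K powr 1" using K b by (intro powr_mono) auto
    finally have F: "real d powr b * (\<epsilon> powr b * \<epsilon> powr b) \<le> K" using K by simp
    have "\<epsilon> powr (1 - 1 / real a) * \<epsilon> powr (1 / real a) = \<epsilon>" using h by (simp flip: powr_add)
    then have quot: "\<epsilon> powr (1 - 1 / real a) / \<epsilon> = 1 / \<epsilon> powr (1 / real a)" using h by (simp add: field_simps)
    have "Z = (real d powr b * real d powr b) * (\<epsilon> powr (1 - 1 / real a) / \<epsilon>)"
      unfolding quot Z_def by (simp flip: b(3) powr_add)
    also have "\<dots> = (real d powr b / \<epsilon>) * (real d powr b * (\<epsilon> powr b * \<epsilon> powr b))"
      unfolding b(3)[symmetric] powr_add by simp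
    also have "\<dots> \<le> (real d powr b / \<epsilon>) * K" by (rule mult_left_mono[OF F X0])
    finally show ?thesis using False by (simp add: mult.commute)
  qed
  then show "real d powr (1 - 1 / real a) / \<epsilon> powr (1 / real a) \<le> (4 * real a) ^ a * (real d powr (1 / 2 - 1 / (2 * real a)) / \<epsilon>
      + (if (4 * real a) ^ a \<le> 8 * real a * real (d - 1) * \<epsilon> then real d powr (1 - 1 / real a) / \<epsilon> powr (1 / real a) else 0))"
    unfolding K_def Z_def b_def .
qed (use a in auto)

theorem theorem2p37:
  shows "(\<forall>\<alpha>::real. 0 < \<alpha> \<and> \<alpha> < 1 \<longrightarrow>
            (\<forall>\<delta>>0. \<exists>c>0. \<exists>\<epsilon>0>0. \<forall>d::nat. \<forall>\<epsilon>::real. \<forall>T::nat.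
               d \<ge> 2 \<and> 0 < \<epsilon> \<and> \<epsilon> < \<epsilon>0 \<and> renyi_estimable \<alpha> d \<epsilon> T \<longrightarrow>
               real T \<ge> c * (real d powr (1/(2*\<alpha>) - \<delta>)
                             + real d powr (1/(2*\<alpha>) - 1/2) / \<epsilon> powr (1/(2*\<alpha>))
                             + sqrt (real d) / sqrt \<epsilon>)))
       \<and> (\<forall>\<alpha>::real. 1 < \<alpha> \<and> \<alpha> \<notin> \<int> \<longrightarrow>
            (\<exists>c>0. \<exists>\<epsilon>0>0. \<forall>d::nat. \<forall>\<epsilon>::real. \<forall>T::nat.
               d \<ge> 2 \<and> 0 < \<epsilon> \<and> \<epsilon> < \<epsilon>0 \<and> renyi_estimable \<alpha> d \<epsilon> T \<longrightarrow>
               real T \<ge> c * (real d powr (1/2 - 1/(2*\<alpha>)) / \<epsilon>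
                             + sqrt (real d) / sqrt \<epsilon>)))
       \<and> (\<forall>a::nat. a \<ge> 2 \<longrightarrow>
            (\<exists>c>0. \<exists>\<epsilon>0>0. \<forall>d::nat. \<forall>\<epsilon>::real. \<forall>T::nat.
               d \<ge> 2 \<and> 0 < \<epsilon> \<and> \<epsilon> < \<epsilon>0 \<and> renyi_estimable (real a) d \<epsilon> T \<longrightarrow>
               real T \<ge> c * (real d powr (1 - 1/real a) / \<epsilon> powr (1/real a)
                             + real d powr (1/2 - 1/(2*real a)) / \<epsilon>)))"
proof (intro conjI allI impI)
  fix \<alpha> \<delta> :: real assume "0 < \<alpha> \<and> \<alpha> < 1" and \<delta>: "0 < \<delta>"
  then have \<alpha>: "0 < \<alpha>" "\<alpha> < 1" "\<alpha> \<noteq> 1" by auto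
  have B: "query_lower_bound \<alpha> (\<lambda>d \<epsilon>. real d powr (1 / (2 * \<alpha>) - 1 / 2) / \<epsilon> powr (1 / (2 * \<alpha>)))"
    unfolding query_lower_bound_def by (rule lower_bound_near_pure[OF \<alpha>(1,2)])
  have "query_lower_bound \<alpha> (\<lambda>d \<epsilon>. sqrt (real d) / sqrt \<epsilon>)"
  proof (rule lower_bound_sqrt[OF \<alpha>(1,3) B])
    show "0 \<le> 1 / (2 * \<alpha>) - 1 / 2" using \<alpha> by (simp add: field_simps)
    fix \<epsilon> :: real assume e: "0 < \<epsilon>" "\<epsilon> < 1"
    have "\<epsilon> powr (1 / (2 * \<alpha>)) \<le> \<epsilon> powr (1 / 2)" using e \<alpha> by (intro powr_mono') (auto simp: field_simps)
    then show "0 < \<epsilon> powr (1 / (2 * \<alpha>)) \<and> \<epsilon> powr (1 / (2 * \<alpha>)) \<le> sqrt \<epsilon>" using e by (simp add: powr_half_sqrt)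
  qed
  from query_lower_bound_add[OF query_lower_bound_add[OF lower_bound_dimension[OF \<alpha>(1,2) \<delta> B] B] this]
  show "\<exists>c>0. \<exists>\<epsilon>0>0. \<forall>d::nat. \<forall>\<epsilon>::real. \<forall>T::nat.
               d \<ge> 2 \<and> 0 < \<epsilon> \<and> \<epsilon> < \<epsilon>0 \<and> renyi_estimable \<alpha> d \<epsilon> T \<longrightarrow>
               real T \<ge> c * (real d powr (1/(2*\<alpha>) - \<delta>)
                             + real d powr (1/(2*\<alpha>) - 1/2) / \<epsilon> powr (1/(2*\<alpha>))
                             + sqrt (real d) / sqrt \<epsilon>)"
    unfolding query_lower_bound_def .
next
  fix \<alpha> :: real assume "1 < \<alpha> \<and> \<alpha> \<notin> \<int>"
  then have \<alpha>: "0 < \<alpha>" "1 < \<alpha>" "\<alpha> \<noteq> 1" by auto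
  have D: "query_lower_bound \<alpha> (\<lambda>d \<epsilon>. real d powr (1 / 2 - 1 / (2 * \<alpha>)) / \<epsilon>)"
    unfolding query_lower_bound_def by (rule lower_bound_spike_precision[OF \<alpha>(2)])
  have "query_lower_bound \<alpha> (\<lambda>d \<epsilon>. sqrt (real d) / sqrt \<epsilon>)"
  proof (rule lower_bound_sqrt[OF \<alpha>(1,3) D])
    show "0 \<le> 1 / 2 - 1 / (2 * \<alpha>)" using \<alpha> by (simp add: field_simps)
    fix \<epsilon> :: real assume e: "0 < \<epsilon>" "\<epsilon> < 1"
    then show "0 < \<epsilon> \<and> \<epsilon> \<le> sqrt \<epsilon>" by (auto intro!: real_le_rsqrt simp: power2_eq_square mult_le_cancel_left1)
  qed
  from query_lower_bound_add[OF D this]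
  show "\<exists>c>0. \<exists>\<epsilon>0>0. \<forall>d::nat. \<forall>\<epsilon>::real. \<forall>T::nat.
               d \<ge> 2 \<and> 0 < \<epsilon> \<and> \<epsilon> < \<epsilon>0 \<and> renyi_estimable \<alpha> d \<epsilon> T \<longrightarrow>
               real T \<ge> c * (real d powr (1/2 - 1/(2*\<alpha>)) / \<epsilon>
                             + sqrt (real d) / sqrt \<epsilon>)"
    unfolding query_lower_bound_def .
next
  fix a :: nat assume a: "2 \<le> a"
  then have "1 < real a" by simp
  then have D: "query_lower_bound (real a) (\<lambda>d \<epsilon>. real d powr (1 / 2 - 1 / (2 * real a)) / \<epsilon>)"
    unfolding query_lower_bound_def by (rule lower_bound_spike_precision)
  from query_lower_bound_add[OF lower_bound_integer_order[OF a D] D]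
  show "\<exists>c>0. \<exists>\<epsilon>0>0. \<forall>d::nat. \<forall>\<epsilon>::real. \<forall>T::nat.
               d \<ge> 2 \<and> 0 < \<epsilon> \<and> \<epsilon> < \<epsilon>0 \<and> renyi_estimable (real a) d \<epsilon> T \<longrightarrow>
               real T \<ge> c * (real d powr (1 - 1/real a) / \<epsilon> powr (1/real a)
                             + real d powr (1/2 - 1/(2*real a)) / \<epsilon>)"
    unfolding query_lower_bound_def .
qed

end
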